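(* Let $(K,u)$ be a generalized minimizer on $U=\{x_2>0\}\subset\mathbb{R}^2$ and suppose that $x\in K\cap\partial U$. Then it is not possible to have $\mathcal{H}^0(K\cap\partial B_r(x))=1$ for a.e. $r>0$.
   Context: Let $U\subset\mathbb{R}^2$ be an open half-plane. $\mathcal{A}(U)$ is the set of pairs $(K,u)$ with $K\subset\overline U$ closed, $u\in W^{1,2}_{\mathrm{loc}}(U\setminus K)$ (locally up to $\partial U\setminus K$, so that traces make sense) and $u=0$ on $\partial U\setminus K$. For a set $A$, $E(K,u,A)=\int_{(A\cap U)\setminus K}|\nabla u|^2+\mathcal{H}^1(K\cap A)$. A pair $(J,w)\in\mathcal{A}(U)$ is an admissible competitor for $(K,u)\in\mathcal{A}(U)$ if there is a bounded open set $O\subset\mathbb{R}^2$ such that: (1) $(J,w)$ coincides with $(K,u)$ in $\overline U\setminus O$; (2) whenever two points of $\mathbb{R}^2\setminus(O\cup K)$ belong to distinct connected components of $\mathbb{R}^2\setminus K$, they belong to distinct connected components of $\mathbb{R}^2\setminus J$. (Components are those of the complement in the whole plane $\mathbb{R}^2$.) $(K,u)\in\mathcal{A}(U)$ is a generalized minimizer on $U$ if $E(K,u,O)\le E(J,w,O)$ for every admissible competitor $(J,w)$ and every associated set $O$. Minimizers are always assumed normalized: $\mathcal{H}^1(K\cap B_\rho(x))>0$ for all $x\in K$, $\rho>0$. $\mathcal{H}^0$ is the counting measure and $B_r(x)$ the open disk of radius $r$ centred at $x$. *)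

theory Defs
  imports "HOL-Analysis.Analysis"
begin

section \<open>One-dimensional Hausdorff measure\<close>

text \<open>The normalising constant of the one-dimensional Hausdorff measure is 1. The boundedness
  requirement excludes unbounded sets, whose \<^const>\<open>diameter\<close> is unspecified.\<close>

definition hausdorff1_pre :: "real \<Rightarrow> 'a::metric_space set \<Rightarrow> ennreal" where
  "hausdorff1_pre \<delta> A =
     (INF E \<in> {E :: nat \<Rightarrow> 'a set. A \<subseteq> (\<Union>i. E i) \<and> (\<forall>i. bounded (E i) \<and> diameter (E i) \<le> \<delta>)}.
        \<Sum>i. ennreal (diameter (E i)))"

definition hausdorff1 :: "'a::metric_space set \<Rightarrow> ennreal" where
  "hausdorff1 A = (SUP \<delta>\<in>{0<..}. hausdorff1_pre \<delta> A)"

definition hausdorff1_measure :: "'a::metric_space measure" where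
  "hausdorff1_measure = measure_of UNIV (sets borel) hausdorff1"

text \<open>The set function \<^const>\<open>hausdorff1\<close> is a metric outer measure, hence
  \<^const>\<open>hausdorff1_measure\<close> is not the degenerate zero measure that \<^const>\<open>measure_of\<close>
  returns for a set function that is not countably additive; see
  \<open>emeasure_hausdorff1_measure\<close> below.\<close>

lemma hausdorff1_gauge:
  fixes \<delta> :: real
  assumes "\<delta> > 0"
  defines "f \<equiv> (\<lambda>E :: 'a::metric_space set.
      if bounded E \<and> diameter E \<le> \<delta> then ennreal (diameter E) else \<infinity>)"
  shows "positive UNIV f" and "increasing UNIV f"
proof -
  show "positive UNIV f"
    using assms by (auto simp: positive_def)
  show "increasing UNIV f"
    unfolding increasing_def
  proof (intro ballI impI)
    fix x y :: "'a set"
    assume xy: "x \<subseteq> y"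
    show "f x \<le> f y"
    proof (cases "bounded y \<and> diameter y \<le> \<delta>")
      case True
      then have "bounded x" "diameter x \<le> diameter y"
        using bounded_subset[of y x] diameter_subset[of x y] xy by auto
      then show ?thesis
        using True by (simp add: f_def ennreal_leI)
    next
      case False
      then show ?thesis by (simp add: f_def del: de_Morgan_conj split del: if_split)
    qed
  qed
qed

lemma hausdorff1_pre_eq_outer_measure:
  assumes "\<delta> > 0"
  shows "hausdorff1_pre \<delta> A =
    outer_measure UNIV (\<lambda>E. if bounded E \<and> diameter E \<le> \<delta> then ennreal (diameter E) else \<infinity>) A"
    (is "_ = outer_measure UNIV ?f A")
proof (rule antisym)
  interpret ring_of_sets UNIV "UNIV :: 'a set set"
    by (rule ring_of_setsI) auto
  note pos = hausdorff1_gauge(1)[OF assms] and inc = hausdorff1_gauge(2)[OF assms]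
  show "outer_measure UNIV ?f A \<le> hausdorff1_pre \<delta> A"
    unfolding hausdorff1_pre_def
  proof (rule INF_greatest)
    fix E :: "nat \<Rightarrow> 'a set"
    assume E: "E \<in> {E. A \<subseteq> (\<Union>i. E i) \<and> (\<forall>i. bounded (E i) \<and> diameter (E i) \<le> \<delta>)}"
    have "outer_measure UNIV ?f A \<le> (\<Sum>i. ?f (E i))"
      using E by (intro outer_measure_le[OF pos inc]) auto
    then show "outer_measure UNIV ?f A \<le> (\<Sum>i. ennreal (diameter (E i)))"
      using E by simp
  qed
  show "hausdorff1_pre \<delta> A \<le> outer_measure UNIV ?f A"
    unfolding outer_measure_def
  proof (rule INF_greatest)
    fix E :: "nat \<Rightarrow> 'a set"
    assume E: "E \<in> {E. range E \<subseteq> UNIV \<and> disjoint_family E \<and> A \<subseteq> (\<Union>i. E i)}"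
    show "hausdorff1_pre \<delta> A \<le> (\<Sum>i. ?f (E i))"
    proof (cases "\<forall>i. bounded (E i) \<and> diameter (E i) \<le> \<delta>")
      case True
      then show ?thesis
        unfolding hausdorff1_pre_def using E by (intro INF_lower2[of E]) auto
    next
      case False
      then obtain i where "\<not> (bounded (E i) \<and> diameter (E i) \<le> \<delta>)" by blast
      then have i: "?f (E i) = \<infinity>" by (simp only: if_False)
      have "?f (E i) \<le> (\<Sum>i. ?f (E i))"
        using sum_le_suminf[of "\<lambda>i. ?f (E i)" "{i}"] by simp
      with i show ?thesis by (simp add: top_unique)
    qed
  qed
qed

lemma hausdorff1_pre_le: "hausdorff1_pre \<delta> A \<le> hausdorff1 A" if "\<delta> > 0"
  unfolding hausdorff1_def using that by (intro SUP_upper) auto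

lemma hausdorff1_pre_antimono: "\<delta> \<le> \<epsilon> \<Longrightarrow> hausdorff1_pre \<epsilon> A \<le> hausdorff1_pre \<delta> A"
  unfolding hausdorff1_pre_def by (intro INF_superset_mono) (auto intro: order_trans)

lemma hausdorff1_mono: "A \<subseteq> B \<Longrightarrow> hausdorff1 A \<le> hausdorff1 B"
  unfolding hausdorff1_def hausdorff1_pre_def
  by (intro SUP_mono' INF_superset_mono) auto

lemma hausdorff1_empty [simp]: "hausdorff1 {} = 0"
proof -
  have "hausdorff1_pre \<delta> ({} :: 'a set) \<le> 0" if "\<delta> > 0" for \<delta>
    unfolding hausdorff1_pre_def using that by (intro INF_lower2[of "\<lambda>_. {}"]) auto
  then show ?thesis unfolding hausdorff1_def by (auto intro!: antisym SUP_least)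
qed

lemma hausdorff1_countably_subadditive: "hausdorff1 (\<Union>n. A n) \<le> (\<Sum>n. hausdorff1 (A n))"
  for A :: "nat \<Rightarrow> 'a::metric_space set"
proof -
  have "hausdorff1_pre \<delta> (\<Union>n. A n) \<le> (\<Sum>n. hausdorff1 (A n))" if \<delta>: "\<delta> > 0" for \<delta>
  proof -
    let ?f = "\<lambda>E :: 'a set. if bounded E \<and> diameter E \<le> \<delta> then ennreal (diameter E) else \<infinity>"
    interpret ring_of_sets UNIV "UNIV :: 'a set set"
      by (rule ring_of_setsI) auto
    note pos = hausdorff1_gauge(1)[OF \<delta>] and inc = hausdorff1_gauge(2)[OF \<delta>]
    note cs = countably_subadditive_outer_measure[OF pos inc]
    have "outer_measure UNIV ?f (\<Union>n. A n) = outer_measure UNIV ?f (\<Union>n. disjointed A n)"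
      by (simp add: UN_disjointed_eq)
    also have "\<dots> \<le> (\<Sum>n. outer_measure UNIV ?f (disjointed A n))"
      using cs disjoint_family_disjointed[of A]
      unfolding countably_subadditive_def Pow_UNIV by simp
    also have "\<dots> = (\<Sum>n. hausdorff1_pre \<delta> (disjointed A n))"
      by (simp add: hausdorff1_pre_eq_outer_measure[OF \<delta>])
    also have "\<dots> \<le> (\<Sum>n. hausdorff1 (A n))"
      by (intro suminf_le order_trans[OF hausdorff1_pre_le[OF \<delta>]] hausdorff1_mono
          disjointed_subset) auto
    finally show ?thesis by (simp add: hausdorff1_pre_eq_outer_measure[OF \<delta>])
  qed
  then show ?thesis unfolding hausdorff1_def[of "\<Union>n. A n"] by (auto intro!: SUP_least)
qed

lemma hausdorff1_outer_measure_space: "outer_measure_space (Pow UNIV) hausdorff1"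
  unfolding outer_measure_space_def positive_def increasing_def countably_subadditive_def
  using hausdorff1_mono hausdorff1_countably_subadditive by auto

lemma hausdorff1_subadditive: "hausdorff1 (A \<union> B) \<le> hausdorff1 A + hausdorff1 B"
proof -
  have "hausdorff1 (\<Union>n. binaryset A B n) \<le> (\<Sum>n. hausdorff1 (binaryset A B n))"
    by (rule hausdorff1_countably_subadditive)
  then show ?thesis
    by (simp add: UN_binaryset_eq suminf_binaryset_eq)
qed

lemma hausdorff1_separated:
  fixes A B :: "'a::metric_space set"
  assumes d: "d > 0" and sep: "\<And>x y. x \<in> A \<Longrightarrow> y \<in> B \<Longrightarrow> d \<le> dist x y"
  shows "hausdorff1 A + hausdorff1 B \<le> hausdorff1 (A \<union> B)"
proof -
  have main: "hausdorff1_pre \<delta> A + hausdorff1_pre \<delta> B \<le> hausdorff1_pre \<delta> (A \<union> B)"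
    if \<delta>: "\<delta> > 0" "\<delta> < d" for \<delta>
    unfolding hausdorff1_pre_def[of \<delta> "A \<union> B"]
  proof (rule INF_greatest)
    fix E :: "nat \<Rightarrow> 'a set"
    assume "E \<in> {E. A \<union> B \<subseteq> (\<Union>i. E i) \<and> (\<forall>i. bounded (E i) \<and> diameter (E i) \<le> \<delta>)}"
    then have cov: "A \<union> B \<subseteq> (\<Union>i. E i)" and bd: "\<And>i. bounded (E i)"
      and dm: "\<And>i. diameter (E i) \<le> \<delta>"
      by auto
    have disj: "E i \<inter> A = {} \<or> E i \<inter> B = {}" for i
    proof (rule ccontr)
      assume "\<not> ?thesis"
      then obtain x y where xy: "x \<in> E i" "x \<in> A" "y \<in> E i" "y \<in> B" by auto
      then have "dist x y \<le> \<delta>"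
        using diameter_bounded_bound[OF bd] dm by (meson order_trans)
      with sep[of x y] xy \<delta> show False by auto
    qed
    define EA where "EA i = (if E i \<inter> A = {} then {} else E i)" for i
    define EB where "EB i = (if E i \<inter> A = {} then E i else {})" for i
    have "hausdorff1_pre \<delta> A \<le> (\<Sum>i. ennreal (diameter (EA i)))"
      unfolding hausdorff1_pre_def
    proof (rule INF_lower)
      show "EA \<in> {E. A \<subseteq> (\<Union>i. E i) \<and> (\<forall>i. bounded (E i) \<and> diameter (E i) \<le> \<delta>)}"
      proof (intro CollectI conjI allI subsetI)
        fix x assume x: "x \<in> A"
        then obtain i where "x \<in> E i" using cov by blast
        then have "x \<in> EA i" using x by (auto simp: EA_def)
        then show "x \<in> (\<Union>i. EA i)" by blast
      qed (use bd dm \<delta> in \<open>auto simp: EA_def\<close>)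
    qed
    moreover have "hausdorff1_pre \<delta> B \<le> (\<Sum>i. ennreal (diameter (EB i)))"
      unfolding hausdorff1_pre_def
    proof (rule INF_lower)
      show "EB \<in> {E. B \<subseteq> (\<Union>i. E i) \<and> (\<forall>i. bounded (E i) \<and> diameter (E i) \<le> \<delta>)}"
      proof (intro CollectI conjI allI subsetI)
        fix x assume x: "x \<in> B"
        then obtain i where i: "x \<in> E i" using cov by blast
        then have "x \<in> EB i" using x disj[of i] by (auto simp: EB_def)
        then show "x \<in> (\<Union>i. EB i)" by blast
      qed (use bd dm \<delta> in \<open>auto simp: EB_def\<close>)
    qed
    ultimately have "hausdorff1_pre \<delta> A + hausdorff1_pre \<delta> B \<le>
        (\<Sum>i. ennreal (diameter (EA i))) + (\<Sum>i. ennreal (diameter (EB i)))"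
      by (rule add_mono)
    also have "\<dots> = (\<Sum>i. ennreal (diameter (EA i)) + ennreal (diameter (EB i)))"
      by (rule suminf_add) auto
    also have "\<dots> = (\<Sum>i. ennreal (diameter (E i)))"
      by (intro suminf_cong) (auto simp: EA_def EB_def)
    finally show "hausdorff1_pre \<delta> A + hausdorff1_pre \<delta> B \<le> (\<Sum>i. ennreal (diameter (E i)))" .
  qed
  have "hausdorff1_pre \<delta> A + hausdorff1_pre \<epsilon> B \<le> hausdorff1 (A \<union> B)"
    if "\<delta> > 0" "\<epsilon> > 0" for \<delta> \<epsilon>
  proof -
    define \<eta> where "\<eta> = min (min \<delta> \<epsilon>) (d / 2)"
    have \<eta>: "\<eta> > 0" "\<eta> < d" "\<eta> \<le> \<delta>" "\<eta> \<le> \<epsilon>" using that d by (auto simp: \<eta>_def)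
    have "hausdorff1_pre \<delta> A + hausdorff1_pre \<epsilon> B \<le> hausdorff1_pre \<eta> A + hausdorff1_pre \<eta> B"
      using \<eta> by (intro add_mono hausdorff1_pre_antimono)
    also have "\<dots> \<le> hausdorff1_pre \<eta> (A \<union> B)" using main \<eta> by auto
    also have "\<dots> \<le> hausdorff1 (A \<union> B)" using hausdorff1_pre_le \<eta> by auto
    finally show ?thesis .
  qed
  then show ?thesis
  proof -
    assume *: "\<And>\<delta> \<epsilon>. 0 < \<delta> \<Longrightarrow> 0 < \<epsilon> \<Longrightarrow>
      hausdorff1_pre \<delta> A + hausdorff1_pre \<epsilon> B \<le> hausdorff1 (A \<union> B)"
    have ne: "{0::real<..} \<noteq> {}" by simp
    have "hausdorff1 A + hausdorff1 B
        = (SUP \<epsilon>\<in>{0<..}. SUP \<delta>\<in>{0<..}. hausdorff1_pre \<delta> A + hausdorff1_pre \<epsilon> B)"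
      unfolding hausdorff1_def
      by (simp only: ennreal_SUP_add_left[OF ne] ennreal_SUP_add_right[OF ne, symmetric])
    also have "\<dots> \<le> hausdorff1 (A \<union> B)"
      using * by (intro SUP_least) simp
    finally show ?thesis .
  qed
qed

lemma hausdorff1_sum_separated:
  fixes R :: "nat \<Rightarrow> 'a::metric_space set"
  assumes sep: "\<And>n. \<exists>d>0. \<forall>x \<in> (\<Union>i<n. R i). \<forall>y \<in> R n. d \<le> dist x y"
  shows "(\<Sum>i<n. hausdorff1 (R i)) \<le> hausdorff1 (\<Union>i<n. R i)"
proof (induction n)
  case (Suc n)
  obtain d where "d > 0" "\<forall>x \<in> (\<Union>i<n. R i). \<forall>y \<in> R n. d \<le> dist x y" using sep by blast
  then have "hausdorff1 (\<Union>i<n. R i) + hausdorff1 (R n) \<le> hausdorff1 ((\<Union>i<n. R i) \<union> R n)"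
    by (intro hausdorff1_separated) auto
  with Suc show ?case
    by (auto simp: lessThan_Suc Un_commute add.commute intro: order_trans add_mono)
qed simp

lemma hausdorff1_closed_caratheodory:
  fixes C A :: "'a::metric_space set"
  assumes C: "closed C"
  shows "hausdorff1 (A \<inter> C) + hausdorff1 (A - C) \<le> hausdorff1 A"
proof (cases "C = {} \<or> hausdorff1 A = \<infinity>")
  case True
  then show ?thesis by auto
next
  case False
  then have ne: "C \<noteq> {}" and fin: "hausdorff1 A < \<infinity>" by (auto simp: less_top)
  define s where "s n = 1 / real (n + 1)" for n
  have s_pos: "s n > 0" for n by (simp add: s_def)
  have s_mono: "s m \<le> s n" if "n \<le> m" for m n using that by (simp add: s_def frac_le)
  have s_less: "s m < s n" if "n < m" for m n using that by (simp add: s_def frac_less2)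
  define F where "F n = {x \<in> A. s n \<le> infdist x C}" for n
  define R where "R n = {x \<in> A. s (Suc n) \<le> infdist x C \<and> infdist x C < s n}" for n
  have lip: "infdist x C \<le> infdist y C + dist x y" for x y
    by (rule infdist_triangle)
  have R_sep: "s (Suc i) - s j \<le> dist x y" if "x \<in> R i" "y \<in> R j" for i j x y
    using that lip[of x y] by (auto simp: R_def)
  have half: "(\<Sum>i. hausdorff1 (R (2 * i + k))) \<le> hausdorff1 A" for k
  proof (rule suminf_le_const[OF summableI])
    fix n
    have "(\<Sum>i<n. hausdorff1 (R (2 * i + k))) \<le> hausdorff1 (\<Union>i<n. R (2 * i + k))"
    proof (rule hausdorff1_sum_separated)
      fix n
      show "\<exists>d>0. \<forall>x \<in> (\<Union>i<n. R (2 * i + k)). \<forall>y \<in> R (2 * n + k). d \<le> dist x y"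
      proof (cases "n = 0")
        case False
        let ?d = "s (2 * n + k - 1) - s (2 * n + k)"
        have "?d > 0" using False by (simp add: s_less)
        moreover have "?d \<le> dist x y"
          if "i < n" "x \<in> R (2 * i + k)" "y \<in> R (2 * n + k)" for i x y
        proof -
          have "Suc (2 * i + k) \<le> 2 * n + k - 1" using that(1) by linarith
          from s_mono[OF this] R_sep[OF that(2,3)] show ?thesis by linarith
        qed
        ultimately show ?thesis by (intro exI[of _ ?d]) auto
      qed (auto intro: exI[of _ 1])
    qed
    also have "\<dots> \<le> hausdorff1 A" by (intro hausdorff1_mono) (auto simp: R_def)
    finally show "(\<Sum>i<n. hausdorff1 (R (2 * i + k))) \<le> hausdorff1 A" .
  qed
  have "(\<Sum>i. hausdorff1 (R i)) \<le> hausdorff1 A + hausdorff1 A"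
  proof (rule suminf_le_const[OF summableI])
    fix n
    have "(\<Sum>i<n. hausdorff1 (R i)) \<le> (\<Sum>i<2 * n. hausdorff1 (R i))"
      by (intro sum_mono2) auto
    also have "\<dots> = (\<Sum>i<n. hausdorff1 (R (2 * i + 0))) + (\<Sum>i<n. hausdorff1 (R (2 * i + 1)))"
      by (induction n) (auto simp: algebra_simps)
    also have "\<dots> \<le> (\<Sum>i. hausdorff1 (R (2 * i + 0))) + (\<Sum>i. hausdorff1 (R (2 * i + 1)))"
      by (intro add_mono sum_le_suminf) auto
    also have "\<dots> \<le> hausdorff1 A + hausdorff1 A" by (intro add_mono half)
    finally show "(\<Sum>i<n. hausdorff1 (R i)) \<le> hausdorff1 A + hausdorff1 A" .
  qed
  then have sum_fin: "(\<Sum>i. hausdorff1 (R i)) < \<infinity>" using fin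
    by (metis ennreal_add_less_top infinity_ennreal_def order_le_less_trans)
  have tail: "(\<lambda>n. \<Sum>i. hausdorff1 (R (i + n))) \<longlonglongrightarrow> 0"
  proof -
    have "R i \<subseteq> A" for i by (auto simp: R_def)
    then have Rfin: "hausdorff1 (R i) \<noteq> top" for i
      using fin hausdorff1_mono[of "R i" A] by (metis infinity_ennreal_def leD)
    define r where "r i = enn2real (hausdorff1 (R i))" for i
    have r: "hausdorff1 (R i) = ennreal (r i)" "r i \<ge> 0" for i
      using Rfin[of i] by (auto simp: r_def less_top)
    have sm: "summable r"
      using sum_fin r by (intro summable_suminf_not_top) auto
    have "(\<lambda>n. ennreal (\<Sum>i. r (i + n))) \<longlonglongrightarrow> ennreal 0"
      by (intro tendsto_ennrealI suminf_exist_split2[OF sm])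
    moreover have "(\<Sum>i. hausdorff1 (R (i + n))) = ennreal (\<Sum>i. r (i + n))" for n
      using r sm by (simp add: suminf_ennreal2 summable_ignore_initial_segment)
    ultimately show ?thesis by simp
  qed
  have cover: "A - C \<subseteq> F n \<union> (\<Union>i. R (i + n))" for n
  proof
    fix x assume x: "x \<in> A - C"
    then have pos: "infdist x C > 0"
      using C ne by (simp add: infdist_pos_not_in_closed)
    show "x \<in> F n \<union> (\<Union>i. R (i + n))"
    proof (cases "s n \<le> infdist x C")
      case True then show ?thesis using x by (auto simp: F_def)
    next
      case False
      obtain m0 where m0: "s m0 \<le> infdist x C"
        using reals_Archimedean[OF pos] by (auto simp: s_def inverse_eq_divide intro: less_imp_le)
      define m where "m = (LEAST m. s m \<le> infdist x C)"
      have m: "s m \<le> infdist x C" unfolding m_def using m0 by (rule LeastI[where P = "\<lambda>m. s m \<le> infdist x C"])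
      have "n < m"
        using m False s_mono[of m n] by (meson not_le_imp_less order_trans)
      then obtain j where j: "m = Suc j" "n \<le> j" by (cases m) auto
      have "\<not> s j \<le> infdist x C"
        using not_less_Least[of j "\<lambda>m. s m \<le> infdist x C"] j unfolding m_def by auto
      then have "x \<in> R j" using m j x by (auto simp: R_def)
      then have "x \<in> R ((j - n) + n)" using j by simp
      then show ?thesis by blast
    qed
  qed
  have est: "hausdorff1 (A \<inter> C) + hausdorff1 (A - C) \<le> hausdorff1 A + (\<Sum>i. hausdorff1 (R (i + n)))"
    for n
  proof -
    have "hausdorff1 (A - C) \<le> hausdorff1 (F n \<union> (\<Union>i. R (i + n)))"
      by (rule hausdorff1_mono[OF cover])
    also have "\<dots> \<le> hausdorff1 (F n) + hausdorff1 (\<Union>i. R (i + n))"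
      by (rule hausdorff1_subadditive)
    also have "\<dots> \<le> hausdorff1 (F n) + (\<Sum>i. hausdorff1 (R (i + n)))"
      by (intro add_left_mono hausdorff1_countably_subadditive)
    finally have "hausdorff1 (A \<inter> C) + hausdorff1 (A - C) \<le>
        (hausdorff1 (A \<inter> C) + hausdorff1 (F n)) + (\<Sum>i. hausdorff1 (R (i + n)))"
      by (simp add: add.assoc add_left_mono)
    also have "hausdorff1 (A \<inter> C) + hausdorff1 (F n) \<le> hausdorff1 (A \<inter> C \<union> F n)"
    proof (rule hausdorff1_separated[OF s_pos[of n]])
      fix x y assume "x \<in> A \<inter> C" "y \<in> F n"
      then show "s n \<le> dist x y"
        using infdist_le[of x C y] by (auto simp: F_def dist_commute)
    qed
    also have "\<dots> \<le> hausdorff1 A" by (intro hausdorff1_mono) (auto simp: F_def)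
    finally show ?thesis by (simp add: add_right_mono)
  qed
  have "(\<lambda>n. hausdorff1 A + (\<Sum>i. hausdorff1 (R (i + n)))) \<longlonglongrightarrow> hausdorff1 A + 0"
    by (intro tendsto_add tendsto_const tail)
  then show ?thesis
    using est by (intro LIMSEQ_le_const[where x = "hausdorff1 A"]) auto
qed

lemma emeasure_hausdorff1_measure:
  assumes "A \<in> sets borel"
  shows "emeasure hausdorff1_measure A = hausdorff1 A"
proof -
  let ?L = "lambda_system UNIV (Pow UNIV) (hausdorff1 :: 'a set \<Rightarrow> ennreal)"
  have ms: "measure_space UNIV ?L hausdorff1"
    by (rule sigma_algebra.caratheodory_lemma[OF sigma_algebra_Pow hausdorff1_outer_measure_space])
  have "closed C \<Longrightarrow> C \<in> ?L" for C :: "'a set"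
    unfolding algebra.lambda_system_eq[OF algebra_Pow]
  proof (safe intro!: antisym)
    fix A assume "closed C"
    then show "hausdorff1 (A \<inter> C) + hausdorff1 (A - C) \<le> hausdorff1 A"
      by (rule hausdorff1_closed_caratheodory)
    show "hausdorff1 A \<le> hausdorff1 (A \<inter> C) + hausdorff1 (A - C)"
      using hausdorff1_subadditive[of "A \<inter> C" "A - C"] by (simp add: Int_Diff_Un)
  qed auto
  then have "sigma_sets UNIV (Collect closed) \<subseteq> ?L"
    using ms by (intro sigma_algebra.sigma_sets_subset) (auto simp: measure_space_def)
  then have "sets borel \<subseteq> ?L" by (simp add: borel_eq_closed)
  then have "measure_space UNIV (sets borel) (hausdorff1 :: 'a set \<Rightarrow> ennreal)"
    by (intro measure_down[OF ms]) (metis sets.sigma_algebra_axioms space_borel)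
  then show ?thesis
    unfolding hausdorff1_measure_def using assms
    by (subst emeasure_measure_of_sigma) (auto simp: measure_space_def)
qed

lemma sets_hausdorff1_measure [simp, measurable_cong]: "sets hausdorff1_measure = sets borel"
  unfolding hausdorff1_measure_def
  by (metis sets.sets_measure_of_eq space_borel)


section \<open>Sobolev functions and traces\<close>

definition C1_gradient :: "(real^2 \<Rightarrow> real) \<Rightarrow> (real^2 \<Rightarrow> real^2) \<Rightarrow> bool" where
  "C1_gradient v Dv \<longleftrightarrow> (\<forall>x. GDERIV v x :> Dv x) \<and> continuous_on UNIV Dv"

text \<open>Weak gradients are tested against compactly supported \<open>C\<^sup>1\<close> functions; by mollification
  this is the same as testing against smooth ones.\<close>

definition weak_gradient_on :: "(real^2) set \<Rightarrow> (real^2 \<Rightarrow> real) \<Rightarrow> (real^2 \<Rightarrow> real^2) \<Rightarrow> bool" where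
  "weak_gradient_on \<Omega> u g \<longleftrightarrow>
     (\<forall>C. compact C \<and> C \<subseteq> \<Omega> \<longrightarrow> u absolutely_integrable_on C \<and> g absolutely_integrable_on C) \<and>
     (\<forall>\<phi> D\<phi> C. C1_gradient \<phi> D\<phi> \<and> compact C \<and> C \<subseteq> \<Omega> \<and> (\<forall>x. x \<notin> C \<longrightarrow> \<phi> x = 0) \<longrightarrow>
        (LINT x:\<Omega>|lebesgue. u x *\<^sub>R D\<phi> x) = - (LINT x:\<Omega>|lebesgue. \<phi> x *\<^sub>R g x))"

text \<open>A representative; weak gradients are unique up to null sets.\<close>

definition weak_grad :: "(real^2) set \<Rightarrow> (real^2 \<Rightarrow> real) \<Rightarrow> real^2 \<Rightarrow> real^2" where
  "weak_grad \<Omega> u = (SOME g. weak_gradient_on \<Omega> u g)"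

text \<open>\<open>u \<in> W\<^sup>1\<^sup>,\<^sup>2\<close> locally in \<open>U - K\<close>, up to the part \<open>\<partial>U - K\<close> of the boundary: the compact
  sets \<open>C\<close> may touch \<open>\<partial>U\<close> but not \<open>K\<close>. Functions are total; only their values almost everywhere
  on \<open>U - K\<close> are relevant.\<close>

definition W12_loc :: "(real^2) set \<Rightarrow> (real^2) set \<Rightarrow> (real^2 \<Rightarrow> real) \<Rightarrow> bool" where
  "W12_loc U K u \<longleftrightarrow>
     (\<exists>g. weak_gradient_on (U - K) u g) \<and>
     (\<forall>C. compact C \<and> C \<subseteq> closure U - K \<longrightarrow>
        (\<lambda>x. (u x)\<^sup>2) absolutely_integrable_on (C \<inter> U) \<and>
        (\<lambda>x. (norm (weak_grad (U - K) u x))\<^sup>2) absolutely_integrable_on (C \<inter> U))"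

text \<open>\<open>\<tau>\<close> is the trace of \<open>u\<close> on \<open>\<partial>U - K\<close>. The trace operator is the continuous extension from
  \<open>W\<^sup>1\<^sup>,\<^sup>2\<close> to \<open>L\<^sup>2\<close> of the boundary of the restriction map on functions that are \<open>C\<^sup>1\<close> up to the
  boundary: near every point of \<open>\<partial>U - K\<close>, \<open>u\<close> is a \<open>W\<^sup>1\<^sup>,\<^sup>2\<close> limit of such functions whose
  restrictions to \<open>\<partial>U\<close> converge to \<open>\<tau>\<close> in \<open>L\<^sup>2\<close>.\<close>

definition has_trace ::
  "(real^2) set \<Rightarrow> (real^2) set \<Rightarrow> (real^2 \<Rightarrow> real) \<Rightarrow> (real^2 \<Rightarrow> real) \<Rightarrow> bool" where
  "has_trace U K u \<tau> \<longleftrightarrow>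
     (\<forall>y \<in> frontier U - K. \<exists>\<rho>>0. ball y \<rho> \<inter> K = {} \<and>
        (\<exists>v Dv. (\<forall>n::nat. C1_gradient (v n) (Dv n)) \<and>
           (\<lambda>n. \<integral>\<^sup>+ x \<in> ball y \<rho> \<inter> U.
               ennreal ((v n x - u x)\<^sup>2 + (norm (Dv n x - weak_grad (U - K) u x))\<^sup>2) \<partial>lebesgue)
             \<longlonglongrightarrow> 0 \<and>
           (\<lambda>n. \<integral>\<^sup>+ x \<in> ball y \<rho> \<inter> frontier U.
               ennreal ((v n x - \<tau> x)\<^sup>2) \<partial>hausdorff1_measure)
             \<longlonglongrightarrow> 0))"


section \<open>Generalized minimizers on a half-plane\<close>

text \<open>In the following \<open>U\<close> is meant to be an open half-plane.\<close>

definition admissible_pair :: "(real^2) set \<Rightarrow> (real^2) set \<Rightarrow> (real^2 \<Rightarrow> real) \<Rightarrow> bool" where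
  "admissible_pair U K u \<longleftrightarrow>
     closed K \<and> K \<subseteq> closure U \<and> W12_loc U K u \<and> has_trace U K u (\<lambda>_. 0)"

definition energy ::
  "(real^2) set \<Rightarrow> (real^2) set \<Rightarrow> (real^2 \<Rightarrow> real) \<Rightarrow> (real^2) set \<Rightarrow> ennreal" where
  "energy U K u A =
     (\<integral>\<^sup>+ x \<in> (A \<inter> U) - K. ennreal ((norm (weak_grad (U - K) u x))\<^sup>2) \<partial>lebesgue)
     + hausdorff1 (K \<inter> A)"

text \<open>Pairs coincide outside \<open>O\<close> if the closed sets agree there and the functions agree there as
  Sobolev functions, i.e. almost everywhere. The letter \<open>V\<close> is used for the open set.\<close>

definition admissible_competitor ::
  "(real^2) set \<Rightarrow> (real^2) set \<Rightarrow> (real^2 \<Rightarrow> real) \<Rightarrow>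
   (real^2) set \<Rightarrow> (real^2 \<Rightarrow> real) \<Rightarrow> (real^2) set \<Rightarrow> bool" where
  "admissible_competitor U K u J w V \<longleftrightarrow>
     admissible_pair U J w \<and> open V \<and> bounded V \<and>
     J - V = K - V \<and> (AE x in lebesgue. x \<in> U - K - V \<longrightarrow> w x = u x) \<and>
     (\<forall>p \<in> - (V \<union> K). \<forall>q \<in> - (V \<union> K).
        connected_component_set (- K) p \<noteq> connected_component_set (- K) q \<longrightarrow>
        connected_component_set (- J) p \<noteq> connected_component_set (- J) q)"

definition generalized_minimizer :: "(real^2) set \<Rightarrow> (real^2) set \<Rightarrow> (real^2 \<Rightarrow> real) \<Rightarrow> bool" where
  "generalized_minimizer U K u \<longleftrightarrow>
     admissible_pair U K u \<and>
     (\<forall>J w V. admissible_competitor U K u J w V \<longrightarrow> energy U K u V \<le> energy U J w V)"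

definition normalized :: "(real^2) set \<Rightarrow> bool" where
  "normalized K \<longleftrightarrow> (\<forall>x \<in> K. \<forall>\<rho>>0. hausdorff1 (K \<inter> ball x \<rho>) > 0)"

end

theory Submission
 imports Defs
begin

text \<open>Let \<open>D r\<close> be the Dirichlet energy of \<open>u\<close> in the disk of radius \<open>r\<close> around \<open>x\<close>. Cutting \<open>u\<close> to zero
 gives \<open>D r \<le> \<pi> r\<close>, and scaling \<open>u\<close> radially writes \<open>D r\<close> as a flux. Half circles meet \<open>K\<close> once
 and \<open>u = 0\<close> on the axis, so Wirtinger's inequality makes \<open>D r / r\<close> nondecreasing, hence nearly constant
 at some scale. There \<open>u\<close> is close to \<open>m sqrt r sin (t / 2)\<close> or its mirror image, and \<open>K\<close> hugs one half
 axis; counting length excludes switching. Cutting under a flat tent over that half axis saves more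
 energy than it costs length.\<close>

text \<open>The separation condition could spoil any competitor; a circle that meets
  \<open>K\<close> in one point disarms it, and every comparison below takes place inside such a
  circle. The threshold 1/4 behind monotonicity is the first eigenvalue of an arc of the largest
  possible length pi, with zero value at the axis and no condition at \<open>K\<close>. Shorter arcs
  have a strictly larger eigenvalue, and this gap pins \<open>K\<close> to the ends of the half
  circle. No blow-up limit is taken: \<open>DD r / r\<close> is monotone and at most pi, so some
  doubling of the radius raises it by at most a prescribed \<open>\<epsilon>\<close>, and all
  closeness statements are quantitative at that one scale. The price is that the half axis chosen by
  \<open>K\<close> might depend on the radius. Since \<open>K\<close> already spends length
  \<open>\<rho>\<close> inside the disk of radius \<open>\<rho>\<close>, it is too short to block
  all rays in a thin annulus, and on two well separated free rays the two profiles are incompatible.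
  The tent wins by orders: with slope \<open>\<delta>\<close> its roof exceeds its base by a
  multiple of \<open>\<delta>^2\<close>, while the energy below it is at least a multiple of
  \<open>\<delta>\<close>.\<close>

abbreviation lborel2 :: "(real * real) measure" where "lborel2 == lborel \<Otimes>\<^sub>M lborel"
notation scaleR (infixr \<open>*R\<close> 75)
lemmas LBINT_def = set_lebesgue_integral_def
lemmas sintegrable_def = set_integrable_def
abbreviation "ind == indicator"
abbreviation "bm == borel_measurable"
abbreviation "sint == set_integrable lborel"
abbreviation nnint (binder \<open>NN \<close> 10) where "nnint f == nn_integral lborel f"
abbreviation nnint2 (binder \<open>NP \<close> 10) where "nnint2 f == nn_integral lborel2 f"
lemmas bochner_bound = Bochner_Integration.integrable_bound
lemmas bochner_cong = Bochner_Integration.integral_cong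

section \<open>Length bounds for Lipschitz images\<close>

text \<open>Cutting \<open>[a, b]\<close> into \<open>n\<close> equal pieces covers the image by
  \<open>n\<close> sets of diameter at most \<open>L * h <= \<delta>\<close>, and these bounds sum
  to \<open>L * (b - a)\<close> whatever \<open>\<delta>\<close> is. All upper bounds for lengths of
  arcs and for the roof of the tent come from here.\<close>

lemma hausdorff1_Lipschitz_image_le:
 fixes g :: "real => 'a::metric_space"
 assumes ab: "a <= b" and L: "L >= 0"
  and lip: "!!s t. s \<in> {a..b} ==> t \<in> {a..b} ==> dist (g s) (g t) <= L * \<bar>s - t\<bar>"
 shows "hausdorff1 (g ` {a..b}) <= ennreal (L * (b - a))"
 unfolding hausdorff1_def
proof (rule SUP_least)
 fix \<delta> :: real assume "\<delta> \<in> {0<..}"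
 then have d: "\<delta> > 0" by simp
 obtain n0 :: nat where n0: "L * (b - a) / \<delta> < n0" using reals_Archimedean2 by blast
 define n where "n = Suc n0"
 have n: "n > 0" "L * (b - a) / n <= \<delta>"
 proof -
  have "L * (b - a) < n0 * \<delta>" using n0 d by (simp add: field_simps)
  also have "... <= n * \<delta>" using d by (simp add: n_def)
  finally show "L * (b - a) / n <= \<delta>" by (simp add: n_def field_simps)
 qed (simp add: n_def)
 define h where "h = (b - a) / n"
 have h0: "h >= 0" using ab by (simp add: h_def)
 define E where "E i = (if i < n then g ` ({a + i * h .. a + Suc i * h} Int {a..b}) else {})" for i :: nat
 have dst: "dist x y <= L * h" if "x \<in> E i" "y \<in> E i" for i x y
 proof -
  have "i < n" using that by (auto simp: E_def split: if_splits)
  then have "x \<in> g ` ({a + i * h .. a + Suc i * h} Int {a..b})" "y \<in> g ` ({a + i * h .. a + Suc i * h} Int {a..b})"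
   using that by (simp_all add: E_def del: of_nat_Suc)
  then obtain s t where st: "x = g s" "y = g t" "s \<in> {a + i * h .. a + Suc i * h} Int {a..b}"
   "t \<in> {a + i * h .. a + Suc i * h} Int {a..b}"
   by (elim imageE)
  have "\<bar>s - t\<bar> <= h" using st(3,4) by (auto simp: algebra_simps)
  then have "L * \<bar>s - t\<bar> <= L * h" using L by (rule mult_left_mono)
  then show ?thesis using lip[of s t] st by auto
 qed
 have Lh: "L * h >= 0" using L h0 by simp
 have diam: "diameter (E i) <= L * h" for i
  unfolding diameter_def using dst Lh by (auto intro!: cSUP_least)
 have bd: "bounded (E i)" for i
  unfolding bounded_two_points using dst by blast
 have cov: "g ` {a..b} <= (\<Union>i. E i)"
 proof
  fix y assume "y \<in> g ` {a..b}"
  then obtain s where s: "s \<in> {a..b}" "y = g s" by auto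
  show "y \<in> (\<Union>i. E i)"
  proof (cases "h = 0")
   case True
   then have "a = b" using n by (simp add: h_def)
   then have "y \<in> E 0" using s n by (auto simp: E_def True)
   then show ?thesis by blast
  next
   case False
   then have h: "h > 0" using h0 by simp
   define i where "i = nat \<lfloor>(s - a) / h\<rfloor>"
   show ?thesis
   proof (cases "i < n")
    case True
    have "0 <= (s - a) / h" using s h by simp
    then have "real i <= (s - a) / h" "(s - a) / h < real i + 1"
     unfolding i_def by (simp_all add: of_nat_nat)
    then have "a + i * h <= s" "s <= a + Suc i * h" using h by (simp_all add: field_simps)
    then have "y \<in> E i" using True s by (auto simp: E_def)
    then show ?thesis by blast
   next
    \<comment> \<open>Only the right end point has floor index \<open>n\<close>, one beyond the last
      piece; it is assigned to the piece \<open>n - 1\<close>.\<close>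
    case False
    have "0 <= (s - a) / h" using s h by simp
    then have "real i <= (s - a) / h" unfolding i_def by (simp add: of_nat_nat)
    then have "a + n * h <= s" using h False
     by (smt (verit) le_divide_eq mult_right_mono of_nat_mono linorder_not_less)
    then have "s = b" using s n by (simp add: h_def)
    then have "s \<in> {a + (n - 1) * h .. a + Suc (n - 1) * h}"
     using n h by (auto simp: h_def of_nat_diff field_simps)
    then have "y \<in> E (n - 1)" using s n by (auto simp: E_def of_nat_diff)
    then show ?thesis by blast
   qed
  qed
 qed
 have "hausdorff1_pre \<delta> (g ` {a..b}) <= (\<Sum>i. ennreal (diameter (E i)))"
  unfolding hausdorff1_pre_def
 proof (rule INF_lower, intro CollectI conjI allI)
  show "diameter (E i) <= \<delta>" for i
   using diam[of i] n(2) by (simp add: h_def)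
 qed (use cov bd in auto)
 also have "... = (\<Sum>i<n. ennreal (diameter (E i)))"
  by (rule suminf_finite) (auto simp: E_def)
 also have "... <= (\<Sum>i<n. ennreal (L * h))"
  by (intro sum_mono ennreal_leI diam)
 also have "... = ennreal (n * (L * h))"
  using Lh by (simp add: ennreal_of_nat_eq_real_of_nat ennreal_mult)
 also have "n * (L * h) = L * (b - a)" using n by (simp add: h_def)
 finally show "hausdorff1_pre \<delta> (g ` {a..b}) <= ennreal (L * (b - a))" .
qed

text \<open>Only pairs at distance at most \<open>\<delta>\<close> matter, since the covers in
  \<open>hausdorff1_pre \<delta>\<close> consist of sets of such diameter, and each is sent into an
  interval of length \<open>C * diameter\<close>. The local form permits a better constant for the
  angle function. \<open>S\<close> is a separate Borel set because the image of \<open>A\<close>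
  need not be measurable.\<close>

lemma lborel_le_hausdorff1_image:
 fixes f :: "'a::metric_space => real"
 assumes d0: "\<delta> > 0" and C0: "C > 0"
  and lip: "!!y z. y \<in> A ==> z \<in> A ==> dist y z <= \<delta> ==> \<bar>f y - f z\<bar> <= C * dist y z"
  and S: "S \<in> sets borel" "S <= f ` A"
 shows "emeasure lborel S <= ennreal C * hausdorff1 A"
proof -
 have C: "C >= 0" using C0 by simp
 have cover: "emeasure lborel S <= ennreal C * (\<Sum>i. ennreal (diameter (E i)))"
  if E: "A <= (\<Union>i. E i)" "!!i. bounded (E i)" "!!i. diameter (E i) <= \<delta>" for E :: "nat => 'a set"
 proof -
  define I where "I i = (if E i Int A = {} then {} else
    {Inf (f ` (E i Int A)) .. Inf (f ` (E i Int A)) + C * diameter (E i)})" for i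
  have close: "\<bar>f y - f z\<bar> <= C * diameter (E i)" if "y \<in> E i Int A" "z \<in> E i Int A" for i y z
  proof -
   have "dist y z <= diameter (E i)" using that diameter_bounded_bound[OF E(2)] by auto
   then show ?thesis using lip[of y z] that E(3)[of i] mult_left_mono[OF _ C] 
    by (meson IntD2 order_trans)
  qed
  have sub: "f y \<in> I i" if "y \<in> E i Int A" for y i
  proof -
   have bb: "bdd_below (f ` (E i Int A))"
    unfolding bdd_below_def using close[OF _ that]
    by (intro exI[of _ "f y - C * diameter (E i)"]) (force simp: abs_le_iff algebra_simps)
   have "Inf (f ` (E i Int A)) <= f y" using bb that by (auto intro: cInf_lower)
   moreover have "f y - C * diameter (E i) <= Inf (f ` (E i Int A))"
   proof (rule cInf_greatest)
    show "f y - C * diameter (E i) <= w" if "w \<in> f ` (E i Int A)" for w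
     using that close[OF _ \<open>y \<in> E i Int A\<close>] by (auto simp: abs_le_iff) (smt (verit))
   qed (use that in auto)
   ultimately show ?thesis using that by (auto simp: I_def)
  qed
  have "S <= (\<Union>i. I i)"
  proof
   fix s assume "s \<in> S"
   then obtain y where "y \<in> A" "s = f y" using S by auto
   moreover obtain i where "y \<in> E i" using E(1) \<open>y \<in> A\<close> by auto
   ultimately show "s \<in> (\<Union>i. I i)" using sub[of y i] by auto
  qed
  then have "emeasure lborel S <= emeasure lborel (\<Union>i. I i)"
   by (intro emeasure_mono) (auto simp: I_def)
  also have "... <= (\<Sum>i. emeasure lborel (I i))"
   by (intro emeasure_subadditive_countably) (auto simp: I_def)
  also have "... <= (\<Sum>i. ennreal C * ennreal (diameter (E i)))"
  proof (intro suminf_le allI)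
   fix i show "emeasure lborel (I i) <= ennreal C * ennreal (diameter (E i))"
    using C diameter_ge_0[OF E(2)[of i]] by (auto simp: I_def ennreal_mult[symmetric])
  qed auto
  also have "... = ennreal C * (\<Sum>i. ennreal (diameter (E i)))" by simp
  finally show ?thesis .
 qed
 have "emeasure lborel S / ennreal C <= hausdorff1_pre \<delta> A"
  unfolding hausdorff1_pre_def
 proof (rule INF_greatest)
  fix E :: "nat => 'a set" assume "E \<in> {E. A <= (\<Union>i. E i) & (\<forall>i. bounded (E i) & diameter (E i) <= \<delta>)}"
  then have "emeasure lborel S <= ennreal C * (\<Sum>i. ennreal (diameter (E i)))"
   using cover by blast
  then show "emeasure lborel S / ennreal C <= (\<Sum>i. ennreal (diameter (E i)))"
   using C0 by (intro divide_le_posI_ennreal) (auto simp: mult.commute)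
 qed
 then have "ennreal C * (emeasure lborel S / ennreal C) <= ennreal C * hausdorff1_pre \<delta> A"
  by (rule mult_left_mono) auto
 moreover have "ennreal C * (emeasure lborel S / ennreal C) = emeasure lborel S"
  using C0 by (metis ennreal_times_divide mult.commute ennreal_mult_divide_eq ennreal_neq_top ennreal_eq_0_iff not_le)
 ultimately have "emeasure lborel S <= ennreal C * hausdorff1_pre \<delta> A" by simp
 also have "... <= ennreal C * hausdorff1 A"
  by (intro mult_left_mono hausdorff1_pre_le d0) auto
 finally show ?thesis .
qed

lemma hausdorff1_Un_disjoint:
 fixes A B :: "'a::metric_space set"
 assumes "A \<in> sets borel" "B \<in> sets borel" "A Int B = {}"
 shows "hausdorff1 (A Un B) = hausdorff1 A + hausdorff1 B"
 using plus_emeasure[of A hausdorff1_measure B] assms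
 by (simp add: emeasure_hausdorff1_measure)

section \<open>Null functions and bump functions\<close>

text \<open>Boxes generate the Borel sets and are stable under intersection; the sets with vanishing
  integral are closed under complements and countable disjoint unions. Hence all Borel integrals of
  \<open>h\<close> vanish.\<close>

lemma AE_zero_if_box_integrals_zero:
 fixes h :: "'a::euclidean_space => real"
 assumes h: "integrable lborel h"
  and box: "!!a b. (LINT x:box a b|lborel. h x) = 0"
 shows "AE x in lborel. h x = 0"
proof (rule sigma_finite_measure.density_zero[OF lborel.sigma_finite_measure_axioms h])
 let ?E = "range (%(a, b). box a b::'a set)"
 \<comment> \<open>The whole space is an increasing union of boxes; its integral is needed for the
   complement step.\<close>
 have lim: "(LBINT x. h x) = 0"
 proof -
  let ?A = "%n::nat. box (- (real n *R One)) (real n *R One) :: 'a set"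
  have U: "(\<Union>i. ?A i) = UNIV" by (rule UN_box_eq_UNIV)
  have "(%n. LINT x:?A n|lborel. h x) \<longlonglongrightarrow> (LINT x:(\<Union>n. ?A n)|lborel. h x)"
  proof (rule set_integral_cont_up)
   show "incseq ?A"
    by (auto simp: incseq_def subset_box mem_box)
   show "sint (\<Union>i. ?A i) h" using h U by (simp add: sintegrable_def)
  qed auto
  then have "(LINT x:(\<Union>n. ?A n)|lborel. h x) = 0" using box by (simp add: LIMSEQ_const_iff)
  then show ?thesis unfolding U by (simp add: LBINT_def)
 qed
 fix A :: "'a set" assume "A \<in> sets lborel"
 then have "A \<in> sigma_sets UNIV ?E" by (simp add: borel_eq_box)
 moreover have "Int_stable ?E" by (auto simp: Int_stable_def box_Int_box)
 moreover have "?E <= Pow UNIV" by auto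
 ultimately show "set_lebesgue_integral lborel A h = 0"
 proof (rule_tac sigma_sets_induct_disjoint[where G = "?E" and \<Omega> = UNIV and A = A and P = "%A. set_lebesgue_integral lborel A h = 0"], goal_cases)
  case (4 A) then show ?case using box by auto next case 5 show ?case by (simp add: LBINT_def) next
  case compl: (6 A)
  then have [measurable]: "A \<in> sets borel" by (simp add: borel_eq_box)
  have "(LINT x:UNIV|lborel. h x) = (LINT x:A|lborel. h x) + (LINT x:(UNIV - A)|lborel. h x)"
  proof -
   have i: "sint B h" if "B \<in> sets borel" for B
    using integrable_mult_indicator[of B lborel h] h that by (simp add: sintegrable_def)
   have "(LINT x:A Un (UNIV - A)|lborel. h x) = (LINT x:A|lborel. h x) + (LINT x:(UNIV - A)|lborel. h x)"
    by (rule set_integral_Un) (auto intro!: i)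
   then show ?thesis by simp
  qed
  with compl lim show ?case by (simp add: LBINT_def)
 next
  case union: (7 A)
  then have "A i \<in> sets borel" for i by (auto simp: borel_eq_box)
  then have "(LINT x:(\<Union>i. A i)|lborel. h x) = (\<Sum>i. LINT x:A i|lborel. h x)"
   using h \<open>disjoint_family A\<close> \<open>!!i. A i \<in> sets borel\<close> integrable_mult_indicator[of "\<Union>(range A)" lborel h]
   by (intro lebesgue_integral_countable_add)
    (auto simp: sintegrable_def disjoint_family_on_def simp del: real_scaleR_def)
  then show ?case using union by simp
 qed auto
qed

text \<open>The square gives the positive part a continuous derivative, so that products of such
  terms are C1 with support in an interval.\<close>

definition sqpos :: "real => real" where "sqpos s = (max 0 s)^2"

lemma sqpos_nonneg [simp]: "sqpos s >= 0" by (simp add: sqpos_def)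

lemma sqpos_pos_iff [simp]: "sqpos s > 0 \<longleftrightarrow> s > 0" by (auto simp: sqpos_def max_def)

lemma sqpos_eq_0_iff [simp]: "sqpos s = 0 \<longleftrightarrow> s <= 0" by (auto simp: sqpos_def max_def)

lemma DERIV_sqpos [derivative_intros]:
 assumes "(f has_real_derivative f') (at s)"
 shows "((%s. sqpos (f s)) has_real_derivative (2 * max 0 (f s) * f')) (at s)"
proof -
 have "(sqpos has_real_derivative (2 * max 0 t)) (at t)" for t
 proof (cases "t = 0")
  case True
  have "((%h. (sqpos (0 + h) - sqpos 0) / h) \<longlongrightarrow> 0) (at 0)"
  proof (rule tendsto_rabs_zero_cancel, rule tendsto_sandwich)
   show "\<forall>\<^sub>F h in at (0::real). 0 <= \<bar>(sqpos (0 + h) - sqpos 0) / h\<bar>" by simp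
   show "\<forall>\<^sub>F h in at (0::real). \<bar>(sqpos (0 + h) - sqpos 0) / h\<bar> <= \<bar>h\<bar>"
    by (rule always_eventually) (auto simp: sqpos_def max_def power2_eq_square)
   show "((%h::real. \<bar>h\<bar>) \<longlongrightarrow> 0) (at 0)" by (rule tendsto_rabs_zero) (rule tendsto_ident_at)
  qed simp
  then show ?thesis unfolding True DERIV_def by simp
 next
  case False
  show ?thesis
  proof (cases "t > 0")
   case True
   have "((%t. t^2) has_real_derivative 2 * max 0 t) (at t)"
    using True by (auto intro!: derivative_eq_intros)
   moreover have "\<forall>\<^sub>F s in nhds t. sqpos s = s^2"
    using eventually_gt_at_top eventually_nhds_in_open[of "{0<..}" t] True
    by (auto elim!: eventually_mono simp: sqpos_def)
   ultimately show ?thesis by (subst DERIV_cong_ev[OF refl _ refl]) auto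
  next
   case False
   then have t: "t < 0" using \<open>t ~= 0\<close> by simp
   have "((%t. 0::real) has_real_derivative 2 * max 0 t) (at t)"
    using t by (auto intro!: derivative_eq_intros)
   moreover have "\<forall>\<^sub>F s in nhds t. sqpos s = 0"
    using eventually_nhds_in_open[of "{..<0}" t] t
    by (auto elim!: eventually_mono simp: sqpos_def)
   ultimately show ?thesis by (subst DERIV_cong_ev[OF refl _ refl]) auto
  qed
 qed
 from DERIV_chain2[OF this assms] show ?thesis .
qed

lemma continuous_on_sqpos [continuous_intros]:
 "continuous_on S f ==> continuous_on S (%s. sqpos (f s))"
 unfolding sqpos_def by (intro continuous_intros)

lemma measurable_sqpos [measurable]: "sqpos \<in> bm borel"
 unfolding sqpos_def by measurable

text \<open>As \<open>n \<rightarrow> \<infinity>\<close> these \<open>C\<^sup>1\<close> functions increase to the indicator function of \<open>(a, b)\<close>.\<close>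

definition bump :: "nat => real => real => real => real" where
 "bump n a b s = (n * (sqpos (s - a) * sqpos (b - s))) / (1 + n * (sqpos (s - a) * sqpos (b - s)))"

definition bump' :: "nat => real => real => real => real" where
 "bump' n a b s = n * (2 * max 0 (s - a) * sqpos (b - s) - sqpos (s - a) * (2 * max 0 (b - s)))
  / (1 + n * (sqpos (s - a) * sqpos (b - s)))^2"

lemma bump_denom_pos: "1 + real n * (sqpos s * sqpos t) > 0"
 by (meson add_pos_nonneg mult_nonneg_nonneg of_nat_0_le_iff sqpos_nonneg zero_less_one)

lemma bump_bounds: "0 <= bump n a b s" "bump n a b s <= 1"
 using bump_denom_pos[of n "s - a" "b - s"]
 by (auto simp: bump_def divide_simps)

lemma bump_eq_0: "s ~: {a<..<b} ==> bump n a b s = 0"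
 by (auto simp: bump_def)

lemma DERIV_bump: "(bump n a b has_real_derivative bump' n a b s) (at s)"
proof -
 let ?w = "%s. real n * (sqpos (s - a) * sqpos (b - s))"
 have "((%s. ?w s / (1 + ?w s)) has_real_derivative bump' n a b s) (at s)"
  using bump_denom_pos[of n "s - a" "b - s"]
  by (auto intro!: derivative_eq_intros simp: bump'_def power2_eq_square)
   (simp add: field_simps)
 then show ?thesis unfolding bump_def[abs_def] .
qed

lemma continuous_on_bump [continuous_intros]:
 "continuous_on S f ==> continuous_on S (%s. bump n a b (f s))"
 unfolding bump_def using bump_denom_pos
 by (intro continuous_intros) (auto simp: less_imp_neq[symmetric] dest: less_imp_neq)

lemma continuous_on_bump' [continuous_intros]:
 "continuous_on S f ==> continuous_on S (%s. bump' n a b (f s))"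
 unfolding bump'_def using bump_denom_pos
 by (intro continuous_intros) (auto simp: less_imp_neq[symmetric] dest: less_imp_neq)

lemma bump_tendsto: "(%n. bump n a b s) \<longlonglongrightarrow> ind {a<..<b} s"
proof (cases "s \<in> {a<..<b}")
 case True
 define c where "c = sqpos (s - a) * sqpos (b - s)"
 have c: "c > 0" using True by (simp add: c_def)
 have "(%n. real n * c / (1 + real n * c)) \<longlonglongrightarrow> 1"
 proof -
  have "(%n. 1 - 1 / (1 + real n * c)) \<longlonglongrightarrow> 1 - 0"
  proof (intro tendsto_intros)
   have "filterlim (%n. 1 + real n * c) at_top sequentially"
    using c by (intro filterlim_tendsto_add_at_top[OF tendsto_const]
      filterlim_at_top_mult_tendsto_pos[OF tendsto_const] filterlim_real_sequentially)
   then show "(%n. 1 / (1 + real n * c)) \<longlonglongrightarrow> 0"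
    by (rule real_tendsto_divide_at_top[OF tendsto_const])
  qed
  moreover have "real n * c / (1 + real n * c) = 1 - 1 / (1 + real n * c)" for n
   using c by (simp add: field_simps add_pos_nonneg less_imp_neq[symmetric])
  ultimately show ?thesis by simp
 qed
 then show ?thesis using True by (simp add: bump_def c_def)
next
 case False
 then show ?thesis by (simp add: bump_eq_0)
qed

section \<open>C1 test functions and uniqueness of weak gradients\<close>

lemma GDERIV_vec_nth: "GDERIV (%y::real^'n. y $ i) y :> axis i 1"
 unfolding gderiv_def inner_axis
 by (simp add: bounded_linear_imp_has_derivative[OF bounded_linear_vec_nth])

lemma C1_gradient_zero: "C1_gradient (%_. 0) (%_. 0)"
 by (simp add: C1_gradient_def GDERIV_const)

lemma C1_gradient_continuous: "C1_gradient f Df ==> continuous_on S f"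
 unfolding C1_gradient_def gderiv_def
 by (meson continuous_on_eq_continuous_at continuous_on_subset has_derivative_continuous open_UNIV subset_UNIV)

lemma C1_gradient_mult:
 assumes "C1_gradient f Df" "C1_gradient h Dh"
 shows "C1_gradient (%y. f y * h y) (%y. f y *R Dh y + h y *R Df y)"
 using assms C1_gradient_continuous[OF assms(1)] C1_gradient_continuous[OF assms(2)]
 unfolding C1_gradient_def by (auto intro!: GDERIV_mult continuous_intros)

text \<open>The open sets \<open>Om\<close> and \<open>- C\<close> cover the plane; on their overlap
  \<open>ph\<close> vanishes locally, so both candidate gradients are zero there and extension by
  zero stays C1.\<close>

lemma C1_gradient_extend:
 assumes O: "open Om" and C: "compact C" "C <= Om"
  and D: "!!y. y \<in> Om ==> GDERIV ph y :> D y" "continuous_on Om D"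
  and z: "!!y. y ~: C ==> ph y = 0"
 shows "C1_gradient ph (%y. if y \<in> Om then D y else 0)"
proof -
 have opC: "open (- C)" using C by (simp add: compact_imp_closed open_Compl)
 have out: "GDERIV ph y :> 0" if "y \<in> - C" for y
  unfolding gderiv_def
 proof (rule has_derivative_transform_within_open[OF _ opC that])
  show "((%_. 0) has_derivative (%h. h \<bullet> 0)) (at y)" by simp
 qed (use z in auto)
 have uniq: "D y = 0" if "y \<in> Om - C" for y
 proof -
  have "(%h. h \<bullet> D y) = (%h. h \<bullet> 0)"
   using D(1)[of y] out[of y] that unfolding gderiv_def by (intro has_derivative_unique) auto
  then have "D y \<bullet> D y = 0" by (metis inner_zero_right)
  then show ?thesis by simp
 qed
 have "continuous_on (Om Un - C) (%y. if y \<in> Om then D y else 0)"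
 proof (rule continuous_on_open_Un[OF O opC])
  show "continuous_on Om (%y. if y \<in> Om then D y else 0)"
   using D(2) by (rule continuous_on_eq) auto
  show "continuous_on (- C) (%y. if y \<in> Om then D y else 0)"
   by (rule continuous_on_eq[of _ "%_. 0"]) (use uniq in auto)
 qed
 moreover have "Om Un - C = UNIV" using C by auto
 ultimately show ?thesis
  unfolding C1_gradient_def using D(1) out C by auto
qed

text \<open>An exhaustion of \<open>Om\<close> by compact sets. \<open>weak_gradient_on\<close>
  provides integrability on compact subsets only, so measurability on all of \<open>Om\<close> has
  to be recovered this way.\<close>

lemma measurable_if_integrable_on_compacts:
 fixes f :: "'a::euclidean_space => 'b::euclidean_space"
 assumes O: "open Om" and f: "!!C. compact C ==> C <= Om ==> f absolutely_integrable_on C"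
 shows "(%y. ind Om y *R f y) \<in> bm lebesgue"
proof -
 obtain C where C: "!!n. compact (C n)" "!!n. C n <= Om" "!!n. C n <= interior (C (Suc n))"
  "(\<Union>n. C n) = Om"
  using open_Union_compact_subsets[OF O] by metis
 have mono: "C m <= C n" if "m <= n" for m n
  by (rule lift_Suc_mono_le[of C, OF _ that]) (meson C(3) interior_subset order_trans)
 show ?thesis
 proof (rule borel_measurable_LIMSEQ_metric)
  show "(%y. ind (C n) y *R f y) \<in> bm lebesgue" for n
   using f[OF C(1,2)] unfolding sintegrable_def by (rule borel_measurable_integrable)
  fix y
  show "(%n. ind (C n) y *R f y) \<longlonglongrightarrow> ind Om y *R f y"
  proof (cases "y \<in> Om")
   case True
   then obtain m where m: "y \<in> C m" using C(4) by auto
   show ?thesis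
    by (rule tendsto_eventually, rule eventually_sequentiallyI[of m]) (use m mono True in "auto simp: indicator_def")
  next
   case False
   then have "y ~: C n" for n using C(2) by blast
   then show ?thesis using False by simp
  qed
 qed
qed

lemma AE_zero_if_box_integrals_zero_lebesgue:
 fixes h :: "'a::euclidean_space => real"
 assumes h: "integrable lebesgue h"
  and box: "!!a b. (LINT x:box a b|lebesgue. h x) = 0"
 shows "AE x in lebesgue. h x = 0"
proof -
 obtain h' where h': "h' \<in> bm lborel" "AE x in lborel. h x = h' x"
  using completion_ex_borel_measurable_real[OF borel_measurable_integrable[OF h]] by auto
 have ae: "AE x in lebesgue. h x = h' x" using h'(2) by (rule AE_completion)
 have "integrable lebesgue h'"
  using h ae h'(1) by (subst integrable_cong_AE[of _ _ h]) (auto simp: measurable_completion)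
 then have i: "integrable lborel h'" using h'(1) by (simp add: integrable_completion)
 have "AE x in lborel. h' x = 0"
 proof (rule AE_zero_if_box_integrals_zero[OF i])
  fix a b :: 'a
  have "(LINT x:box a b|lebesgue. h' x) = (LINT x:box a b|lebesgue. h x)"
   using ae h h'(1) by (intro set_lebesgue_integral_cong_AE) (auto simp: measurable_completion)
  moreover have "(LINT x:box a b|lebesgue. h' x) = (LINT x:box a b|lborel. h' x)"
   unfolding LBINT_def using h'(1) by (intro integral_completion) auto
  ultimately show "(LINT x:box a b|lborel. h' x) = 0" using box by simp
 qed
 then have "AE x in lebesgue. h' x = 0" by (rule AE_completion)
 with ae show ?thesis by eventually_elim simp
qed

lemma C1_gradient_bump2:
 "C1_gradient (%y::real^2. bump n a b (y $ 1) * bump m c d (y $ 2))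
  (%y. bump n a b (y $ 1) *R (bump' m c d (y $ 2) *R axis 2 1)
    + bump m c d (y $ 2) *R (bump' n a b (y $ 1) *R axis 1 1))"
proof -
 have "C1_gradient (%y::real^2. bump n a b (y $ i)) (%y. bump' n a b (y $ i) *R axis i 1)"
  for n a b and i :: 2
  unfolding C1_gradient_def
  by (auto intro!: GDERIV_DERIV_compose[OF GDERIV_vec_nth DERIV_bump] continuous_intros)
 from C1_gradient_mult[OF this this] show ?thesis .
qed

text \<open>Fundamental lemma of the calculus of variations. Products of two bumps are C1 test
  functions supported in a closed box and tend to the indicator of the open box, so dominated
  convergence gives zero integrals of \<open>h\<close> over all boxes inside
  \<open>Om\<close>.\<close>

lemma weak_gradient_unique_aux:
 fixes h :: "real^2 => real^2"
 assumes O: "open Om"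
  and int: "!!C. compact C ==> C <= Om ==> h absolutely_integrable_on C"
  and test: "!!ph Dph C. C1_gradient ph Dph ==> compact C ==> C <= Om ==> (!!x. x ~: C ==> ph x = 0) ==>
   (LINT x:Om|lebesgue. ph x *R h x) = 0"
 shows "AE x in lebesgue. x \<in> Om --> h x = 0"
proof -
 have sub0: "(LINT x:box a b|lebesgue. h x) = 0" if ab: "cbox a b <= Om" for a b
 proof -
  define ph where "ph n y = bump n (a$1) (b$1) (y $ 1) * bump n (a$2) (b$2) (y $ 2)" for n and y :: "real^2"
  define k where "k = (%y. ind (cbox a b) y *R h y)"
  have lim: "(%n. LINT y|lebesgue. ph n y *R k y)
   \<longlonglongrightarrow> (LINT y|lebesgue. ind (box a b) y *R h y)"
  proof (rule integral_dominated_convergence)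
   have i: "integrable lebesgue (%y. k y)"
    using int[OF compact_cbox ab] by (simp add: sintegrable_def k_def)
   then show "integrable lebesgue (%y. norm (k y))" by (rule integrable_norm)
   have "(%y. ind (box a b) y *R k y) \<in> bm lebesgue"
    using i by (intro borel_measurable_integrable integrable_mult_indicator) auto
   moreover have "(%y. ind (box a b) y *R k y) = (%y. ind (box a b) y *R h y)"
    using box_subset_cbox[of a b] by (auto simp: indicator_def fun_eq_iff k_def)
   ultimately show "(%y. ind (box a b) y *R h y) \<in> bm lebesgue" by simp
   have "continuous_on UNIV (ph n)" for n unfolding ph_def by (intro continuous_intros)
   then have [measurable]: "ph n \<in> bm borel" for n
    by (rule borel_measurable_continuous_onI)
   have "ph n \<in> bm lebesgue" for n
    by (rule measurable_completion) measurable
   then show "(%y. ph n y *R k y) \<in> bm lebesgue" for n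
    using i by (intro borel_measurable_scaleR) (auto simp: borel_measurable_integrable)
   have "\<bar>ph n y\<bar> <= 1" for n y
    using bump_bounds unfolding ph_def by (simp add: abs_mult mult_le_one)
   then show "AE y in lebesgue. norm (ph n y *R k y) <= norm (k y)" for n
    by (intro AE_I2) (simp add: mult_left_le_one_le)
   show "AE y in lebesgue. (%n. ph n y *R k y) \<longlonglongrightarrow> ind (box a b) y *R h y"
   proof (rule AE_I2)
    fix y
    have "(%n. ph n y *R k y) \<longlonglongrightarrow>
      (ind {a$1<..<b$1} (y$1) * ind {a$2<..<b$2} (y$2)) *R k y"
     unfolding ph_def by (intro tendsto_intros bump_tendsto)
    also have "(ind {a$1<..<b$1} (y$1) * ind {a$2<..<b$2} (y$2)) *R k y
      = ind (box a b) y *R h y"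
     by (auto simp: indicator_def mem_box_cart forall_2 k_def)
    finally show "(%n. ph n y *R k y) \<longlonglongrightarrow> ind (box a b) y *R h y" .
   qed
  qed
  have "(LINT y|lebesgue. ph n y *R k y) = 0" for n
  proof -
   have z: "ph n y = 0" if "y ~: cbox a b" for y
    using that unfolding ph_def by (auto simp: mem_box_cart forall_2 not_le intro: bump_eq_0)
   have "(LINT y:Om|lebesgue. ph n y *R h y) = 0"
    using z unfolding ph_def by (intro test[OF C1_gradient_bump2 compact_cbox ab]) auto
   moreover have "ind Om y *R (ph n y *R h y) = ph n y *R k y" for y
   proof (cases "y \<in> cbox a b")
    case True then show ?thesis using ab by (auto simp: indicator_def k_def)
   next
    case False then show ?thesis using z by simp
   qed
   ultimately show ?thesis by (simp add: LBINT_def)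
  qed
  with lim show ?thesis by (simp add: LBINT_def LIMSEQ_const_iff)
 qed
 \<comment> \<open>Countably many closed boxes fill \<open>Om\<close>; on each one \<open>h\<close>
   is integrable, and the boundary of a box is negligible.\<close>
 obtain \<D> where D: "countable \<D>" "\<D> <= Pow Om" "!!X. X \<in> \<D> ==> \<exists>a b. X = cbox a b" "\<Union>\<D> = Om"
  by (rule open_countable_Union_open_cbox[OF O]) (rule that)
 have "AE x in lebesgue. x \<in> X --> h x = 0" if X: "X \<in> \<D>" for X
 proof -
  obtain c d where cd: "X = cbox c d" using D(3) X by blast
  have sub: "cbox c d <= Om" using D(4) X cd by auto
  have i: "integrable lebesgue (%y. ind (cbox c d) y *R h y)"
   using int[OF compact_cbox sub] by (simp add: sintegrable_def)
  have "AE x in lebesgue. (ind (box c d) x *R h x) $ k = 0" for k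
  proof (rule AE_zero_if_box_integrals_zero_lebesgue)
   have "integrable lebesgue (%y. ind (box c d) y *R (ind (cbox c d) y *R h y))"
    by (rule integrable_mult_indicator[OF _ i]) auto
   then have i2: "integrable lebesgue (%y. ind (box c d) y *R h y)"
    using box_subset_cbox[of c d]
    by (elim back_subst[of "integrable lebesgue"]) (auto simp: indicator_def fun_eq_iff)
   then show "integrable lebesgue (%x. (ind (box c d) x *R h x) $ k)"
    using integrable_inner_left[of "axis k 1" lebesgue "%x. ind (box c d) x *R h x"]
    by (simp add: cart_eq_inner_axis)
   fix a b :: "real^2"
   obtain a' b' where ab': "box a b Int box c d = box a' b'" using box_Int_box[of a b c d] by (rule that)
   show "(LINT x:box a b|lebesgue. (ind (box c d) x *R h x) $ k) = 0"
   proof (cases "box a' b' = {}")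
    case True
    then have "(%x. ind (box a b) x *R (ind (box c d) x *R h x) $ k) = (%_. 0)"
     using ab' by (auto simp: fun_eq_iff indicator_def)
    then show ?thesis by (simp add: LBINT_def)
   next
    case False
    have "cbox a' b' = closure (box a' b')" using False by simp
    also have "... <= closure (box c d)" using ab' by (intro closure_mono) auto
    also have "... <= cbox c d" by (intro closure_minimal box_subset_cbox closed_cbox)
    finally have "cbox a' b' <= Om" using sub by blast
    then have z: "(LINT x:box a' b'|lebesgue. h x) = 0" by (rule sub0)
    have "(LINT x:box a b|lebesgue. (ind (box c d) x *R h x) $ k)
      = (LINT x|lebesgue. (ind (box a' b') x *R h x) \<bullet> axis k 1)"
     unfolding LBINT_def ab'[symmetric]
     by (intro bochner_cong) (auto simp: indicator_def cart_eq_inner_axis)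
    also have "... = (LINT x|lebesgue. ind (box a' b') x *R h x) \<bullet> axis k 1"
    proof (rule integral_inner_left)
     have "integrable lebesgue (%y. ind (box a b) y *R (ind (box c d) y *R h y))"
      by (rule integrable_mult_indicator[OF _ i2]) auto
     then show "integrable lebesgue (%x. ind (box a' b') x *R h x)"
      unfolding ab'[symmetric]
      by (elim back_subst[of "integrable lebesgue"]) (auto simp: indicator_def fun_eq_iff)
    qed
    finally show ?thesis using z by (simp add: LBINT_def)
   qed
  qed
  then have "AE x in lebesgue. \<forall>k. (ind (box c d) x *R h x) $ k = 0"
   by (subst AE_all_countable) blast
  moreover have "AE x in lebesgue. x ~: cbox c d - box c d"
   using negligible_frontier_interval[of c d] by (intro AE_not_in) (simp add: negligible_iff_null_sets)
  ultimately show ?thesis unfolding cd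
   by eventually_elim (auto simp: vec_eq_iff indicator_def split: if_splits)
 qed
 then have "AE x in lebesgue. \<forall>X\<in>\<D>. x \<in> X --> h x = 0"
  using D(1) by (subst AE_ball_countable) auto
 then show ?thesis by eventually_elim (use D(4) in auto)
qed

lemma set_integrable_continuous_scaleR:
 fixes h :: "'a::euclidean_space => 'b::euclidean_space" and ph :: "'a => real"
 assumes O: "open Om" and C: "compact C" "C <= Om" and z: "!!x. x ~: C ==> ph x = 0"
  and c: "continuous_on UNIV ph" and h: "h absolutely_integrable_on C"
 shows "set_integrable lebesgue Om (%x. ph x *R h x)"
proof -
 obtain B where B: "!!y. y \<in> C ==> norm (ph y) <= B"
  using compact_imp_bounded[OF compact_continuous_image[OF continuous_on_subset[OF c] C(1)]]
  by (auto simp: bounded_iff)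
 have "integrable lebesgue (%x. ph x *R (ind C x *R h x))"
 proof (rule bochner_bound)
  show "integrable lebesgue (%x. B *R norm (ind C x *R h x))"
   using h unfolding sintegrable_def by (intro integrable_scaleR_right integrable_norm) auto
  have "ph \<in> bm lebesgue"
   using borel_measurable_continuous_onI[OF c] by (intro measurable_completion) simp
  then show "(%x. ph x *R (ind C x *R h x)) \<in> bm lebesgue"
   using h unfolding sintegrable_def
   by (intro borel_measurable_scaleR[OF _ borel_measurable_integrable])
  show "AE x in lebesgue. norm (ph x *R (ind C x *R h x)) <= norm (B *R norm (ind C x *R h x))"
  proof (rule AE_I2)
   fix x
   show "norm (ph x *R (ind C x *R h x)) <= norm (B *R norm (ind C x *R h x))"
   proof (cases "x \<in> C")
    case True
    then have "norm (ph x) <= \<bar>B\<bar>" using B[of x] by simp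
    then show ?thesis using True by (simp add: abs_mult mult_right_mono)
   qed auto
  qed
 qed
 then show ?thesis unfolding sintegrable_def
  by (elim back_subst[of "integrable lebesgue"]) (use z C in "auto simp: indicator_def fun_eq_iff")
qed

lemma weak_gradient_unique:
 assumes O: "open Om" and w1: "weak_gradient_on Om u g1" and w2: "weak_gradient_on Om u g2"
 shows "AE x in lebesgue. x \<in> Om --> g1 x = g2 x"
proof -
 have "AE x in lebesgue. x \<in> Om --> g1 x - g2 x = 0"
 proof (rule weak_gradient_unique_aux[OF O])
  show "(%x. g1 x - g2 x) absolutely_integrable_on C" if "compact C" "C <= Om" for C
   using that w1 w2 unfolding weak_gradient_on_def by (intro set_integral_diff) auto
  fix ph Dph C assume a: "C1_gradient ph Dph" "compact C" "C <= Om" "!!x. x ~: C ==> ph x = 0"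
  have i: "set_integrable lebesgue Om (%x. ph x *R g x)" if "weak_gradient_on Om u g" for g
   using that a unfolding weak_gradient_on_def
   by (intro set_integrable_continuous_scaleR[OF O a(2,3,4) C1_gradient_continuous[OF a(1)]]) auto
  have "(LINT x:Om|lebesgue. u x *R Dph x) = - (LINT x:Om|lebesgue. ph x *R g1 x)"
   using w1 a unfolding weak_gradient_on_def by blast
  moreover have "(LINT x:Om|lebesgue. u x *R Dph x) = - (LINT x:Om|lebesgue. ph x *R g2 x)"
   using w2 a unfolding weak_gradient_on_def by blast
  ultimately show "(LINT x:Om|lebesgue. ph x *R (g1 x - g2 x)) = 0"
   using set_integral_diff(2)[OF i[OF w1] i[OF w2]] by (simp add: scaleR_diff_right)
 qed
 then show ?thesis by eventually_elim auto
qed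

text \<open>\<open>weak_grad\<close> is an unspecified choice among the weak gradients; this is the
  bridge from an explicitly computed weak gradient to the definitions of energy and trace.\<close>

lemma weak_grad_AE:
 assumes "open Om" "weak_gradient_on Om u g"
 shows "AE x in lebesgue. x \<in> Om --> weak_grad Om u x = g x"
proof (rule weak_gradient_unique[OF assms(1) _ assms(2)])
 show "weak_gradient_on Om u (weak_grad Om u)"
  unfolding weak_grad_def by (rule someI[of _ g]) (rule assms(2))
qed

lemma measurable_weak_gradient:
 assumes "open Om" "weak_gradient_on Om u g"
 shows "(%y. ind Om y *R u y) \<in> bm lebesgue"
  and "(%y. ind Om y *R g y) \<in> bm lebesgue"
 using assms measurable_if_integrable_on_compacts[OF assms(1), of u]
  measurable_if_integrable_on_compacts[OF assms(1), of g]
 by (auto simp: weak_gradient_on_def)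

text \<open>\<open>W12_loc\<close> speaks about the chosen representative, so measurability and
  integrability are carried over from the explicit \<open>g\<close> along an a.e. equality.\<close>

lemma W12_locI:
 assumes O: "open (U - K)" and w: "weak_gradient_on (U - K) u g"
  and C: "!!C. compact C ==> C <= closure U - K ==> (%x. (u x)^2) absolutely_integrable_on (C Int U)"
   "!!C. compact C ==> C <= closure U - K ==> (%x. (norm (g x))^2) absolutely_integrable_on (C Int U)"
 shows "W12_loc U K u"
 unfolding W12_loc_def
proof (intro conjI allI impI)
 fix C assume CC: "compact C & C <= closure U - K"
 have ae: "AE x in lebesgue. x \<in> U - K --> weak_grad (U - K) u x = g x" by (rule weak_grad_AE[OF O w])
 show "(%x. (norm (weak_grad (U - K) u x))^2) absolutely_integrable_on (C Int U)"
  unfolding sintegrable_def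
 proof (rule bochner_bound)
  show "integrable lebesgue (%x. ind (C Int U) x *R (norm (g x))^2)"
   using C(2) CC unfolding sintegrable_def by auto
  have eq: "AE x in lebesgue. ind (C Int U) x *R (norm (weak_grad (U - K) u x))^2 = ind (C Int U) x *R (norm (g x))^2"
   using ae by eventually_elim (use CC in "auto simp: indicator_def")
  show "(%x. ind (C Int U) x *R (norm (weak_grad (U - K) u x))^2) \<in> bm lebesgue"
  proof (rule borel_measurable_AE)
   show "(%x. ind (C Int U) x *R (norm (g x))^2) \<in> bm lebesgue"
    using C(2) CC by (auto simp: sintegrable_def)
   show "AE x in lebesgue. ind (C Int U) x *R (norm (g x))^2 =
     ind (C Int U) x *R (norm (weak_grad (U - K) u x))^2"
    using eq by eventually_elim (rule sym)
  qed
  show "AE x in lebesgue. norm (ind (C Int U) x *R (norm (weak_grad (U - K) u x))^2)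
    <= norm (ind (C Int U) x *R (norm (g x))^2)"
   using eq by eventually_elim auto
 qed
qed (use w C in auto)

lemma energy_eq:
 assumes O: "open (U - K)" and w: "weak_gradient_on (U - K) u g"
 shows "energy U K u A = (\<integral>\<^sup>+ x \<in> (A Int U) - K. ennreal ((norm (g x))^2) \<partial>lebesgue) + hausdorff1 (K Int A)"
proof -
 have "(\<integral>\<^sup>+ x \<in> (A Int U) - K. ennreal ((norm (weak_grad (U - K) u x))^2) \<partial>lebesgue)
  = (\<integral>\<^sup>+ x \<in> (A Int U) - K. ennreal ((norm (g x))^2) \<partial>lebesgue)"
  by (rule nn_integral_cong_AE) (use weak_grad_AE[OF O w] in "auto simp: indicator_def")
 then show ?thesis by (simp add: energy_def)
qed

section \<open>Polar parametrisation and separation by circles\<close>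

definition pol :: "real^2 => real => real => real^2" where
 "pol x r t = x + r *R vector [cos t, sin t]"

lemma pol_nth [simp]: "pol x r t $ 1 = x $ 1 + r * cos t" "pol x r t $ 2 = x $ 2 + r * sin t"
 by (simp_all add: pol_def)

lemma norm_vec2_sq: "(norm (y::real^2))^2 = (y $ 1)^2 + (y $ 2)^2"
 unfolding power2_norm_eq_inner by (simp add: inner_vec_def sum_2 power2_eq_square)

lemma dist_vec2_sq: "(dist (y::real^2) z)^2 = (y $ 1 - z $ 1)^2 + (y $ 2 - z $ 2)^2"
 by (simp add: dist_norm norm_vec2_sq)

text \<open>The law of cosines, arranged so that a radial part and an angular part appear, both
  nonnegative when \<open>r * s >= 0\<close>.\<close>

lemma dist_pol_sq: "(dist (pol x r a) (pol x s b))^2 = (r - s)^2 + 2 * r * s * (1 - cos (a - b))"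
proof -
 have "(dist (pol x r a) (pol x s b))^2 = (r * cos a - s * cos b)^2 + (r * sin a - s * sin b)^2"
  by (simp add: dist_vec2_sq)
 also have "... = r^2 * ((cos a)^2 + (sin a)^2) + s^2 * ((cos b)^2 + (sin b)^2)
   - 2 * r * s * (cos a * cos b + sin a * sin b)"
  by algebra
 also have "... = r^2 + s^2 - 2 * r * s * cos (a - b)"
  by (simp add: cos_diff)
 also have "... = (r - s)^2 + 2 * r * s * (1 - cos (a - b))"
  by (simp add: power2_eq_square algebra_simps)
 finally show ?thesis .
qed

lemma dist_pol: "dist x (pol x r t) = \<bar>r\<bar>"
proof -
 have "(dist x (pol x r t))^2 = r^2 * (cos t)^2 + r^2 * (sin t)^2"
  by (simp add: dist_vec2_sq power_mult_distrib)
 also have "... = r^2" by (simp add: distrib_left[symmetric])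
 finally have "sqrt ((dist x (pol x r t))^2) = sqrt (r^2)" by simp
 then show ?thesis by simp
qed

lemma continuous_on_pol [continuous_intros]:
 fixes f h :: "'a::t2_space => real"
 assumes "continuous_on S f" "continuous_on S h"
 shows "continuous_on S (%s. pol x (f s) (h s))"
proof -
 have "pol x r t = x + r *R (cos t *R axis 1 1 + sin t *R axis 2 1)" for r t
  by (simp add: vec_eq_iff forall_2 axis_def)
 then show ?thesis using assms by (simp only:) (intro continuous_intros)
qed

text \<open>The start \<open>c\<close> of the angular window is free, so that later proofs can
  centre the window at a given angle or cut the circle open at a given point.\<close>

lemma pol_surj:
 assumes "dist x y = r"
 obtains t where "c <= t" "t < c + 2 * pi" "y = pol x r t"
proof (cases "r = 0")
 case True
 then show ?thesis using assms that[of c] by (simp add: pol_def)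
next
 case False
 then have r: "r > 0" using assms by auto
 have "(y $ 1 - x $ 1)^2 + (y $ 2 - x $ 2)^2 = r^2"
  using assms dist_vec2_sq[of y x] by (simp add: dist_commute)
 then have "((y $ 1 - x $ 1) / r)^2 + ((y $ 2 - x $ 2) / r)^2 = 1"
  using r by (simp add: power_divide add_divide_distrib[symmetric])
 then obtain t where t: "0 <= t" "t < 2 * pi" "(y $ 1 - x $ 1) / r = cos t" "(y $ 2 - x $ 2) / r = sin t"
  by (rule sincos_total_2pi)
 define k where "k = \<lceil>(c - t) / (2 * pi)\<rceil>"
 define t' where "t' = t + 2 * pi * of_int k"
 have "(c - t) / (2 * pi) <= k" "k < (c - t) / (2 * pi) + 1" unfolding k_def by linarith+
 then have "c - t <= 2 * pi * k" "2 * pi * k < c - t + 2 * pi" by (simp_all add: field_simps)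
 then have "c <= t'" "t' < c + 2 * pi" by (simp_all add: t'_def)
 moreover have "cos t' = cos t" "sin t' = sin t"
  unfolding t'_def cos_add sin_add by simp_all
 then have "y = pol x r t'"
  using t(3,4) r by (simp add: vec_eq_iff forall_2 field_simps)
 ultimately show ?thesis by (rule that)
qed

lemma pol_inj:
 assumes "pol x r a = pol x r b" "r > 0" "\<bar>a - b\<bar> < 2 * pi"
 shows "a = b"
proof -
 have "2 * r * r * (1 - cos (a - b)) = 0" using dist_pol_sq[of x r a r b] assms(1) by simp
 then have "cos (a - b) = 1" using assms(2) by simp
 then obtain n :: int where n: "a - b = n * 2 * pi" by (auto simp: cos_one_2pi_int)
 then have "\<bar>real_of_int n\<bar> < 1" using assms(3) by (simp add: abs_mult)
 then have "n = 0" by linarith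
 then show ?thesis using n by simp
qed

lemma connected_circle_minus_point:
 assumes "r > 0" shows "connected (sphere x r - {p :: real^2})"
proof (cases "p \<in> sphere x r")
 case False
 then show ?thesis by (simp add: connected_sphere)
next
 case True
 then obtain c where c: "p = pol x r c" using pol_surj[of x p r 0] by auto
 have "sphere x r - {p} = pol x r ` {c<..<c + 2 * pi}"
 proof (intro set_eqI iffI)
  fix y assume y: "y \<in> sphere x r - {p}"
  then obtain t where t: "c <= t" "t < c + 2 * pi" "y = pol x r t" using pol_surj[of x y r c] by auto
  then have "t ~= c" using y c by auto
  then show "y \<in> pol x r ` {c<..<c + 2 * pi}" using t by auto
 next
  fix y assume "y \<in> pol x r ` {c<..<c + 2 * pi}"
  then obtain t where t: "c < t" "t < c + 2 * pi" "y = pol x r t" by auto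
  then have "y ~= p" using pol_inj[of x r t c] assms c by auto
  then show "y \<in> sphere x r - {p}" using t assms by (simp add: dist_pol)
 qed
 moreover have "connected (pol x r ` {c<..<c + 2 * pi})"
  by (intro connected_continuous_image continuous_intros) auto
 ultimately show ?thesis by simp
qed

text \<open>A circle that meets \<open>K\<close> in one point stays connected off \<open>K\<close>. Changing \<open>K\<close> inside it
 therefore never joins different components of the complement.\<close>

lemma separation_preserved:
 fixes K J :: "(real^2) set"
 assumes R: "R > 0" and K: "closed K" "K Int sphere x R <= {p0}"
  and J: "J - ball x R = K - ball x R"
  and p: "p \<in> - (ball x R Un K)" and q: "q \<in> - (ball x R Un K)"
  and ne: "connected_component_set (- K) p ~= connected_component_set (- K) q"
 shows "connected_component_set (- J) p ~= connected_component_set (- J) q"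
proof -
 let ?S = "sphere x R - {p0}"
 have S: "connected ?S" "?S <= - K" using connected_circle_minus_point[OF R] K(2) by auto
 \<comment> \<open>If the component of \<open>z\<close> in \<open>- K\<close> missed the circle, it
   would lie outside the closed disk. There \<open>J\<close> and \<open>K\<close> agree, so the
   component of \<open>- J\<close> through \<open>z\<close> could not leave it and would not contain
   \<open>w\<close>.\<close>
 have main: "connected_component_set (- K) z Int sphere x R ~= {}"
  if z: "z \<in> - (ball x R Un K)" and w: "w \<in> - (ball x R Un K)"
   and neq: "connected_component_set (- K) z ~= connected_component_set (- K) w"
   and eq: "connected_component_set (- J) z = connected_component_set (- J) w" for z w
 proof
  assume emp: "connected_component_set (- K) z Int sphere x R = {}"
  let ?C = "connected_component_set (- K) z"
  have zC: "z \<in> ?C" using z by simp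
  have opC: "open ?C" using K(1) by (simp add: open_connected_component open_Compl)
  have conC: "connected ?C" by simp
  have out: "?C <= - cball x R"
  proof (rule ccontr)
   assume "\<not> ?C <= - cball x R"
   then obtain y where y: "y \<in> ?C" "y \<in> cball x R" by auto
   have "z ~: sphere x R" using emp zC by blast
   then have "z ~: cball x R" using z by auto
   then have "?C Int cball x R ~= {}" "?C - cball x R ~= {}" using y zC by blast+
   then have "?C Int frontier (cball x R) ~= {}" using connected_Int_frontier[OF conC] by blast
   then show False using emp R by (simp add: frontier_cball)
  qed
  define T where "T = connected_component_set (- J) z"
  have zJ: "z ~: J" "w ~: J" using z w J by blast+
  have T: "connected T" "z \<in> T" "w \<in> T" "T <= - J"
  proof -
   have "w \<in> connected_component_set (- J) w" using zJ by simp
   then show "w \<in> T" unfolding T_def eq .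
  qed (use zJ in "simp_all add: T_def connected_component_subset")
  \<comment> \<open>A limit point of the component that lies in \<open>T\<close> is outside the open
    disk and off \<open>J\<close>, hence off \<open>K\<close>; components of \<open>- K\<close> are
    relatively closed.\<close>
  have "T Int closure ?C <= ?C"
  proof
   fix y assume y: "y \<in> T Int closure ?C"
   have "closure ?C <= - ball x R"
    using out by (intro closure_minimal) (auto simp: closed_Compl)
   then have "y ~: ball x R" "y ~: J" using y T by auto
   then have "y \<in> - K" using J by blast
   moreover have "closedin (top_of_set (- K)) ?C" by (rule closedin_connected_component)
   ultimately show "y \<in> ?C" using y by (auto simp: closedin_limpt closure_def)
  qed
  then have "T Int frontier ?C = {}" using opC by (auto simp: frontier_def interior_open)
  then have "T <= ?C" using connected_Int_frontier[OF T(1), of ?C] T(2) zC by blast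
  then have "w \<in> ?C" using T by auto
  then have "connected_component_set (- K) w = connected_component_set (- K) z"
   by (rule connected_component_eq)
  then show False using neq by simp
 qed
 show ?thesis
 proof
  assume eq: "connected_component_set (- J) p = connected_component_set (- J) q"
  obtain a where a: "a \<in> connected_component_set (- K) p" "a \<in> sphere x R"
   using main[OF p q ne eq] by blast
  obtain b where b: "b \<in> connected_component_set (- K) q" "b \<in> sphere x R"
   using main[OF q p ne[symmetric] eq[symmetric]] by blast
  have notp: "y \<in> ?S" if "y \<in> - K" "y \<in> sphere x R" "p0 \<in> K" for y using that by auto
  \<comment> \<open>Both components reach the circle, and what remains of the circle off
    \<open>K\<close> is a single connected piece.\<close>
  have "connected_component (- K) a b"
  proof (cases "p0 \<in> K")
   case True
   have "a \<in> - K" "b \<in> - K" using a b connected_component_subset by blast+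
   then have "a \<in> ?S" "b \<in> ?S" using notp a b True by blast+
   then show ?thesis unfolding connected_component_def using S by (intro exI[of _ ?S]) auto
  next
   case False
   then have "sphere x R <= - K" using K(2) by auto
   then show ?thesis using a b connected_sphere[of x R] unfolding connected_component_def by (intro exI[of _ "sphere x R"]) auto
  qed
  then have "b \<in> connected_component_set (- K) a" by simp
  then have "connected_component_set (- K) b = connected_component_set (- K) a"
   by (rule connected_component_eq)
  moreover have "connected_component_set (- K) p = connected_component_set (- K) a"
   "connected_component_set (- K) q = connected_component_set (- K) b"
   using connected_component_eq[OF a(1)] connected_component_eq[OF b(1)] by simp_all
  ultimately show False using ne by simp
 qed
qed

section \<open>Competitors obtained by cutting to zero\<close>

lemma C1_gradient_zero_outside:
 assumes "C1_gradient ph Dph" "closed C" "!!y. y ~: C ==> ph y = 0" "y ~: C"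
 shows "Dph y = 0"
proof -
 have "((%_. 0) has_derivative (%h. h \<bullet> Dph y)) (at y)"
 proof (rule has_derivative_transform_within_open)
  show "(ph has_derivative (%h. h \<bullet> Dph y)) (at y)"
   using assms(1) by (simp add: C1_gradient_def gderiv_def)
  show "open (- C)" "y \<in> - C" using assms by auto
 qed (use assms in auto)
 then have "(%h. h \<bullet> Dph y) = (%h. 0)"
  by (rule has_derivative_unique) simp
 then have "Dph y \<bullet> Dph y = 0" by (rule fun_cong)
 then show ?thesis by simp
qed

text \<open>The frontier of \<open>W\<close> misses the support \<open>C\<close>, so no jump is
  created: the open sets \<open>W\<close>, \<open>- closure W\<close> and \<open>- C\<close> cover
  the plane, and on each of them the cut function is visibly C1.\<close>

lemma C1_gradient_cut:
 assumes c: "C1_gradient ph Dph" and C: "closed C" "!!y. y ~: C ==> ph y = 0"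
  and W: "open W" "frontier W Int C = {}"
 shows "C1_gradient (%y. if y \<in> W then 0 else ph y) (%y. if y \<in> W then 0 else Dph y)"
  (is "C1_gradient ?f ?D")
proof -
 have D: "GDERIV ph y :> Dph y" "continuous_on UNIV Dph" for y
  using c by (simp_all add: C1_gradient_def)
 have z: "Dph y = 0" if "y ~: C" for y using C1_gradient_zero_outside[OF c C that] .
 have op: "open (- closure W)" "open (- C)" using C by auto
 have cov: "y \<in> W \<or> y \<in> - closure W \<or> y \<in> - C" for y
  using W by (auto simp: frontier_def interior_open)
 have "GDERIV ?f y :> ?D y" for y
 proof -
  consider "y \<in> W" | "y \<in> - closure W" | "y \<in> - C" using cov by blast
  then show ?thesis
  proof cases
   case 1
   show ?thesis unfolding gderiv_def
    by (rule has_derivative_transform_within_open[OF _ W(1) 1, of "%_. 0"]) (use 1 in auto)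
  next
   case 2
   then have "y ~: W" using closure_subset by auto
   show ?thesis unfolding gderiv_def
    by (rule has_derivative_transform_within_open[OF _ op(1) 2, of ph])
     (use D(1)[of y] \<open>y ~: W\<close> closure_subset in "auto simp: gderiv_def")
  next
   case 3
   show ?thesis unfolding gderiv_def
    by (rule has_derivative_transform_within_open[OF _ op(2) 3, of "%_. 0"])
     (use 3 z[of y] C in auto)
  qed
 qed
 moreover have "continuous_on (W Un (- closure W Un - C)) ?D"
 proof (intro continuous_on_open_Un open_Un op W(1))
  show "continuous_on W ?D" by (rule continuous_on_eq[of _ "%_. 0"]) auto
  show "continuous_on (- closure W) ?D"
   by (rule continuous_on_eq[OF continuous_on_subset[OF D(2)]]) (use closure_subset in auto)
  show "continuous_on (- C) ?D" by (rule continuous_on_eq[of _ "%_. 0"]) (use z in auto)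
 qed
 moreover have "W Un (- closure W Un - C) = UNIV" using cov by auto
 ultimately show ?thesis unfolding C1_gradient_def by auto
qed

lemma set_integrable_vanishing:
 assumes "set_integrable M (C - W) f"
 shows "set_integrable M C (%y. if y \<in> W then 0 else f y)"
 using assms unfolding sintegrable_def
 by (elim back_subst[of "integrable M"]) (auto simp: fun_eq_iff indicator_def)

text \<open>A test function on \<open>Om'\<close> vanishes near the frontier of \<open>W\<close>,
  which \<open>Om'\<close> avoids. Cutting the test function instead of \<open>u\<close> therefore
  gives an admissible test function on \<open>Om\<close>, and the identity for \<open>u\<close>
  transfers.\<close>

lemma weak_gradient_on_cut:
 assumes w: "weak_gradient_on Om u g" and W: "open W"
  and sub: "Om' - W <= Om" and fr: "frontier W Int Om' = {}"
 shows "weak_gradient_on Om' (%y. if y \<in> W then 0 else u y) (%y. if y \<in> W then 0 else g y)"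
 unfolding weak_gradient_on_def
proof (intro conjI allI impI)
 fix C assume "compact C & C <= Om'"
 then have C: "compact (C - W)" "C - W <= Om" using W sub by (auto simp: compact_diff)
 then have i: "u absolutely_integrable_on (C - W)" "g absolutely_integrable_on (C - W)"
  using w by (auto simp: weak_gradient_on_def)
 show "(%y. if y \<in> W then 0 else u y) absolutely_integrable_on C"
  using i(1) by (rule set_integrable_vanishing)
 show "(%y. if y \<in> W then 0 else g y) absolutely_integrable_on C"
  using i(2) by (rule set_integrable_vanishing)
next
 fix ph Dph C
 assume a: "C1_gradient ph Dph & compact C & C <= Om' & (\<forall>x. x ~: C --> ph x = 0)"
 define \<psi> where "\<psi> y = (if y \<in> W then 0 else ph y)" for y
 define D\<psi> where "D\<psi> y = (if y \<in> W then 0 else Dph y)" for y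
 have clC: "closed C" using a by (simp add: compact_imp_closed)
 have C1: "C1_gradient \<psi> D\<psi>"
  unfolding \<psi>_def D\<psi>_def using a fr by (intro C1_gradient_cut[OF _ clC _ W]) auto
 have C: "compact (C - W)" "C - W <= Om" using a W sub by (auto simp: compact_diff)
 have z: "\<psi> y = 0" if "y ~: C - W" for y using that a by (auto simp: \<psi>_def)
 have Dz: "Dph y = 0" if "y ~: C" for y
  using a that clC C1_gradient_zero_outside[of ph Dph C y] by blast
 have "(LINT y:Om|lebesgue. u y *R D\<psi> y) = - (LINT y:Om|lebesgue. \<psi> y *R g y)"
  using w C1 C z unfolding weak_gradient_on_def by blast
 moreover have "(LINT y:Om'|lebesgue. (if y \<in> W then 0 else u y) *R Dph y) = (LINT y:Om|lebesgue. u y *R D\<psi> y)"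
  unfolding LBINT_def
  by (rule bochner_cong) (use a C Dz in "auto simp: D\<psi>_def indicator_def")
 moreover have "(LINT y:Om'|lebesgue. ph y *R (if y \<in> W then 0 else g y)) = (LINT y:Om|lebesgue. \<psi> y *R g y)"
  unfolding LBINT_def
  by (rule bochner_cong) (use a C in "auto simp: \<psi>_def indicator_def")
 ultimately show "(LINT x:Om'|lebesgue. (if x \<in> W then 0 else u x) *R Dph x)
   = - (LINT x:Om'|lebesgue. ph x *R (if x \<in> W then 0 else g x))" by simp
qed

text \<open>\<open>one_point\<close> is the assertion to be refuted; \<open>False\<close> will be
  derived from these assumptions.\<close>

locale crack =
 fixes U K :: "(real^2) set" and u :: "real^2 => real" and x :: "real^2"
 assumes U: "U = {y. y $ 2 > 0}"
  and minimizer: "generalized_minimizer U K u" and norm_K: "normalized K"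
  and x_in: "x \<in> K" "x $ 2 = 0"
  and one_point: "AE r in lborel. r > 0 --> emeasure (count_space UNIV) (K Int frontier (ball x r)) = 1"
begin

definition good :: "real => bool" where "good r \<longleftrightarrow> r > 0 & (\<exists>p. K Int sphere x r = {p})"

definition g :: "real^2 => real^2" where "g = weak_grad (U - K) u"

lemma AE_good: "AE r in lborel. r > 0 --> good r"
 using one_point
proof eventually_elim
 case (elim r)
 show ?case
 proof
  assume r: "r > 0"
  then have e: "emeasure (count_space UNIV) (K Int sphere x r) = 1" using elim by simp
  then have fin: "finite (K Int sphere x r)"
   by (rule_tac ccontr) (simp add: emeasure_count_space_infinite)
  then have "card (K Int sphere x r) = 1" using e by (simp add: emeasure_count_space_finite)
  then show "good r" using r by (auto simp: good_def card_1_singleton_iff)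
 qed
qed

lemma good_between: assumes "0 <= a" "a < b" obtains r where "a < r" "r < b" "good r"
proof -
 have "{a<..<b} ~: null_sets lborel" using assms by (simp add: null_sets_def)
 then have *: "\<not> (AE r in lborel. r ~: {a<..<b})"
  by (subst AE_iff_null_sets[symmetric]) auto
 have "\<exists>r\<in>{a<..<b}. good r"
 proof (rule ccontr)
  assume n: "\<not> ?thesis"
  have "AE r in lborel. r ~: {a<..<b}"
   using AE_good by eventually_elim (use n assms in auto)
  with * show False by simp
 qed
 then show ?thesis using that by auto
qed

lemma admissible: "admissible_pair U K u" using minimizer by (simp add: generalized_minimizer_def)

lemma closed_K: "closed K" and K_sub: "K <= closure U" and W12: "W12_loc U K u"
 and trace: "has_trace U K u (%_. 0)"
 using admissible by (simp_all add: admissible_pair_def)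

lemma U_simps: "y \<in> U \<longleftrightarrow> y $ 2 > 0" "closure U = {y. y $ 2 >= 0}" "frontier U = {y. y $ 2 = 0}" "open U"
proof -
 show "y \<in> U \<longleftrightarrow> y $ 2 > 0" by (simp add: U)
 show o: "open U" unfolding U by (rule open_halfspace_component_gt_cart)
 show c: "closure U = {y. y $ 2 >= 0}" unfolding U by simp
 show "frontier U = {y. y $ 2 = 0}" unfolding frontier_def c interior_open[OF o] by (auto simp: U)
qed

lemma open_UK: "open (U - K)" using U_simps(4) closed_K by (rule open_Diff)

lemma weak_g: "weak_gradient_on (U - K) u g"
proof -
 obtain h where "weak_gradient_on (U - K) u h" using W12 by (auto simp: W12_loc_def)
 then show ?thesis unfolding g_def weak_grad_def by (rule someI[where P = "weak_gradient_on (U - K) u"])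
qed

lemma W12_u: "compact C ==> C <= closure U - K ==> (%x. (u x)^2) absolutely_integrable_on (C Int U)"
 and W12_g: "compact C ==> C <= closure U - K ==> (%x. (norm (g x))^2) absolutely_integrable_on (C Int U)"
 using W12 by (simp_all add: W12_loc_def g_def)

definition dirichlet :: "(real^2) set => ennreal" where
 "dirichlet A = (\<integral>\<^sup>+ y \<in> (A Int U) - K. ennreal ((norm (g y))^2) \<partial>lebesgue)"

lemma energy_u: "energy U K u A = dirichlet A + hausdorff1 (K Int A)"
 by (simp add: energy_def dirichlet_def g_def)

text \<open>\<open>u\<close> is set to zero in \<open>W\<close>, \<open>K\<close> is erased in
  \<open>W\<close>, and the jump is paid for by adding the frontier of \<open>W\<close>, of which
  only the part in \<open>closure U\<close> may and need be added. The closure of \<open>W\<close>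
  may touch the circle, but only in points of \<open>K\<close>, so that the new set still equals
  \<open>K\<close> off the disk; this freedom is used in the proof of finite energy.\<close>

lemma competitor_cut:
 assumes R: "good R" and W: "open W" "W <= ball x R" "frontier W - ball x R <= K"
 shows "admissible_competitor U K u ((K - W) Un (frontier W Int closure U)) (%y. if y \<in> W then 0 else u y) (ball x R)"
  and "energy U ((K - W) Un (frontier W Int closure U)) (%y. if y \<in> W then 0 else u y) (ball x R)
   <= dirichlet (ball x R - W) + (hausdorff1 (K Int ball x R - W) + hausdorff1 (frontier W Int closure U Int ball x R))"
proof -
 define J where "J = (K - W) Un (frontier W Int closure U)"
 define w where "w y = (if y \<in> W then 0 else u y)" for y
 define h where "h y = (if y \<in> W then 0 else g y)" for y
 have clJ: "closed J" unfolding J_def using closed_K W by auto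
 have Jsub: "J <= closure U" using K_sub by (auto simp: J_def)
 have opJ: "open (U - J)" using U_simps(4) clJ by (rule open_Diff)
 have disj: "frontier W Int W = {}" unfolding frontier_def interior_open[OF W(1)] by blast
 have wg: "weak_gradient_on (U - J) w h"
  unfolding w_def[abs_def] h_def[abs_def]
  by (rule weak_gradient_on_cut[OF weak_g W(1)]) (use closure_subset[of U] in "auto simp: J_def")
 have ae: "AE y in lebesgue. y \<in> U - J --> weak_grad (U - J) w y = h y"
  by (rule weak_grad_AE[OF opJ wg])
 have W12J: "W12_loc U J w"
 proof (rule W12_locI[OF opJ wg])
  fix C assume "compact C" "C <= closure U - J"
  then have C: "compact (C - W)" "C - W <= closure U - K" using W by (auto simp: compact_diff J_def)
  have e: "(C - W) Int U = C Int U - W" by auto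
  have "(%y. if y \<in> W then 0 else (u y)^2) absolutely_integrable_on (C Int U)"
   using W12_u[OF C] unfolding e by (rule set_integrable_vanishing)
  then show "(%y. (w y)^2) absolutely_integrable_on (C Int U)"
   by (elim back_subst[of "%f. f absolutely_integrable_on _"]) (auto simp: w_def)
  have "(%y. if y \<in> W then 0 else (norm (g y))^2) absolutely_integrable_on (C Int U)"
   using W12_g[OF C] unfolding e by (rule set_integrable_vanishing)
  then show "(%y. (norm (h y))^2) absolutely_integrable_on (C Int U)"
   by (elim back_subst[of "%f. f absolutely_integrable_on _"]) (auto simp: h_def)
 qed
 have tr: "has_trace U J w (%_. 0)"
  unfolding has_trace_def
 proof
  fix y assume y: "y \<in> frontier U - J"
  then have yc: "y \<in> closure U" by (simp add: U_simps)
  then have "y ~: frontier W" using y by (auto simp: J_def)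
  \<comment> \<open>In \<open>W\<close> the zero function approximates itself; off
    \<open>closure W\<close> the approximants of \<open>u\<close> serve on a smaller ball, where
    \<open>w\<close> and \<open>u\<close> agree.\<close>
  then consider "y \<in> W" | "y \<in> - closure W" by (auto simp: frontier_def interior_open[OF W(1)])
  then show "\<exists>\<rho>>0. ball y \<rho> Int J = {} &
    (\<exists>v Dv. (\<forall>n::nat. C1_gradient (v n) (Dv n)) &
     (%n. \<integral>\<^sup>+ z \<in> ball y \<rho> Int U. ennreal ((v n z - w z)^2 + (norm (Dv n z - weak_grad (U - J) w z))^2) \<partial>lebesgue) \<longlonglongrightarrow> 0 &
     (%n. \<integral>\<^sup>+ z \<in> ball y \<rho> Int frontier U. ennreal ((v n z - 0)^2) \<partial>hausdorff1_measure) \<longlonglongrightarrow> 0)"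
  proof cases
   case 1
   then obtain \<rho> where \<rho>: "\<rho> > 0" "ball y \<rho> <= W" using W(1) open_contains_ball by blast
   then have bJ: "ball y \<rho> Int J = {}" using disj by (auto simp: J_def)
   have "(\<integral>\<^sup>+ z \<in> ball y \<rho> Int U. ennreal ((0 - w z)^2 + (norm (0 - weak_grad (U - J) w z))^2) \<partial>lebesgue) = nn_integral (lebesgue :: (real^2) measure) (%_. 0)"
   proof (rule nn_integral_cong_AE)
    show "AE z in lebesgue. ennreal ((0 - w z)^2 + (norm (0 - weak_grad (U - J) w z))^2) * ind (ball y \<rho> Int U) z = 0"
     using ae by eventually_elim (use \<rho> bJ in "auto simp: w_def h_def indicator_def")
   qed
   then show ?thesis using \<rho> bJ C1_gradient_zero
    by (intro exI[of _ \<rho>] conjI exI[of _ "%_ _. 0"]) auto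
  next
   case 2
   then have "y ~: K" using y closure_subset by (auto simp: J_def)
   then have "y \<in> frontier U - K" using y by auto
   then obtain \<rho> v Dv where r: "\<rho> > 0" "ball y \<rho> Int K = {}" "!!n::nat. C1_gradient (v n) (Dv n)"
    and l1: "(%n. \<integral>\<^sup>+ z \<in> ball y \<rho> Int U. ennreal ((v n z - u z)^2 + (norm (Dv n z - weak_grad (U - K) u z))^2) \<partial>lebesgue) \<longlonglongrightarrow> 0"
    and l2: "(%n. \<integral>\<^sup>+ z \<in> ball y \<rho> Int frontier U. ennreal ((v n z - 0)^2) \<partial>hausdorff1_measure) \<longlonglongrightarrow> 0"
    using trace unfolding has_trace_def by blast
   obtain \<sigma> where s: "\<sigma> > 0" "ball y \<sigma> <= - closure W" using 2 open_contains_ball[of "- closure W"] by auto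
   define \<tau> where "\<tau> = min \<rho> \<sigma>"
   have t: "\<tau> > 0" "ball y \<tau> <= ball y \<rho>" "ball y \<tau> <= - closure W" using r s by (auto simp: \<tau>_def)
   have WcW: "W <= closure W" "frontier W <= closure W" by (auto simp: closure_subset frontier_def)
   have bJ: "ball y \<tau> Int J = {}" using t r WcW by (auto simp: J_def)
   have "(%n. \<integral>\<^sup>+ z \<in> ball y \<tau> Int U. ennreal ((v n z - w z)^2 + (norm (Dv n z - weak_grad (U - J) w z))^2) \<partial>lebesgue) \<longlonglongrightarrow> 0"
   proof (rule tendsto_sandwich[OF _ _ tendsto_const l1], goal_cases)
    case 2
    show ?case
    proof (rule always_eventually, intro allI nn_integral_mono_AE)
     fix n
     show "AE z in lebesgue. ennreal ((v n z - w z)^2 + (norm (Dv n z - weak_grad (U - J) w z))^2) * ind (ball y \<tau> Int U) z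
      <= ennreal ((v n z - u z)^2 + (norm (Dv n z - weak_grad (U - K) u z))^2) * ind (ball y \<rho> Int U) z"
      using ae
     proof eventually_elim
      case (elim z)
      show ?case
      proof (cases "z \<in> ball y \<tau> Int U")
       case True
       then have "z ~: W" "z ~: J" "z \<in> ball y \<rho> Int U" using t WcW bJ by auto
       then show ?thesis using elim True by (simp add: w_def h_def g_def)
      qed simp
     qed
    qed
   qed simp
   moreover have "(%n. \<integral>\<^sup>+ z \<in> ball y \<tau> Int frontier U. ennreal ((v n z - 0)^2) \<partial>hausdorff1_measure) \<longlonglongrightarrow> 0"
   proof (rule tendsto_sandwich[OF _ _ tendsto_const l2], goal_cases)
    case 2
    show ?case
     using t by (intro always_eventually allI nn_integral_mono) (auto simp: indicator_def)
   qed simp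
   ultimately show ?thesis using t(1) bJ r(3) by blast
  qed
 qed
 have pair: "admissible_pair U J w"
  using clJ Jsub W12J tr by (simp add: admissible_pair_def)
 have JV: "J - ball x R = K - ball x R" using W by (auto simp: J_def)
 obtain p where p: "K Int sphere x R = {p}" "R > 0" using R by (auto simp: good_def)
 show "admissible_competitor U K u ((K - W) Un (frontier W Int closure U)) (%y. if y \<in> W then 0 else u y) (ball x R)"
  unfolding admissible_competitor_def J_def[symmetric] w_def[symmetric]
 proof (intro conjI ballI impI pair JV)
  show "AE y in lebesgue. y \<in> U - K - ball x R --> w y = u y" by (intro AE_I2) (use W(2) in "auto simp: w_def")
  fix a b assume "a \<in> - (ball x R Un K)" "b \<in> - (ball x R Un K)"
   "connected_component_set (- K) a ~= connected_component_set (- K) b"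
  then show "connected_component_set (- J) a ~= connected_component_set (- J) b"
   using p by (intro separation_preserved[OF p(2) closed_K _ JV]) auto
 qed auto
 have "(\<integral>\<^sup>+ y \<in> (ball x R Int U) - J. ennreal ((norm (h y))^2) \<partial>lebesgue) <= dirichlet (ball x R - W)"
  unfolding dirichlet_def by (rule nn_integral_mono) (auto simp: h_def J_def indicator_def)
 moreover have "hausdorff1 (J Int ball x R) <= hausdorff1 (K Int ball x R - W) + hausdorff1 (frontier W Int closure U Int ball x R)"
 proof -
  have "J Int ball x R = (K Int ball x R - W) Un (frontier W Int closure U Int ball x R)" by (auto simp: J_def)
  then show ?thesis by (simp add: hausdorff1_subadditive)
 qed
 ultimately show "energy U ((K - W) Un (frontier W Int closure U)) (%y. if y \<in> W then 0 else u y) (ball x R)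
   <= dirichlet (ball x R - W) + (hausdorff1 (K Int ball x R - W) + hausdorff1 (frontier W Int closure U Int ball x R))"
  unfolding J_def[symmetric] w_def[symmetric] energy_eq[OF opJ wg] by (rule add_mono)
qed

end

section \<open>Sine bounds and lengths of arcs\<close>

text \<open>\<open>sin z - z * cos z\<close> vanishes at 0 and has derivative
  \<open>z * sin z\<close>. Used for the singular boundary term in Wirtinger's inequality and for
  comparing angles with chords.\<close>

lemma mult_cos_le_sin:
 assumes "0 <= z" "z <= pi" shows "z * cos z <= sin z"
proof -
 have "(%z. sin z - z * cos z) 0 <= (%z. sin z - z * cos z) z"
 proof (rule DERIV_nonneg_imp_nondecreasing[OF assms(1)])
  fix t assume "0 <= t" "t <= z"
  then show "\<exists>y. ((%z. sin z - z * cos z) has_real_derivative y) (at t) & 0 <= y"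
   using assms by (intro exI[of _ "t * sin t"] conjI)
    (auto intro!: derivative_eq_intros mult_nonneg_nonneg sin_ge_zero)
 qed
 then show ?thesis by simp
qed

lemma half_le_sin:
 assumes "0 <= z" "z <= pi / 2" shows "z / 2 <= sin z"
proof (cases "z <= pi / 3")
 case True
 then have "cos (pi / 3) <= cos z" using assms by (intro cos_monotone_0_pi_le) auto
 then have "z * (1 / 2) <= z * cos z" using assms by (intro mult_left_mono) (auto simp: cos_60)
 also have "... <= sin z" using assms by (intro mult_cos_le_sin) auto
 finally show ?thesis by simp
next
 case False
 then have "sin (pi / 3) <= sin z" using assms by (intro sin_monotone_2pi_le) auto
 then have "sqrt 3 / 2 <= sin z" by (simp add: sin_60)
 moreover have "1.7 <= sqrt 3" by (rule real_le_rsqrt) (simp add: power2_eq_square)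
 moreover have "pi < 3.2" using pi_less_4 pi_approx by simp
 ultimately show ?thesis using assms by linarith
qed

lemma one_minus_cos: "1 - cos z = 2 * (sin (z / 2))^2" for z :: real
 using cos_double_sin[of "z / 2"] by simp

lemma dist_pol_le: assumes "r >= 0" shows "dist (pol x r a) (pol x r b) <= r * \<bar>a - b\<bar>"
proof (rule power2_le_imp_le)
 have "(dist (pol x r a) (pol x r b))^2 = (2 * r * \<bar>sin ((a - b) / 2)\<bar>)^2"
  unfolding dist_pol_sq one_minus_cos by (simp add: power_mult_distrib power2_eq_square)
 also have "... <= (2 * r * \<bar>(a - b) / 2\<bar>)^2"
  using assms by (intro power_mono mult_left_mono abs_sin_x_le_abs_x) auto
 finally show "(dist (pol x r a) (pol x r b))^2 <= (r * \<bar>a - b\<bar>)^2" by simp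
qed (use assms in auto)

lemma hausdorff1_arc_le:
 assumes "r >= 0" "a <= b" shows "hausdorff1 (pol x r ` {a..b}) <= ennreal (r * (b - a))"
 using assms by (intro hausdorff1_Lipschitz_image_le dist_pol_le)

lemma hausdorff1_sphere_le:
 assumes "r >= 0" shows "hausdorff1 (sphere (x::real^2) r) <= ennreal (r * (2 * pi))"
proof -
 have "sphere x r <= pol x r ` {0..2 * pi}"
 proof
  fix y assume "y \<in> sphere x r"
  then obtain t where "0 <= t" "t < 0 + 2 * pi" "y = pol x r t" using pol_surj[of x y r 0] by auto
  then show "y \<in> pol x r ` {0..2 * pi}" by auto
 qed
 then have "hausdorff1 (sphere x r) <= hausdorff1 (pol x r ` {0..2 * pi})" by (rule hausdorff1_mono)
 also have "... <= ennreal (r * (2 * pi - 0))" using assms by (intro hausdorff1_arc_le) auto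
 finally show ?thesis by simp
qed

text \<open>A small disk around a point of the outer circle cuts from a nearby concentric circle
  only an arc of length comparable to its own radius. This bounds the walls of the region used for
  finite energy.\<close>

lemma hausdorff1_sphere_Int_cball_le:
 assumes R: "0 < R" "R / 2 <= r" "r <= R" and p: "dist x p = R" and s: "s >= 0"
 shows "hausdorff1 (sphere (x::real^2) r Int cball p s) <= ennreal (8 * s)"
proof -
 obtain c where c: "p = pol x R c" using pol_surj[of x p R 0] p by auto
 \<comment> \<open>Half angle of the covering arc: \<open>half_le_sin\<close> yields
   \<open>R * \<bar>t - c\<bar> <= sqrt 8 * s\<close>, rounded up to \<open>4 * s\<close>.\<close>
 define d where "d = 4 * s / R"
 have "sphere x r Int cball p s <= pol x r ` {c - d..c + d}"
 proof
  fix y assume y: "y \<in> sphere x r Int cball p s"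
  then obtain t where t: "c - pi <= t" "t < c - pi + 2 * pi" "y = pol x r t"
   using pol_surj[of x y r "c - pi"] by auto
  define a where "a = \<bar>t - c\<bar>"
  have ca: "cos (t - c) = cos a" by (simp add: a_def abs_if cos_diff)
  have dd: "(dist y p)^2 = (r - R)^2 + 4 * r * R * (sin (a / 2))^2"
   unfolding t(3) c dist_pol_sq ca one_minus_cos by simp
  have "a / 2 / 2 <= sin (a / 2)" unfolding a_def using t by (intro half_le_sin) auto
  then have "(a / 2 / 2)^2 <= (sin (a / 2))^2" by (intro power_mono) (auto simp: a_def)
  moreover have "4 * (R / 2) * R <= 4 * r * R" using R by (intro mult_right_mono) auto
  ultimately have "(4 * (R / 2) * R) * (a / 2 / 2)^2 <= (4 * r * R) * (sin (a / 2))^2"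
   using R by (intro mult_mono) auto
  moreover have "R^2 * \<bar>t - c\<bar>^2 / 8 = (4 * (R / 2) * R) * (a / 2 / 2)^2"
   by (simp add: a_def power2_eq_square)
  ultimately have "R^2 * \<bar>t - c\<bar>^2 / 8 <= (dist y p)^2"
   unfolding dd using zero_le_power2[of "r - R"] by linarith
  also have "... <= s^2" using y by (intro power_mono) (auto simp: dist_commute)
  finally have "(R * \<bar>t - c\<bar>)^2 <= 8 * s^2" by (simp add: power_mult_distrib)
  also have "... <= (4 * s)^2" by (simp add: power_mult_distrib)
  finally have "R * \<bar>t - c\<bar> <= 4 * s" using s by (rule_tac power2_le_imp_le) auto
  then have "\<bar>t - c\<bar> <= d" using R by (simp add: d_def field_simps)
  then have "t \<in> {c - d..c + d}" by (simp add: abs_le_iff)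
  then show "y \<in> pol x r ` {c - d..c + d}" using t by blast
 qed
 then have "hausdorff1 (sphere x r Int cball p s) <= hausdorff1 (pol x r ` {c - d..c + d})" by (rule hausdorff1_mono)
 also have "... <= ennreal (r * ((c + d) - (c - d)))" using R s by (intro hausdorff1_arc_le) (auto simp: d_def)
 also have "... <= ennreal (8 * s)"
 proof (rule ennreal_leI)
  have "r * ((c + d) - (c - d)) = r * (8 * s / R)" by (simp add: d_def)
  also have "... <= R * (8 * s / R)" using R s by (intro mult_right_mono) auto
  finally show "r * ((c + d) - (c - d)) <= 8 * s" using R by simp
 qed
 finally show ?thesis .
qed

section \<open>Finite energy and the cut inequality\<close>

context crack
begin

text \<open>The gradient is set to zero off \<open>U - K\<close>, so that \<open>dirichlet\<close>
  is the measure with this density and inherits additivity and continuity from above.\<close>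

definition dens :: "real^2 => ennreal" where
 "dens y = ennreal ((norm (ind (U - K) y *R g y))^2)"

lemma dens_measurable: "dens \<in> bm lebesgue"
proof -
 have "(%y. ind (U - K) y *R g y) \<in> bm lebesgue"
  by (rule measurable_weak_gradient(2)[OF open_UK weak_g])
 from measurable_compose[OF this borel_measurable_norm] show ?thesis
  unfolding dens_def[abs_def] by measurable
qed

lemma dirichlet_eq: "dirichlet A = (\<integral>\<^sup>+ y \<in> A. dens y \<partial>lebesgue)"
 unfolding dirichlet_def dens_def by (rule nn_integral_cong) (auto simp: indicator_def)

lemma dirichlet_emeasure: "A \<in> sets lebesgue ==> dirichlet A = emeasure (density lebesgue dens) A"
 using dens_measurable by (simp add: dirichlet_eq emeasure_density)

lemma dirichlet_mono: "A <= B ==> dirichlet A <= dirichlet B"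
 unfolding dirichlet_eq by (rule nn_integral_mono) (auto simp: indicator_def)

lemma dirichlet_compact:
 assumes "compact C" "C <= closure U - K" shows "dirichlet C < \<infinity>"
proof -
 have "dirichlet C = (\<integral>\<^sup>+ y. ennreal (norm (ind (C Int U) y *R (norm (g y))^2)) \<partial>lebesgue)"
  unfolding dirichlet_def by (rule nn_integral_cong) (use assms in "auto simp: indicator_def")
 also have "... < \<infinity>"
  using W12_g[OF assms] unfolding sintegrable_def integrable_iff_bounded by simp
 finally show ?thesis .
qed

lemma lmeas [simp, intro]: "A \<in> sets borel ==> A \<in> sets lebesgue" by simp

text \<open>At distance at least \<open>s\<close> from \<open>p\<close> the compact part of
  \<open>K\<close> stays strictly inside the circle, so beyond some radius \<open>r1\<close> a
  compact set free of \<open>K\<close> remains, and its energy is finite. The half open annuli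
  \<open>r <= dist x y < R\<close> decrease to the empty set as \<open>r\<close> tends to
  \<open>R\<close>, hence their energies tend to zero.\<close>

lemma thin_annulus:
 assumes R: "R > 0" and p: "K Int sphere x R = {p}" and s: "s > 0" and e: "e > 0"
 obtains r0 where "0 < r0" "r0 < R"
  "!!y. y \<in> K ==> r0 <= dist x y ==> dist x y < R ==> dist y p >= s ==> False"
  "dirichlet {y. r0 <= dist x y & dist x y < R & s <= dist y p} <= ennreal e"
proof -
 define A where "A = K Int cball x R Int {y. s <= dist y p}"
 have cA: "compact A" unfolding A_def using closed_K
  by (intro compact_Int_closed closed_Int_compact compact_cball closed_Collect_le continuous_intros)
 have "\<exists>r1. R / 2 <= r1 & r1 < R & (\<forall>y\<in>A. dist x y < r1)"
 proof (cases "A = {}")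
  case True then show ?thesis using R by (intro exI[of _ "R / 2"]) auto
 next
  case False
  have "continuous_on A (dist x)" by (intro continuous_intros)
  then obtain ys where ys: "ys \<in> A" "!!y. y \<in> A ==> dist x y <= dist x ys"
   using continuous_attains_sup[OF cA False, of "dist x"] by blast
  have "dist x ys ~= R"
  proof
   assume "dist x ys = R"
   then have "ys \<in> K Int sphere x R" using ys(1) by (auto simp: A_def)
   then have "ys = p" using p by simp
   then show False using ys(1) s by (auto simp: A_def)
  qed
  moreover have "dist x ys <= R" using ys(1) by (auto simp: A_def)
  ultimately have "dist x ys < R" by simp
  moreover have "dist x y < max (R / 2) ((dist x ys + R) / 2)" if "y \<in> A" for y
  proof -
   have "dist x y < (dist x ys + R) / 2" using ys(2)[OF that] \<open>dist x ys < R\<close> by simp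
   then show ?thesis by (simp add: less_max_iff_disj)
  qed
  ultimately show ?thesis using R
   by (intro exI[of _ "max (R / 2) ((dist x ys + R) / 2)"]) auto
 qed
 then obtain r1 where r1: "R / 2 <= r1" "r1 < R" "!!y. y \<in> A ==> dist x y < r1" by blast
 define Q where "Q r = {y. r <= dist x y & dist x y < R & s <= dist y p}" for r
 have Qm: "Q r \<in> sets lebesgue" for r
 proof -
  have "Q r = {y. r <= dist x y} Int {y. dist x y < R} Int {y. s <= dist y p}" by (auto simp: Q_def)
  moreover have "closed {y. r <= dist x y}" "open {y. dist x y < R}" "closed {y. s <= dist y p}"
   by (intro closed_Collect_le open_Collect_less continuous_intros)+
  ultimately show ?thesis by (simp add: borel_closed borel_open)
 qed
 define C where "C = closure U Int cball x R Int {y. r1 <= dist x y} Int {y. s <= dist y p}"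
 have "compact C" unfolding C_def
  by (intro compact_Int_closed closed_Int_compact compact_cball closed_Collect_le continuous_intros closed_closure)
 moreover have "C <= closure U - K" using r1(3) by (force simp: C_def A_def)
 ultimately have "dirichlet C < \<infinity>" by (rule dirichlet_compact)
 moreover have "dirichlet (Q r1) <= dirichlet C"
 proof -
  have "dirichlet (Q r1) = dirichlet (Q r1 Int U)" unfolding dirichlet_def by (simp add: Int_assoc)
  also have "... <= dirichlet C" using closure_subset[of U] by (intro dirichlet_mono) (auto simp: Q_def C_def)
  finally show ?thesis .
 qed
 ultimately have fin: "dirichlet (Q r1) < \<infinity>" by (rule le_less_trans[rotated])
 define t where "t n = R - (R - r1) / (real n + 1)" for n :: nat
 have t0: "t n >= r1" "t n < R" for n
 proof -
  have "(R - r1) / (real n + 1) <= (R - r1) / 1" using r1 by (intro divide_left_mono) auto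
  then show "t n >= r1" by (simp add: t_def)
  show "t n < R" using r1 by (simp add: t_def)
 qed
 have "decseq (%n. Q (t n))"
 proof (rule antimonoI)
  fix m n :: nat assume "m <= n"
  then have "(R - r1) / (real n + 1) <= (R - r1) / (real m + 1)" using r1 by (intro divide_left_mono) auto
  then show "Q (t n) <= Q (t m)" by (auto simp: Q_def t_def)
 qed
 then have "(%n. emeasure (density lebesgue dens) (Q (t n))) \<longlonglongrightarrow> emeasure (density lebesgue dens) (\<Inter>n. Q (t n))"
 proof (intro Lim_emeasure_decseq)
  show "range (%n. Q (t n)) <= sets (density lebesgue dens)" using Qm by auto
  show "emeasure (density lebesgue dens) (Q (t n)) ~= \<infinity>" for n
  proof -
   have "dirichlet (Q (t n)) <= dirichlet (Q r1)" using t0(1)[of n] by (intro dirichlet_mono) (auto simp: Q_def)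
   then show ?thesis using fin Qm by (simp add: dirichlet_emeasure[symmetric] top_unique less_top[symmetric])
     (auto simp: top_unique)
  qed
 qed
 moreover have "(\<Inter>n. Q (t n)) = {}"
 proof (rule equals0I)
  fix y assume y: "y \<in> (\<Inter>n. Q (t n))"
  then have d: "dist x y < R" by (auto simp: Q_def)
  obtain n :: nat where n: "(R - r1) / (R - dist x y) < n" using reals_Archimedean2 by blast
  then have "R - r1 < n * (R - dist x y)" using d by (simp add: field_simps)
  also have "... <= (real n + 1) * (R - dist x y)" using d by (intro mult_right_mono) auto
  finally have "dist x y < t n" by (simp add: t_def field_simps)
  moreover have "y \<in> Q (t n)" using y by blast
  ultimately show False by (simp add: Q_def)
 qed
 ultimately have "(%n. dirichlet (Q (t n))) \<longlonglongrightarrow> 0" using Qm by (simp add: dirichlet_emeasure)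
 then have "\<forall>\<^sub>F n in sequentially. dirichlet (Q (t n)) < ennreal e"
  using e by (intro order_tendstoD) auto
 then obtain n where n: "dirichlet (Q (t n)) < ennreal e" by (auto simp: eventually_sequentially)
 show ?thesis
 proof (rule that[of "t n"])
  show "0 < t n" "t n < R" using t0[of n] r1 R by linarith+
  show "dirichlet {y. t n <= dist x y & dist x y < R & s <= dist y p} <= ennreal e"
   using n by (simp add: Q_def less_imp_le)
  fix y assume "y \<in> K" "t n <= dist x y" "dist x y < R" "dist y p >= s"
  then show False using r1(3)[of y] t0(1)[of n] by (auto simp: A_def)
 qed
qed

text \<open>To see that the energy is finite, \<open>u\<close> is cut to zero in a region \<open>W\<close> that fills the disk up to
 a layer along the circle. The layer gets so thin near the point of \<open>K\<close> on the circle that its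
 energy is finite, although \<open>u\<close> has no a priori bound near \<open>K\<close>.\<close>

lemma finite_energy:
 assumes gR: "good R" shows "energy U K u (ball x R) < \<infinity>"
proof -
 obtain p where R: "R > 0" and p: "K Int sphere x R = {p}" using gR by (auto simp: good_def)
 have dp: "dist x p = R" using p by auto
 define s where "s k = R / 2 ^ k" for k :: nat
 have s: "s k > 0" for k using R by (simp add: s_def)
 \<comment> \<open>\<open>r\<close> is so close to \<open>R\<close> that beyond it \<open>K\<close>
   stays within \<open>s k\<close> of \<open>p\<close>, and the energy at distance at least
   \<open>s k\<close> from \<open>p\<close> is at most the \<open>k\<close>-th term of a geometric
   series.\<close>
 define P where "P k r \<longleftrightarrow> 0 < r & r < R &
  (\<forall>y. y \<in> K --> r <= dist x y --> dist x y < R --> dist y p < s k) &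
  dirichlet {y. r <= dist x y & dist x y < R & s k <= dist y p} <= ennreal ((1/2) ^ k)" for k r
 have "\<exists>r. P k r" for k
 proof -
  obtain r where r: "0 < r" "r < R"
   and a: "!!y. y \<in> K ==> r <= dist x y ==> dist x y < R ==> dist y p >= s k ==> False"
   and d: "dirichlet {y. r <= dist x y & dist x y < R & s k <= dist y p} <= ennreal ((1/2) ^ k)"
   by (rule thin_annulus[OF R p s[of k], of "(1/2) ^ k"]) (auto intro: that)
  have "dist y p < s k" if "y \<in> K" "r <= dist x y" "dist x y < R" for y
  proof (rule ccontr)
   assume "\<not> dist y p < s k"
   then show False using a that by (simp add: not_less)
  qed
  then have "P k r" unfolding P_def using r d by (intro conjI allI impI)
  then show ?thesis by (rule exI)
 qed
 then obtain r0 where P: "!!k. P k (r0 k)" by metis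
 have r0: "!!k. 0 < r0 k" "!!k. r0 k < R"
  "!!k y. y \<in> K ==> r0 k <= dist x y ==> dist x y < R ==> dist y p < s k"
  "!!k. dirichlet {y. r0 k <= dist x y & dist x y < R & s k <= dist y p} <= ennreal ((1/2) ^ k)"
  using P unfolding P_def by blast+
 have "\<exists>\<rho>. \<forall>k. (max (r0 k) (R - s k / 2) <= \<rho> k & \<rho> k < R) & \<rho> k < \<rho> (Suc k)"
 proof (rule dependent_nat_choice)
  show "\<exists>r. max (r0 0) (R - s 0 / 2) <= r & r < R"
   using r0(2)[of 0] s[of 0] by (intro exI[of _ "max (r0 0) (R - s 0 / 2)"]) auto
  fix r k assume "max (r0 k) (R - s k / 2) <= r & r < R"
  then show "\<exists>r'. (max (r0 (Suc k)) (R - s (Suc k) / 2) <= r' & r' < R) & r < r'"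
   using r0(2)[of "Suc k"] s[of "Suc k"]
   by (intro exI[of _ "max (max (r0 (Suc k)) (R - s (Suc k) / 2)) ((r + R) / 2)"])
    (auto simp: less_max_iff_disj field_simps)
 qed
 then obtain \<rho> where \<rho>: "!!k. r0 k <= \<rho> k" "!!k. R - s k / 2 <= \<rho> k" "!!k. \<rho> k < R" "!!k. \<rho> k < \<rho> (Suc k)"
  by auto
 have \<rho>2: "R / 2 <= \<rho> k" for k
 proof -
  have "s k <= R" using R by (simp add: s_def divide_le_eq_1 field_simps)
  then show ?thesis using \<rho>(2)[of k] by linarith
 qed
 have s0: "s \<longlonglongrightarrow> 0" unfolding s_def[abs_def]
  using tendsto_mult[OF tendsto_const[of R] LIMSEQ_power_zero[of "1/2::real"]]
  by (simp add: power_divide)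
 \<comment> \<open>Constraint \<open>k\<close> stops the region at radius \<open>\<rho> k\<close>
   except within \<open>s k\<close> of \<open>p\<close>. As \<open>\<rho>\<close> increases and
   \<open>s\<close> decreases, the region ends at radius \<open>\<rho> (Suc k)\<close> where the
   distance to \<open>p\<close> lies between \<open>s (Suc k)\<close> and \<open>s k\<close>, and
   its closure meets the circle at most at \<open>p\<close>.\<close>
 define O' where "O' k = ball x (\<rho> k) Un ball p (s k)" for k
 define W where "W = ball x R Int (\<Inter>k. O' k)"
 \<comment> \<open>On a ball of radius \<open>r < R\<close> all but finitely many constraints are
   void, so the infinite intersection is open.\<close>
 have oW: "open W"
 proof (subst open_subopen, intro ballI)
  fix y assume y: "y \<in> W"
  then have "dist x y < R" by (auto simp: W_def)
  then have "\<forall>\<^sub>F k in sequentially. s k < R - dist x y" using s0 by (intro order_tendstoD) auto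
  then obtain N where N: "!!k. k >= N ==> s k < R - dist x y" by (auto simp: eventually_sequentially)
  define r where "r = (R + dist x y) / 2"
  have far: "r < \<rho> k" if "k >= N" for k using N[OF that] \<rho>(2)[of k] by (simp add: r_def field_simps)
  show "\<exists>T. open T & y \<in> T & T <= W"
  proof (intro exI[of _ "ball x r Int (\<Inter>k<N. O' k)"] conjI subsetI)
   show "open (ball x r Int (\<Inter>k<N. O' k))" by (auto simp: O'_def intro!: open_Int open_INT)
   show "y \<in> ball x r Int (\<Inter>k<N. O' k)" using y by (auto simp: W_def r_def)
   fix z assume z: "z \<in> ball x r Int (\<Inter>k<N. O' k)"
   have "z \<in> O' k" for k
   proof (cases "k < N")
    case False
    then have "r < \<rho> k" using far by simp
    then show ?thesis using z by (auto simp: O'_def)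
   qed (use z in auto)
   moreover have "r < R" using \<open>dist x y < R\<close> by (simp add: r_def)
   ultimately show "z \<in> W" using z by (auto simp: W_def)
  qed
 qed
 have WV: "W <= ball x R" by (auto simp: W_def)
 have clW: "y \<in> closure W ==> dist x y <= \<rho> k \<or> dist p y <= s k" for y k
 proof -
  assume y: "y \<in> closure W"
  have "W <= cball x (\<rho> k) Un cball p (s k)"
  proof
   fix z assume "z \<in> W"
   then have "z \<in> O' k" by (auto simp: W_def)
   then show "z \<in> cball x (\<rho> k) Un cball p (s k)" by (auto simp: O'_def)
  qed
  then have "closure W <= cball x (\<rho> k) Un cball p (s k)" by (intro closure_minimal) auto
  then show "dist x y <= \<rho> k \<or> dist p y <= s k" using y by auto
 qed
 have clR: "y \<in> closure W ==> dist x y <= R" for y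
  using closure_minimal[OF subset_trans[OF WV ball_subset_cball] closed_cball] by auto
 have frW: "frontier W - ball x R <= K"
 proof
  fix y assume y: "y \<in> frontier W - ball x R"
  then have c: "y \<in> closure W" by (simp add: frontier_def)
  then have "dist x y = R" using clR[OF c] y by auto
  then have "dist p y <= s k" for k using clW[OF c, of k] \<rho>(3)[of k] by linarith
  then have "dist p y <= 0" using s0 by (intro LIMSEQ_le_const[OF s0]) auto
  then show "y \<in> K" using p by auto
 qed
 \<comment> \<open>Constraint \<open>k\<close> contributes two walls: the circle around
   \<open>p\<close>, and the arc at radius \<open>\<rho> k\<close>, which the previous constraint
   confines to distance \<open>s (k - 1) = 2 * s k\<close> from \<open>p\<close>. For
   \<open>k = 0\<close> the bound \<open>2 * s 0 = 2 * R\<close> is the diameter of the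
   disk.\<close>
 define F where "F k = sphere p (s k) Un (sphere x (\<rho> k) Int cball p (2 * s k))" for k
 have frF: "frontier W Int ball x R <= (\<Union>k. F k)"
 proof
  fix y assume y: "y \<in> frontier W Int ball x R"
  then have c: "y \<in> closure W" "y ~: W" by (auto simp: frontier_def interior_open[OF oW])
  then obtain k where k: "dist x y >= \<rho> k" "dist p y >= s k" using y by (auto simp: W_def O'_def not_less)
  show "y \<in> (\<Union>k. F k)"
  proof (cases "dist p y = s k")
   case True then show ?thesis by (auto simp: F_def)
  next
   case False
   then have "dist x y = \<rho> k" using clW[OF c(1), of k] k by auto
   moreover have "dist p y <= 2 * s k"
   proof (cases k)
    case 0
    have "dist p y <= dist p x + dist x y" by (rule dist_triangle)
    then show ?thesis using dp y 0 by (auto simp: s_def dist_commute)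
   next
    case (Suc j)
    have "dist p y <= s j" using clW[OF c(1), of j] \<rho>(4)[of j] k(1) Suc by auto
    then show ?thesis using Suc by (simp add: s_def)
   qed
   ultimately have "y \<in> F k" by (auto simp: F_def)
   then show ?thesis by blast
  qed
 qed
 have HF: "hausdorff1 (F k) <= ennreal (24 * R * (1/2) ^ k)" for k
 proof -
  have "hausdorff1 (F k) <= hausdorff1 (sphere p (s k)) + hausdorff1 (sphere x (\<rho> k) Int cball p (2 * s k))"
   unfolding F_def by (rule hausdorff1_subadditive)
  also have "... <= ennreal (s k * (2 * pi)) + ennreal (8 * (2 * s k))"
   using s[of k] \<rho>2[of k] \<rho>(3)[of k] R dp
   by (intro add_mono hausdorff1_sphere_le hausdorff1_sphere_Int_cball_le[of R]) auto
  also have "... = ennreal (s k * (2 * pi) + 8 * (2 * s k))" using s[of k] by (intro ennreal_plus[symmetric]) auto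
  also have "... <= ennreal (24 * R * (1/2) ^ k)"
  proof (rule ennreal_leI)
   have "s k * (2 * pi) <= s k * 8" using s[of k] pi_less_4 by (intro mult_left_mono) auto
   then show "s k * (2 * pi) + 8 * (2 * s k) <= 24 * R * (1/2) ^ k" by (simp add: s_def power_divide)
  qed
  finally show ?thesis .
 qed
 have "hausdorff1 (frontier W Int closure U Int ball x R) <= hausdorff1 (\<Union>k. F k)"
  using frF by (intro hausdorff1_mono) auto
 also have "... <= (\<Sum>k. hausdorff1 (F k))" by (rule hausdorff1_countably_subadditive)
 also have "... <= (\<Sum>k. ennreal (24 * R * (1/2) ^ k))" by (intro suminf_le HF) auto
 also have "... < \<infinity>"
  using R by (subst suminf_ennreal2) (auto intro!: summable_mult summable_geometric)
 finally have H: "hausdorff1 (frontier W Int closure U Int ball x R) < \<infinity>" .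
 define Q where "Q k = {y. r0 k <= dist x y & dist x y < R & s k <= dist y p}" for k
 have Qm: "Q k \<in> sets lebesgue" for k
 proof -
  have "Q k = {y. r0 k <= dist x y} Int {y. dist x y < R} Int {y. s k <= dist y p}" by (auto simp: Q_def)
  moreover have "closed {y. r0 k <= dist x y}" "open {y. dist x y < R}" "closed {y. s k <= dist y p}"
   by (intro closed_Collect_le open_Collect_less continuous_intros)+
  ultimately show ?thesis by (simp add: borel_closed borel_open)
 qed
 have VW: "ball x R - W <= (\<Union>k. Q k)"
 proof
  fix y assume y: "y \<in> ball x R - W"
  then obtain k where "\<rho> k <= dist x y" "s k <= dist p y" by (auto simp: W_def O'_def not_less)
  then have "y \<in> Q k" using \<rho>(1)[of k] y by (auto simp: Q_def dist_commute)
  then show "y \<in> (\<Union>k. Q k)" by blast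
 qed
 then have "dirichlet (ball x R - W) <= dirichlet (\<Union>k. Q k)" by (rule dirichlet_mono)
 also have "... = emeasure (density lebesgue dens) (\<Union>k. Q k)" using Qm by (intro dirichlet_emeasure) auto
 also have "... <= (\<Sum>k. emeasure (density lebesgue dens) (Q k))"
  using Qm by (intro emeasure_subadditive_countably) auto
 also have "... <= (\<Sum>k. ennreal ((1/2) ^ k))"
  using r0(4) Qm by (intro suminf_le) (auto simp: dirichlet_emeasure[symmetric] Q_def)
 also have "... < \<infinity>"
  by (subst suminf_ennreal2) (auto intro!: summable_geometric)
 finally have D: "dirichlet (ball x R - W) < \<infinity>" .
 \<comment> \<open>The layer contains no part of \<open>K\<close>: points of \<open>Q k\<close> keep
   distance at least \<open>s k\<close> from \<open>p\<close>, where the choice of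
   \<open>r0 k\<close> excludes \<open>K\<close>.\<close>
 have "K Int ball x R - W = {}"
 proof (rule equals0I)
  fix y assume y: "y \<in> K Int ball x R - W"
  then obtain k where "y \<in> Q k" using VW by blast
  then show False using y r0(3)[of y k] by (auto simp: Q_def)
 qed
 then have "energy U ((K - W) Un (frontier W Int closure U)) (%y. if y \<in> W then 0 else u y) (ball x R) <=
   dirichlet (ball x R - W) + (0 + hausdorff1 (frontier W Int closure U Int ball x R))"
  using competitor_cut(2)[OF gR oW WV frW] by (simp only: hausdorff1_empty)
 also have "... < \<infinity>" using D H by simp
 finally have "energy U ((K - W) Un (frontier W Int closure U)) (%y. if y \<in> W then 0 else u y) (ball x R) < \<infinity>" .
 moreover have "energy U K u (ball x R) <= energy U ((K - W) Un (frontier W Int closure U)) (%y. if y \<in> W then 0 else u y) (ball x R)"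
  using minimizer competitor_cut(1)[OF gR oW WV frW] unfolding generalized_minimizer_def by blast
 ultimately show ?thesis by (rule le_less_trans[rotated])
qed

lemma finite_bounded:
 assumes "bounded A" shows "dirichlet A < \<infinity>" "hausdorff1 (K Int A) < \<infinity>"
proof -
 obtain a where a: "A <= ball x a" "a > 0" using bounded_subset_ballD[OF assms, of x] by auto
 obtain R where R: "a < R" "good R" by (rule good_between[of a "a + 1"]) (use a in auto)
 have "dirichlet (ball x R) + hausdorff1 (K Int ball x R) < \<infinity>" using finite_energy[OF R(2)] by (simp add: energy_u)
 moreover have "dirichlet A <= dirichlet (ball x R)" "hausdorff1 (K Int A) <= hausdorff1 (K Int ball x R)"
  using a R by (auto intro!: dirichlet_mono hausdorff1_mono dest: subsetD)
 ultimately show "dirichlet A < \<infinity>" "hausdorff1 (K Int A) < \<infinity>"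
  by (auto simp: less_top[symmetric] top_unique)
qed

text \<open>The comparison is made in a large good disk \<open>V\<close> that contains
  \<open>closure W\<close>. What lies in \<open>V - W\<close> is common to both pairs and can be
  cancelled because it is finite. In this form the bound no longer refers to good radii, so
  \<open>W\<close> may be chosen freely.\<close>

lemma cut_inequality:
 assumes W: "open W" "bounded W"
 shows "dirichlet W + hausdorff1 (K Int W) <= hausdorff1 (frontier W Int closure U)"
proof -
 have "bounded (closure W)" using W by (simp add: bounded_closure)
 then obtain a where a: "closure W <= ball x a" "a > 0" using bounded_subset_ballD[of "closure W" x] by auto
 obtain R where R: "a < R" "good R" by (rule good_between[of a "a + 1"]) (use a in auto)
 define V where "V = ball x R"
 have cV: "closure W <= V" using a R by (auto simp: V_def dest: subsetD)
 then have WV: "W <= V" using closure_subset by blast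
 have fr: "frontier W - V <= K" using cV by (auto simp: frontier_def)
 have b: "bounded V" by (simp add: V_def)
 have m: "W \<in> sets lebesgue" "V \<in> sets lebesgue" "V - W \<in> sets lebesgue"
  using W by (auto simp: V_def)
 have D: "dirichlet V = dirichlet W + dirichlet (V - W)"
 proof -
  have "emeasure (density lebesgue dens) (W Un (V - W)) = emeasure (density lebesgue dens) W + emeasure (density lebesgue dens) (V - W)"
   using m by (intro plus_emeasure[symmetric]) auto
  moreover have "W Un (V - W) = V" using WV by auto
  ultimately show ?thesis using m by (simp add: dirichlet_emeasure)
 qed
 have H: "hausdorff1 (K Int V) = hausdorff1 (K Int W) + hausdorff1 (K Int V - W)"
 proof -
  have "hausdorff1 ((K Int W) Un (K Int V - W)) = hausdorff1 (K Int W) + hausdorff1 (K Int V - W)"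
   using W closed_K by (intro hausdorff1_Un_disjoint) (auto simp: V_def borel_closed borel_open)
  moreover have "(K Int W) Un (K Int V - W) = K Int V" using WV by auto
  ultimately show ?thesis by simp
 qed
 have "energy U K u V <= energy U ((K - W) Un (frontier W Int closure U)) (%y. if y \<in> W then 0 else u y) V"
  using minimizer competitor_cut(1)[OF R(2) W(1)] WV fr unfolding generalized_minimizer_def V_def by blast
 also have "... <= dirichlet (V - W) + (hausdorff1 (K Int V - W) + hausdorff1 (frontier W Int closure U Int V))"
  using competitor_cut(2)[OF R(2) W(1)] WV fr unfolding V_def by blast
 also have "... <= dirichlet (V - W) + (hausdorff1 (K Int V - W) + hausdorff1 (frontier W Int closure U))"
  by (intro add_mono order_refl hausdorff1_mono) auto
 finally have "(dirichlet (V - W) + hausdorff1 (K Int V - W)) + (dirichlet W + hausdorff1 (K Int W))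
  <= (dirichlet (V - W) + hausdorff1 (K Int V - W)) + hausdorff1 (frontier W Int closure U)"
  unfolding energy_u D H by (simp add: ac_simps)
 moreover have "dirichlet (V - W) + hausdorff1 (K Int V - W) < \<infinity>"
  using finite_bounded[of "V - W"] b by (auto simp: Int_Diff bounded_diff)
 ultimately show ?thesis by (auto simp only: ennreal_add_left_cancel_le)
qed

end

section \<open>Multiplying the minimizer by a C1 factor\<close>

lemma absolutely_integrable_continuous_scaleR:
 fixes h :: "'a::euclidean_space => 'b::euclidean_space" and ph :: "'a => real"
 assumes C: "compact C" and c: "continuous_on UNIV ph" and h: "h absolutely_integrable_on (C Int S)" and S: "S \<in> sets lebesgue"
 shows "(%x. ph x *R h x) absolutely_integrable_on (C Int S)"
proof (rule absolutely_integrable_bounded_measurable_product[OF _ _ _ _ h, where h = "scaleR"])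
 show "bilinear (scaleR :: real => 'b => 'b)"
  by (simp add: bilinear_conv_bounded_bilinear bounded_bilinear_scaleR)
 show "ph \<in> bm (lebesgue_on (C Int S))"
  using borel_measurable_continuous_onI[OF c] by (intro measurable_restrict_space1 measurable_completion) simp
 show "C Int S \<in> sets lebesgue" using C S by (intro sets.Int) (auto simp: borel_compact)
 show "bounded (ph ` (C Int S))"
  using compact_imp_bounded[OF compact_continuous_image[OF continuous_on_subset[OF c] C]]
  by (rule bounded_subset) auto
qed

lemma absolutely_integrable_scaleR_continuous:
 fixes h :: "'a::euclidean_space => real" and D :: "'a => 'b::euclidean_space"
 assumes C: "compact C" and c: "continuous_on UNIV D" and h: "h absolutely_integrable_on (C Int S)" and S: "S \<in> sets lebesgue"
 shows "(%x. h x *R D x) absolutely_integrable_on (C Int S)"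
proof (rule absolutely_integrable_bounded_measurable_product[OF _ _ _ _ h, where h = "%v c. c *R v"])
 show "bilinear (%(v::'b) (c::real). c *R v)"
  unfolding bilinear_conv_bounded_bilinear
  by (rule bounded_bilinear.flip) (rule bounded_bilinear_scaleR)
 show "D \<in> bm (lebesgue_on (C Int S))"
  using borel_measurable_continuous_onI[OF c] by (intro measurable_restrict_space1 measurable_completion) simp
 show "C Int S \<in> sets lebesgue" using C S by (intro sets.Int) (auto simp: borel_compact)
 show "bounded (D ` (C Int S))"
  using compact_imp_bounded[OF compact_continuous_image[OF continuous_on_subset[OF c] C]]
  by (rule bounded_subset) auto
qed

lemma set_integrable_supported:
 assumes "set_integrable M C f" "C <= Om" "!!y. y ~: C ==> f y = 0"
 shows "set_integrable M Om f"
 using assms unfolding sintegrable_def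
 by (elim back_subst[of "integrable M"]) (auto simp: fun_eq_iff indicator_def)

text \<open>The product rule, obtained by testing the identity for \<open>u\<close> with the product
  of \<open>\<eta>\<close> and the test function.\<close>

lemma weak_gradient_on_mult:
 assumes w: "weak_gradient_on Om u g" and e: "C1_gradient \<eta> D\<eta>"
 shows "weak_gradient_on Om (%y. \<eta> y * u y) (%y. \<eta> y *R g y + u y *R D\<eta> y)"
proof -
 have ce: "continuous_on UNIV \<eta>" "continuous_on UNIV D\<eta>"
  using C1_gradient_continuous[OF e] e by (auto simp: C1_gradient_def)
 have i: "u absolutely_integrable_on C" "g absolutely_integrable_on C" if "compact C" "C <= Om" for C
  using w that by (auto simp: weak_gradient_on_def)
 have i1: "(%y. ph y *R u y) absolutely_integrable_on C" "(%y. ph y *R g y) absolutely_integrable_on C"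
  if "compact C" "C <= Om" "continuous_on UNIV ph" for C and ph :: "real^2 => real"
  using absolutely_integrable_continuous_scaleR[OF that(1,3), where S = UNIV and h = u] i(1)[OF that(1,2)]
   absolutely_integrable_continuous_scaleR[OF that(1,3), where S = UNIV and h = g] i(2)[OF that(1,2)]
  unfolding Int_UNIV_right by simp_all
 have i2: "(%y. u y *R D y) absolutely_integrable_on C"
  if "compact C" "C <= Om" "continuous_on UNIV D" for C and D :: "real^2 => real^2"
  using absolutely_integrable_scaleR_continuous[OF that(1,3), where S = UNIV and h = u] i(1)[OF that(1,2)]
  unfolding Int_UNIV_right by simp
 show ?thesis
  unfolding weak_gradient_on_def
 proof (intro conjI allI impI)
  fix C assume C: "compact C & C <= Om"
  show "(%y. \<eta> y * u y) absolutely_integrable_on C" using i1(1)[of C \<eta>] C ce by simp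
  show "(%y. \<eta> y *R g y + u y *R D\<eta> y) absolutely_integrable_on C"
   using i1(2)[of C \<eta>] i2[of C D\<eta>] C ce by (intro set_integral_add) auto
 next
  fix ph Dph C
  assume a: "C1_gradient ph Dph & compact C & C <= Om & (\<forall>x. x ~: C --> ph x = 0)"
  then have C: "compact C" "C <= Om" "C1_gradient ph Dph" and z: "!!y. y ~: C ==> ph y = 0" by auto
  have Dz: "Dph y = 0" if "y ~: C" for y
   using C1_gradient_zero_outside[OF C(3) compact_imp_closed[OF C(1)] z that] .
  have cp: "continuous_on UNIV ph" "continuous_on UNIV Dph"
   using C1_gradient_continuous[OF C(3)] C(3) by (auto simp: C1_gradient_def)
  have "(LINT y:Om|lebesgue. u y *R (\<eta> y *R Dph y + ph y *R D\<eta> y)) = - (LINT y:Om|lebesgue. (\<eta> y * ph y) *R g y)"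
  proof -
   have "C1_gradient (%y. \<eta> y * ph y) (%y. \<eta> y *R Dph y + ph y *R D\<eta> y)"
    by (rule C1_gradient_mult[OF e C(3)])
   moreover have "\<forall>x. x ~: C --> \<eta> x * ph x = 0" using z by simp
   ultimately show ?thesis using w C(1,2) unfolding weak_gradient_on_def by blast
  qed
  moreover have "(LINT y:Om|lebesgue. u y *R (\<eta> y *R Dph y + ph y *R D\<eta> y))
   = (LINT y:Om|lebesgue. (\<eta> y * u y) *R Dph y) + (LINT y:Om|lebesgue. ph y *R (u y *R D\<eta> y))"
  proof -
   have "set_integrable lebesgue Om (%y. u y *R (\<eta> y *R Dph y))"
    by (rule set_integrable_supported[OF i2[OF C(1,2)] C(2)])
     (use Dz in "auto intro!: continuous_intros ce cp")
   moreover have "set_integrable lebesgue Om (%y. u y *R (ph y *R D\<eta> y))"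
    by (rule set_integrable_supported[OF i2[OF C(1,2)] C(2)])
     (use z in "auto intro!: continuous_intros ce cp")
   ultimately have "(LINT y:Om|lebesgue. u y *R (\<eta> y *R Dph y) + u y *R (ph y *R D\<eta> y))
    = (LINT y:Om|lebesgue. u y *R (\<eta> y *R Dph y)) + (LINT y:Om|lebesgue. u y *R (ph y *R D\<eta> y))"
    by (rule set_integral_add)
   then show ?thesis by (simp add: scaleR_add_right mult.commute)
  qed
  moreover have "(LINT y:Om|lebesgue. ph y *R (\<eta> y *R g y + u y *R D\<eta> y))
   = (LINT y:Om|lebesgue. (\<eta> y * ph y) *R g y) + (LINT y:Om|lebesgue. ph y *R (u y *R D\<eta> y))"
  proof -
   have "set_integrable lebesgue Om (%y. (\<eta> y * ph y) *R g y)"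
    by (rule set_integrable_supported[OF i1(2)[OF C(1,2)] C(2)])
     (use z in "auto intro!: continuous_intros ce cp")
   moreover have "set_integrable lebesgue Om (%y. u y *R (ph y *R D\<eta> y))"
    by (rule set_integrable_supported[OF i2[OF C(1,2)] C(2)])
     (use z in "auto intro!: continuous_intros ce cp")
   ultimately have "(LINT y:Om|lebesgue. (\<eta> y * ph y) *R g y + u y *R (ph y *R D\<eta> y))
    = (LINT y:Om|lebesgue. (\<eta> y * ph y) *R g y) + (LINT y:Om|lebesgue. u y *R (ph y *R D\<eta> y))"
    by (rule set_integral_add)
   then show ?thesis by (simp add: scaleR_add_right mult.commute)
  qed
  ultimately show "(LINT x:Om|lebesgue. (\<eta> x * u x) *R Dph x)
    = - (LINT x:Om|lebesgue. ph x *R (\<eta> x *R g x + u x *R D\<eta> x))"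
   by (simp add: eq_diff_eq)
 qed
qed

lemma norm_add_sq_le: "(norm (a + b))^2 <= 2 * (norm a)^2 + 2 * (norm (b::'a::real_normed_vector))^2"
proof -
 have "(norm (a + b))^2 <= (norm a + norm b)^2" by (intro power_mono norm_triangle_ineq) auto
 also have "... <= 2 * (norm a)^2 + 2 * (norm b)^2"
  using sum_squares_bound[of "norm a" "norm b"] by (simp add: power2_sum)
 finally show ?thesis .
qed

context crack
begin

text \<open>\<open>K\<close> is kept, so the separation condition is trivial and the finite length
  of \<open>K\<close> cancels. The work is the trace of the product: the approximants of
  \<open>u\<close>, multiplied by \<open>\<eta>\<close>, still converge because
  \<open>\<eta>\<close> and its gradient are bounded on a ball.\<close>

lemma scaled_competitor:
 assumes R: "good R" and e: "C1_gradient \<eta> D\<eta>" and one: "!!y. y ~: ball x R ==> \<eta> y = 1"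
 shows "dirichlet (ball x R) <= (\<integral>\<^sup>+ y \<in> (ball x R Int U) - K. ennreal ((norm (\<eta> y *R g y + u y *R D\<eta> y))^2) \<partial>lebesgue)"
proof -
 define w where "w y = \<eta> y * u y" for y
 define h where "h y = \<eta> y *R g y + u y *R D\<eta> y" for y
 have ce: "continuous_on UNIV \<eta>" "continuous_on UNIV D\<eta>"
  using C1_gradient_continuous[OF e] e by (auto simp: C1_gradient_def)
 have wg: "weak_gradient_on (U - K) w h"
  unfolding w_def[abs_def] h_def[abs_def] by (rule weak_gradient_on_mult[OF weak_g e])
 have ae: "AE y in lebesgue. y \<in> U - K --> weak_grad (U - K) w y = h y"
  by (rule weak_grad_AE[OF open_UK wg])
 have hm: "(%y. ind (U - K) y *R h y) \<in> bm lebesgue"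
  by (rule measurable_weak_gradient(2)[OF open_UK wg])
 have um: "(%y. ind (U - K) y *R u y) \<in> bm lebesgue"
  and gm: "(%y. ind (U - K) y *R g y) \<in> bm lebesgue"
  by (rule measurable_weak_gradient[OF open_UK weak_g])+
 have Um: "U \<in> sets lebesgue" using U_simps(4) by auto
 have W12w: "W12_loc U K w"
 proof (rule W12_locI[OF open_UK wg])
  fix C assume C: "compact C" "C <= closure U - K"
  have ce2: "continuous_on UNIV (%y. (\<eta> y)^2)" "continuous_on UNIV (%y. (norm (D\<eta> y))^2)"
   by (intro continuous_intros ce)+
  have 1: "(%y. (\<eta> y)^2 *R (u y)^2) absolutely_integrable_on (C Int U)"
   by (rule absolutely_integrable_continuous_scaleR[OF C(1) ce2(1) W12_u[OF C] Um])
  have 2: "(%y. (\<eta> y)^2 *R (norm (g y))^2) absolutely_integrable_on (C Int U)"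
   by (rule absolutely_integrable_continuous_scaleR[OF C(1) ce2(1) W12_g[OF C] Um])
  have 3: "(%y. (norm (D\<eta> y))^2 *R (u y)^2) absolutely_integrable_on (C Int U)"
   by (rule absolutely_integrable_continuous_scaleR[OF C(1) ce2(2) W12_u[OF C] Um])
  show "(%y. (w y)^2) absolutely_integrable_on (C Int U)"
   using 1 by (simp add: w_def power_mult_distrib)
  have b: "(%y. 2 * ((\<eta> y)^2 *R (norm (g y))^2) + 2 * ((norm (D\<eta> y))^2 *R (u y)^2)) absolutely_integrable_on (C Int U)"
   by (intro set_integral_add(1) set_integrable_mult_right 2 3)
  show "(%y. (norm (h y))^2) absolutely_integrable_on (C Int U)"
   unfolding sintegrable_def
  proof (rule bochner_bound[OF b[unfolded sintegrable_def]])
   have "(%y. ind (C Int U) y *R (norm (ind (U - K) y *R h y))^2) \<in> bm lebesgue"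
    using C(1) Um measurable_compose[OF hm borel_measurable_norm]
    by (intro borel_measurable_scaleR borel_measurable_power borel_measurable_indicator sets.Int) (auto simp: borel_compact)
   moreover have "(%y. ind (C Int U) y *R (norm (ind (U - K) y *R h y))^2) = (%y. ind (C Int U) y *R (norm (h y))^2)"
    using C(2) by (auto simp: fun_eq_iff indicator_def)
   ultimately show "(%y. ind (C Int U) y *R (norm (h y))^2) \<in> bm lebesgue" by simp
   have "(norm (h y))^2 <= 2 * ((\<eta> y)^2 *R (norm (g y))^2) + 2 * ((norm (D\<eta> y))^2 *R (u y)^2)" for y
    using norm_add_sq_le[of "\<eta> y *R g y" "u y *R D\<eta> y"] by (simp add: h_def power_mult_distrib mult.commute)
   then show "AE y in lebesgue. norm (ind (C Int U) y *R (norm (h y))^2)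
    <= norm (ind (C Int U) y *R (2 * ((\<eta> y)^2 *R (norm (g y))^2) + 2 * ((norm (D\<eta> y))^2 *R (u y)^2)))"
    by (intro AE_I2) (auto simp: indicator_def)
  qed
 qed
 have tr: "has_trace U K w (%_. 0)"
  unfolding has_trace_def
 proof
  fix y assume y: "y \<in> frontier U - K"
  then obtain \<rho> v Dv where r: "\<rho> > 0" "ball y \<rho> Int K = {}" "!!n::nat. C1_gradient (v n) (Dv n)"
   and l1: "(%n. \<integral>\<^sup>+ z \<in> ball y \<rho> Int U. ennreal ((v n z - u z)^2 + (norm (Dv n z - weak_grad (U - K) u z))^2) \<partial>lebesgue) \<longlonglongrightarrow> 0"
   and l2: "(%n. \<integral>\<^sup>+ z \<in> ball y \<rho> Int frontier U. ennreal ((v n z - 0)^2) \<partial>hausdorff1_measure) \<longlonglongrightarrow> 0"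
   using trace unfolding has_trace_def by blast
  obtain B where B: "B > 0" "!!z. z \<in> ball y \<rho> ==> \<bar>\<eta> z\<bar> <= B" "!!z. z \<in> ball y \<rho> ==> norm (D\<eta> z) <= B"
  proof -
   have "bounded (\<eta> ` cball y \<rho>)" "bounded (D\<eta> ` cball y \<rho>)"
    by (intro compact_imp_bounded compact_continuous_image continuous_on_subset[OF ce(1)] continuous_on_subset[OF ce(2)]; simp)+
   then obtain B1 B2 where b: "\<forall>z\<in>\<eta> ` cball y \<rho>. norm z <= B1" "\<forall>z\<in>D\<eta> ` cball y \<rho>. norm z <= B2"
    unfolding bounded_iff by blast
   show ?thesis
   proof (rule that[of "max 1 (max B1 B2)"])
    fix z assume "z \<in> ball y \<rho>"
    then have z: "z \<in> cball y \<rho>" by auto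
    have "norm (\<eta> z) <= B1" "norm (D\<eta> z) <= B2" using b z by blast+
    then show "\<bar>\<eta> z\<bar> <= max 1 (max B1 B2)" "norm (D\<eta> z) <= max 1 (max B1 B2)"
     by (auto simp: le_max_iff_disj)
   qed simp
  qed
  define d where "d n z = ennreal ((v n z - u z)^2 + (norm (Dv n z - weak_grad (U - K) u z))^2) * ind (ball y \<rho> Int U) z" for n z
  have dm: "d n \<in> bm lebesgue" for n
  proof -
   have cv: "continuous_on UNIV (v n)" "continuous_on UNIV (Dv n)"
    using C1_gradient_continuous[OF r(3)] r(3)[of n] by (auto simp: C1_gradient_def)
   have vm: "v n \<in> bm lebesgue" "Dv n \<in> bm lebesgue"
    using borel_measurable_continuous_onI[OF cv(1)] borel_measurable_continuous_onI[OF cv(2)]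
    by (auto intro!: measurable_completion)
   have bm: "ball y \<rho> Int U \<in> sets lebesgue" using Um by auto
   have "d n = (%z. ennreal ((v n z - ind (U - K) z *R u z)^2 + (norm (Dv n z - ind (U - K) z *R g z))^2) * ind (ball y \<rho> Int U) z)"
    using r(2) by (auto simp: d_def g_def indicator_def fun_eq_iff)
   moreover have "... \<in> bm lebesgue"
    using vm um gm bm measurable_compose[OF borel_measurable_diff[OF vm(2) gm] borel_measurable_norm]
    by (intro borel_measurable_times_ennreal measurable_compose[OF _ measurable_ennreal] borel_measurable_add
      borel_measurable_power borel_measurable_diff borel_measurable_indicator)
   ultimately show ?thesis by simp
  qed
  define v' where "v' n z = \<eta> z * v n z" for n z
  define Dv' where "Dv' n z = \<eta> z *R Dv n z + v n z *R D\<eta> z" for n z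
  have C1: "C1_gradient (v' n) (Dv' n)" for n
   unfolding v'_def[abs_def] Dv'_def[abs_def] by (rule C1_gradient_mult[OF e r(3)])
  \<comment> \<open>With errors \<open>a\<close> of the values and \<open>b\<close> of the gradients
    of \<open>v n\<close>, the values cost \<open>B^2 * a^2\<close> and the gradients
    \<open>2 * B^2 * (a^2 + (norm b)^2)\<close>, together at most
    \<open>3 * B^2 * (a^2 + (norm b)^2)\<close>.\<close>
  have l3: "(%n. ennreal (3 * B^2) * (\<integral>\<^sup>+ z. d n z \<partial>lebesgue)) \<longlonglongrightarrow> 0"
   using ennreal_tendsto_cmult[OF _ l1[folded d_def], of "ennreal (3 * B^2)"] by simp
  have "(%n. \<integral>\<^sup>+ z \<in> ball y \<rho> Int U. ennreal ((v' n z - w z)^2 + (norm (Dv' n z - weak_grad (U - K) w z))^2) \<partial>lebesgue) \<longlonglongrightarrow> 0"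
  proof (rule tendsto_sandwich[OF _ _ tendsto_const l3], goal_cases)
   case 2
   show ?case
   proof (rule always_eventually, intro allI)
    fix n
    have "(\<integral>\<^sup>+ z \<in> ball y \<rho> Int U. ennreal ((v' n z - w z)^2 + (norm (Dv' n z - weak_grad (U - K) w z))^2) \<partial>lebesgue)
     <= (\<integral>\<^sup>+ z. ennreal (3 * B^2) * d n z \<partial>lebesgue)"
    proof (rule nn_integral_mono_AE)
     show "AE z in lebesgue. ennreal ((v' n z - w z)^2 + (norm (Dv' n z - weak_grad (U - K) w z))^2) * ind (ball y \<rho> Int U) z
      <= ennreal (3 * B^2) * d n z"
      using ae
     proof eventually_elim
      case (elim z)
      show ?case
      proof (cases "z \<in> ball y \<rho> Int U")
       case True
       then have zz: "z \<in> U - K" "weak_grad (U - K) w z = h z" using elim r(2) by auto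
       define a where "a = v n z - u z"
       define b where "b = Dv n z - g z"
       have B2: "(\<eta> z)^2 <= B^2" "(norm (D\<eta> z))^2 <= B^2"
        using B(2,3)[of z] True B(1) by (auto simp: abs_le_square_iff[symmetric] intro: power_mono)
       have e1: "(v' n z - w z)^2 = (\<eta> z)^2 * a^2" by (simp add: v'_def w_def a_def power_mult_distrib[symmetric] algebra_simps)
       have e2: "Dv' n z - h z = \<eta> z *R b + a *R D\<eta> z"
        by (simp add: Dv'_def h_def a_def b_def algebra_simps)
       have "(norm (Dv' n z - h z))^2 <= 2 * ((\<eta> z)^2 * (norm b)^2) + 2 * ((norm (D\<eta> z))^2 * a^2)"
        unfolding e2 using norm_add_sq_le[of "\<eta> z *R b" "a *R D\<eta> z"] by (simp add: power_mult_distrib mult.commute)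
       also have "... <= 2 * (B^2 * (norm b)^2) + 2 * (B^2 * a^2)"
        using B2 by (intro add_mono mult_left_mono mult_right_mono) auto
       finally have n1: "(norm (Dv' n z - h z))^2 <= 2 * (B^2 * (norm b)^2) + 2 * (B^2 * a^2)" .
       have "(\<eta> z)^2 * a^2 <= B^2 * a^2" using B2(1) by (rule mult_right_mono) simp
       moreover have "0 <= B^2 * (norm b)^2" by simp
       moreover have "3 * B^2 * (a^2 + (norm b)^2) = 3 * (B^2 * a^2) + 3 * (B^2 * (norm b)^2)"
        by (simp add: algebra_simps)
       ultimately have "(v' n z - w z)^2 + (norm (Dv' n z - h z))^2 <= 3 * B^2 * (a^2 + (norm b)^2)"
        using n1 unfolding e1 by linarith
       then have "ennreal ((v' n z - w z)^2 + (norm (Dv' n z - h z))^2) <= ennreal (3 * B^2 * (a^2 + (norm b)^2))"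
        by (rule ennreal_leI)
       also have "... = ennreal (3 * B^2) * ennreal (a^2 + (norm b)^2)" by (rule ennreal_mult) auto
       finally show ?thesis using True unfolding zz(2) d_def a_def b_def g_def by (simp only: indicator_simps mult_1_right)
      qed (simp add: d_def)
     qed
    qed
    also have "... = ennreal (3 * B^2) * (\<integral>\<^sup>+ z. d n z \<partial>lebesgue)"
     using dm by (rule nn_integral_cmult)
    finally show "(\<integral>\<^sup>+ z \<in> ball y \<rho> Int U. ennreal ((v' n z - w z)^2 + (norm (Dv' n z - weak_grad (U - K) w z))^2) \<partial>lebesgue)
     <= ennreal (3 * B^2) * (\<integral>\<^sup>+ z. d n z \<partial>lebesgue)" .
   qed
  qed simp
  moreover have "(%n. \<integral>\<^sup>+ z \<in> ball y \<rho> Int frontier U. ennreal ((v' n z - 0)^2) \<partial>hausdorff1_measure) \<longlonglongrightarrow> 0"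
  proof -
   have l4: "(%n. ennreal (B^2) * (\<integral>\<^sup>+ z \<in> ball y \<rho> Int frontier U. ennreal ((v n z - 0)^2) \<partial>hausdorff1_measure)) \<longlonglongrightarrow> 0"
    using ennreal_tendsto_cmult[OF _ l2, of "ennreal (B^2)"] by simp
   show ?thesis
   proof (rule tendsto_sandwich[OF _ _ tendsto_const l4], goal_cases)
    case 2
    show ?case
    proof (rule always_eventually, intro allI)
     fix n
     have [measurable]: "v n \<in> bm hausdorff1_measure"
      using borel_measurable_continuous_onI[OF C1_gradient_continuous[OF r(3)[of n]]] by simp
     have "(\<integral>\<^sup>+ z \<in> ball y \<rho> Int frontier U. ennreal ((v' n z - 0)^2) \<partial>hausdorff1_measure)
      <= (\<integral>\<^sup>+ z. ennreal (B^2) * (ennreal ((v n z - 0)^2) * ind (ball y \<rho> Int frontier U) z) \<partial>hausdorff1_measure)"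
     proof (rule nn_integral_mono)
      fix z
      show "ennreal ((v' n z - 0)^2) * ind (ball y \<rho> Int frontier U) z <= ennreal (B^2) * (ennreal ((v n z - 0)^2) * ind (ball y \<rho> Int frontier U) z)"
      proof (cases "z \<in> ball y \<rho> Int frontier U")
       case True
       then have "(\<eta> z)^2 <= B^2" using B(2)[of z] B(1) by (auto simp: abs_le_square_iff[symmetric])
       then have "(v' n z)^2 <= B^2 * (v n z)^2" by (simp add: v'_def power_mult_distrib mult_right_mono)
       then show ?thesis using True by (simp add: ennreal_mult[symmetric])
      qed simp
     qed
     also have "... = ennreal (B^2) * (\<integral>\<^sup>+ z \<in> ball y \<rho> Int frontier U. ennreal ((v n z - 0)^2) \<partial>hausdorff1_measure)"
     proof (rule nn_integral_cmult)
      have [measurable]: "ball y \<rho> Int frontier U \<in> sets hausdorff1_measure" by auto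
      show "(%z. ennreal ((v n z - 0)^2) * ind (ball y \<rho> Int frontier U) z) \<in> bm hausdorff1_measure"
       by (intro borel_measurable_times_ennreal borel_measurable_indicator) measurable
     qed
     finally show "(\<integral>\<^sup>+ z \<in> ball y \<rho> Int frontier U. ennreal ((v' n z - 0)^2) \<partial>hausdorff1_measure)
      <= ennreal (B^2) * (\<integral>\<^sup>+ z \<in> ball y \<rho> Int frontier U. ennreal ((v n z - 0)^2) \<partial>hausdorff1_measure)" .
    qed
   qed simp
  qed
  ultimately show "\<exists>\<rho>>0. ball y \<rho> Int K = {} &
    (\<exists>v Dv. (\<forall>n::nat. C1_gradient (v n) (Dv n)) &
     (%n. \<integral>\<^sup>+ z \<in> ball y \<rho> Int U. ennreal ((v n z - w z)^2 + (norm (Dv n z - weak_grad (U - K) w z))^2) \<partial>lebesgue) \<longlonglongrightarrow> 0 &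
     (%n. \<integral>\<^sup>+ z \<in> ball y \<rho> Int frontier U. ennreal ((v n z - 0)^2) \<partial>hausdorff1_measure) \<longlonglongrightarrow> 0)"
   using r(1,2) C1 by (intro exI[of _ \<rho>] conjI exI[of _ v'] exI[of _ Dv'] allI)
 qed
 have "admissible_competitor U K u K w (ball x R)"
  unfolding admissible_competitor_def
 proof (intro conjI ballI impI)
  show "admissible_pair U K w" using closed_K K_sub W12w tr by (simp add: admissible_pair_def)
  show "AE y in lebesgue. y \<in> U - K - ball x R --> w y = u y"
   by (intro AE_I2) (use one in "simp add: w_def")
 qed auto
 then have "energy U K u (ball x R) <= energy U K w (ball x R)"
  using minimizer unfolding generalized_minimizer_def by blast
 then have "dirichlet (ball x R) + hausdorff1 (K Int ball x R)
  <= (\<integral>\<^sup>+ y \<in> (ball x R Int U) - K. ennreal ((norm (h y))^2) \<partial>lebesgue) + hausdorff1 (K Int ball x R)"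
  unfolding energy_u energy_eq[OF open_UK wg] .
 moreover have "hausdorff1 (K Int ball x R) ~= \<infinity>" using finite_bounded(2)[of "ball x R"] by simp
 ultimately show ?thesis unfolding h_def by (simp add: add.commute[of _ "hausdorff1 (K Int ball x R)"] ennreal_add_left_cancel_le)
qed

end

section \<open>Cauchy-Schwarz and absolutely continuous functions\<close>

lemma integrable_of_square:
 fixes f h :: "'a => real"
 assumes "f \<in> bm M" "h \<in> bm M"
  and "integrable M (%x. (f x)^2)" "integrable M (%x. (h x)^2)"
 shows "integrable M (%x. f x * h x)"
proof (rule bochner_bound)
 show "integrable M (%x. (f x)^2 + (h x)^2)" using assms by simp
 show "(%x. f x * h x) \<in> bm M" using assms by simp
 have "\<bar>f x * h x\<bar> <= (f x)^2 + (h x)^2" for x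
 proof -
  have "0 <= \<bar>f x\<bar> * \<bar>h x\<bar>" by simp
  then show ?thesis using sum_squares_bound[of "\<bar>f x\<bar>" "\<bar>h x\<bar>"] unfolding abs_mult power2_abs by linarith
 qed
 then show "AE x in M. norm (f x * h x) <= norm ((f x)^2 + (h x)^2)" by simp
qed

lemma Cauchy_Schwarz_integral:
 fixes f h :: "'a => real"
 assumes fm: "f \<in> bm M" "h \<in> bm M"
  and i: "integrable M (%x. (f x)^2)" "integrable M (%x. (h x)^2)"
 shows "(LINT x|M. f x * h x)^2 <= (LINT x|M. (f x)^2) * (LINT x|M. (h x)^2)"
proof -
 define a b c where "a = (LINT x|M. (f x)^2)" and "b = (LINT x|M. (h x)^2)" and "c = (LINT x|M. f x * h x)"
 note ifh = integrable_of_square[OF fm i]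
 have q: "0 <= a - 2 * t * c + t^2 * b" for t
 proof -
  have "0 <= (LINT x|M. (f x - t * h x)^2)" by simp
  also have "... = (LINT x|M. (f x)^2 - (2 * t) * (f x * h x) + t^2 * (h x)^2)"
   by (rule bochner_cong) (auto simp: power2_eq_square algebra_simps)
  also have "... = a - 2 * t * c + t^2 * b"
   using i ifh by (simp add: a_def b_def c_def)
  finally show ?thesis .
 qed
 have a0: "a >= 0" and b0: "b >= 0" by (simp_all add: a_def b_def)
 have "c^2 <= a * b"
 proof (cases "b = 0")
  case True
  have "c = 0"
  proof (rule ccontr)
   assume "c ~= 0"
   then show False using q[of "(a + 1) / c"] True a0 by simp
  qed
  then show ?thesis using True by simp
 next
  case False
  then have "b > 0" using b0 by simp
  have "0 <= (a - 2 * (c / b) * c + (c / b)^2 * b) * b" using q[of "c / b"] b0 by (intro mult_nonneg_nonneg) auto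
  also have "... = a * b - c^2" using \<open>b > 0\<close> by (simp add: field_simps power2_eq_square)
  finally show ?thesis by simp
 qed
 then show ?thesis by (simp add: a_def b_def c_def)
qed

text \<open>\<open>ac a b F f\<close>: the function \<open>F\<close> is absolutely continuous on \<open>[a, b]\<close> with derivative \<open>f\<close>.\<close>

definition ac :: "real => real => (real => real) => (real => real) => bool" where
 "ac a b F f \<longleftrightarrow> sint {a..b} f &
  (\<forall>t\<in>{a..b}. F t = F a + (LBINT s:{a..t}. f s))"

lemma set_integral_split:
 fixes f :: "real => real"
 assumes f: "sint {a..b} f" and abc: "a <= c" "c <= b"
 shows "(LBINT s:{a..b}. f s) = (LBINT s:{a..c}. f s) + (LBINT s:{c..b}. f s)"
proof -
 have i: "sint {a..c} f" "sint {c..b} f"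
  using abc by (auto intro: set_integrable_subset[OF f])
 have "(LINT s:{a..c} Un {c..b}|lborel. f s) = (LBINT s:{a..c}. f s) + (LBINT s:{c..b}. f s)"
 proof (rule set_integral_Un_AE[OF _ _ _ i])
  have "AE s in lborel. s ~= c" by (rule AE_lborel_singleton)
  then show "AE s in lborel. \<not> (s \<in> {a..c} & s \<in> {c..b})" by eventually_elim auto
 qed auto
 then show ?thesis using abc by (simp add: ivl_disj_un_two_touch)
qed

lemma ac_integrable: "ac a b F f ==> sint {a..b} f"
 by (simp add: ac_def)

lemma ac_eq: "ac a b F f ==> t \<in> {a..b} ==> F t = F a + (LBINT s:{a..t}. f s)"
 unfolding ac_def by blast

lemma ac_diff: assumes "ac a b F f" "a <= c" "c <= d" "d <= b"
 shows "F d - F c = (LBINT s:{c..d}. f s)"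
proof -
 have "sint {a..d} f"
  using assms by (intro set_integrable_subset[OF ac_integrable[OF assms(1)]]) auto
 from set_integral_split[OF this assms(2,3)]
 have "(LBINT s:{a..d}. f s) = (LBINT s:{a..c}. f s) + (LBINT s:{c..d}. f s)" .
 moreover have "F c = F a + (LBINT s:{a..c}. f s)" "F d = F a + (LBINT s:{a..d}. f s)"
  using ac_eq[OF assms(1), of c] ac_eq[OF assms(1), of d] assms(2-4) by simp_all
 ultimately show ?thesis by linarith
qed

lemma ac_subinterval: assumes "ac a b F f" "a <= c" "d <= b"
 shows "ac c d F f"
 unfolding ac_def
proof (intro conjI ballI)
 show "sint {c..d} f"
  using assms by (intro set_integrable_subset[OF ac_integrable[OF assms(1)]]) auto
 fix t assume "t \<in> {c..d}"
 then show "F t = F c + (LBINT s:{c..t}. f s)" using ac_diff[OF assms(1,2), of t] assms(3) by simp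
qed

lemma ac_continuous: assumes "ac a b F f" shows "continuous_on {a..b} F"
proof -
 have "sint {a..t} f" if "t \<in> {a..b}" for t
  using that by (intro set_integrable_subset[OF ac_integrable[OF assms]]) auto
 then have "F t = F a + integral {a..t} f" if "t \<in> {a..b}" for t
  using ac_eq[OF assms that] that by (simp add: set_borel_integral_eq_integral(2))
 moreover have "continuous_on {a..b} (%t. F a + integral {a..t} f)"
  using set_borel_integral_eq_integral(1)[OF ac_integrable[OF assms]]
  by (intro continuous_intros indefinite_integral_continuous_1)
 ultimately show ?thesis by (elim continuous_on_eq) (rule sym)
qed

lemma set_integrable_mult_continuous:
 fixes f F :: "real => real"
 assumes f: "sint {a..b} f" and F: "continuous_on {a..b} F"
 shows "sint {a..b} (%t. f t * F t)" "sint {a..b} (%t. F t * f t)"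
proof -
 obtain B where "\<forall>y\<in>F ` {a..b}. norm y <= B"
  using compact_imp_bounded[OF compact_continuous_image[OF F compact_Icc]] unfolding bounded_iff by blast
 then have B: "!!t. t \<in> {a..b} ==> norm (F t) <= B" by blast
 have Fm: "(%t. ind {a..b} t *R F t) \<in> bm lborel"
  using borel_measurable_continuous_on_indicator[OF _ F] by simp
 have "integrable lborel (%t. (ind {a..b} t *R F t) * (ind {a..b} t *R f t))"
 proof (rule bochner_bound)
  show "integrable lborel (%t. B * norm (ind {a..b} t *R f t))"
   using f unfolding sintegrable_def by (intro integrable_mult_right integrable_norm)
  show "(%t. (ind {a..b} t *R F t) * (ind {a..b} t *R f t)) \<in> bm lborel"
   using Fm borel_measurable_integrable[OF f[unfolded sintegrable_def]] by (rule borel_measurable_times)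
  show "AE t in lborel. norm ((ind {a..b} t *R F t) * (ind {a..b} t *R f t)) <= norm (B * norm (ind {a..b} t *R f t))"
  proof (rule AE_I2)
   fix t
   show "norm ((ind {a..b} t *R F t) * (ind {a..b} t *R f t)) <= norm (B * norm (ind {a..b} t *R f t))"
   proof (cases "t \<in> {a..b}")
    case True
    have "\<bar>F t\<bar> <= \<bar>B\<bar>" using B[OF True] by simp
    then show ?thesis using True by (simp add: abs_mult mult_right_mono)
   qed simp
  qed
 qed
 moreover have "(%t. (ind {a..b} t *R F t) * (ind {a..b} t *R f t)) = (%t. ind {a..b} t *R (F t * f t))"
  by (auto simp: fun_eq_iff indicator_def)
 ultimately show "sint {a..b} (%t. F t * f t)" by (simp add: sintegrable_def)
 then show "sint {a..b} (%t. f t * F t)" by (simp add: mult.commute)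
qed

lemma sets_lborel_pair: "sets lborel2 = sets (borel :: (real \<times> real) measure)"
proof -
 have "sets lborel2 = sets ((borel :: real measure) \<Otimes>\<^sub>M (borel :: real measure))"
  by (rule sets_pair_measure_cong) simp_all
 then show ?thesis by (simp only: borel_prod)
qed

text \<open>The product of the two increments is the integral of \<open>f s * k t\<close> over the
  square. Splitting the square along the diagonal and applying Fubini, the inner integral over each
  triangle is again an increment of \<open>F\<close> or \<open>G\<close>.\<close>

lemma ac_by_parts:
 assumes F: "ac a b F f" and G: "ac a b G k" and ab: "a <= b"
 shows "F b * G b - F a * G a = (LBINT t:{a..b}. f t * G t + F t * k t)"
proof -
 define f' where "f' t = ind {a..b} t *R f t" for t
 define k' where "k' t = ind {a..b} t *R k t" for t
 have i: "integrable lborel f'" "integrable lborel k'"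
  using ac_integrable[OF F] ac_integrable[OF G]
  by (simp_all add: sintegrable_def f'_def[abs_def] k'_def[abs_def])
 note [measurable] = borel_measurable_integrable[OF i(1)] borel_measurable_integrable[OF i(2)]
 have fm[measurable]: "f' \<in> bm borel" "k' \<in> bm borel"
  using borel_measurable_integrable[OF i(1)] borel_measurable_integrable[OF i(2)] by simp_all
 define Q where "Q = (%(s::real, t::real). f' s * k' t)"
 have iQ: "integrable lborel2 Q"
  unfolding Q_def
 proof (rule lborel_pair.Fubini_integrable)
  show "(%(s, t). f' s * k' t) \<in> bm lborel2" by measurable
  show "integrable lborel (%s. LBINT t. norm (case (s, t) of (s, t) => f' s * k' t))"
   using i by (simp add: abs_mult)
  show "AE s in lborel. integrable lborel (%t. case (s, t) of (s, t) => f' s * k' t)"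
   using i by simp
 qed
 define Lo where "Lo = {p :: real \<times> real. fst p <= snd p}"
 have "closed Lo" unfolding Lo_def by (intro closed_Collect_le continuous_intros)
 then have Lom: "Lo \<in> sets lborel2" "- Lo \<in> sets lborel2"
  unfolding sets_lborel_pair by auto
 have i1: "integrable lborel2 (%p. ind Lo p *R Q p)"
  "integrable lborel2 (%p. ind (- Lo) p *R Q p)"
  using iQ Lom by (intro integrable_mult_indicator; simp)+
 have cumF: "(LBINT s. ind {..t} s * f' s) = F t - F a" if "t \<in> {a..b}" for t
 proof -
  have "(LBINT s. ind {..t} s * f' s) = (LBINT s:{a..t}. f s)"
   unfolding LBINT_def
   by (rule bochner_cong) (use that in "auto simp: f'_def indicator_def")
  then show ?thesis using ac_eq[OF F that] by linarith
 qed
 have cumG: "(LBINT s. ind {..<t} s * k' s) = G t - G a" if "t \<in> {a..b}" for t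
 proof -
  have "(LBINT s. ind {..<t} s * k' s) = (LBINT s:{a..t}. k s)"
   unfolding LBINT_def
  proof (rule integral_cong_AE)
   have "AE s in lborel. s ~= t" by (rule AE_lborel_singleton)
   then show "AE s in lborel. ind {..<t} s * k' s = ind {a..t} s *R k s"
    by eventually_elim (use that in "auto simp: k'_def indicator_def")
   have "sint {a..t} k" using that by (intro set_integrable_subset[OF ac_integrable[OF G]]) auto
   then show "(%s. ind {a..t} s *R k s) \<in> bm lborel"
    unfolding sintegrable_def by (rule borel_measurable_integrable)
  qed measurable
  then show ?thesis using ac_eq[OF G that] by linarith
 qed
 have Fb: "(LBINT s. f' s) = F b - F a" "(LBINT s. k' s) = G b - G a"
  using ac_eq[OF F, of b] ac_eq[OF G, of b] ab by (simp_all add: f'_def k'_def LBINT_def)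
 have "(F b - F a) * (G b - G a) = (LBINT s. (LBINT t. f' s * k' t))"
  by (simp add: Fb)
 also have "... = integral\<^sup>L lborel2 Q"
  using lborel_pair.integral_fst'[OF iQ] by (simp add: Q_def)
 also have "... = (LINT p|lborel2. ind Lo p *R Q p) + (LINT p|lborel2. ind (- Lo) p *R Q p)"
  by (subst Bochner_Integration.integral_add[OF i1, symmetric])
   (auto intro!: bochner_cong simp: indicator_def)
 also have "(LINT p|lborel2. ind Lo p *R Q p) = (LBINT t. (LBINT s. ind Lo (s, t) *R Q (s, t)))"
  using lborel_pair.integral_snd[of "%s t. ind Lo (s, t) *R Q (s, t)"] i1(1) by (simp add: case_prod_unfold)
 also have "... = (LBINT t. k' t * (F t - F a))"
 proof (rule bochner_cong[OF refl])
  fix t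
  have "(LBINT s. ind Lo (s, t) *R Q (s, t)) = (LBINT s. k' t * (ind {..t} s * f' s))"
   by (rule bochner_cong) (auto simp: Lo_def Q_def indicator_def)
  also have "... = k' t * (F t - F a)"
   using cumF[of t] by (cases "t \<in> {a..b}") (auto simp: k'_def)
  finally show "(LBINT s. ind Lo (s, t) *R Q (s, t)) = k' t * (F t - F a)" .
 qed
 also have "(LINT p|lborel2. ind (- Lo) p *R Q p) = (LBINT s. (LBINT t. ind (- Lo) (s, t) *R Q (s, t)))"
  using lborel_pair.integral_fst'[OF i1(2)] by simp
 also have "... = (LBINT s. f' s * (G s - G a))"
 proof (rule bochner_cong[OF refl])
  fix s
  have "(LBINT t. ind (- Lo) (s, t) *R Q (s, t)) = (LBINT t. f' s * (ind {..<s} t * k' t))"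
   by (rule bochner_cong) (auto simp: Lo_def Q_def indicator_def)
  also have "... = f' s * (G s - G a)"
   using cumG[of s] by (cases "s \<in> {a..b}") (auto simp: f'_def)
  finally show "(LBINT t. ind (- Lo) (s, t) *R Q (s, t)) = f' s * (G s - G a)" .
 qed
 also have "(LBINT t. k' t * (F t - F a)) = (LBINT t:{a..b}. F t * k t) - F a * (G b - G a)"
 proof -
  have 1: "integrable lborel (%t. ind {a..b} t *R (F t * k t))"
   using set_integrable_mult_continuous(2)[OF ac_integrable[OF G] ac_continuous[OF F]] by (simp add: sintegrable_def)
  have "(LBINT t. k' t * (F t - F a)) = (LBINT t. ind {a..b} t *R (F t * k t) - F a * k' t)"
   by (rule bochner_cong) (auto simp: k'_def indicator_def algebra_simps)
  then show ?thesis using 1 i by (simp add: LBINT_def Fb)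
 qed
 also have "(LBINT s. f' s * (G s - G a)) = (LBINT t:{a..b}. f t * G t) - G a * (F b - F a)"
 proof -
  have 1: "integrable lborel (%t. ind {a..b} t *R (f t * G t))"
   using set_integrable_mult_continuous(1)[OF ac_integrable[OF F] ac_continuous[OF G]] by (simp add: sintegrable_def)
  have "(LBINT t. f' t * (G t - G a)) = (LBINT t. ind {a..b} t *R (f t * G t) - G a * f' t)"
   by (rule bochner_cong) (auto simp: f'_def indicator_def algebra_simps)
  then show ?thesis using 1 i by (simp add: LBINT_def Fb)
 qed
 finally have "(F b - F a) * (G b - G a) = (LBINT t:{a..b}. F t * k t) - F a * (G b - G a) + ((LBINT t:{a..b}. f t * G t) - G a * (F b - F a))" .
 moreover have "(LBINT t:{a..b}. f t * G t + F t * k t) = (LBINT t:{a..b}. f t * G t) + (LBINT t:{a..b}. F t * k t)"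
  using set_integrable_mult_continuous(1)[OF ac_integrable[OF F] ac_continuous[OF G]]
   set_integrable_mult_continuous(2)[OF ac_integrable[OF G] ac_continuous[OF F]] by (rule set_integral_add)
 ultimately show ?thesis by (simp add: algebra_simps)
qed

lemma ac_mult:
 assumes F: "ac a b F f" and G: "ac a b G k"
 shows "ac a b (%t. F t * G t) (%t. f t * G t + F t * k t)"
 unfolding ac_def
proof (intro conjI ballI)
 show "sint {a..b} (%t. f t * G t + F t * k t)"
  using set_integrable_mult_continuous(1)[OF ac_integrable[OF F] ac_continuous[OF G]]
   set_integrable_mult_continuous(2)[OF ac_integrable[OF G] ac_continuous[OF F]] by (rule set_integral_add)
 fix t assume "t \<in> {a..b}"
 then show "F t * G t = F a * G a + (LBINT s:{a..t}. f s * G s + F s * k s)"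
  using ac_by_parts[OF ac_subinterval[OF F, of a t] ac_subinterval[OF G, of a t]] by simp
qed

lemma ac_C1:
 assumes "!!t. a <= t ==> t <= b ==> (F has_real_derivative f t) (at t)" "continuous_on {a..b} f"
 shows "ac a b F f"
 unfolding ac_def
proof (intro conjI ballI)
 show "sint {a..b} f" using borel_integrable_atLeastAtMost'[OF assms(2)] .
 fix t assume t: "t \<in> {a..b}"
 have "(LBINT s:{a..t}. f s) = F t - F a"
  unfolding LBINT_def
 proof (rule integral_FTC_Icc)
  fix s assume "a <= s" "s <= t"
  then show "(F has_vector_derivative f s) (at s within {a..t})"
   using assms(1)[of s] t by (auto simp: has_real_derivative_iff_has_vector_derivative intro: has_vector_derivative_at_within)
 qed (use t continuous_on_subset[OF assms(2)] in auto)
 then show "F t = F a + (LBINT s:{a..t}. f s)" by simp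
qed

lemma Cauchy_Schwarz_set_integral:
 fixes f h :: "real => real"
 assumes A: "A \<in> sets lborel" and m: "f \<in> bm borel" "h \<in> bm borel"
  and i: "sint A (%x. (f x)^2)" "sint A (%x. (h x)^2)"
 shows "(LINT x:A|lborel. f x * h x)^2 <= (LINT x:A|lborel. (f x)^2) * (LINT x:A|lborel. (h x)^2)"
  and "sint A (%x. f x * h x)"
proof -
 define f' h' where "f' x = ind A x * f x" and "h' x = ind A x * h x" for x
 have sq: "(f' x)^2 = ind A x *R (f x)^2" "(h' x)^2 = ind A x *R (h x)^2"
  "f' x * h' x = ind A x *R (f x * h x)" for x
  by (auto simp: f'_def h'_def indicator_def)
 have m': "f' \<in> bm lborel" "h' \<in> bm lborel"
  unfolding f'_def[abs_def] h'_def[abs_def] using m A by auto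
 have i': "integrable lborel (%x. (f' x)^2)" "integrable lborel (%x. (h' x)^2)"
  using i unfolding sq sintegrable_def .
 show "(LINT x:A|lborel. f x * h x)^2 <= (LINT x:A|lborel. (f x)^2) * (LINT x:A|lborel. (h x)^2)"
  using Cauchy_Schwarz_integral[OF m' i'] unfolding sq LBINT_def .
 show "sint A (%x. f x * h x)"
  using integrable_of_square[OF m' i'] unfolding sq sintegrable_def .
qed

lemma set_integrable_const_Icc: "sint {a..b::real} (%_. c::real)"
 by (rule borel_integrable_atLeastAtMost') auto

lemma set_integrable_of_square:
 fixes q :: "real => real"
 assumes m: "q \<in> bm borel" and i: "sint {a..b} (%t. (q t)^2)"
 shows "sint {a..b} q"
 using Cauchy_Schwarz_set_integral(2)[OF _ _ m _ i, of "%_. 1"] set_integrable_const_Icc[of a b 1] by simp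

lemma set_integral_mono_set:
 fixes f :: "real => real"
 assumes "sint B f" "A <= B" "A \<in> sets lborel" "!!x. f x >= 0"
 shows "(LINT x:A|lborel. f x) <= (LINT x:B|lborel. f x)"
 unfolding LBINT_def
proof (rule integral_mono)
 have "sint A f" using assms by (intro set_integrable_subset[OF assms(1)]) auto
 then show "integrable lborel (%x. ind A x *R f x)" by (simp add: sintegrable_def)
 show "integrable lborel (%x. ind B x *R f x)" using assms(1) by (simp add: sintegrable_def)
 show "ind A x *R f x <= ind B x *R f x" for x using assms(2,4) by (auto simp: indicator_def)
qed

section \<open>Wirtinger's inequality and its stability on a half circle\<close>

text \<open>One arc of a half circle: zero value at angle 0, on the axis, and no condition at the
  angle \<open>ka\<close>, where \<open>K\<close> is met.\<close>

locale arc =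
 fixes ka :: real and F q :: "real => real"
 assumes k: "0 < ka" and F: "ac 0 ka F q" and F0: "F 0 = 0" and qm: "q \<in> bm borel"
  and q2: "sint {0..ka} (%t. (q t)^2)"
begin

lemma q2_sub: "0 <= a ==> b <= ka ==> sint {a..b} (%t. (q t)^2)"
 by (rule set_integrable_subset[OF q2]) auto

lemma F_sq_le: assumes "0 <= t" "t <= ka" shows "(F t)^2 <= t * (LBINT s:{0..t}. (q s)^2)"
proof -
 have "F t = (LBINT s:{0..t}. 1 * q s)" using ac_eq[OF F, of t] F0 assms by simp
 moreover have "(LBINT s:{0..t}. 1 * q s)^2 <= (LBINT s:{0..t}. 1^2) * (LBINT s:{0..t}. (q s)^2)"
  using q2_sub[of 0 t] assms qm set_integrable_const_Icc[of 0 t 1]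
  by (intro Cauchy_Schwarz_set_integral(1)) auto
 moreover have "(LBINT s:{0..t}. 1^2) = t" using assms by (simp add: set_integral_const)
 ultimately show ?thesis by simp
qed

lemma F2_int: "0 <= a ==> b <= ka ==> sint {a..b} (%t. (F t)^2)"
 using continuous_on_subset[OF ac_continuous[OF F], of "{a..b}"]
 by (intro borel_integrable_atLeastAtMost' continuous_intros) auto

text \<open>Substitution of the ground state \<open>sin (\<mu> t)\<close>: with \<open>c t = \<mu> cot (\<mu> t)\<close> one has \<open>c' = - \<mu>^2 - c^2\<close>.\<close>

lemma ground_state:
 assumes a: "0 < a" "a <= ka" and l: "0 < \<mu>" "\<mu> * ka <= pi / 2"
 shows "sint {a..ka} (%t. (q t - \<mu> * cos (\<mu> * t) / sin (\<mu> * t) * F t)^2)"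
  and "(LBINT t:{a..ka}. (q t - \<mu> * cos (\<mu> * t) / sin (\<mu> * t) * F t)^2) + \<mu>^2 * (LBINT t:{a..ka}. (F t)^2)
   <= (LBINT t:{0..ka}. (q t)^2)"
proof -
 define c where "c t = \<mu> * cos (\<mu> * t) / sin (\<mu> * t)" for t
 define c' where "c' t = - (\<mu>^2) - (c t)^2" for t
 have st: "sin (\<mu> * t) > 0" if "a <= t" "t <= ka" for t
 proof (rule sin_gt_zero)
  show "0 < \<mu> * t" using a l that by simp
  have "\<mu> * t <= \<mu> * ka" using l that by simp
  then show "\<mu> * t < pi" using l pi_gt_zero by linarith
 qed
 have cc: "continuous_on {a..ka} c" unfolding c_def[abs_def]
  using st by (intro continuous_intros) (auto simp: less_imp_neq[symmetric] dest: less_imp_neq)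
 have acc: "ac a ka c c'"
 proof (rule ac_C1)
  fix t assume t: "a <= t" "t <= ka"
  have s: "sin (\<mu> * t) ~= 0" using st[OF t] by simp
  have "(c has_real_derivative ((\<mu> * (- sin (\<mu> * t) * \<mu>)) * sin (\<mu> * t) - (\<mu> * cos (\<mu> * t)) * (cos (\<mu> * t) * \<mu>)) / (sin (\<mu> * t) * sin (\<mu> * t))) (at t)"
   unfolding c_def[abs_def] using s by (auto intro!: derivative_eq_intros)
  moreover have "((\<mu> * (- sin (\<mu> * t) * \<mu>)) * sin (\<mu> * t) - (\<mu> * cos (\<mu> * t)) * (cos (\<mu> * t) * \<mu>)) / (sin (\<mu> * t) * sin (\<mu> * t)) = c' t"
   using s by (simp add: c'_def c_def field_simps power2_eq_square)
  ultimately show "(c has_real_derivative c' t) (at t)" by simp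
 next
  show "continuous_on {a..ka} c'" unfolding c'_def[abs_def] by (intro continuous_intros cc)
 qed
 have Fa: "ac a ka F q" using ac_subinterval[OF F, of a ka] a by simp
 have cF: "continuous_on {a..ka} F" by (rule ac_continuous[OF Fa])
 define D where "D t = c' t * (F t * F t) + c t * (q t * F t + F t * q t)" for t
 have acD: "ac a ka (%t. c t * (F t * F t)) D"
  unfolding D_def[abs_def] by (rule ac_mult[OF acc ac_mult[OF Fa Fa]])
 have eq: "(q t - c t * F t)^2 = (q t)^2 - D t - \<mu>^2 * (F t)^2" for t
  by (simp add: D_def c'_def power2_eq_square algebra_simps)
 have iD: "sint {a..ka} D" by (rule ac_integrable[OF acD])
 have iq: "sint {a..ka} (%t. (q t)^2)" using a by (intro q2_sub) auto
 have iF: "sint {a..ka} (%t. \<mu>^2 * (F t)^2)"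
  using a F2_int[of a ka] by simp
 show "sint {a..ka} (%t. (q t - \<mu> * cos (\<mu> * t) / sin (\<mu> * t) * F t)^2)"
  unfolding c_def[symmetric] eq by (intro set_integral_diff iD iq iF)
 have I: "(LBINT t:{a..ka}. (q t - c t * F t)^2) = (LBINT t:{a..ka}. (q t)^2) - (LBINT t:{a..ka}. D t) - \<mu>^2 * (LBINT t:{a..ka}. (F t)^2)"
  unfolding eq using iD iq iF by (simp add: set_integral_diff)
 have "(LBINT t:{a..ka}. D t) = c ka * (F ka * F ka) - c a * (F a * F a)"
  using ac_diff[OF acD, of a ka] a by simp
 \<comment> \<open>At the free end the boundary term has a favourable sign because
   \<open>\<mu> * ka <= pi / 2\<close>.\<close>
 moreover have "c ka * (F ka * F ka) >= 0"
 proof -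
  have "cos (\<mu> * ka) >= 0" using l k by (intro cos_ge_zero) (auto intro: order_trans[of _ 0])
  then have "c ka >= 0" using st[of ka] a l by (simp add: c_def)
  then show ?thesis by simp
 qed
 \<comment> \<open>The function \<open>c\<close> is singular at 0, which is why the interval starts
   at \<open>a > 0\<close>. By \<open>c a <= 1 / a\<close> and \<open>F_sq_le\<close> the energy on
   \<open>[0, a]\<close> absorbs this boundary term.\<close>
 moreover have "c a * (F a * F a) <= (LBINT s:{0..a}. (q s)^2)"
 proof -
  have "(\<mu> * a) * cos (\<mu> * a) <= sin (\<mu> * a)"
  proof (rule mult_cos_le_sin)
   have "\<mu> * a <= \<mu> * ka" using l a by simp
   then show "\<mu> * a <= pi" using l pi_gt_zero by linarith
  qed (use l a in simp)
  then have "c a <= 1 / a" using st[of a] a by (simp add: c_def field_simps)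
  then have "c a * (F a)^2 <= 1 / a * (F a)^2" by (rule mult_right_mono) simp
  also have "... <= 1 / a * (a * (LBINT s:{0..a}. (q s)^2))"
   using F_sq_le[of a] a by (intro mult_left_mono) auto
  finally show ?thesis using a by (simp add: power2_eq_square)
 qed
 moreover have "(LBINT t:{0..ka}. (q t)^2) = (LBINT s:{0..a}. (q s)^2) + (LBINT t:{a..ka}. (q t)^2)"
  using set_integral_split[OF q2, of a] a by simp
 ultimately show "(LBINT t:{a..ka}. (q t - \<mu> * cos (\<mu> * t) / sin (\<mu> * t) * F t)^2) + \<mu>^2 * (LBINT t:{a..ka}. (F t)^2)
   <= (LBINT t:{0..ka}. (q t)^2)"
  unfolding c_def[symmetric] I by linarith
qed

definition Q where "Q = (LBINT t:{0..ka}. (q t)^2)"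
definition A where "A = (LBINT t:{0..ka}. (F t)^2)"

lemma Q_nonneg: "Q >= 0" and A_nonneg: "A >= 0"
 by (auto simp: Q_def A_def LBINT_def)

lemma near_zero_le: assumes "0 <= a" "a <= ka" shows "(LBINT t:{0..a}. (F t)^2) <= a * (ka * Q)"
proof -
 have "(LBINT t:{0..a}. (F t)^2) <= (LBINT t:{0..a}. ka * Q)"
 proof (rule set_integral_mono)
  fix t assume t: "t \<in> {0..a}"
  then have "(F t)^2 <= t * (LBINT s:{0..t}. (q s)^2)" using assms by (intro F_sq_le) auto
  also have "... <= ka * Q"
  proof (rule mult_mono)
   show "(LBINT s:{0..t}. (q s)^2) <= Q"
    unfolding Q_def using t assms by (intro set_integral_mono_set[OF q2]) auto
  qed (use t assms k in "auto simp: LBINT_def")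
  finally show "(F t)^2 <= ka * Q" .
 qed (use assms F2_int[of 0 a] set_integrable_const_Icc in auto)
 also have "... = a * (ka * Q)" using assms by (simp add: set_integral_const)
 finally show ?thesis .
qed

lemma A_split: assumes "0 <= a" "a <= ka"
 shows "A = (LBINT t:{0..a}. (F t)^2) + (LBINT t:{a..ka}. (F t)^2)"
 unfolding A_def using F2_int[of 0 ka] assms by (intro set_integral_split) auto

text \<open>The admissible \<open>\<mu>^2\<close> range up to \<open>(pi / (2 * ka))^2\<close>, the
  first eigenvalue for a zero value at one end and a free other end. It follows from the ground
  state inequality by letting the excised interval \<open>[0, a]\<close> shrink.\<close>

lemma Wirtinger:
 assumes l: "0 < \<mu>" "\<mu> * ka <= pi / 2"
 shows "\<mu>^2 * A <= Q"
proof (rule field_le_epsilon)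
 fix e :: real assume e: "e > 0"
 define a where "a = min ka (e / (\<mu>^2 * (ka * Q) + 1))"
 have dpos: "\<mu>^2 * (ka * Q) + 1 > 0" using k Q_nonneg by (intro add_nonneg_pos) auto
 have a: "0 < a" "a <= ka" using k e dpos by (auto simp: a_def)
 have "0 <= (LBINT t:{a..ka}. (q t - \<mu> * cos (\<mu> * t) / sin (\<mu> * t) * F t)^2)"
  by (auto simp: LBINT_def)
 then have "\<mu>^2 * (LBINT t:{a..ka}. (F t)^2) <= Q"
  using ground_state(2)[OF a l] unfolding Q_def by linarith
 moreover have "\<mu>^2 * (LBINT t:{0..a}. (F t)^2) <= \<mu>^2 * (a * (ka * Q))"
  using near_zero_le[of a] a by (intro mult_left_mono) auto
 moreover have "\<mu>^2 * (a * (ka * Q)) <= e"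
 proof -
  have "\<mu>^2 * (a * (ka * Q)) = a * (\<mu>^2 * (ka * Q))" by simp
  also have "... <= a * (\<mu>^2 * (ka * Q) + 1)" using a by (intro mult_left_mono) auto
  also have "... <= e / (\<mu>^2 * (ka * Q) + 1) * (\<mu>^2 * (ka * Q) + 1)"
   using dpos by (intro mult_right_mono) (auto simp: a_def)
  also have "... = e" using dpos by simp
  finally show ?thesis .
 qed
 ultimately show "\<mu>^2 * A <= Q + e" unfolding A_split[OF less_imp_le[OF a(1)] a(2)] by (simp add: distrib_left)
qed

text \<open>The quotient of \<open>F\<close> by \<open>sin (t / 2)\<close> has derivative
  \<open>S t * h t\<close>, and the square integral of \<open>h\<close> is at most the deficit
  \<open>Q - A / 4\<close>. By Cauchy-Schwarz the quotient is nearly constant. The integral of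
  \<open>S^2\<close> is at most \<open>2 * cos (th / 2) / sin (th / 2)\<close>; after multiplication
  by \<open>(sin (th / 2))^2\<close> it becomes \<open>sin th <= 1\<close>, so the bound is uniform
  down to the axis.\<close>

lemma close_to_ground_state:
 assumes kp: "ka <= pi" and t: "0 < th" "th <= ka"
 shows "(F th - F ka / sin (ka / 2) * sin (th / 2))^2 <= Q - A / 4"
proof -
 define c where "c t = (1/2) * cos ((1/2) * t) / sin ((1/2) * t)" for t :: real
 define d where "d = Q - A / 4"
 have l: "0 < (1/2::real)" "(1/2) * ka <= pi / 2" using kp by auto
 have st: "sin (t / 2) > 0" if "th <= t" "t <= ka" for t using that t kp by (intro sin_gt_zero) auto
 have gs: "(LBINT t:{a..ka}. (q t - c t * F t)^2) + (LBINT t:{a..ka}. (F t)^2) / 4 <= Q"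
  "sint {a..ka} (%t. (q t - c t * F t)^2)" if "0 < a" "a <= ka" for a
  using ground_state[OF that l] unfolding c_def[symmetric] Q_def[symmetric] by (simp_all add: power2_eq_square)
 have small: "(LBINT t:{th..ka}. (q t - c t * F t)^2) <= d"
 proof (rule field_le_epsilon)
  fix e :: real assume e: "e > 0"
  define a where "a = min th (e / (ka * Q + 1))"
  have dpos: "ka * Q + 1 > 0" using k Q_nonneg by (intro add_nonneg_pos) auto
  have a: "0 < a" "a <= th" using t e dpos by (auto simp: a_def)
  have "(LBINT t:{th..ka}. (q t - c t * F t)^2) <= (LBINT t:{a..ka}. (q t - c t * F t)^2)"
   using gs(2)[of a] a t by (intro set_integral_mono_set) auto
  moreover have "(LBINT t:{0..a}. (F t)^2) <= a * (ka * Q)" using near_zero_le[of a] a t by auto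
  moreover have "a * (ka * Q) <= e"
  proof -
   have "a * (ka * Q) <= a * (ka * Q + 1)" using a by (intro mult_left_mono) auto
   also have "... <= e / (ka * Q + 1) * (ka * Q + 1)" using dpos by (intro mult_right_mono) (auto simp: a_def)
   also have "... = e" using dpos by simp
   finally show ?thesis .
  qed
  ultimately show "(LBINT t:{th..ka}. (q t - c t * F t)^2) <= d + e"
  proof -
   have "(LBINT t:{a..ka}. (q t - c t * F t)^2) + (LBINT t:{a..ka}. (F t)^2) / 4 <= Q"
    using gs(1)[of a] a t by simp
   moreover have "A = (LBINT t:{0..a}. (F t)^2) + (LBINT t:{a..ka}. (F t)^2)"
    using A_split[of a] a t by simp
   ultimately show ?thesis
    using \<open>(LBINT t:{th..ka}. (q t - c t * F t)^2) <= (LBINT t:{a..ka}. (q t - c t * F t)^2)\<close>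
     \<open>(LBINT t:{0..a}. (F t)^2) <= a * (ka * Q)\<close> \<open>a * (ka * Q) <= e\<close> e
    unfolding d_def by linarith
  qed
 qed
 define S where "S t = 1 / sin (t / 2)" for t :: real
 define S' where "S' t = - (cos (t / 2) / 2) / (sin (t / 2))^2" for t :: real
 have ac_S: "ac th ka S S'"
 proof (rule ac_C1)
  fix t assume "th <= t" "t <= ka"
  then have "sin (t / 2) ~= 0" using st by force
  then show "(S has_real_derivative S' t) (at t)" unfolding S_def[abs_def] S'_def
   by (auto intro!: derivative_eq_intros simp: power2_eq_square)
 next
  show "continuous_on {th..ka} S'" unfolding S'_def[abs_def]
   using st by (intro continuous_intros) (auto simp: less_imp_neq[symmetric] dest: less_imp_neq)
 qed
 have Ft: "ac th ka F q" using ac_subinterval[OF F, of th ka] t by simp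
 define h where "h t = q t - c t * F t" for t
 have D: "q t * S t + F t * S' t = S t * h t" if "t \<in> {th..ka}" for t
 proof -
  have "sin (t / 2) ~= 0" using st[of t] that by force
  then show ?thesis by (simp add: S_def S'_def h_def c_def field_simps power2_eq_square)
 qed
 have "F ka * S ka - F th * S th = (LBINT t:{th..ka}. q t * S t + F t * S' t)"
  using ac_diff[OF ac_mult[OF Ft ac_S], of th ka] t by simp
 also have "... = (LBINT t:{th..ka}. S t * h t)"
  by (rule set_lebesgue_integral_cong) (use D in auto)
 finally have m: "F ka * S ka - F th * S th = (LBINT t:{th..ka}. S t * h t)" .
 define S2 where "S2 t = ind {th..ka} t * S t" for t
 define h2 where "h2 t = ind {th..ka} t * h t" for t
 have cS: "continuous_on {th..ka} S" by (rule ac_continuous[OF ac_S])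
 have cF: "continuous_on {th..ka} F" by (rule ac_continuous[OF Ft])
 have cc: "continuous_on {th..ka} c" unfolding c_def[abs_def]
  using st by (intro continuous_intros) (auto simp: less_imp_neq[symmetric] dest: less_imp_neq)
 have mS: "S2 \<in> bm borel"
  unfolding S2_def[abs_def] using borel_measurable_continuous_on_indicator[OF _ cS] by simp
 have mh: "h2 \<in> bm borel"
 proof -
  have "(%t. ind {th..ka} t *R (c t * F t)) \<in> bm borel"
   by (rule borel_measurable_continuous_on_indicator) (auto intro!: continuous_intros cc cF)
  moreover have "h2 = (%t. ind {th..ka} t * q t - ind {th..ka} t *R (c t * F t))"
   by (auto simp: h2_def h_def indicator_def fun_eq_iff)
  ultimately show ?thesis using qm by simp
 qed
 have iS: "sint {th..ka} (%t. (S t)^2)"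
  by (intro borel_integrable_atLeastAtMost' continuous_intros cS)
 have ind: "sint {th..ka} (%t. (S2 t)^2)" "sint {th..ka} (%t. (h2 t)^2)"
  using iS gs(2)[OF t] unfolding sintegrable_def h_def[symmetric]
  by (elim back_subst[of "integrable lborel"]; auto simp: S2_def h2_def indicator_def fun_eq_iff)+
 have "(LBINT t:{th..ka}. S2 t * h2 t)^2 <= (LBINT t:{th..ka}. (S2 t)^2) * (LBINT t:{th..ka}. (h2 t)^2)"
  by (rule Cauchy_Schwarz_set_integral(1)[OF _ mS mh ind]) simp
 moreover have "(LBINT t:{th..ka}. S2 t * h2 t) = (LBINT t:{th..ka}. S t * h t)"
  "(LBINT t:{th..ka}. (S2 t)^2) = (LBINT t:{th..ka}. (S t)^2)"
  "(LBINT t:{th..ka}. (h2 t)^2) = (LBINT t:{th..ka}. (h t)^2)"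
  by (intro set_lebesgue_integral_cong; auto simp: S2_def h2_def)+
 ultimately have CS0: "(LBINT t:{th..ka}. S t * h t)^2 <= (LBINT t:{th..ka}. (S t)^2) * (LBINT t:{th..ka}. (h t)^2)"
  by simp
 have CS: "(F ka * S ka - F th * S th)^2 <= (LBINT t:{th..ka}. (S t)^2) * d"
 proof -
  have "0 <= (LBINT t:{th..ka}. (S t)^2)" by (auto simp: LBINT_def)
  then have "(LBINT t:{th..ka}. (S t)^2) * (LBINT t:{th..ka}. (h t)^2) <= (LBINT t:{th..ka}. (S t)^2) * d"
   using small unfolding h_def[symmetric] by (intro mult_left_mono)
  then show ?thesis using CS0 unfolding m by simp
 qed
 have S2_int: "(LBINT t:{th..ka}. (S t)^2) <= 2 * (cos (th / 2) / sin (th / 2))"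
 proof -
  have "ac th ka (%t. - 2 * (cos (t / 2) / sin (t / 2))) (%t. (S t)^2)"
  proof (rule ac_C1)
   fix t assume "th <= t" "t <= ka"
   then have s: "sin (t / 2) ~= 0" using st by force
   have e: "- 2 * ((- b * (1 / 2) * b - a * (a * (1 / 2))) / (b * b)) = (b^2 + a^2) / b^2"
    if "b ~= 0" for a b :: real using that by (simp add: field_simps power2_eq_square)
   have d1: "((%t. cos (t / 2)) has_real_derivative - sin (t / 2) * (1 / 2)) (at t)"
    "((%t. sin (t / 2)) has_real_derivative cos (t / 2) * (1 / 2)) (at t)"
    by (auto intro!: derivative_eq_intros)
   show "((%t. - 2 * (cos (t / 2) / sin (t / 2))) has_real_derivative (S t)^2) (at t)"
    using DERIV_cmult[OF DERIV_divide[OF d1 s], of "- 2"] unfolding e[OF s]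
    by (simp add: S_def power_divide)
  qed (intro continuous_intros cS)
  from ac_diff[OF this, of th ka] t have "(LBINT t:{th..ka}. (S t)^2) = 2 * (cos (th / 2) / sin (th / 2)) - 2 * (cos (ka / 2) / sin (ka / 2))"
   by simp
  moreover have "cos (ka / 2) / sin (ka / 2) >= 0"
   using kp k st[of ka] t by (intro divide_nonneg_pos cos_ge_zero) auto
  ultimately show ?thesis by linarith
 qed
 have d0: "d >= 0" using Wirtinger[OF l] by (simp add: d_def power2_eq_square)
 have s: "sin (th / 2) > 0" using st[of th] t by simp
 have "F th - F ka / sin (ka / 2) * sin (th / 2) = - sin (th / 2) * (F ka * S ka - F th * S th)"
  using s by (simp add: S_def field_simps)
 then have "(F th - F ka / sin (ka / 2) * sin (th / 2))^2 = (sin (th / 2))^2 * (F ka * S ka - F th * S th)^2"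
  by (simp add: power_mult_distrib)
 also have "... <= (sin (th / 2))^2 * ((LBINT t:{th..ka}. (S t)^2) * d)"
  using CS by (intro mult_left_mono) auto
 also have "... <= (sin (th / 2))^2 * ((2 * (cos (th / 2) / sin (th / 2))) * d)"
  using S2_int d0 by (intro mult_left_mono mult_right_mono) auto
 also have "... = (2 * sin (th / 2) * cos (th / 2)) * d" using s by (simp add: power2_eq_square field_simps)
 also have "... = sin th * d" using sin_double[of "th / 2"] by simp
 also have "... <= 1 * d" using d0 by (intro mult_right_mono) auto
 finally show ?thesis by (simp add: d_def)
qed

end

text \<open>\<open>slice ka f q\<close>: the restriction \<open>f\<close> of \<open>u\<close> to a half circle that \<open>K\<close> meets at the angle \<open>ka\<close>.\<close>

definition slice :: "real => (real => real) => (real => real) => bool" where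
 "slice ka f q \<longleftrightarrow> 0 <= ka & ka <= pi & f \<in> bm borel & q \<in> bm borel &
  sint {0..pi} (%t. (q t)^2) &
  (AE t\<in>{0<..<ka} in lborel. f t = (LBINT s:{0..t}. q s)) &
  (AE t\<in>{ka<..<pi} in lborel. f t = - (LBINT s:{t..pi}. q s))"

lemma AE_reflect:
 assumes "AE t in lborel. P t" shows "AE t in lborel. P (c - t :: real)"
proof -
 obtain N where P: "!!t. t \<in> space lborel - N ==> P t" and N: "N \<in> null_sets lborel"
  using AE_E3[OF assms] by blast
 then have "AE t in lborel. t ~: N" by (intro AE_not_in)
 then have "AE t in lborel. (c + (- 1) * t) ~: N"
  using N by (intro AE_borel_affine) (auto simp: null_sets_def)
 then show ?thesis by eventually_elim (use P in auto)
qed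

lemma set_integral_reflect:
 fixes f :: "real => real"
 shows "(LBINT t:{a..b}. f (c - t)) = (LBINT t:{c - b..c - a}. f t)"
  and "sint {a..b} (%t. f (c - t)) \<longleftrightarrow> sint {c - b..c - a} f"
proof -
 have e: "ind {c - b..c - a} (c + - 1 * t) *R f (c + - 1 * t) = ind {a..b} t *R f (c - t)" for t
  by (auto simp: indicator_def)
 show "(LBINT t:{a..b}. f (c - t)) = (LBINT t:{c - b..c - a}. f t)"
  unfolding LBINT_def
  using lborel_integral_real_affine[of "- 1" "%t. ind {c - b..c - a} t *R f t" c] unfolding e by simp
 show "sint {a..b} (%t. f (c - t)) \<longleftrightarrow> sint {c - b..c - a} f"
  unfolding sintegrable_def
  using lborel_integrable_real_affine_iff[of "- 1" "%t. ind {c - b..c - a} t *R f t" c] unfolding e by simp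
qed

text \<open>The mirror image \<open>t\<close> to \<open>pi - t\<close> exchanges the two arcs and
  reduces every statement about the right arc to the left one; the sign in front of \<open>q\<close>
  is the chain rule.\<close>

lemma slice_reflect:
 assumes "slice ka f q" shows "slice (pi - ka) (%t. f (pi - t)) (%t. - q (pi - t))"
proof -
 note s = assms[unfolded slice_def]
 have m: "f \<in> bm borel" "q \<in> bm borel" using s by auto
 have q2: "sint {0..pi} (%t. (q t)^2)" using s by blast
 have 1: "AE t\<in>{0<..<ka} in lborel. f t = (LBINT s:{0..t}. q s)"
  and 2: "AE t\<in>{ka<..<pi} in lborel. f t = - (LBINT s:{t..pi}. q s)" using s by blast+
 have n: "(LBINT s:{a..b}. - q (pi - s)) = - (LBINT s:{pi - b..pi - a}. q s)" for a b
  using set_integral_reflect(1)[of a b q pi] by (simp add: LBINT_def)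
 show ?thesis
  unfolding slice_def
 proof (intro conjI)
  show "0 <= pi - ka" "pi - ka <= pi" using s by auto
  show "(%t. f (pi - t)) \<in> bm borel" "(%t. - q (pi - t)) \<in> bm borel"
   using m by measurable
  show "sint {0..pi} (%t. (- q (pi - t))^2)"
   using set_integral_reflect(2)[of 0 pi "%t. (q t)^2" pi] q2 by simp
  show "AE t\<in>{0<..<pi - ka} in lborel. f (pi - t) = (LBINT s:{0..t}. - q (pi - s))"
   using AE_reflect[OF 2, of pi] by eventually_elim (auto simp: n)
  show "AE t\<in>{pi - ka<..<pi} in lborel. f (pi - t) = - (LBINT s:{t..pi}. - q (pi - s))"
   using AE_reflect[OF 1, of pi] by eventually_elim (auto simp: n)
 qed
qed

text \<open>Carries the estimates from the primitive of \<open>q\<close> to \<open>f\<close>, which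
  equals it only almost everywhere. The arc of length zero is not an instance of \<open>arc\<close>
  and is treated apart.\<close>

lemma slice_left:
 assumes S: "slice ka f q"
 shows "sint {0..ka} (%t. (f t)^2)"
  and "0 < \<mu> ==> \<mu> * ka <= pi / 2 ==> \<mu>^2 * (LBINT t:{0..ka}. (f t)^2) <= (LBINT t:{0..ka}. (q t)^2)"
  and "\<exists>m. AE t in lborel. t \<in> {0<..<ka} -->
   (f t - m * sin (t / 2))^2 <= (LBINT t:{0..ka}. (q t)^2) - (LBINT t:{0..ka}. (f t)^2) / 4"
proof -
 note s = S[unfolded slice_def]
 have k: "0 <= ka" "ka <= pi" and m: "f \<in> bm borel" "q \<in> bm borel"
  and q2: "sint {0..pi} (%t. (q t)^2)"
  and 1: "AE t\<in>{0<..<ka} in lborel. f t = (LBINT s:{0..t}. q s)" using s by blast+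
 have "sint {0..ka} (%t. (f t)^2) &
  (0 < \<mu> --> \<mu> * ka <= pi / 2 --> \<mu>^2 * (LBINT t:{0..ka}. (f t)^2) <= (LBINT t:{0..ka}. (q t)^2)) &
  (\<exists>m. AE t in lborel. t \<in> {0<..<ka} -->
   (f t - m * sin (t / 2))^2 <= (LBINT t:{0..ka}. (q t)^2) - (LBINT t:{0..ka}. (f t)^2) / 4)"
 proof (cases "ka = 0")
  case True
  have z: "AE t in lborel. ind {0::real} t *R h t = 0" for h :: "real => real"
   using AE_lborel_singleton[of 0] by eventually_elim auto
  have "integrable lborel (%t. ind {0::real} t *R (f t)^2)"
   using m by (subst integrable_cong_AE[OF _ _ z]) auto
  moreover have "(LBINT t:{0::real}. h t) = 0" if "h \<in> bm borel" for h :: "real => real"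
   unfolding LBINT_def using that by (subst integral_cong_AE[OF _ _ z]) auto
  ultimately show ?thesis using True m by (auto simp: sintegrable_def)
 next
  case False
  define F where "F t = (LBINT s:{0..t}. q s)" for t
  have q2': "sint {0..ka} (%t. (q t)^2)" using k by (intro set_integrable_subset[OF q2]) auto
  interpret arc ka F q
  proof
   have F0: "F 0 = 0" unfolding F_def LBINT_def
   proof (rule integral_eq_zero_AE)
    show "AE t in lborel. ind {0..0::real} t *R q t = 0"
     using AE_lborel_singleton[of 0] by eventually_elim auto
   qed
   then show "F 0 = 0" .
   show "ac 0 ka F q" unfolding ac_def
   proof (intro conjI ballI)
    show "sint {0..ka} q" by (rule set_integrable_of_square[OF m(2) q2'])
    fix t show "F t = F 0 + (LBINT s:{0..t}. q s)" unfolding F0 by (simp add: F_def)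
   qed
  qed (use False k m q2' in auto)
  have cF: "continuous_on {0..ka} F" by (rule ac_continuous[OF F])
  have ae: "AE t\<in>{0<..<ka} in lborel. f t = F t" using 1 by (simp add: F_def)
  have ae2: "AE t in lborel. ind {0..ka} t *R (f t)^2 = ind {0..ka} t *R (F t)^2"
   using ae AE_lborel_singleton[of 0] AE_lborel_singleton[of ka]
   by eventually_elim (auto simp: indicator_def)
  have mF: "(%t. ind {0..ka} t *R (F t)^2) \<in> bm lborel"
   using borel_measurable_integrable[OF F2_int[of 0 ka, unfolded sintegrable_def]] by simp
  have mf: "(%t. ind {0..ka} t *R (f t)^2) \<in> bm lborel" using m by measurable
  have I: "(LBINT t:{0..ka}. (f t)^2) = A" unfolding A_def LBINT_def
   by (rule integral_cong_AE[OF mf mF ae2])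
  have J: "sint {0..ka} (%t. (f t)^2)" unfolding sintegrable_def
   using F2_int[of 0 ka] integrable_cong_AE[OF mf mF ae2] by (simp add: sintegrable_def)
  have "\<exists>m. AE t\<in>{0<..<ka} in lborel. (f t - m * sin (t / 2))^2 <= Q - A / 4"
  proof (intro exI[of _ "F ka / sin (ka / 2)"])
   show "AE t\<in>{0<..<ka} in lborel. (f t - F ka / sin (ka / 2) * sin (t / 2))^2 <= Q - A / 4"
    using ae
   proof eventually_elim
    case (elim t)
    then show ?case using close_to_ground_state[OF \<open>ka <= pi\<close>, of t] by auto
   qed
  qed
  then show ?thesis using J Wirtinger unfolding I Q_def by auto
 qed
 then show "sint {0..ka} (%t. (f t)^2)"
  and "0 < \<mu> ==> \<mu> * ka <= pi / 2 ==> \<mu>^2 * (LBINT t:{0..ka}. (f t)^2) <= (LBINT t:{0..ka}. (q t)^2)"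
  and "\<exists>m. AE t in lborel. t \<in> {0<..<ka} -->
   (f t - m * sin (t / 2))^2 <= (LBINT t:{0..ka}. (q t)^2) - (LBINT t:{0..ka}. (f t)^2) / 4" by blast+
qed

lemma slice_right:
 assumes S: "slice ka f q"
 shows "sint {ka..pi} (%t. (f t)^2)"
  and "0 < \<mu> ==> \<mu> * (pi - ka) <= pi / 2 ==> \<mu>^2 * (LBINT t:{ka..pi}. (f t)^2) <= (LBINT t:{ka..pi}. (q t)^2)"
proof -
 have e: "(LBINT t:{0..pi - ka}. (f (pi - t))^2) = (LBINT t:{ka..pi}. (f t)^2)"
  "(LBINT t:{0..pi - ka}. (- q (pi - t))^2) = (LBINT t:{ka..pi}. (q t)^2)"
  using set_integral_reflect(1)[of 0 "pi - ka" "%t. (f t)^2" pi] set_integral_reflect(1)[of 0 "pi - ka" "%t. (q t)^2" pi] by simp_all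
 show "sint {ka..pi} (%t. (f t)^2)"
  using slice_left(1)[OF slice_reflect[OF S]] set_integral_reflect(2)[of 0 "pi - ka" "%t. (f t)^2" pi] by simp
 show "0 < \<mu> ==> \<mu> * (pi - ka) <= pi / 2 ==> \<mu>^2 * (LBINT t:{ka..pi}. (f t)^2) <= (LBINT t:{ka..pi}. (q t)^2)"
  using slice_left(2)[OF slice_reflect[OF S], of \<mu>] unfolding e by blast
qed

text \<open>The factor 4 is the inverse of \<open>(1/2)^2\<close>: both arcs have length at most pi,
  so \<open>\<mu> = 1/2\<close> is allowed on each.\<close>

lemma slice_total:
 assumes S: "slice ka f q"
 shows "sint {0..pi} (%t. (f t)^2)"
  and "(LBINT t:{0..pi}. (f t)^2) = (LBINT t:{0..ka}. (f t)^2) + (LBINT t:{ka..pi}. (f t)^2)"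
  and "(LBINT t:{0..pi}. (q t)^2) = (LBINT t:{0..ka}. (q t)^2) + (LBINT t:{ka..pi}. (q t)^2)"
  and "(LBINT t:{0..pi}. (f t)^2) <= 4 * (LBINT t:{0..pi}. (q t)^2)"
proof -
 have k: "0 <= ka" "ka <= pi" and q2: "sint {0..pi} (%t. (q t)^2)" using S by (auto simp: slice_def)
 have "sint ({0..ka} Un {ka..pi}) (%t. (f t)^2)"
  by (rule set_integrable_Un[OF slice_left(1)[OF S] slice_right(1)[OF S]]) auto
 then show f2: "sint {0..pi} (%t. (f t)^2)" using k by (simp add: ivl_disj_un_two_touch)
 show a: "(LBINT t:{0..pi}. (f t)^2) = (LBINT t:{0..ka}. (f t)^2) + (LBINT t:{ka..pi}. (f t)^2)"
  by (rule set_integral_split[OF f2 k])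
 show b: "(LBINT t:{0..pi}. (q t)^2) = (LBINT t:{0..ka}. (q t)^2) + (LBINT t:{ka..pi}. (q t)^2)"
  by (rule set_integral_split[OF q2 k])
 have "(1/2)^2 * (LBINT t:{0..ka}. (f t)^2) <= (LBINT t:{0..ka}. (q t)^2)"
  by (rule slice_left(2)[OF S]) (use k in auto)
 moreover have "(1/2)^2 * (LBINT t:{ka..pi}. (f t)^2) <= (LBINT t:{ka..pi}. (q t)^2)"
  by (rule slice_right(2)[OF S]) (use k in auto)
 ultimately show "(LBINT t:{0..pi}. (f t)^2) <= 4 * (LBINT t:{0..pi}. (q t)^2)"
  unfolding a b by (simp add: power2_eq_square)
qed

text \<open>The short arc has length below \<open>pi / 2\<close>, hence eigenvalue at least 1, and
  the deficit leaves it only mass \<open>4 * \<gamma> / 3\<close>. Nearly all mass sits on the long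
  arc, where \<open>f\<close> follows a multiple \<open>m\<close> of the ground state; the mass then
  forces a lower bound for \<open>m^2\<close>.\<close>

lemma slice_profile_left:
 assumes S: "slice ka f q" and kb: "ka > pi - \<eta>" "\<eta> <= pi / 2"
  and l: "\<gamma> <= l / 16" "(LBINT t:{0..pi}. (f t)^2) >= l"
  and def: "(LBINT t:{0..pi}. (q t)^2) - (LBINT t:{0..pi}. (f t)^2) / 4 <= \<gamma>"
 shows "\<exists>m. m^2 >= l / (4 * pi) & (AE t\<in>{0<..<pi - \<eta>} in lborel. (f t - m * sin (t / 2))^2 <= \<gamma>)"
proof -
 define A1 A2 G1 G2 where "A1 = (LBINT t:{0..ka}. (f t)^2)" and "A2 = (LBINT t:{ka..pi}. (f t)^2)"
  and "G1 = (LBINT t:{0..ka}. (q t)^2)" and "G2 = (LBINT t:{ka..pi}. (q t)^2)"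
 have k: "0 <= ka" "ka <= pi" using S by (auto simp: slice_def)
 have w1: "(1/2)^2 * A1 <= G1" unfolding A1_def G1_def by (rule slice_left(2)[OF S]) (use k in auto)
 have w2: "1^2 * A2 <= G2" unfolding A2_def G2_def by (rule slice_right(2)[OF S]) (use kb in auto)
 have A: "A1 >= 0" "A2 >= 0" by (auto simp: A1_def A2_def LBINT_def)
 have tot: "G1 + G2 - (A1 + A2) / 4 <= \<gamma>" "A1 + A2 >= l"
  using def l slice_total(2,3)[OF S] by (simp_all add: A1_def A2_def G1_def G2_def)
 have d1: "G1 - A1 / 4 <= \<gamma>" and A2: "A2 <= 4 * \<gamma> / 3" and g0: "\<gamma> >= 0"
 proof -
  have "A1 / 4 <= G1" "A2 <= G2" using w1 w2 by (simp_all add: power2_eq_square)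
  then show "G1 - A1 / 4 <= \<gamma>" "A2 <= 4 * \<gamma> / 3" "\<gamma> >= 0" using tot A by argo+
 qed
 obtain m where m: "AE t\<in>{0<..<ka} in lborel. (f t - m * sin (t / 2))^2 <= G1 - A1 / 4"
  using slice_left(3)[OF S] unfolding A1_def G1_def by blast
 have "A1 <= (LBINT t:{0..ka}. 2 * m^2 + 2 * \<gamma>)"
  unfolding A1_def LBINT_def
 proof (rule integral_mono_AE)
  show "integrable lborel (%t. ind {0..ka} t *R (f t)^2)" using slice_left(1)[OF S] by (simp add: sintegrable_def)
  show "integrable lborel (%t. ind {0..ka} t *R (2 * m^2 + 2 * \<gamma>))"
   using set_integrable_const_Icc by (simp add: sintegrable_def)
  show "AE t in lborel. ind {0..ka} t *R (f t)^2 <= ind {0..ka} t *R (2 * m^2 + 2 * \<gamma>)"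
   using m AE_lborel_singleton[of 0] AE_lborel_singleton[of ka]
  proof eventually_elim
   case (elim t)
   show ?case
   proof (cases "t \<in> {0..ka}")
    case True
    then have "(f t - m * sin (t / 2))^2 <= \<gamma>" using elim d1 by auto
    moreover have "(m * sin (t / 2))^2 <= m^2 * 1"
     unfolding power_mult_distrib by (intro mult_left_mono) (auto simp: abs_square_le_1)
    moreover have "(f t)^2 <= 2 * (f t - m * sin (t / 2))^2 + 2 * (m * sin (t / 2))^2"
     using norm_add_sq_le[of "f t - m * sin (t / 2)" "m * sin (t / 2)"] by simp
    ultimately show ?thesis using True by simp
   qed simp
  qed
 qed
 also have "... = ka * (2 * m^2 + 2 * \<gamma>)" using k by (simp add: set_integral_const)
 also have "... <= pi * (2 * m^2 + 2 * \<gamma>)" using k g0 by (intro mult_right_mono) auto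
 finally have "l <= pi * (2 * m^2 + 2 * \<gamma>) + 4 * \<gamma> / 3" using tot A2 by linarith
 moreover have "pi * \<gamma> <= 3.2 * \<gamma>" using g0 pi_approx by (intro mult_right_mono) auto
 ultimately have "l / 2 <= 2 * pi * m^2" using l(1) g0 by (simp add: algebra_simps)
 then have "l / (4 * pi) <= m^2" by (simp add: field_simps)
 moreover have "AE t\<in>{0<..<pi - \<eta>} in lborel. (f t - m * sin (t / 2))^2 <= \<gamma>"
  using m by eventually_elim (use kb d1 in auto)
 ultimately show ?thesis by blast
qed

text \<open>If \<open>K\<close> crosses near an end of the half circle, the previous lemma applies,
  directly or after reflection. A crossing in between is impossible, because then both arcs have an
  eigenvalue that exceeds 1/4 by too much for the deficit.\<close>

lemma slice_profile:
 assumes S: "slice ka f q" and e: "0 < \<eta>" "\<eta> <= pi / 2"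
  and l: "0 < l" "\<gamma> <= l / 16" "\<gamma> < \<eta> * l / (2 * pi)" "(LBINT t:{0..pi}. (f t)^2) >= l"
  and def: "(LBINT t:{0..pi}. (q t)^2) - (LBINT t:{0..pi}. (f t)^2) / 4 <= \<gamma>"
 shows "(ka > pi - \<eta> & (\<exists>m. m^2 >= l / (4 * pi) & (AE t\<in>{0<..<pi - \<eta>} in lborel. (f t - m * sin (t / 2))^2 <= \<gamma>))) \<or>
  (ka < \<eta> & (\<exists>m. m^2 >= l / (4 * pi) & (AE t\<in>{\<eta><..<pi} in lborel. (f t - m * cos (t / 2))^2 <= \<gamma>)))"
proof -
 have k: "0 <= ka" "ka <= pi" using S by (auto simp: slice_def)
 consider "ka > pi - \<eta>" | "ka < \<eta>" | "\<eta> <= ka" "ka <= pi - \<eta>" by linarith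
 then show ?thesis
 proof cases
  case 1
  then show ?thesis using slice_profile_left[OF S 1 e(2) l(2,4) def] by blast
 next
  case 2
  have "\<exists>m. m^2 >= l / (4 * pi) & (AE t\<in>{0<..<pi - \<eta>} in lborel. (f (pi - t) - m * sin (t / 2))^2 <= \<gamma>)"
  proof (rule slice_profile_left[OF slice_reflect[OF S] _ e(2) l(2)])
   show "pi - \<eta> < pi - ka" using 2 by simp
   have r: "(LBINT t:{0..pi}. (f (pi - t))^2) = (LBINT t:{0..pi}. (f t)^2)"
    "(LBINT t:{0..pi}. (- q (pi - t))^2) = (LBINT t:{0..pi}. (q t)^2)"
    using set_integral_reflect(1)[of 0 pi "%t. (f t)^2" pi] set_integral_reflect(1)[of 0 pi "%t. (q t)^2" pi] by simp_all
   show "l <= (LBINT t:{0..pi}. (f (pi - t))^2)" unfolding r by (rule l(4))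
   show "(LBINT t:{0..pi}. (- q (pi - t))^2) - (LBINT t:{0..pi}. (f (pi - t))^2) / 4 <= \<gamma>"
    unfolding r by (rule def)
  qed
  then obtain m where m: "m^2 >= l / (4 * pi)" "AE t\<in>{0<..<pi - \<eta>} in lborel. (f (pi - t) - m * sin (t / 2))^2 <= \<gamma>"
   by blast
  have sc: "sin ((pi - t) / 2) = cos (t / 2)" for t :: real
   by (simp add: diff_divide_distrib sin_diff)
  then have "AE t\<in>{\<eta><..<pi} in lborel. (f t - m * cos (t / 2))^2 <= \<gamma>"
   using AE_reflect[OF m(2), of pi] by eventually_elim (auto simp: sc)
  then show ?thesis using 2 m(1) by blast
 next
  case 3
  \<comment> \<open>The square root of the first eigenvalue of an arc of length
    \<open>pi - \<eta>\<close>. Below it is shown that \<open>\<mu>^2\<close> exceeds 1/4 by at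
    least \<open>\<eta> / (2 * pi)\<close>, which explains the assumption
    \<open>\<gamma> < \<eta> * l / (2 * pi)\<close>.\<close>
  define \<mu> where "\<mu> = (pi / 2) / (pi - \<eta>)"
  have pe: "pi - \<eta> > 0" using e pi_gt_zero by linarith
  have gen: "(pi / 2) / b * b = pi / 2" "((pi / 2) / b)^2 - 1/4 = (pi^2 - b^2) / (4 * b^2)"
   if "b > 0" for b :: real
   using that by (simp_all add: power_divide diff_divide_distrib)
  have mu: "\<mu> > 0" "\<mu> * (pi - \<eta>) = pi / 2" using pe gen(1)[OF pe] by (simp_all only: \<mu>_def) simp
  have "\<mu> * ka <= \<mu> * (pi - \<eta>)" "\<mu> * (pi - ka) <= \<mu> * (pi - \<eta>)" using 3 mu(1) by (auto intro!: mult_left_mono)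
  then have "\<mu>^2 * (LBINT t:{0..pi}. (f t)^2) <= (LBINT t:{0..pi}. (q t)^2)"
   using slice_left(2)[OF S mu(1)] slice_right(2)[OF S mu(1)] mu(2) unfolding slice_total(2,3)[OF S]
   by (simp add: distrib_left)
  then have b: "(\<mu>^2 - 1/4) * (LBINT t:{0..pi}. (f t)^2) <= \<gamma>" using def by (simp add: algebra_simps)
  have "\<mu>^2 - 1/4 >= \<eta> / (2 * pi)"
  proof -
   have "pi^2 - (pi - \<eta>)^2 = \<eta> * (2 * pi - \<eta>)" by (simp add: power2_eq_square algebra_simps)
   moreover have "\<mu>^2 - 1/4 = (pi^2 - (pi - \<eta>)^2) / (4 * (pi - \<eta>)^2)"
    unfolding \<mu>_def by (rule gen(2)[OF pe])
   ultimately have m4: "\<mu>^2 - 1/4 = \<eta> * (2 * pi - \<eta>) / (4 * (pi - \<eta>)^2)" by simp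
   have "\<eta> / (2 * pi) * (4 * (pi - \<eta>)^2) <= \<eta> * (2 * pi - \<eta>)"
   proof -
    have "4 * (pi - \<eta>)^2 <= 2 * pi * (2 * pi - \<eta>)"
    proof -
     have "2 * pi * (2 * pi - \<eta>) - 4 * (pi - \<eta>)^2 = \<eta> * (6 * pi - 4 * \<eta>)" by (simp add: power2_eq_square algebra_simps)
     moreover have "\<eta> * (6 * pi - 4 * \<eta>) >= 0" using e pi_gt_zero by (intro mult_nonneg_nonneg) linarith+
     ultimately show ?thesis by linarith
    qed
    then have "\<eta> / (2 * pi) * (4 * (pi - \<eta>)^2) <= \<eta> / (2 * pi) * (2 * pi * (2 * pi - \<eta>))"
     using e by (intro mult_left_mono) auto
    then show ?thesis by simp
   qed
   then show ?thesis unfolding m4 using pe by (simp add: pos_le_divide_eq)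
  qed
  then have "\<eta> / (2 * pi) * l <= (\<mu>^2 - 1/4) * (LBINT t:{0..pi}. (f t)^2)"
  proof (intro mult_mono)
   have "0 <= \<eta> / (2 * pi)" using e by simp
   then show "0 <= \<mu>^2 - 1/4" using \<open>\<mu>^2 - 1/4 >= \<eta> / (2 * pi)\<close> by linarith
  qed (use l(1,4) in auto)
  then show ?thesis using b l(3) by simp
 qed
qed

section \<open>Integration in polar coordinates\<close>

text \<open>Identifies pairs with \<open>real^2\<close>: Fubini works on pairs, the change of
  variables formula on \<open>real^2\<close>.\<close>

definition vec2 :: "real \<times> real => real^2" where
 "vec2 p = fst p *R axis 1 1 + snd p *R axis 2 1"

lemma vec2_nth [simp]: "vec2 p $ 1 = fst p" "vec2 p $ 2 = snd p"
 by (simp_all add: vec2_def axis_def)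

lemma continuous_vec2: "continuous_on UNIV vec2"
 unfolding vec2_def[abs_def] by (intro continuous_intros)

lemma measurable_vec2 [measurable]: "vec2 \<in> bm lborel2"
proof -
 have "vec2 \<in> bm borel" by (rule borel_measurable_continuous_onI[OF continuous_vec2])
 then show ?thesis by (subst measurable_cong_sets[OF sets_lborel_pair refl])
qed

lemma lborel_vec2: "(lborel :: (real^2) measure) = distr lborel2 borel vec2"
proof (rule lborel_eqI)
 fix l u :: "real^2" assume lu: "!!b. b \<in> Basis ==> l \<bullet> b <= u \<bullet> b"
 have B: "(Basis :: (real^2) set) = {axis 1 1, axis 2 1}" by (auto simp: Basis_vec_def UNIV_2)
 have ne: "(axis 1 1 :: real^2) ~= axis 2 1" by (simp add: axis_eq_axis)
 have le: "l $ 1 <= u $ 1" "l $ 2 <= u $ 2"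
  using lu[of "axis 1 1"] lu[of "axis 2 1"] by (auto simp: B cart_eq_inner_axis)
 have "vec2 -` box l u Int space lborel2 = {l $ 1<..<u $ 1} \<times> {l $ 2<..<u $ 2}"
  by (auto simp: mem_box_cart forall_2 space_pair_measure)
 then have "emeasure (distr lborel2 borel vec2) (box l u) = emeasure lborel2 ({l $ 1<..<u $ 1} \<times> {l $ 2<..<u $ 2})"
  by (simp add: emeasure_distr)
 also have "... = ennreal (u $ 1 - l $ 1) * ennreal (u $ 2 - l $ 2)"
  using le by (subst lborel.emeasure_pair_measure_Times) auto
 also have "... = ennreal ((u $ 1 - l $ 1) * (u $ 2 - l $ 2))" using le by (simp add: ennreal_mult)
 also have "(u $ 1 - l $ 1) * (u $ 2 - l $ 2) = (\<Prod>b\<in>Basis. (u - l) \<bullet> b)"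
  unfolding B using ne by (simp add: cart_eq_inner_axis[symmetric])
 finally show "emeasure (distr lborel2 borel vec2) (box l u) = ennreal (\<Prod>b\<in>Basis. (u - l) \<bullet> b)" .
qed simp

definition polp :: "real^2 => real \<times> real => real^2" where "polp x p = pol x (fst p) (snd p)"

lemma continuous_polp: "continuous_on UNIV (polp x)"
 unfolding polp_def[abs_def] by (intro continuous_intros)

lemma measurable_polp [measurable]: "polp x \<in> bm lborel2"
proof -
 have "polp x \<in> bm borel" by (rule borel_measurable_continuous_onI[OF continuous_polp])
 then show ?thesis by (subst measurable_cong_sets[OF sets_lborel_pair refl])
qed

definition strip :: "(real \<times> real) set" where "strip = {0<..} \<times> {0<..<pi}"

lemma strip_sets [measurable]: "strip \<in> sets lborel2"
 unfolding strip_def by (intro pair_measureI) auto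

definition polar_measure :: "(real \<times> real) measure" where
 "polar_measure = density lborel2 (%p. ennreal (fst p) * ind strip p)"

definition half_plane :: "(real^2) set" where "half_plane = {y. y $ 2 > 0}"

lemma half_plane_sets [measurable]: "half_plane \<in> sets borel"
 unfolding half_plane_def using open_halfspace_component_gt_cart by (rule borel_open)

lemma polar_bij:
 assumes x: "x $ 2 = 0"
 shows "inj_on (%z::real^2. pol x (z $ 1) (z $ 2)) {z::real^2. 0 < z $ 1 & 0 < z $ 2 & z $ 2 < pi}"
  and "(%z::real^2. pol x (z $ 1) (z $ 2)) ` {z::real^2. 0 < z $ 1 & 0 < z $ 2 & z $ 2 < pi} = half_plane"
proof -
 show "inj_on (%z::real^2. pol x (z $ 1) (z $ 2)) {z::real^2. 0 < z $ 1 & 0 < z $ 2 & z $ 2 < pi}"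
 proof (rule inj_onI)
  fix z z' :: "real^2" assume a: "z \<in> {z::real^2. 0 < z $ 1 & 0 < z $ 2 & z $ 2 < pi}" "z' \<in> {z::real^2. 0 < z $ 1 & 0 < z $ 2 & z $ 2 < pi}"
   and e: "pol x (z $ 1) (z $ 2) = pol x (z' $ 1) (z' $ 2)"
  have "dist x (pol x (z $ 1) (z $ 2)) = dist x (pol x (z' $ 1) (z' $ 2))" using e by simp
  then have 1: "z $ 1 = z' $ 1" using a by (simp add: dist_pol)
  then have "z $ 2 = z' $ 2" using e a by (intro pol_inj[of x "z $ 1"]) auto
  then show "z = z'" using 1 by (simp add: vec_eq_iff forall_2)
 qed
 show "(%z::real^2. pol x (z $ 1) (z $ 2)) ` {z::real^2. 0 < z $ 1 & 0 < z $ 2 & z $ 2 < pi} = half_plane"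
 proof (intro set_eqI iffI)
  fix y assume "y \<in> (%z::real^2. pol x (z $ 1) (z $ 2)) ` {z::real^2. 0 < z $ 1 & 0 < z $ 2 & z $ 2 < pi}"
  then show "y \<in> half_plane" using x by (auto simp: half_plane_def sin_gt_zero)
 next
  fix y assume y: "y \<in> half_plane"
  obtain t where t: "- pi <= t" "t < - pi + 2 * pi" "y = pol x (dist x y) t" using pol_surj[of x y "dist x y" "- pi"] by auto
  have r: "dist x y > 0" using y x by (auto simp: half_plane_def)
  have "dist x y * sin t > 0" using y x t(3) by (metis (mono_tags) add_0 half_plane_def mem_Collect_eq pol_nth(2))
  then have s: "sin t > 0" using r by (simp add: zero_less_mult_iff)
  have "t > 0"
  proof (rule ccontr)
   assume "\<not> t > 0"
   then have "sin (- t) >= 0" using t by (intro sin_ge_zero) auto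
   then show False using s by simp
  qed
  then show "y \<in> (%z::real^2. pol x (z $ 1) (z $ 2)) ` {z::real^2. 0 < z $ 1 & 0 < z $ 2 & z $ 2 < pi}"
   using t r by (intro image_eqI[of _ _ "vec2 (dist x y, t)"]) auto
 qed
qed

text \<open>The change of variables formula for an injective differentiable map with Jacobian
  determinant \<open>z $ 1\<close>. Boundedness of \<open>A\<close> makes the parameter set
  \<open>T\<close> bounded, so that the measures involved are finite real numbers.\<close>

lemma polar_measure_box:
 assumes x: "x $ 2 = 0" and A: "A \<in> sets borel" "bounded A"
 shows "emeasure lborel (half_plane Int A) = emeasure (distr polar_measure borel (polp x)) A"
proof -
 define S where "S = {z::real^2. 0 < z $ 1 & 0 < z $ 2 & z $ 2 < pi}"
 define \<psi> where "\<psi> z = pol x (z $ 1) (z $ 2)" for z :: "real^2"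
 define \<psi>' where "\<psi>' z h = (h $ 1 * cos (z $ 2) - h $ 2 * (z $ 1 * sin (z $ 2))) *R axis 1 1 + (h $ 1 * sin (z $ 2) + h $ 2 * (z $ 1 * cos (z $ 2))) *R (axis 2 1 :: real^2)" for z h :: "real^2"
 have pol_alt: "pol x r t = x + (r * cos t) *R axis 1 1 + (r * sin t) *R axis 2 1" for r t
  by (simp add: vec_eq_iff forall_2 axis_def)
 have nthd: "((%z::real^2. z $ i) has_derivative (%h. h $ i)) F" for i F
  by (rule bounded_linear_imp_has_derivative[OF bounded_linear_vec_nth])
 have der: "(\<psi> has_derivative \<psi>' z) (at z within T)" for z T
  unfolding \<psi>_def[abs_def] pol_alt \<psi>'_def[abs_def]
  by (auto intro!: derivative_eq_intros nthd simp: fun_eq_iff algebra_simps)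
 have det: "\<bar>det (matrix (\<psi>' z))\<bar> = z $ 1" if "z \<in> S" for z
 proof -
  have "det (matrix (\<psi>' z)) = cos (z $ 2) * (z $ 1 * cos (z $ 2)) + z $ 1 * sin (z $ 2) * sin (z $ 2)"
   by (simp add: det_2 matrix_def \<psi>'_def axis_def)
  also have "... = z $ 1 * ((cos (z $ 2))^2 + (sin (z $ 2))^2)" by algebra
  finally show ?thesis using that by (simp add: S_def)
 qed
 have c\<psi>: "continuous_on UNIV \<psi>" unfolding \<psi>_def[abs_def] by (intro continuous_intros)
 have mS: "S \<in> sets borel"
 proof -
  have "S = {z. 0 < z $ 1} Int {z. 0 < z $ 2} Int {z. z $ 2 < pi}" by (auto simp: S_def)
  moreover have "open ({z::real^2. 0 < z $ 1} Int {z. 0 < z $ 2} Int {z. z $ 2 < pi})"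
   by (intro open_Int open_halfspace_component_gt_cart open_halfspace_component_lt_cart)
  ultimately show ?thesis by (simp add: borel_open)
 qed
 define T where "T = S Int \<psi> -` A"
 have mT: "T \<in> sets borel"
  using mS measurable_sets[OF borel_measurable_continuous_onI[OF c\<psi>] A(1)] by (auto simp: T_def)
 obtain B where B: "A <= ball x B" "B > 0" using bounded_subset_ballD[OF A(2), of x] by auto
 have Tb: "z $ 1 <= B" if "z \<in> T" for z
 proof -
  have "\<psi> z \<in> ball x B" using that B by (auto simp: T_def)
  then show ?thesis using that by (simp add: T_def S_def \<psi>_def dist_pol)
 qed
 have Tsub: "T <= cbox (vec2 (0, 0)) (vec2 (B, pi))" using Tb by (auto simp: mem_box_cart forall_2 T_def S_def intro: less_imp_le)
 have img: "\<psi> ` T = half_plane Int A"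
 proof -
  have "\<psi> ` S = half_plane" using polar_bij(2)[OF x] unfolding S_def \<psi>_def[abs_def] .
  moreover have "\<psi> ` (S Int \<psi> -` A) = \<psi> ` S Int A" by auto
  ultimately show ?thesis unfolding T_def by simp
 qed
 have inj: "inj_on \<psi> T"
  by (rule inj_on_subset[of _ S]) (use polar_bij(1)[OF x] in "simp_all add: T_def S_def \<psi>_def[abs_def]")
 have Tlm: "T \<in> lmeasurable" using Tsub mT by (intro bounded_set_imp_lmeasurable) (auto intro: bounded_subset[OF bounded_cbox])
 have Tm: "(%z. ind T z *R z $ 1) \<in> bm borel"
  using mT by (intro borel_measurable_scaleR borel_measurable_indicator borel_measurable_continuous_onI continuous_intros)
 have int: "integrable lebesgue (%z. ind T z *R z $ 1)"
 proof (rule bochner_bound)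
  show "integrable lebesgue (%z. B * ind T z :: real)"
   using Tlm by (intro integrable_mult_right integrable_real_indicator) (auto simp: fmeasurable_def)
  show "(%z. ind T z *R z $ 1) \<in> bm lebesgue"
   using Tm by (intro measurable_completion) simp
  show "AE z in lebesgue. norm (ind T z *R z $ 1) <= norm (B * ind T z :: real)"
   using Tb B by (intro AE_I2) (auto simp: indicator_def T_def S_def)
 qed
 have int2: "(%z. \<bar>det (matrix (\<psi>' z))\<bar>) absolutely_integrable_on T"
  using int unfolding sintegrable_def
  by (elim back_subst[of "integrable lebesgue"]) (use det in "auto simp: fun_eq_iff indicator_def T_def")
 have TL: "T \<in> sets lebesgue" using mT by auto
 have lm: "\<psi> ` T \<in> lmeasurable"
  by (rule measurable_differentiable_image[OF TL der]) (use int2 in "auto simp: set_lebesgue_integral_eq_integral(1)")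
 have "measure lebesgue (\<psi> ` T) = integral T (%z. \<bar>det (matrix (\<psi>' z))\<bar>)"
  by (rule measure_differentiable_image_eq[OF TL der inj]) (use int2 in "auto simp: set_lebesgue_integral_eq_integral(1)")
 also have "... = (LINT z:T|lebesgue. \<bar>det (matrix (\<psi>' z))\<bar>)"
  using set_lebesgue_integral_eq_integral(2)[OF int2] by simp
 also have "... = (LINT z|lebesgue. ind T z *R z $ 1)"
  unfolding LBINT_def
  by (rule bochner_cong) (use det in "auto simp: indicator_def T_def")
 finally have m: "measure lebesgue (\<psi> ` T) = (LINT z|lebesgue. ind T z *R z $ 1)" .
 have "emeasure lborel (half_plane Int A) = emeasure lebesgue (\<psi> ` T)"
  unfolding img using A by (subst emeasure_completion) auto
 also have "... = ennreal (measure lebesgue (\<psi> ` T))" using lm by (simp add: emeasure_eq_measure2)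
 also have "... = (\<integral>\<^sup>+ z. ennreal (ind T z *R z $ 1) \<partial>lebesgue)"
  unfolding m by (rule nn_integral_eq_integral[OF int, symmetric]) (auto simp: indicator_def T_def S_def)
 also have "... = (NN z. ennreal (ind T z *R z $ 1))" by (rule nn_integral_completion)
 also have "... = (NP p. ennreal (ind T (vec2 p) *R vec2 p $ 1))"
 proof -
  show ?thesis unfolding lborel_vec2
   by (rule nn_integral_distr[OF measurable_vec2]) (use Tm in simp)
 qed
 also have "... = (NP p. (ennreal (fst p) * ind strip p) * ind (polp x -` A) p)"
  by (rule nn_integral_cong) (auto simp: indicator_def T_def S_def strip_def polp_def \<psi>_def)
 also have "... = emeasure polar_measure (polp x -` A Int space lborel2)"
 proof -
  have "polp x -` A Int space lborel2 \<in> sets lborel2"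
   by (rule measurable_sets[OF measurable_polp A(1)])
  then show ?thesis unfolding polar_measure_def
   by (subst emeasure_density) (auto simp: space_pair_measure)
 qed
 also have "... = emeasure (distr polar_measure borel (polp x)) A"
  using A by (subst emeasure_distr) (auto simp: polar_measure_def)
 finally show ?thesis .
qed

text \<open>Both measures agree on boxes, which generate the Borel sets and exhaust the plane. With
  \<open>x\<close> on the axis the half plane corresponds to the angles in \<open>(0, pi)\<close>,
  so no branch cut of the angle enters.\<close>

theorem polar_coordinates:
 assumes x: "x $ 2 = 0"
 shows "density lborel (ind half_plane) = distr polar_measure borel (polp x)"
proof (rule measure_eqI_generator_eq)
 let ?E = "range (%(a, b). box a b :: (real^2) set)"
 let ?A = "%n::nat. box (- (real n *R One)) (real n *R One) :: (real^2) set"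
 show "Int_stable ?E" by (auto simp: Int_stable_def box_Int_box)
 show "?E <= Pow UNIV" "sets (density lborel (ind half_plane)) = sigma_sets UNIV ?E"
  "sets (distr polar_measure borel (polp x)) = sigma_sets UNIV ?E"
  by (simp_all add: borel_eq_box)
 show "range ?A <= ?E" "(\<Union>i. ?A i) = UNIV" unfolding UN_box_eq_UNIV by auto
 have e: "emeasure (density lborel (ind half_plane)) A = emeasure lborel (half_plane Int A)" if "A \<in> sets borel" for A
  using that by (subst emeasure_density) (auto simp: indicator_inter_arith[symmetric])
 show "emeasure (density lborel (ind half_plane)) (?A i) ~= \<infinity>" for i
 proof -
  have "emeasure (density lborel (ind half_plane)) (?A i) <= emeasure lborel (?A i)"
   by (subst e, simp, rule emeasure_mono) auto
  also have "... < \<infinity>" by (rule emeasure_bounded_finite) (rule bounded_box)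
  finally show ?thesis by simp
 qed
 show "emeasure (density lborel (ind half_plane)) X = emeasure (distr polar_measure borel (polp x)) X" if X: "X \<in> ?E" for X
 proof -
  have "X \<in> sets borel" "bounded X" using X by auto
  then show ?thesis using polar_measure_box[OF x] e by simp
 qed
qed

lemma nn_integral_polar:
 assumes x: "x $ 2 = 0" and f: "f \<in> bm borel"
 shows "(NN y. f y * ind half_plane y) = (NP p. (ennreal (fst p) * ind strip p) * f (polp x p))"
proof -
 have "(NN y. f y * ind half_plane y) = (\<integral>\<^sup>+ y. f y \<partial>density lborel (ind half_plane))"
  using f by (subst nn_integral_density) (auto simp: mult.commute)
 also have "... = (\<integral>\<^sup>+ p. f (polp x p) \<partial>polar_measure)"
  unfolding polar_coordinates[OF x] using f by (subst nn_integral_distr) (auto simp: polar_measure_def)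
 also have "... = (NP p. (ennreal (fst p) * ind strip p) * f (polp x p))"
  unfolding polar_measure_def using f by (subst nn_integral_density) auto
 finally show ?thesis .
qed

lemma integral_polar:
 fixes f :: "real^2 => real"
 assumes x: "x $ 2 = 0" and f: "f \<in> bm borel"
 shows "(LBINT y. ind half_plane y *R f y) = (LINT p|lborel2. ind strip p *R (fst p * f (polp x p)))"
  and "integrable lborel (%y. ind half_plane y *R f y) \<longleftrightarrow> integrable lborel2 (%p. ind strip p *R (fst p * f (polp x p)))"
proof -
 have d1: "density lborel (ind half_plane) = density lborel (%y. ennreal (ind half_plane y))"
  by (rule arg_cong[of _ _ "density lborel"]) (auto simp: fun_eq_iff indicator_def)
 have d2: "polar_measure = density lborel2 (%p. ennreal (fst p * ind strip p))"
  unfolding polar_measure_def by (rule arg_cong[of _ _ "density _"]) (auto simp: fun_eq_iff indicator_def)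
 have nn: "AE p in lborel \<Otimes>\<^sub>M lborel. 0 <= fst p * ind strip p" by (auto simp: strip_def indicator_def)
 have m: "(%p. f (polp x p)) \<in> bm lborel2" using f by measurable
 have e: "ind strip p *R (fst p * f (polp x p)) = (fst p * ind strip p) *R f (polp x p)" for p
  by (auto simp: indicator_def)
 show "(LBINT y. ind half_plane y *R f y) = (LINT p|lborel2. ind strip p *R (fst p * f (polp x p)))"
 proof -
  have "(LBINT y. ind half_plane y *R f y) = integral\<^sup>L (density lborel (ind half_plane)) f"
   unfolding d1 using f by (subst integral_density) auto
  also have "... = (LINT p|polar_measure. f (polp x p))"
   unfolding polar_coordinates[OF x] using f by (subst integral_distr) (auto simp: polar_measure_def)
  also have "... = (LINT p|lborel2. (fst p * ind strip p) *R f (polp x p))"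
   unfolding d2 using m nn by (subst integral_density) auto
  finally show ?thesis unfolding e .
 qed
 show "integrable lborel (%y. ind half_plane y *R f y) \<longleftrightarrow> integrable lborel2 (%p. ind strip p *R (fst p * f (polp x p)))"
 proof -
  have "integrable lborel (%y. ind half_plane y *R f y) \<longleftrightarrow> integrable (density lborel (ind half_plane)) f"
   unfolding d1 using f by (subst integrable_density) auto
  also have "... \<longleftrightarrow> integrable polar_measure (%p. f (polp x p))"
   unfolding polar_coordinates[OF x] using f by (subst integrable_distr_eq) (auto simp: polar_measure_def)
  also have "... \<longleftrightarrow> integrable lborel2 (%p. (fst p * ind strip p) *R f (polp x p))"
   unfolding d2 using m nn by (subst integrable_density) auto
  finally show ?thesis unfolding e .
 qed
qed

section \<open>Absolute continuity on lines\<close>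

lemma bump_measurable [measurable]: "bump n a b \<in> bm borel"
 by (rule borel_measurable_continuous_onI) (intro continuous_intros)

lemma bump_abs_le: "\<bar>bump n a b s\<bar> <= 1"
 using bump_bounds[of n a b s] by simp

lemma set_integrable_times_bounded:
 fixes h k :: "real => real"
 assumes "set_integrable M A h" "k \<in> bm M" "!!t. \<bar>k t\<bar> <= B"
 shows "set_integrable M A (%t. k t * h t)"
 unfolding sintegrable_def
proof (rule bochner_bound)
 note i = assms(1)[unfolded sintegrable_def]
 show "integrable M (%t. B * norm (ind A t *R h t))" using i by (intro integrable_mult_right integrable_norm)
 have "(%t. k t * (ind A t *R h t)) \<in> bm M"
  using assms(2) borel_measurable_integrable[OF i] by (rule borel_measurable_times)
 then show "(%t. ind A t *R (k t * h t)) \<in> bm M"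
  by (elim back_subst[of "%f. f \<in> bm M"]) (auto simp: fun_eq_iff)
 have "norm (ind A t *R (k t * h t)) <= norm (B * norm (ind A t *R h t))" for t
 proof -
  have "\<bar>k t\<bar> <= \<bar>B\<bar>" using assms(3)[of t] by simp
  then show ?thesis by (auto simp: indicator_def abs_mult intro: mult_right_mono)
 qed
 then show "AE t in M. norm (ind A t *R (k t * h t)) <= norm (B * norm (ind A t *R h t))" by simp
qed

lemma bump_integral_limit:
 fixes h :: "real => real"
 assumes h: "sint A h"
 shows "(%n. LINT t:A|lborel. bump n a b t * h t) \<longlonglongrightarrow> (LINT t:A|lborel. ind {a<..<b} t * h t)"
 unfolding LBINT_def
proof (rule integral_dominated_convergence)
 note i = h[unfolded sintegrable_def]
 show "integrable lborel (%t. norm (ind A t *R h t))" using i by (rule integrable_norm)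
 show "(%t. ind A t *R (bump n a b t * h t)) \<in> bm lborel" for n
 proof -
  have "sint A (%t. bump n a b t * h t)"
   by (rule set_integrable_times_bounded[OF h, of _ 1]) (auto simp: bump_abs_le)
  then show ?thesis unfolding sintegrable_def by (rule borel_measurable_integrable)
 qed
 show "(%t. ind A t *R (ind {a<..<b} t * h t)) \<in> bm lborel"
 proof -
  have "sint A (%t. ind {a<..<b} t * h t)"
   by (rule set_integrable_times_bounded[OF h, of _ 1]) (auto simp: indicator_def)
  then show ?thesis unfolding sintegrable_def by (rule borel_measurable_integrable)
 qed
 have "norm (ind A t *R (bump n a b t * h t)) <= norm (ind A t *R h t)" for n t
  using bump_bounds[of n a b t] by (auto simp: indicator_def abs_mult mult_left_le_one_le)
 then show "AE t in lborel. norm (ind A t *R (bump n a b t * h t)) <= norm (ind A t *R h t)" for n by simp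
 show "AE t in lborel. (%n. ind A t *R (bump n a b t * h t)) \<longlonglongrightarrow> ind A t *R (ind {a<..<b} t * h t)"
  by (intro AE_I2 tendsto_intros bump_tendsto)
qed

text \<open>Bumps increase to the indicator of an interval, so the primitive of \<open>h\<close>
  takes the same value at all rational points and is constant by continuity. Restricting to rational
  end points keeps the number of tests countable, which is essential when \<open>h\<close> depends
  on a parameter.\<close>

lemma AE_zero_if_bump_integrals_zero:
 fixes h :: "real => real"
 assumes h: "sint {c..d} h"
  and z: "!!n a b. a \<in> \<rat> ==> b \<in> \<rat> ==> c < a ==> a < b ==> b < d ==> (LBINT t:{c..d}. bump n a b t * h t) = 0"
 shows "AE t\<in>{c<..<d} in lborel. h t = 0"
proof (cases "c < d")
 case True
 define H where "H t = (LBINT s:{c..t}. h s)" for t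
 have H0: "H c = 0"
  unfolding H_def LBINT_def
 proof (rule integral_eq_zero_AE)
  show "AE t in lborel. ind {c..c} t *R h t = 0"
   using AE_lborel_singleton[of c] by eventually_elim auto
 qed
 have acH: "ac c d H h"
  unfolding ac_def
 proof (intro conjI ballI h)
  fix t show "H t = H c + (LBINT s:{c..t}. h s)" unfolding H0 by (simp add: H_def)
 qed
 have op: "(LBINT t:{c..d}. ind {a<..<b} t * h t) = H b - H a" if "c <= a" "a <= b" "b <= d" for a b
 proof -
  have "(LBINT t:{c..d}. ind {a<..<b} t * h t) = (LBINT s:{a..b}. h s)"
   unfolding LBINT_def
  proof (rule integral_cong_AE)
   have "sint {c..d} (%t. ind {a<..<b} t * h t)"
    by (rule set_integrable_times_bounded[OF h, of _ 1]) (auto simp: indicator_def)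
   then show "(%t. ind {c..d} t *R (ind {a<..<b} t * h t)) \<in> bm lborel"
    unfolding sintegrable_def by (rule borel_measurable_integrable)
   have "sint {a..b} h" using that by (intro set_integrable_subset[OF h]) auto
   then show "(%t. ind {a..b} t *R h t) \<in> bm lborel"
    unfolding sintegrable_def by (rule borel_measurable_integrable)
   show "AE t in lborel. ind {c..d} t *R (ind {a<..<b} t * h t) = ind {a..b} t *R h t"
    using AE_lborel_singleton[of a] AE_lborel_singleton[of b]
    by eventually_elim (use that in "auto simp: indicator_def")
  qed
  then show ?thesis using ac_diff[OF acH that] by simp
 qed
 have rat: "H a = H b" if "a \<in> \<rat>" "b \<in> \<rat>" "c < a" "a < b" "b < d" for a b
 proof -
  have "(LBINT t:{c..d}. ind {a<..<b} t * h t) = 0"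
   using bump_integral_limit[OF h, of a b] z[OF that] by (simp add: LIMSEQ_const_iff)
  then show ?thesis using op[of a b] that by simp
 qed
 obtain a0 where a0: "a0 \<in> \<rat>" "c < a0" "a0 < d" using Rats_dense_in_real[OF True] by blast
 have const: "H t = H a0" if "t \<in> {c..d}" for t
 proof -
  have cl: "closure ({c<..<d} Int \<rat>) = {c..d}"
   using closure_open_Int_superset[of "{c<..<d}" "\<rat>"] Rats_closure_real True by simp
  show ?thesis
  proof (rule continuous_constant_on_closure[where S = "{c<..<d} Int \<rat>" and f = H])
   show "continuous_on (closure ({c<..<d} Int \<rat>)) H" unfolding cl by (rule ac_continuous[OF acH])
   show "H s = H a0" if "s \<in> {c<..<d} Int \<rat>" for s
   proof (cases s a0 rule: linorder_cases)
    case less show ?thesis by (rule rat) (use less that a0 in auto)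
   next
    case greater show ?thesis by (rule rat[symmetric]) (use greater that a0 in auto)
   qed simp
   show "t \<in> closure ({c<..<d} Int \<rat>)" unfolding cl by (rule that)
  qed
 qed
 have hi: "sint {c<..<d} h" by (rule set_integrable_subset[OF h]) auto
 have "AE t in lborel. ind {c<..<d} t * h t = (0::real)"
 proof (rule AE_zero_if_box_integrals_zero)
  show "integrable lborel (%t. ind {c<..<d} t * h t)" using hi by (simp add: sintegrable_def)
  fix a b :: real
  define a' b' where "a' = max a c" and "b' = min b d"
  show "(LINT t:box a b|lborel. ind {c<..<d} t * h t) = 0"
  proof (cases "a' <= b'")
   case True
   have "(LINT t:box a b|lborel. ind {c<..<d} t * h t) = (LBINT t:{c..d}. ind {a'<..<b'} t * h t)"
    unfolding LBINT_def
    by (rule bochner_cong) (auto simp: indicator_def a'_def b'_def)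
   also have "... = H b' - H a'" using True by (intro op) (auto simp: a'_def b'_def)
   also have "H b' = H a0" by (rule const) (use True \<open>c < d\<close> in "auto simp: a'_def b'_def")
   also have "H a' = H a0" by (rule const) (use True \<open>c < d\<close> in "auto simp: a'_def b'_def")
   also have "H a0 - H a0 = 0" by simp
   finally show ?thesis .
  next
   case False
   then have "(%t. ind (box a b) t *R (ind {c<..<d} t * h t)) = (%_. 0)"
    by (auto simp: fun_eq_iff indicator_def a'_def b'_def)
   then show ?thesis by (simp add: LBINT_def)
  qed
 qed
 then show ?thesis by eventually_elim (auto simp: indicator_def)
qed simp

lemma set_integral_zero_singleton: "(LBINT s:{c::real}. h s) = (0::real)"
 unfolding LBINT_def
proof (rule integral_eq_zero_AE)
 show "AE t in lborel. ind {c} t *R h t = 0"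
  using AE_lborel_singleton[of c] by eventually_elim auto
qed

lemma ac_indefinite:
 assumes "sint {c..d} h" shows "ac c d (%t. LBINT s:{c..t}. h s) h"
 unfolding ac_def by (intro conjI ballI assms) (simp add: set_integral_zero_singleton)

text \<open>The weak \<open>t\<close>-derivative on a rectangle is tested against products \<open>\<alpha> r * \<beta> t\<close>.\<close>

lemma ACL_rectangle:
 fixes v q :: "real \<times> real => real"
 assumes lt: "t1 < t2"
  and iv: "integrable lborel2 (%p. ind ({r1..r2} \<times> {t1..t2}) p * v p)"
  and iq: "integrable lborel2 (%p. ind ({r1..r2} \<times> {t1..t2}) p * q p)"
  and test: "!!n a b \<beta> \<beta>'. r1 < a ==> a < b ==> b < r2 ==> (!!t. (\<beta> has_real_derivative \<beta>' t) (at t)) ==>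
   continuous_on UNIV \<beta>' ==> (!!t. t ~: {t1..t2} ==> \<beta> t = 0) ==> (!!t. t ~: {t1..t2} ==> \<beta>' t = 0) ==>
   (LINT p|lborel2. ind ({r1..r2} \<times> {t1..t2}) p * (bump n a b (fst p) * (v p * \<beta>' (snd p) + q p * \<beta> (snd p)))) = 0"
 shows "AE r\<in>{r1<..<r2} in lborel. (\<exists>c. AE t\<in>{t1<..<t2} in lborel. v (r, t) = c + (LBINT s:{t1..t}. q (r, s)))"
proof -
 \<comment> \<open>A fixed density of positive integral. Subtracting a suitable multiple of it gives
   every bump mean zero, so that its primitive \<open>\<beta>\<close> vanishes outside
   \<open>[t1, t2]\<close> and is a legitimate test function.\<close>
 define k0 where "k0 = bump 1 t1 t2"
 define I0 where "I0 = (LBINT t:{t1..t2}. k0 t)"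
 have kc: "continuous_on S (bump n a b)" for S n a b by (intro continuous_intros)
 have ki: "sint {c..d} (bump n a b)" for c d n a b
  by (rule borel_integrable_atLeastAtMost'[OF kc])
 have I0: "I0 > 0"
 proof -
  have "I0 = integral\<^sup>L lborel (%t. ind {t1..t2} t * k0 t)" by (simp add: I0_def LBINT_def)
  moreover have "... ~= 0"
  proof
   assume z: "integral\<^sup>L lborel (%t. ind {t1..t2} t * k0 t) = 0"
   have "integrable lborel (%t. ind {t1..t2} t * k0 t)"
    using ki[of t1 t2] by (simp add: k0_def sintegrable_def)
   then have "AE t in lborel. ind {t1..t2} t * k0 t = 0"
    using z bump_bounds by (subst (asm) integral_nonneg_eq_0_iff_AE) (auto simp: k0_def)
   then have "AE t in lborel. t ~: {t1<..<t2}"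
   proof eventually_elim
    case (elim t)
    have "k0 t > 0" if "t \<in> {t1<..<t2}"
     using that bump_denom_pos[of 1 "t - t1" "t2 - t"] by (auto simp: k0_def bump_def intro!: divide_pos_pos)
    then show ?case using elim by (auto simp: indicator_def)
   qed
   then have "{t1<..<t2} \<in> null_sets lborel" by (subst AE_iff_null_sets) auto
   then show False using lt by (simp add: null_sets_def)
  qed
  moreover have "integral\<^sup>L lborel (%t. ind {t1..t2} t * k0 t) >= 0"
   using bump_bounds by (intro integral_nonneg_AE) (auto simp: k0_def)
  ultimately show ?thesis by simp
 qed
 define I where "I n a b = (LBINT t:{t1..t2}. bump n a b t)" for n a b
 define \<beta>' where "\<beta>' n a b t = I0 * bump n a b t - I n a b * k0 t" for n a b t
 define \<beta> where "\<beta> n a b t = (if t < t1 then 0 else LBINT s:{t1..t}. \<beta>' n a b s)" for n a b t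
 have c\<beta>': "continuous_on S (\<beta>' n a b)" for S n a b
  unfolding \<beta>'_def[abs_def] k0_def by (intro continuous_intros)
 have z\<beta>': "\<beta>' n a b t = 0" if "t ~: {t1..t2}" "t1 <= a" "b <= t2" for n a b t
  using that by (auto simp: \<beta>'_def k0_def bump_eq_0)
 have i\<beta>': "sint {c..d} (\<beta>' n a b)" for c d n a b
  by (rule borel_integrable_atLeastAtMost'[OF c\<beta>'])
 have tot: "(LBINT s:{t1..t2}. \<beta>' n a b s) = 0" for n a b
  unfolding \<beta>'_def using ki[of t1 t2] by (simp add: set_integral_diff I_def I0_def k0_def)
 have z\<beta>: "\<beta> n a b t = 0" if "t ~: {t1..t2}" "t1 <= a" "b <= t2" for n a b t
 proof (cases "t < t1")
  case False
  then have t: "t2 < t" using that by auto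
  have "(LBINT s:{t1..t}. \<beta>' n a b s) = (LBINT s:{t1..t2}. \<beta>' n a b s) + (LBINT s:{t2..t}. \<beta>' n a b s)"
   using t lt by (intro set_integral_split i\<beta>') auto
  moreover have "(LBINT s:{t2..t}. \<beta>' n a b s) = 0"
   unfolding LBINT_def
  proof (rule integral_eq_zero_AE)
   show "AE s in lborel. ind {t2..t} s *R \<beta>' n a b s = 0"
    using AE_lborel_singleton[of t2] by eventually_elim (use z\<beta>' that in "auto simp: indicator_def")
  qed
  ultimately show ?thesis using tot False by (simp add: \<beta>_def)
 qed (simp add: \<beta>_def)
 have \<beta>_alt: "\<beta> n a b t = (LBINT s:{c..t}. \<beta>' n a b s)" if "t1 <= a" "b <= t2" "c <= t1" "c <= t" for n a b t c
 proof (cases "t < t1")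
  case True
  have "(LBINT s:{c..t}. \<beta>' n a b s) = 0"
   unfolding LBINT_def
   by (rule integral_eq_zero_AE) (use True z\<beta>' that in "auto simp: indicator_def")
  then show ?thesis using True by (simp add: \<beta>_def)
 next
  case False
  have "(LBINT s:{c..t}. \<beta>' n a b s) = (LBINT s:{c..t1}. \<beta>' n a b s) + (LBINT s:{t1..t}. \<beta>' n a b s)"
   using False that by (intro set_integral_split i\<beta>') auto
  moreover have "(LBINT s:{c..t1}. \<beta>' n a b s) = 0"
   unfolding LBINT_def
  proof (rule integral_eq_zero_AE)
   show "AE s in lborel. ind {c..t1} s *R \<beta>' n a b s = 0"
    using AE_lborel_singleton[of t1] by eventually_elim (use z\<beta>' that in "auto simp: indicator_def")
  qed
  ultimately show ?thesis using False by (simp add: \<beta>_def)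
 qed
 have D\<beta>: "(\<beta> n a b has_real_derivative \<beta>' n a b t) (at t)" if "t1 <= a" "b <= t2" for n a b t
 proof -
  define c where "c = min t1 t - 1"
  have "((%t. integral {c..t} (\<beta>' n a b)) has_vector_derivative \<beta>' n a b t) (at t within {c..t+1})"
   by (rule integral_has_vector_derivative[OF c\<beta>']) (auto simp: c_def)
  then have "((%t. integral {c..t} (\<beta>' n a b)) has_vector_derivative \<beta>' n a b t) (at t)"
   by (subst (asm) at_within_interior[of t]) (auto simp: c_def)
  then have "((%t. integral {c..t} (\<beta>' n a b)) has_real_derivative \<beta>' n a b t) (at t)"
   by (simp add: has_real_derivative_iff_has_vector_derivative)
  moreover have "\<forall>\<^sub>F s in nhds t. \<beta> n a b s = integral {c..s} (\<beta>' n a b)"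
  proof -
   have "\<forall>\<^sub>F s in nhds t. s \<in> {c<..}" by (rule eventually_nhds_in_open) (auto simp: c_def)
   then show ?thesis
   proof eventually_elim
    case (elim s)
    then have "\<beta> n a b s = (LBINT s:{c..s}. \<beta>' n a b s)" using that by (intro \<beta>_alt) (auto simp: c_def)
    then show ?case using set_borel_integral_eq_integral(2)[OF i\<beta>', of c s] by simp
   qed
  qed
  ultimately show ?thesis by (subst DERIV_cong_ev[OF refl _ refl])
 qed
 define R where "R = {r1..r2} \<times> {t1..t2}"
 define G where "G n a b p = ind R p * (v p * \<beta>' n a b (snd p) + q p * \<beta> n a b (snd p))" for n a b p
 have bdd: "\<exists>B. \<forall>t. \<bar>f t\<bar> <= B" if c: "continuous_on {t1..t2} f" and z: "!!t. t ~: {t1..t2} ==> f t = 0" for f :: "real => real"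
 proof -
  obtain B where B: "\<forall>y\<in>f ` {t1..t2}. norm y <= B"
   using compact_imp_bounded[OF compact_continuous_image[OF c compact_Icc]] unfolding bounded_iff by blast
  have "\<bar>f t\<bar> <= max 0 B" for t
  proof (cases "t \<in> {t1..t2}")
   case True then show ?thesis using B by (auto simp: le_max_iff_disj)
  qed (use z in simp)
  then show ?thesis by blast
 qed
 have c\<beta>: "continuous_on S (\<beta> n a b)" if "t1 <= a" "b <= t2" for S n a b
  using D\<beta>[OF that] DERIV_continuous_on[of S "\<beta> n a b" "\<beta>' n a b"] by (auto intro: has_field_derivative_at_within)
 have prod_int: "integrable lborel2 (%p. f (snd p) * (ind R p * w p))"
  if w: "integrable lborel2 (%p. ind R p * w p)" and c: "continuous_on UNIV f"
   and z: "!!t. t ~: {t1..t2} ==> f t = 0" for f and w :: "real \<times> real => real"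
 proof -
  obtain B where B: "!!t. \<bar>f t\<bar> <= B" using bdd[OF continuous_on_subset[OF c] z] by auto
  have fm[measurable]: "f \<in> bm borel" by (rule borel_measurable_continuous_onI[OF c])
  show ?thesis
  proof (rule bochner_bound)
   show "integrable lborel2 (%p. B * norm (ind R p * w p))" using w by (intro integrable_mult_right integrable_norm)
   have "(%p. f (snd p)) \<in> bm lborel2" by measurable
   then show "(%p. f (snd p) * (ind R p * w p)) \<in> bm lborel2"
    using borel_measurable_integrable[OF w] by (rule borel_measurable_times)
   have "norm (f (snd p) * (ind R p * w p)) <= norm (B * norm (ind R p * w p))" for p
   proof -
    have "\<bar>f (snd p)\<bar> <= \<bar>B\<bar>" using B[of "snd p"] by simp
    then show ?thesis unfolding norm_mult real_norm_def abs_abs abs_mult by (intro mult_right_mono) auto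
   qed
   then show "AE p in lborel \<Otimes>\<^sub>M lborel. norm (f (snd p) * (ind R p * w p)) <= norm (B * norm (ind R p * w p))" by simp
  qed
 qed
 have iG: "integrable lborel2 (G n a b)" if "t1 <= a" "b <= t2" for n a b
 proof -
  have "integrable lborel2 (%p. \<beta>' n a b (snd p) * (ind R p * v p) + \<beta> n a b (snd p) * (ind R p * q p))"
   using prod_int[OF iv[folded R_def] c\<beta>'] prod_int[OF iq[folded R_def] c\<beta>[OF that]] z\<beta>' z\<beta> that
   by (intro Bochner_Integration.integrable_add) auto
  then show ?thesis by (elim back_subst[of "integrable _"]) (auto simp: G_def fun_eq_iff algebra_simps)
 qed
 have Gz: "AE r\<in>{r1<..<r2} in lborel. (LBINT t. G n a b (r, t)) = 0" if ab: "t1 <= a" "b <= t2" for n a b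
 proof (rule AE_zero_if_bump_integrals_zero)
  have i: "integrable lborel (%r. LBINT t. G n a b (r, t))" by (rule lborel_pair.integrable_fst'[OF iG[OF ab]])
  show "sint {r1..r2} (%r. LBINT t. G n a b (r, t))"
   unfolding sintegrable_def by (rule integrable_mult_indicator[OF _ i]) auto
  fix m c d assume cd: "r1 < c" "c < d" "d < r2"
  have mb: "integrable lborel2 (%p. bump m c d (fst p) * G n a b p)"
  proof (rule bochner_bound[OF iG[OF ab]])
   have "(%p. bump m c d (fst p)) \<in> bm lborel2" by measurable
   then show "(%p. bump m c d (fst p) * G n a b p) \<in> bm lborel2"
    using borel_measurable_integrable[OF iG[OF ab]] by (rule borel_measurable_times)
   have "norm (bump m c d (fst p) * G n a b p) <= norm (G n a b p)" for p
    using bump_bounds[of m c d "fst p"] by (simp add: abs_mult mult_left_le_one_le)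
   then show "AE p in lborel \<Otimes>\<^sub>M lborel. norm (bump m c d (fst p) * G n a b p) <= norm (G n a b p)" by simp
  qed
  have "(LBINT r:{r1..r2}. bump m c d r * (LBINT t. G n a b (r, t))) = (LBINT r. (LBINT t. bump m c d r * G n a b (r, t)))"
   unfolding LBINT_def
  proof (rule bochner_cong[OF refl])
   fix r
   have "bump m c d r = 0" if "r ~: {r1..r2}" using that cd by (auto intro: bump_eq_0)
   then show "ind {r1..r2} r *R (bump m c d r * (LBINT t. G n a b (r, t))) = (LBINT t. bump m c d r * G n a b (r, t))"
    by (auto simp: indicator_def)
  qed
  also have "... = (LINT p|lborel2. bump m c d (fst p) * G n a b p)"
   using lborel_pair.integral_fst'[OF mb] by simp
  also have "... = (LINT p|lborel2. ind R p * (bump m c d (fst p) * (v p * \<beta>' n a b (snd p) + q p * \<beta> n a b (snd p))))"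
   by (rule bochner_cong) (auto simp: G_def)
  also have "... = 0"
   unfolding R_def using D\<beta>[OF ab] c\<beta>' z\<beta>[OF _ ab] z\<beta>'[OF _ ab] cd by (intro test) auto
  finally show "(LBINT r:{r1..r2}. bump m c d r * (LBINT t. G n a b (r, t))) = 0" .
 qed
 \<comment> \<open>There are only countably many tests, so a single null set of \<open>r\<close>
   serves all of them.\<close>
 have A1: "AE r in lborel. \<forall>n. \<forall>a\<in>\<rat> Int {t1..t2}. \<forall>b\<in>\<rat> Int {t1..t2}. r \<in> {r1<..<r2} --> (LBINT t. G n a b (r, t)) = 0"
 proof -
  have cnt: "countable (\<rat> Int {t1..t2})" by (intro countable_Int1 countable_rat)
  have "AE r in lborel. \<forall>b\<in>\<rat> Int {t1..t2}. r \<in> {r1<..<r2} --> (LBINT t. G n a b (r, t)) = 0" if "a \<in> \<rat> Int {t1..t2}" for n a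
   using Gz that by (subst AE_ball_countable[OF cnt]) auto
  then have "AE r in lborel. \<forall>a\<in>\<rat> Int {t1..t2}. \<forall>b\<in>\<rat> Int {t1..t2}. r \<in> {r1<..<r2} --> (LBINT t. G n a b (r, t)) = 0" for n
   by (subst AE_ball_countable[OF cnt]) blast
  then show ?thesis by (subst AE_all_countable) blast
 qed
 have A2: "AE r in lborel. integrable lborel (%t. ind R (r, t) * v (r, t))"
  "AE r in lborel. integrable lborel (%t. ind R (r, t) * q (r, t))"
  using lborel_pair.AE_integrable_fst'[OF iv] lborel_pair.AE_integrable_fst'[OF iq] by (simp_all add: R_def)
 show ?thesis
  using A1 A2
 proof eventually_elim
  case (elim r)
  show ?case
  proof
   assume r: "r \<in> {r1<..<r2}"
   have ind: "ind R (r, t) = (ind {t1..t2} t :: real)" for t using r by (auto simp: R_def indicator_def)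
   have vi: "sint {t1..t2} (%t. v (r, t))" and qi: "sint {t1..t2} (%t. q (r, t))"
    using elim(2,3) unfolding ind by (simp_all add: sintegrable_def)
   define Q where "Q t = (LBINT s:{t1..t}. q (r, s))" for t
   have acQ: "ac t1 t2 Q (%t. q (r, t))" unfolding Q_def[abs_def] by (rule ac_indefinite[OF qi])
   have Qi: "sint {t1..t2} Q" by (rule borel_integrable_atLeastAtMost'[OF ac_continuous[OF acQ]])
   define w where "w t = v (r, t) - Q t" for t
   have wi: "sint {t1..t2} w" unfolding w_def[abs_def] by (rule set_integral_diff[OF vi Qi])
   \<comment> \<open>The \<open>k0\<close>-weighted mean of \<open>w\<close>. The mean zero tests
     say that the integral of a bump times \<open>w\<close> is \<open>c\<close> times the integral
     of the bump.\<close>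
   define c where "c = (LBINT t:{t1..t2}. k0 t * w t) / I0"
   have bw: "sint {t1..t2} (%t. bump n a b t * w t)" for n a b
    by (rule set_integrable_times_bounded[OF wi, of _ 1]) (auto simp: bump_abs_le)
   have "AE t\<in>{t1<..<t2} in lborel. w t - c = 0"
   proof (rule AE_zero_if_bump_integrals_zero)
    show "sint {t1..t2} (%t. w t - c)" by (intro set_integral_diff wi set_integrable_const_Icc)
    fix n a b assume ab: "a \<in> \<rat>" "b \<in> \<rat>" "t1 < a" "a < b" "b < t2"
    have ab': "t1 <= a" "b <= t2" using ab by auto
    have ac\<beta>: "ac t1 t2 (\<beta> n a b) (\<beta>' n a b)" by (rule ac_C1) (use D\<beta>[OF ab'] c\<beta>' in auto)
    have "\<beta> n a b t1 = 0" "\<beta> n a b t2 = 0"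
     using tot by (auto simp: \<beta>_def set_integral_zero_singleton lt less_imp_le not_less)
    then have parts: "(LBINT t:{t1..t2}. q (r, t) * \<beta> n a b t + Q t * \<beta>' n a b t) = 0"
     using ac_by_parts[OF acQ ac\<beta>] lt by simp
    have i1: "sint {t1..t2} (%t. q (r, t) * \<beta> n a b t + Q t * \<beta>' n a b t)"
     by (rule ac_integrable[OF ac_mult[OF acQ ac\<beta>]])
    have i2: "sint {t1..t2} (%t. v (r, t) * \<beta>' n a b t + q (r, t) * \<beta> n a b t)"
     using set_integrable_mult_continuous(1)[OF vi c\<beta>'] set_integrable_mult_continuous(1)[OF qi c\<beta>[OF ab']]
     by (rule set_integral_add)
    have "(LBINT t:{t1..t2}. v (r, t) * \<beta>' n a b t + q (r, t) * \<beta> n a b t) = 0"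
    proof -
     have "(LBINT t. G n a b (r, t)) = 0" using elim(1) ab r by auto
     then show ?thesis unfolding G_def ind LBINT_def by simp
    qed
    then have "0 = (LBINT t:{t1..t2}. (v (r, t) * \<beta>' n a b t + q (r, t) * \<beta> n a b t) - (q (r, t) * \<beta> n a b t + Q t * \<beta>' n a b t))"
     using parts set_integral_diff(2)[OF i2 i1] by simp
    also have "... = (LBINT t:{t1..t2}. I0 * (bump n a b t * w t) - I n a b * (k0 t * w t))"
     by (rule set_lebesgue_integral_cong) (auto simp: w_def \<beta>'_def algebra_simps)
    also have "... = I0 * (LBINT t:{t1..t2}. bump n a b t * w t) - I n a b * (LBINT t:{t1..t2}. k0 t * w t)"
     using bw unfolding k0_def by (subst set_integral_diff(2)) auto
    finally have "I0 * (LBINT t:{t1..t2}. bump n a b t * w t) = I n a b * (c * I0)" using I0 by (simp add: c_def)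
    then have e: "(LBINT t:{t1..t2}. bump n a b t * w t) = c * I n a b" using I0 by simp
    have "(LBINT t:{t1..t2}. bump n a b t * (w t - c)) = (LBINT t:{t1..t2}. bump n a b t * w t - c * bump n a b t)"
     by (rule set_lebesgue_integral_cong) (auto simp: algebra_simps)
    also have "... = (LBINT t:{t1..t2}. bump n a b t * w t) - c * I n a b"
     using bw ki[of t1 t2] by (subst set_integral_diff(2)) (auto simp: I_def)
    finally show "(LBINT t:{t1..t2}. bump n a b t * (w t - c)) = 0" using e by simp
   qed
   then show "\<exists>c. AE t\<in>{t1<..<t2} in lborel. v (r, t) = c + (LBINT s:{t1..t}. q (r, s))"
    by (intro exI[of _ c], eventually_elim) (auto simp: w_def Q_def)
  qed
 qed
qed

lemma borel_representative:
 fixes f :: "'a::euclidean_space => real"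
 assumes "f \<in> bm lebesgue"
 obtains f' where "f' \<in> bm borel" "AE y in lebesgue. f y = f' y"
 using completion_ex_borel_measurable_real[OF assms] AE_completion that by auto

text \<open>The polar test identities carry powers of \<open>r\<close>. Dividing the test factor by
  \<open>r\<close> compensates for them and keeps it C1, because it vanishes below
  \<open>r1 > 0\<close>.\<close>

lemma divide_by_id_C1:
 fixes \<beta> \<beta>' :: "real => real"
 assumes r1: "0 < r1" and D: "!!r. (\<beta> has_real_derivative \<beta>' r) (at r)" and c: "continuous_on UNIV \<beta>'"
  and z: "!!r. r < r1 ==> \<beta> r = 0" "!!r. r < r1 ==> \<beta>' r = 0"
 shows "((%r. \<beta> r / r) has_real_derivative (\<beta>' r / r - \<beta> r / r^2)) (at r)"
  and "continuous_on UNIV (%r. \<beta>' r / r - \<beta> r / r^2)"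
proof -
 show "((%r. \<beta> r / r) has_real_derivative (\<beta>' r / r - \<beta> r / r^2)) (at r)"
 proof (cases "r < r1")
  case True
  have "((%r. 0) has_real_derivative 0) (at r)" by simp
  then have "((%r. \<beta> r / r) has_real_derivative 0) (at r)"
   by (rule has_field_derivative_transform_within_open[of _ _ _ "{..<r1}"]) (use True z in auto)
  then show ?thesis using z True by simp
 next
  case False
  then have "r ~= 0" using r1 by simp
  then show ?thesis using D[of r] by (auto intro!: derivative_eq_intros simp: field_simps power2_eq_square)
 qed
 have cb: "continuous_on UNIV \<beta>" using D by (auto intro: DERIV_continuous_on has_field_derivative_at_within)
 have "continuous_on ({0<..} Un {..<r1}) (%r. \<beta>' r / r - \<beta> r / r^2)"
 proof (rule continuous_on_open_Un)
  show "continuous_on {0<..} (%r. \<beta>' r / r - \<beta> r / r^2)"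
   by (intro continuous_intros continuous_on_subset[OF c] continuous_on_subset[OF cb]) auto
  show "continuous_on {..<r1} (%r. \<beta>' r / r - \<beta> r / r^2)"
   by (rule continuous_on_eq[of _ "%_. 0"]) (use z in auto)
 qed auto
 moreover have "{0<..} Un {..<r1} = UNIV" using r1 by auto
 ultimately show "continuous_on UNIV (%r. \<beta>' r / r - \<beta> r / r^2)" by simp
qed

section \<open>The minimizer in polar coordinates\<close>

context crack
begin

text \<open>Composition with \<open>polp x\<close> preserves measurability for Borel functions,
  whereas \<open>u\<close> and its gradient are only Lebesgue measurable off \<open>K\<close>. Hence
  Borel representatives of \<open>u\<close> and of the two gradient components, extended by zero,
  are fixed once and for all.\<close>

definition u0 where "u0 = (SOME f. f \<in> bm borel & (AE y in lebesgue. ind (U - K) y * u y = f y))"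
definition ga where "ga = (SOME f. f \<in> bm borel & (AE y in lebesgue. ind (U - K) y * g y $ 1 = f y))"
definition gb where "gb = (SOME f. f \<in> bm borel & (AE y in lebesgue. ind (U - K) y * g y $ 2 = f y))"

lemma representatives:
 shows u0_meas [measurable]: "u0 \<in> bm borel" and u0_AE: "AE y in lebesgue. ind (U - K) y * u y = u0 y"
  and ga_meas [measurable]: "ga \<in> bm borel" and ga_AE: "AE y in lebesgue. ind (U - K) y * g y $ 1 = ga y"
  and gb_meas [measurable]: "gb \<in> bm borel" and gb_AE: "AE y in lebesgue. ind (U - K) y * g y $ 2 = gb y"
proof -
 have "(%y. ind (U - K) y *R u y) \<in> bm lebesgue"
  and gm: "(%y. ind (U - K) y *R g y) \<in> bm lebesgue"
  by (rule measurable_weak_gradient[OF open_UK weak_g])+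
 moreover have "(%y. ind (U - K) y * g y $ i) \<in> bm lebesgue" for i
  using borel_measurable_inner[OF gm measurable_const[of "axis i 1"]] by (simp add: cart_eq_inner_axis)
 ultimately have m: "(%y. ind (U - K) y * u y) \<in> bm lebesgue"
  "(%y. ind (U - K) y * g y $ 1) \<in> bm lebesgue" "(%y. ind (U - K) y * g y $ 2) \<in> bm lebesgue"
  by auto
 have "\<exists>f'. f' \<in> bm borel & (AE y in lebesgue. f y = f' y)" if "f \<in> bm lebesgue" for f :: "real^2 => real"
  using borel_representative[OF that] by blast
 from someI_ex[OF this[OF m(1)]] someI_ex[OF this[OF m(2)]] someI_ex[OF this[OF m(3)]]
 show "u0 \<in> bm borel" "AE y in lebesgue. ind (U - K) y * u y = u0 y"
  "ga \<in> bm borel" "AE y in lebesgue. ind (U - K) y * g y $ 1 = ga y"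
  "gb \<in> bm borel" "AE y in lebesgue. ind (U - K) y * g y $ 2 = gb y"
  unfolding u0_def ga_def gb_def by auto
qed

text \<open>\<open>P\<close> and \<open>Q\<close> are the partial derivatives of \<open>V\<close> in
  the radius and in the angle. \<open>Q\<close> therefore carries a factor \<open>fst p\<close>, and
  the squared gradient is \<open>P^2 + Q^2 / r^2\<close>, called \<open>En\<close> below.\<close>

definition V where "V p = u0 (polp x p)"
definition P where "P p = ga (polp x p) * cos (snd p) + gb (polp x p) * sin (snd p)"
definition Q where "Q p = fst p * (gb (polp x p) * cos (snd p) - ga (polp x p) * sin (snd p))"

lemma VPQ_meas [measurable]: "V \<in> bm lborel2" "P \<in> bm lborel2"
 "Q \<in> bm lborel2"
 unfolding V_def[abs_def] P_def[abs_def] Q_def[abs_def] by measurable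

lemma U_half_plane: "U = half_plane" by (simp add: U half_plane_def)

lemma K_borel [measurable]: "K \<in> sets borel" using closed_K by (rule borel_closed)

definition En where "En p = (P p)^2 + (Q p)^2 / (fst p)^2"

lemma En_eq: "fst p > 0 ==> En p = (ga (polp x p))^2 + (gb (polp x p))^2"
proof -
 assume "fst p > 0"
 then have "En p = (ga (polp x p) * cos (snd p) + gb (polp x p) * sin (snd p))^2 + (gb (polp x p) * cos (snd p) - ga (polp x p) * sin (snd p))^2"
  unfolding En_def P_def Q_def power_divide[symmetric] by simp
 also have "... = (ga (polp x p))^2 * ((cos (snd p))^2 + (sin (snd p))^2) + (gb (polp x p))^2 * ((cos (snd p))^2 + (sin (snd p))^2)"
  by algebra
 finally show ?thesis by simp
qed

lemma dirichlet_polar: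
 assumes A: "A \<in> sets borel"
 shows "dirichlet A = (NP p. ennreal (fst p * En p) * ind strip p * ind A (polp x p))"
proof -
 have "dirichlet A = (\<integral>\<^sup>+ y. (ennreal ((ga y)^2 + (gb y)^2) * ind A y) * ind half_plane y \<partial>lebesgue)"
  unfolding dirichlet_eq
 proof (rule nn_integral_cong_AE)
  show "AE y in lebesgue. dens y * ind A y = (ennreal ((ga y)^2 + (gb y)^2) * ind A y) * ind half_plane y"
   using ga_AE gb_AE
  proof eventually_elim
   case (elim y)
   show ?case
   proof (cases "y \<in> U - K")
    case True
    moreover have "y \<in> half_plane" using True U_half_plane by auto
    ultimately show ?thesis using elim by (simp add: dens_def norm_vec2_sq del: ennreal_plus)
   qed (use elim in "simp add: dens_def")
  qed
 qed
 also have "... = (NN y. (ennreal ((ga y)^2 + (gb y)^2) * ind A y) * ind half_plane y)"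
  by (rule nn_integral_completion)
 also have "... = (NP p. (ennreal (fst p) * ind strip p) * (ennreal ((ga (polp x p))^2 + (gb (polp x p))^2) * ind A (polp x p)))"
  by (intro nn_integral_polar[OF x_in(2)] borel_measurable_times_ennreal borel_measurable_indicator A measurable_compose[OF _ measurable_ennreal] borel_measurable_add borel_measurable_power ga_meas gb_meas)
 also have "... = (NP p. ennreal (fst p * En p) * ind strip p * ind A (polp x p))"
 proof (rule nn_integral_cong)
  fix p
  show "(ennreal (fst p) * ind strip p) * (ennreal ((ga (polp x p))^2 + (gb (polp x p))^2) * ind A (polp x p))
   = ennreal (fst p * En p) * ind strip p * ind A (polp x p)"
  proof (cases "p \<in> strip")
   case True
   then have "fst p > 0" by (auto simp: strip_def)
   then show ?thesis using True by (simp add: En_eq ennreal_mult mult.assoc del: ennreal_plus)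
  qed simp
 qed
 finally show ?thesis .
qed

text \<open>The polar angle written with arctan, which is smooth on the whole upper half
  plane.\<close>

definition ang :: "real^2 => real" where "ang y = pi / 2 - arctan ((y $ 1 - x $ 1) / y $ 2)"

lemma ang_pol: "r > 0 ==> t \<in> {0<..<pi} ==> ang (pol x r t) = t"
proof -
 assume r: "r > 0" and t: "t \<in> {0<..<pi}"
 have "(pol x r t $ 1 - x $ 1) / pol x r t $ 2 = tan (pi / 2 - t)"
  using r x_in(2) by (simp add: tan_def sin_diff cos_diff)
 moreover have "arctan (tan (pi / 2 - t)) = pi / 2 - t" using t by (intro arctan_tan) auto
 ultimately show ?thesis by (simp add: ang_def)
qed

lemma pol_in_U: "r > 0 ==> t \<in> {0<..<pi} ==> pol x r t \<in> U"
 using x_in(2) by (simp add: U sin_gt_zero)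

text \<open>The weak gradient is tested with \<open>\<psi>\<close> times a vector field, where
  \<open>\<psi>\<close> is \<open>a\<close> of the radius times \<open>\<beta>\<close> of the angle.
  The rotation field is divergence free and yields the angular derivative in the first identity. The
  field \<open>y - x\<close> has divergence 2, hence the term \<open>2 * a\<close> beside
  \<open>r * a'\<close> in the second. The leading factor \<open>fst p\<close> is the Jacobian. The
  rectangle must miss \<open>K\<close> so that the test functions have compact support in
  \<open>U - K\<close>.\<close>

lemma polar_test_general:
 fixes a a' \<beta> \<beta>' :: "real => real"
 assumes r: "0 < r1" "r1 < r2" and t: "0 < t1" "t1 < t2" "t2 < pi"
  and free: "!!r t. r \<in> {r1..r2} ==> t \<in> {t1..t2} ==> pol x r t ~: K"
  and a: "!!r. (a has_real_derivative a' r) (at r)" "continuous_on UNIV a'" "!!r. r ~: {r1..r2} ==> a r = 0" "!!r. r ~: {r1..r2} ==> a' r = 0"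
  and b: "!!t. (\<beta> has_real_derivative \<beta>' t) (at t)" "continuous_on UNIV \<beta>'" "!!t. t ~: {t1..t2} ==> \<beta> t = 0" "!!t. t ~: {t1..t2} ==> \<beta>' t = 0"
 shows "(LINT p|lborel2. ind ({r1..r2} \<times> {t1..t2}) p * (fst p * a (fst p) * (V p * \<beta>' (snd p) + Q p * \<beta> (snd p)))) = 0"
  and "(LINT p|lborel2. ind ({r1..r2} \<times> {t1..t2}) p *
   (fst p * \<beta> (snd p) * (V p * (fst p * a' (fst p) + 2 * a (fst p)) + P p * (fst p * a (fst p))))) = 0"
  and "integrable lborel2 (%p. ind ({r1..r2} \<times> {t1..t2}) p * V p)"
  and "integrable lborel2 (%p. ind ({r1..r2} \<times> {t1..t2}) p * P p)"
  and "integrable lborel2 (%p. ind ({r1..r2} \<times> {t1..t2}) p * Q p)"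
proof -
 define R where "R = {r1..r2} \<times> {t1..t2}"
 define C where "C = polp x ` R"
 have Rs: "R <= strip" using r t by (auto simp: R_def strip_def)
 have cR: "compact R" unfolding R_def by (intro compact_Times compact_Icc)
 have cC: "compact C" unfolding C_def by (intro compact_continuous_image continuous_on_subset[OF continuous_polp] cR) auto
 have CO: "C <= U - K"
 proof
  fix y assume "y \<in> C"
  then obtain p where p: "p \<in> R" "y = pol x (fst p) (snd p)" by (auto simp: C_def polp_def)
  then show "y \<in> U - K" using free[of "fst p" "snd p"] pol_in_U[of "fst p" "snd p"] r t by (auto simp: R_def)
 qed
 define rho where "rho y = sqrt ((y $ 1 - x $ 1) * (y $ 1 - x $ 1) + y $ 2 * y $ 2)" for y :: "real^2"
 have rho_pol: "rho (pol x r t) = r" if "r > 0" for r t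
 proof -
  have "(r * cos t) * (r * cos t) + (r * sin t) * (r * sin t) = r^2 * ((cos t)^2 + (sin t)^2)" by algebra
  then show ?thesis using that x_in(2) by (simp add: rho_def)
 qed
 have repr: "\<exists>r>0. \<exists>t\<in>{0<..<pi}. y = pol x r t" if "y \<in> U" for y
 proof -
  have "y \<in> (%z::real^2. pol x (z $ 1) (z $ 2)) ` {z::real^2. 0 < z $ 1 & 0 < z $ 2 & z $ 2 < pi}"
   unfolding polar_bij(2)[OF x_in(2)] using that U_half_plane by simp
  then obtain z :: "real^2" where "y = pol x (z $ 1) (z $ 2)" "0 < z $ 1" "0 < z $ 2" "z $ 2 < pi" by auto
  then show ?thesis by (intro exI[of _ "z $ 1"] bexI[of _ "z $ 2"] conjI) auto
 qed
 define \<psi> where "\<psi> y = (if y \<in> U then a (rho y) * \<beta> (ang y) else 0)" for y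
 have zero: "a (rho y) * b' (ang y) = 0" "a' (rho y) * b' (ang y) = 0" if y: "y \<in> U" "y ~: C" and b': "!!t. t ~: {t1..t2} ==> b' t = 0" for y and b' :: "real => real"
 proof -
  obtain r t where p: "r > 0" "t \<in> {0<..<pi}" "y = pol x r t" using repr[OF y(1)] by blast
  have "(r, t) ~: R"
  proof
   assume "(r, t) \<in> R"
   then have "polp x (r, t) \<in> C" unfolding C_def by (rule imageI)
   then show False using y(2) p by (simp add: polp_def)
  qed
  then have "a r = 0 & a' r = 0 \<or> b' t = 0" using a(3,4) b' by (auto simp: R_def)
  then show "a (rho y) * b' (ang y) = 0" "a' (rho y) * b' (ang y) = 0" using p rho_pol ang_pol by auto
 qed
 define Dr :: "real^2 => real^2" where "Dr y = (inverse (rho y)) *R ((y $ 1 - x $ 1) *R axis 1 1 + y $ 2 *R axis 2 1)" for y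
 define Da :: "real^2 => real^2" where "Da y = (inverse ((rho y)^2)) *R ((- y $ 2) *R axis 1 1 + (y $ 1 - x $ 1) *R axis 2 1)" for y
 have rp: "rho y > 0" if "y \<in> U" for y
 proof -
  have "y $ 2 * y $ 2 > 0" using that by (simp add: U)
  then show ?thesis unfolding rho_def by (intro real_sqrt_gt_zero add_nonneg_pos) auto
 qed
 have rsq: "(rho y)^2 = (y $ 1 - x $ 1) * (y $ 1 - x $ 1) + y $ 2 * y $ 2" for y
  unfolding rho_def by (intro real_sqrt_pow2 add_nonneg_nonneg) auto
 have n1: "GDERIV (%y::real^2. y $ 1 - x $ 1) y :> axis 1 1" and n2: "GDERIV (%y::real^2. y $ 2) y :> axis 2 1" for y
  using GDERIV_diff[OF GDERIV_vec_nth[of 1 y] GDERIV_const[of "x $ 1" y]] GDERIV_vec_nth[of 2 y] by simp_all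
 have Gr: "GDERIV rho y :> Dr y" if y: "y \<in> U" for y
 proof -
  let ?s = "(y $ 1 - x $ 1) * (y $ 1 - x $ 1) + y $ 2 * y $ 2"
  have s0: "?s > 0" using rp[OF y] rsq[of y] by (metis zero_less_power)
  have "GDERIV (%y::real^2. sqrt ((y $ 1 - x $ 1) * (y $ 1 - x $ 1) + y $ 2 * y $ 2)) y :>
   (inverse (sqrt ?s) / 2) *R (((y $ 1 - x $ 1) *R axis 1 1 + (y $ 1 - x $ 1) *R axis 1 1) + (y $ 2 *R axis 2 1 + y $ 2 *R axis 2 1))"
   by (rule GDERIV_DERIV_compose[OF GDERIV_add[OF GDERIV_mult[OF n1 n1] GDERIV_mult[OF n2 n2]] DERIV_real_sqrt[OF s0]])
  then show ?thesis unfolding rho_def[abs_def] Dr_def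
   by (elim GDERIV_subst) (simp add: vec_eq_iff forall_2 axis_def rho_def)
 qed
 have Ga: "GDERIV ang y :> Da y" if y: "y \<in> U" for y
 proof -
  have y2: "y $ 2 > 0" using y by (simp add: U)
  let ?w = "(y $ 1 - x $ 1) * inverse (y $ 2)"
  have "GDERIV (%y::real^2. pi / 2 - arctan ((y $ 1 - x $ 1) * inverse (y $ 2))) y :>
   (0 - inverse (1 + ?w^2) *R ((y $ 1 - x $ 1) *R (- ((inverse (y $ 2))^2) *R axis 2 1) + inverse (y $ 2) *R axis 1 1))"
   using y2 by (intro GDERIV_diff GDERIV_const GDERIV_DERIV_compose[OF GDERIV_mult[OF n1 GDERIV_inverse[OF n2]] DERIV_arctan]) auto
  moreover have "0 - inverse (1 + ?w^2) *R ((y $ 1 - x $ 1) *R (- ((inverse (y $ 2))^2) *R axis 2 1) + inverse (y $ 2) *R axis 1 1) = Da y"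
  proof -
   have s: "(y $ 1 - x $ 1) * (y $ 1 - x $ 1) + y $ 2 * y $ 2 > 0" using y2 by (intro add_nonneg_pos) auto
   have w: "1 + ?w^2 = ((y $ 1 - x $ 1) * (y $ 1 - x $ 1) + y $ 2 * y $ 2) / (y $ 2 * y $ 2)"
    using y2 by (simp add: field_simps power2_eq_square)
   have k: "inverse (1 + ?w^2) * inverse (y $ 2) = inverse ((rho y)^2) * y $ 2"
    "inverse (1 + ?w^2) * ((y $ 1 - x $ 1) * (inverse (y $ 2))^2) = inverse ((rho y)^2) * (y $ 1 - x $ 1)"
    unfolding w rsq using y2 s by (simp_all add: divide_simps power2_eq_square)
   have "0 - c *R (z *R (- (i^2) *R axis 2 1) + i *R axis 1 1) = (- (c * i)) *R axis 1 1 + (c * (z * i^2)) *R (axis 2 1 :: real^2)" for c z i :: real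
    by (simp add: scaleR_diff_right)
   then show ?thesis unfolding Da_def by (simp add: k scaleR_add_right scaleR_diff_right)
  qed
  ultimately show ?thesis unfolding ang_def[abs_def] divide_inverse by simp
 qed
 define D\<psi> where "D\<psi> y = (a (rho y) * \<beta>' (ang y)) *R Da y + (a' (rho y) * \<beta> (ang y)) *R Dr y" for y
 have G\<psi>: "GDERIV \<psi> y :> D\<psi> y" if y: "y \<in> U" for y
 proof -
  have "GDERIV (%y. a (rho y) * \<beta> (ang y)) y :> a (rho y) *R (\<beta>' (ang y) *R Da y) + \<beta> (ang y) *R (a' (rho y) *R Dr y)"
   by (rule GDERIV_mult[OF GDERIV_DERIV_compose[OF Gr[OF y] a(1)] GDERIV_DERIV_compose[OF Ga[OF y] b(1)]])
  then have "GDERIV (%y. a (rho y) * \<beta> (ang y)) y :> D\<psi> y" by (elim GDERIV_subst) (simp add: D\<psi>_def mult.commute)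
  then show ?thesis unfolding gderiv_def
   by (rule has_derivative_transform_within_open[OF _ U_simps(4) y]) (simp add: \<psi>_def)
 qed
 have crho: "continuous_on UNIV rho" unfolding rho_def[abs_def] by (intro continuous_intros)
 have cang: "continuous_on U ang" unfolding ang_def[abs_def] by (intro continuous_intros) (auto simp: U)
 have ca: "continuous_on UNIV a" "continuous_on UNIV \<beta>" using a(1) b(1) by (auto intro: DERIV_continuous_on has_field_derivative_at_within)
 have cU: "continuous_on U (%y. f (rho y))" "continuous_on U (%y. f (ang y))" if "continuous_on UNIV f" for f :: "real => real"
  using continuous_on_compose2[OF that continuous_on_subset[OF crho, of U]] continuous_on_compose2[OF that cang] by auto
 have cDr: "continuous_on U Dr" "continuous_on U Da"
  unfolding Dr_def[abs_def] Da_def[abs_def] using rp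
  by (intro continuous_intros continuous_on_subset[OF crho]; force)+
 have cD\<psi>: "continuous_on U D\<psi>" unfolding D\<psi>_def[abs_def] by (intro continuous_intros cU cDr ca a(2) b(2))
 have c\<psi>: "continuous_on U \<psi>" by (rule continuous_on_eq[of _ "%y. a (rho y) * \<beta> (ang y)"]) (auto intro!: continuous_intros cU ca simp: \<psi>_def)
 have z\<psi>: "\<psi> y = 0" if "y ~: C" for y using zero(1)[where b' = \<beta>, OF _ that b(3)] by (auto simp: \<psi>_def)
 have zD: "D\<psi> y = 0" if "y \<in> U" "y ~: C" for y
 proof -
  have "a (rho y) * \<beta>' (ang y) = 0" "a' (rho y) * \<beta> (ang y) = 0"
   using zero(1)[OF that, of \<beta>'] zero(2)[OF that, of \<beta>] b(3,4) by blast+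
  then show ?thesis unfolding D\<psi>_def by (simp only: scaleR_zero_left add_0)
 qed
 note iC0 = weak_g[unfolded weak_gradient_on_def, THEN conjunct1, rule_format, OF conjI[OF cC CO]]
 note iC = iC0[THEN conjunct1] iC0[THEN conjunct2]
 have mC: "C \<in> sets borel" using cC by (rule borel_compact)
 have compu: "integrable lborel (%y. ind half_plane y *R (ind C y * f0 y))"
  if f: "integrable lebesgue (%y. ind C y *R f y)" and fm: "f0 \<in> bm borel" and ae: "AE y in lebesgue. ind (U - K) y * f y = f0 y" for f f0 :: "real^2 => real"
 proof -
  have m: "(%y. ind half_plane y *R (ind C y * f0 y)) \<in> bm borel"
   using mC fm half_plane_sets by (intro borel_measurable_scaleR borel_measurable_times borel_measurable_indicator) auto
  have "integrable lebesgue (%y. ind half_plane y *R (ind C y * f0 y))"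
  proof (rule integrable_cong_AE_imp[OF f])
   show "(%y. ind half_plane y *R (ind C y * f0 y)) \<in> bm lebesgue"
    using m by (intro measurable_completion) simp
   show "AE y in lebesgue. ind C y *R f y = ind half_plane y *R (ind C y * f0 y)"
    using ae
   proof eventually_elim
    case (elim y)
    show ?case
    proof (cases "y \<in> C")
     case True
     then have "y \<in> U - K" "y \<in> half_plane" using CO U_half_plane by blast+
     then show ?thesis using elim True by simp
    qed simp
   qed
  qed
  then show ?thesis using m by (subst (asm) integrable_completion) auto
 qed
 have gi: "integrable lebesgue (%y. ind C y *R g y $ i)" for i
  using integrable_inner_left[OF iC(2)[unfolded sintegrable_def], of "axis i 1"] by (simp add: cart_eq_inner_axis)
 have pint: "integrable lborel2 (%p. ind R p * (f0 (polp x p) * c p))"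
  if f: "integrable lborel (%y. ind half_plane y *R (ind C y * f0 y))" and fm: "f0 \<in> bm borel"
   and c: "continuous_on UNIV c" for f0 and c :: "real \<times> real => real"
 proof -
  obtain B where B: "!!p. p \<in> R ==> \<bar>c p / fst p\<bar> <= B"
  proof -
   have "continuous_on R (%p. c p / fst p)" using r by (intro continuous_intros continuous_on_subset[OF c]) (auto simp: R_def)
   from compact_imp_bounded[OF compact_continuous_image[OF this cR]] obtain B where "\<forall>y\<in>(%p. c p / fst p) ` R. norm y <= B"
    unfolding bounded_iff by blast
   then show ?thesis by (intro that[of B]) auto
  qed
  have i: "integrable lborel2 (%p. ind strip p *R (fst p * (ind C (polp x p) * f0 (polp x p))))"
   using f mC fm by (subst (asm) integral_polar(2)[OF x_in(2)]) auto
  have mR: "R \<in> sets lborel2" unfolding R_def by (intro pair_measureI) auto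
  have cm: "c \<in> bm lborel2"
   using borel_measurable_continuous_onI[OF c] by (subst measurable_cong_sets[OF sets_lborel_pair refl])
  show ?thesis
  proof (rule bochner_bound)
   show "integrable lborel2 (%p. B * norm (ind strip p *R (fst p * (ind C (polp x p) * f0 (polp x p)))))"
    using i by (intro integrable_mult_right integrable_norm)
   show "(%p. ind R p * (f0 (polp x p) * c p)) \<in> bm lborel2"
    using mR cm measurable_compose[OF measurable_polp fm] by (intro borel_measurable_times borel_measurable_indicator)
   show "AE p in lborel \<Otimes>\<^sub>M lborel. norm (ind R p * (f0 (polp x p) * c p)) <= norm (B * norm (ind strip p *R (fst p * (ind C (polp x p) * f0 (polp x p)))))"
   proof (rule AE_I2)
    fix p
    show "norm (ind R p * (f0 (polp x p) * c p)) <= norm (B * norm (ind strip p *R (fst p * (ind C (polp x p) * f0 (polp x p)))))"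
    proof (cases "p \<in> R")
     case True
     then have s: "p \<in> strip" "polp x p \<in> C" "fst p > 0" using Rs r by (auto simp: C_def R_def)
     have "\<bar>c p\<bar> = \<bar>c p / fst p\<bar> * fst p" using s by simp
     also have "... <= B * fst p" using B[OF True] s by (intro mult_right_mono) auto
     finally have "\<bar>f0 (polp x p)\<bar> * \<bar>c p\<bar> <= \<bar>f0 (polp x p)\<bar> * (B * fst p)" by (intro mult_left_mono) auto
     also have "... <= \<bar>B * (fst p * \<bar>f0 (polp x p)\<bar>)\<bar>" by (simp add: mult_ac)
     finally show ?thesis using True s by (simp add: abs_mult)
    qed simp
   qed
  qed
 qed
 note iu = compu[OF iC(1)[unfolded sintegrable_def] u0_meas u0_AE]
 note ia = compu[OF gi[of 1] ga_meas ga_AE] and ib = compu[OF gi[of 2] gb_meas gb_AE]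
 show "integrable lborel2 (%p. ind ({r1..r2} \<times> {t1..t2}) p * V p)"
  using pint[OF iu u0_meas, of "%_. 1"] by (simp add: V_def R_def)
 show "integrable lborel2 (%p. ind ({r1..r2} \<times> {t1..t2}) p * P p)"
  using Bochner_Integration.integrable_add[OF pint[OF ia ga_meas, of "%p. cos (snd p)"] pint[OF ib gb_meas, of "%p. sin (snd p)"]]
  by (simp add: P_def R_def distrib_left continuous_intros)
 show "integrable lborel2 (%p. ind ({r1..r2} \<times> {t1..t2}) p * Q p)"
  using Bochner_Integration.integrable_diff[OF pint[OF ib gb_meas, of "%p. fst p * cos (snd p)"] pint[OF ia ga_meas, of "%p. fst p * sin (snd p)"]]
  by (simp add: Q_def R_def right_diff_distrib mult_ac continuous_intros)
 \<comment> \<open>The divergence form: the first gradient component is tested with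
   \<open>ph1\<close>, the second with \<open>ph2\<close>, and the sum is rewritten in polar
   coordinates.\<close>
 have key: "(LINT p|lborel2. ind R p * (fst p * (V p * (D1 (polp x p) $ 1 + D2 (polp x p) $ 2) + (ph1 (polp x p) * ga (polp x p) + ph2 (polp x p) * gb (polp x p))))) = 0"
  if f1: "!!y. y \<in> U ==> GDERIV ph1 y :> D1 y" "continuous_on U D1" "!!y. y ~: C ==> ph1 y = 0"
   and f2: "!!y. y \<in> U ==> GDERIV ph2 y :> D2 y" "continuous_on U D2" "!!y. y ~: C ==> ph2 y = 0" for ph1 ph2 D1 D2
 proof -
  have half: "(LBINT y. ind half_plane y *R (ind C y * (u0 y * D y $ i + ph y * gi0 y))) = 0"
   "integrable lborel (%y. ind half_plane y *R (ind C y * (u0 y * D y $ i + ph y * gi0 y)))"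
   "(%y. ind C y * (u0 y * D y $ i + ph y * gi0 y)) \<in> bm borel"
   if f: "!!y. y \<in> U ==> GDERIV ph y :> D y" "continuous_on U D" "!!y. y ~: C ==> ph y = 0"
    and gm: "gi0 \<in> bm borel" and ge: "AE y in lebesgue. ind (U - K) y * g y $ i = gi0 y" for ph D i gi0
  proof -
   have CU: "C <= U" using CO by blast
   have C1: "C1_gradient ph (%y. if y \<in> U then D y else 0)"
    by (rule C1_gradient_extend[OF U_simps(4) cC CU f])
   define E where "E = (%y. if y \<in> U then D y else 0)"
   have cE: "continuous_on UNIV E" "continuous_on UNIV ph"
    using C1 C1_gradient_continuous[OF C1] by (auto simp: C1_gradient_def E_def)
   have zE: "E y = 0" if "y ~: C" for y
    using C1_gradient_zero_outside[OF C1 compact_imp_closed[OF cC] f(3) that] by (auto simp: E_def)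
   have "(LINT y:U - K|lebesgue. u y *R E y) = - (LINT y:U - K|lebesgue. ph y *R g y)"
    using weak_g C1 cC CO f(3) unfolding weak_gradient_on_def E_def by blast
   moreover have I1: "set_integrable lebesgue (U - K) (%y. u y *R E y)"
   proof (rule set_integrable_supported[OF _ CO])
    show "(%y. u y *R E y) absolutely_integrable_on C"
     using absolutely_integrable_scaleR_continuous[OF cC cE(1), where S = UNIV and h = u] iC(1) by simp
   qed (use zE in auto)
   moreover have I2: "set_integrable lebesgue (U - K) (%y. ph y *R g y)"
   proof (rule set_integrable_supported[OF _ CO])
    show "(%y. ph y *R g y) absolutely_integrable_on C"
     using absolutely_integrable_continuous_scaleR[OF cC cE(2), where S = UNIV and h = g] iC(2) by simp
   qed (use f(3) in auto)
   ultimately have "(LINT y:U - K|lebesgue. u y *R E y + ph y *R g y) = 0" by simp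
   then have z: "(LINT y|lebesgue. ind (U - K) y *R (u y *R E y + ph y *R g y)) \<bullet> axis i 1 = 0" by (simp add: LBINT_def)
   have I3: "integrable lebesgue (%y. ind (U - K) y *R (u y *R E y + ph y *R g y))"
    using set_integral_add(1)[OF I1 I2] by (simp add: sintegrable_def)
   define F where "F y = ind C y * (u0 y * E y $ i + ph y * gi0 y)" for y
   have mE: "(%y. E y $ i) \<in> bm borel" "ph \<in> bm borel"
    using cE by (auto intro!: borel_measurable_continuous_onI continuous_intros)
   have mF: "F \<in> bm borel" unfolding F_def[abs_def] using mE mC gm by measurable
   have ae: "AE y in lebesgue. (ind (U - K) y *R (u y *R E y + ph y *R g y)) \<bullet> axis i 1 = ind half_plane y *R F y"
    using u0_AE ge
   proof eventually_elim
    case (elim y)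
    show ?case
    proof (cases "y \<in> C")
     case True
     then have "y \<in> U - K" using CO by blast
     then show ?thesis using elim True by (simp add: F_def U_half_plane[symmetric] cart_eq_inner_axis[symmetric])
    qed (use zE f(3) in "simp add: F_def")
   qed
   have m2: "(%y. ind half_plane y *R F y) \<in> bm borel" using mF half_plane_sets by measurable
   have i4: "integrable lebesgue (%y. ind half_plane y *R F y)"
    by (rule integrable_cong_AE_imp[OF integrable_inner_left[OF I3, of "axis i 1"]])
     (use m2 ae in "auto intro!: measurable_completion simp: eq_commute")
   then show "integrable lborel (%y. ind half_plane y *R (ind C y * (u0 y * D y $ i + ph y * gi0 y)))"
   proof -
    have "integrable lborel (%y. ind half_plane y *R F y)" using i4 m2 by (subst (asm) integrable_completion) auto
    then show ?thesis by (elim back_subst[of "integrable lborel"]) (auto simp: F_def E_def U_half_plane[symmetric] indicator_def fun_eq_iff)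
   qed
   have "(LINT y|lebesgue. ind half_plane y *R F y) = (LINT y|lebesgue. (ind (U - K) y *R (u y *R E y + ph y *R g y)) \<bullet> axis i 1)"
    by (rule integral_cong_AE[symmetric])
     (rule borel_measurable_integrable[OF integrable_inner_left[OF I3]], rule borel_measurable_integrable[OF i4], rule ae)
   also have "... = 0" using z integral_inner_left[OF I3] by simp
   finally have "(LBINT y. ind half_plane y *R F y) = 0" using m2 by (subst (asm) integral_completion) auto
   moreover have "(%y. ind half_plane y *R F y) = (%y. ind half_plane y *R (ind C y * (u0 y * D y $ i + ph y * gi0 y)))"
    by (auto simp: F_def E_def U_half_plane[symmetric] indicator_def fun_eq_iff)
   ultimately show "(LBINT y. ind half_plane y *R (ind C y * (u0 y * D y $ i + ph y * gi0 y))) = 0" by simp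
   have "F = (%y. ind C y * (u0 y * D y $ i + ph y * gi0 y))" using CU by (auto simp: F_def E_def indicator_def fun_eq_iff)
   then show "(%y. ind C y * (u0 y * D y $ i + ph y * gi0 y)) \<in> bm borel" using mF by simp
  qed
  note h1 = half[OF f1 ga_meas ga_AE] and h2 = half[OF f2 gb_meas gb_AE]
  define F where "F y = ind C y * (u0 y * D1 y $ 1 + ph1 y * ga y) + ind C y * (u0 y * D2 y $ 2 + ph2 y * gb y)" for y
  have "(LBINT y. ind half_plane y *R F y) = 0"
   unfolding F_def scaleR_add_right using h1 h2 by simp
  moreover have "F \<in> bm borel" unfolding F_def[abs_def] using h1(3) h2(3) by (rule borel_measurable_add)
  ultimately have "(LINT p|lborel2. ind strip p *R (fst p * F (polp x p))) = 0"
   by (subst (asm) integral_polar(1)[OF x_in(2)])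
  also have "(%p. ind strip p *R (fst p * F (polp x p))) =
   (%p. ind R p * (fst p * (V p * (D1 (polp x p) $ 1 + D2 (polp x p) $ 2) + (ph1 (polp x p) * ga (polp x p) + ph2 (polp x p) * gb (polp x p)))))"
  proof
   fix p
   have "polp x p \<in> C \<longleftrightarrow> p \<in> R" if s: "p \<in> strip"
   proof
    assume "polp x p \<in> C"
    then obtain p' where p': "p' \<in> R" "polp x p = polp x p'" by (auto simp: C_def)
    then have "p' \<in> strip" using Rs by auto
    have "rho (polp x p) = fst p" "rho (polp x p') = fst p'" "ang (polp x p) = snd p" "ang (polp x p') = snd p'"
     using s \<open>p' \<in> strip\<close> rho_pol ang_pol by (auto simp: strip_def polp_def)
    then have "p = p'" using p'(2) by (simp add: prod_eq_iff)
    then show "p \<in> R" using p' by simp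
   qed (auto simp: C_def)
   then show "ind strip p *R (fst p * F (polp x p)) = ind R p * (fst p * (V p * (D1 (polp x p) $ 1 + D2 (polp x p) $ 2) + (ph1 (polp x p) * ga (polp x p) + ph2 (polp x p) * gb (polp x p))))"
    using Rs by (cases "p \<in> strip") (auto simp: F_def V_def indicator_def algebra_simps)
  qed
  finally show ?thesis .
 qed
 have comp: "Dr y $ 1 = (y $ 1 - x $ 1) / rho y" "Dr y $ 2 = y $ 2 / rho y" "Da y $ 1 = - y $ 2 / (rho y)^2" "Da y $ 2 = (y $ 1 - x $ 1) / (rho y)^2" for y
  by (simp_all add: Dr_def Da_def axis_def divide_inverse)
 have G1: "GDERIV (%y. \<psi> y * (- 1 * y $ 2)) y :> \<psi> y *R (- 1 *R axis 2 1) + (- 1 * y $ 2) *R D\<psi> y"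
  "GDERIV (%y. \<psi> y * (y $ 1 - x $ 1)) y :> \<psi> y *R axis 1 1 + (y $ 1 - x $ 1) *R D\<psi> y"
  "GDERIV (%y. \<psi> y * y $ 2) y :> \<psi> y *R axis 2 1 + (y $ 2) *R D\<psi> y" if "y \<in> U" for y
  using GDERIV_mult[OF G\<psi>[OF that] GDERIV_mult[OF GDERIV_const[of "-1"] n2]] GDERIV_mult[OF G\<psi>[OF that] n1] GDERIV_mult[OF G\<psi>[OF that] n2] by simp_all
 have on_R: "polp x p \<in> U" "rho (polp x p) = fst p" "ang (polp x p) = snd p" "fst p > 0"
   "polp x p $ 1 - x $ 1 = fst p * cos (snd p)" "polp x p $ 2 = fst p * sin (snd p)" "\<psi> (polp x p) = a (fst p) * \<beta> (snd p)" if "p \<in> R" for p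
  using that Rs rho_pol[of "fst p" "snd p"] ang_pol[of "fst p" "snd p"] pol_in_U[of "fst p" "snd p"] x_in(2)
  by (auto simp: strip_def polp_def \<psi>_def)
 have DX: "D\<psi> (polp x p) $ 1 = a (fst p) * \<beta>' (snd p) * (- sin (snd p) / fst p) + a' (fst p) * \<beta> (snd p) * cos (snd p)"
  "D\<psi> (polp x p) $ 2 = a (fst p) * \<beta>' (snd p) * (cos (snd p) / fst p) + a' (fst p) * \<beta> (snd p) * sin (snd p)" if "p \<in> R" for p
  using on_R[OF that] by (simp_all add: D\<psi>_def comp power2_eq_square)
 have cs: "(cos t)^2 + (sin t)^2 = 1" for t :: real by simp
 have gen: "- (r * s) * (A * (- s / r) + B * c) + (r * c) * (A * (c / r) + B * s) = A * (c^2 + s^2)"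
  "(r * c) * (A * (- s / r) + B * c) + (r * s) * (A * (c / r) + B * s) = r * B * (c^2 + s^2)" if "r ~= 0" for r s c A B :: real
  using that by (simp_all add: field_simps power2_eq_square)
 show "(LINT p|lborel2. ind ({r1..r2} \<times> {t1..t2}) p * (fst p * a (fst p) * (V p * \<beta>' (snd p) + Q p * \<beta> (snd p)))) = 0"
 proof -
  let ?D1 = "%y. \<psi> y *R (- 1 *R axis 2 1) + (- 1 * y $ 2) *R D\<psi> y"
  let ?D2 = "%y. \<psi> y *R axis 1 1 + (y $ 1 - x $ 1) *R D\<psi> y"
  have e: "ind ({r1..r2} \<times> {t1..t2}) p * (fst p * a (fst p) * (V p * \<beta>' (snd p) + Q p * \<beta> (snd p)))
   = ind R p * (fst p * (V p * (?D1 (polp x p) $ 1 + ?D2 (polp x p) $ 2) + (\<psi> (polp x p) * (- 1 * polp x p $ 2) * ga (polp x p) + \<psi> (polp x p) * (polp x p $ 1 - x $ 1) * gb (polp x p))))" for p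
  proof (cases "p \<in> R")
   case True
   have "?D1 (polp x p) $ 1 + ?D2 (polp x p) $ 2 = - (fst p * sin (snd p)) * D\<psi> (polp x p) $ 1 + (fst p * cos (snd p)) * D\<psi> (polp x p) $ 2"
    using on_R(5,6)[OF True] by (simp add: axis_def)
   also have "... = a (fst p) * \<beta>' (snd p) * ((cos (snd p))^2 + (sin (snd p))^2)"
    unfolding DX[OF True] by (rule gen(1)) (use on_R(4)[OF True] in simp)
   finally have d: "?D1 (polp x p) $ 1 + ?D2 (polp x p) $ 2 = a (fst p) * \<beta>' (snd p)" unfolding cs by simp
   show ?thesis unfolding d unfolding R_def[symmetric] Q_def on_R(5,6,7)[OF True] by (simp add: algebra_simps)
  qed (simp add: R_def)
  show ?thesis unfolding e
   by (rule key) (use G1 in "auto intro!: continuous_intros c\<psi> cD\<psi> simp: z\<psi>")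
 qed
 show "(LINT p|lborel2. ind ({r1..r2} \<times> {t1..t2}) p *
   (fst p * \<beta> (snd p) * (V p * (fst p * a' (fst p) + 2 * a (fst p)) + P p * (fst p * a (fst p))))) = 0"
 proof -
  let ?D1 = "%y. \<psi> y *R axis 1 1 + (y $ 1 - x $ 1) *R D\<psi> y"
  let ?D2 = "%y. \<psi> y *R axis 2 1 + (y $ 2) *R D\<psi> y"
  have e: "ind ({r1..r2} \<times> {t1..t2}) p * (fst p * \<beta> (snd p) * (V p * (fst p * a' (fst p) + 2 * a (fst p)) + P p * (fst p * a (fst p))))
   = ind R p * (fst p * (V p * (?D1 (polp x p) $ 1 + ?D2 (polp x p) $ 2) + (\<psi> (polp x p) * (polp x p $ 1 - x $ 1) * ga (polp x p) + \<psi> (polp x p) * polp x p $ 2 * gb (polp x p))))" for p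
  proof (cases "p \<in> R")
   case True
   have "?D1 (polp x p) $ 1 + ?D2 (polp x p) $ 2 = 2 * (a (fst p) * \<beta> (snd p)) + ((fst p * cos (snd p)) * D\<psi> (polp x p) $ 1 + (fst p * sin (snd p)) * D\<psi> (polp x p) $ 2)"
    using on_R(5,6,7)[OF True] by (simp add: axis_def)
   also have "(fst p * cos (snd p)) * D\<psi> (polp x p) $ 1 + (fst p * sin (snd p)) * D\<psi> (polp x p) $ 2 = fst p * (a' (fst p) * \<beta> (snd p)) * ((cos (snd p))^2 + (sin (snd p))^2)"
    unfolding DX[OF True] by (rule gen(2)) (use on_R(4)[OF True] in simp)
   finally have d: "?D1 (polp x p) $ 1 + ?D2 (polp x p) $ 2 = \<beta> (snd p) * (fst p * a' (fst p) + 2 * a (fst p))" unfolding cs by (simp add: algebra_simps)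
   show ?thesis unfolding d unfolding R_def[symmetric] P_def on_R(5,6,7)[OF True] by (simp add: algebra_simps)
  qed (simp add: R_def)
  show ?thesis unfolding e
   by (rule key) (use G1 in "auto intro!: continuous_intros c\<psi> cD\<psi> simp: z\<psi>")
 qed
qed

end

section \<open>The minimizer on almost every circle and ray\<close>

text \<open>Every point of \<open>S\<close> lies in an interval with rational end points on which
  the claim holds almost everywhere, and there are countably many of these. \<open>S\<close> may be
  arbitrary, in particular its measurability is not at issue.\<close>

lemma AE_local:
 fixes P :: "real => bool"
 assumes "!!r0. r0 \<in> S ==> \<exists>\<delta>>0. AE r in lborel. \<bar>r - r0\<bar> < \<delta> --> r \<in> S --> P r"
 shows "AE r in lborel. r \<in> S --> P r"
proof -
 define C where "C = {(a, b). a \<in> \<rat> & b \<in> \<rat> & (AE r\<in>{a<..<b} in lborel. r \<in> S --> P r)}"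
 have "C <= \<rat> \<times> \<rat>" by (auto simp: C_def)
 then have "countable C" using countable_SIGMA[OF countable_rat, of "%_. \<rat>"] countable_rat countable_subset by blast
 then have "AE r in lborel. \<forall>c\<in>C. r \<in> {fst c<..<snd c} --> r \<in> S --> P r"
  by (subst AE_ball_countable) (auto simp: C_def)
 then show ?thesis
 proof eventually_elim
  case (elim r)
  show ?case
  proof
   assume r: "r \<in> S"
   obtain \<delta> where d: "\<delta> > 0" "AE s in lborel. \<bar>s - r\<bar> < \<delta> --> s \<in> S --> P s" using assms[OF r] by blast
   obtain a b where ab: "a \<in> \<rat>" "r - \<delta> < a" "a < r" "b \<in> \<rat>" "r < b" "b < r + \<delta>"
    using Rats_dense_in_real[of "r - \<delta>" r] Rats_dense_in_real[of r "r + \<delta>"] d(1) by auto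
   have "AE s\<in>{a<..<b} in lborel. s \<in> S --> P s"
    using d(2) by eventually_elim (use ab in auto)
   then have "(a, b) \<in> C" using ab by (auto simp: C_def)
   then have "r \<in> {a<..<b} --> r \<in> S --> P r" using elim by fastforce
   then show "P r" using r ab by auto
  qed
 qed
qed

text \<open>The trace condition is stated with the Hausdorff measure on the axis, the slices are
  integrated over the radius. Projection along a half axis is 1-Lipschitz, and the condition
  \<open>sin a0 = 0\<close> covers both half axes.\<close>

lemma lborel_line_le_hausdorff1:
 fixes h :: "real^2 => ennreal"
 assumes h: "h \<in> bm borel" and sc: "sin a0 = 0" and N: "N \<in> sets borel"
  and sub: "!!r. r \<in> {r1<..<r2} ==> pol x r a0 \<in> N"
 shows "(NN r. h (pol x r a0) * ind {r1<..<r2} r) <= (\<integral>\<^sup>+ y \<in> N. h y \<partial>hausdorff1_measure)"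
proof -
 have pm [measurable]: "(%r. pol x r a0) \<in> bm borel"
  by (rule borel_measurable_continuous_onI) (intro continuous_intros)
 have c1: "(cos a0)^2 = 1" using sc by (simp add: cos_squared_eq)
 define M1 where "M1 = distr (density lborel (ind {r1<..<r2})) borel (%r. pol x r a0)"
 have le: "M1 <= hausdorff1_measure"
 proof (subst le_measure)
  show "sets M1 = sets hausdorff1_measure" by (simp add: M1_def)
  show "\<forall>A\<in>sets M1. emeasure M1 A <= emeasure hausdorff1_measure A"
  proof
   fix A assume "A \<in> sets M1"
   then have A: "A \<in> sets borel" by (simp add: M1_def)
   have S: "{r1<..<r2} Int ((%r. pol x r a0) -` A) \<in> sets borel" using measurable_sets[OF pm A] by auto
   have "emeasure M1 A = emeasure lborel ({r1<..<r2} Int ((%r. pol x r a0) -` A))"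
    unfolding M1_def using A S measurable_sets[OF pm A]
    by (subst emeasure_distr) (auto simp: emeasure_density indicator_inter_arith[symmetric])
   also have "... <= ennreal 1 * hausdorff1 A"
   proof (rule lborel_le_hausdorff1_image[where \<delta> = 1 and f = "%y. (y $ 1 - x $ 1) * cos a0"])
    fix y z :: "real^2"
    have "\<bar>(y $ 1 - x $ 1) * cos a0 - (z $ 1 - x $ 1) * cos a0\<bar> = \<bar>(y - z) $ 1\<bar> * \<bar>cos a0\<bar>"
     by (simp add: abs_mult[symmetric] algebra_simps)
    also have "\<bar>cos a0\<bar> = 1" using c1 by (simp only: abs_square_eq_1)
    finally show "\<bar>(y $ 1 - x $ 1) * cos a0 - (z $ 1 - x $ 1) * cos a0\<bar> <= 1 * dist y z"
     using component_le_norm_cart[of "y - z" 1] by (simp add: dist_norm)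
    show "{r1<..<r2} Int ((%r. pol x r a0) -` A) <= (%y. (y $ 1 - x $ 1) * cos a0) ` A"
    proof
     fix r assume r: "r \<in> {r1<..<r2} Int ((%r. pol x r a0) -` A)"
     have "(pol x r a0 $ 1 - x $ 1) * cos a0 = r * (cos a0)^2" by (simp add: power2_eq_square)
     then show "r \<in> (%y. (y $ 1 - x $ 1) * cos a0) ` A" using r c1 by (intro image_eqI[of _ _ "pol x r a0"]) auto
    qed
   qed (use S in auto)
   finally show "emeasure M1 A <= emeasure hausdorff1_measure A" using A by (simp add: emeasure_hausdorff1_measure)
  qed
 qed
 have "(NN r. h (pol x r a0) * ind {r1<..<r2} r) = (NN r. (h (pol x r a0) * ind N (pol x r a0)) * ind {r1<..<r2} r)"
  using sub by (intro nn_integral_cong) (auto simp: indicator_def)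
 also have "... = (\<integral>\<^sup>+ y. h y * ind N y \<partial>M1)"
  unfolding M1_def using h N by (subst nn_integral_distr) (auto simp: nn_integral_density mult.commute)
 also have "... <= (\<integral>\<^sup>+ y \<in> N. h y \<partial>hausdorff1_measure)"
  by (rule nn_integral_mono_measure[OF _ le]) (simp add: M1_def)
 finally show ?thesis .
qed

context crack
begin

text \<open>The primitive of \<open>Q\<close> along a half circle: the absolutely continuous
  function to which \<open>V\<close> will be compared.\<close>

definition \<Psi> where "\<Psi> r t = (LBINT s:{0..t}. Q (r, s))"

text \<open>The first test identity has the weight \<open>r * a r\<close>; taking for
  \<open>a\<close> a bump divided by \<open>r\<close> produces exactly the tests that
  \<open>ACL_rectangle\<close> asks for.\<close>

lemma angular_ACL:
 assumes r: "0 < r1" "r1 < r2" and t: "0 < t1" "t1 < t2" "t2 < pi"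
  and free: "!!r t. r \<in> {r1..r2} ==> t \<in> {t1..t2} ==> pol x r t ~: K"
 shows "AE r\<in>{r1<..<r2} in lborel. (\<exists>c. AE t\<in>{t1<..<t2} in lborel. V (r, t) = c + (LBINT s:{t1..t}. Q (r, s)))"
proof (rule ACL_rectangle[OF t(2)])
 note pt = polar_test_general[OF r t free]
 note zero = pt(3-5)[of "%_. 0" "%_. 0" "%_. 0" "%_. 0"]
 show "integrable lborel2 (%p. ind ({r1..r2} \<times> {t1..t2}) p * V p)"
  "integrable lborel2 (%p. ind ({r1..r2} \<times> {t1..t2}) p * Q p)"
  using zero by auto
 fix n a b and \<beta> \<beta>' :: "real => real"
 assume ab: "r1 < a" "a < b" "b < r2" and b: "!!t. (\<beta> has_real_derivative \<beta>' t) (at t)" "continuous_on UNIV \<beta>'"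
  "!!t. t ~: {t1..t2} ==> \<beta> t = 0" "!!t. t ~: {t1..t2} ==> \<beta>' t = 0"
 have z: "bump n a b r = 0" "bump' n a b r = 0" if "r ~: {a<..<b}" for r
  using that by (auto simp: bump_eq_0 bump'_def sqpos_def max_def)
 note C1 = divide_by_id_C1[of r1 "bump n a b" "bump' n a b", OF r(1) DERIV_bump]
 have "(LINT p|lborel2. ind ({r1..r2} \<times> {t1..t2}) p * (fst p * (bump n a b (fst p) / fst p) * (V p * \<beta>' (snd p) + Q p * \<beta> (snd p)))) = 0"
  by (rule pt(1)[OF _ _ C1]) (use ab z b in "auto intro!: continuous_intros")
 moreover have "ind ({r1..r2} \<times> {t1..t2}) p * (fst p * (bump n a b (fst p) / fst p) * (V p * \<beta>' (snd p) + Q p * \<beta> (snd p)))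
  = ind ({r1..r2} \<times> {t1..t2}) p * (bump n a b (fst p) * (V p * \<beta>' (snd p) + Q p * \<beta> (snd p)))" for p
  using r by (auto simp: indicator_def)
 ultimately show "(LINT p|lborel2. ind ({r1..r2} \<times> {t1..t2}) p * (bump n a b (fst p) * (V p * \<beta>' (snd p) + Q p * \<beta> (snd p)))) = 0"
  by (simp only:)
qed

text \<open>With \<open>a = \<beta> / r^2\<close> the weights of the second test identity cancel:
  \<open>r * (r * a' + 2 * a) = \<beta>'\<close> and \<open>r * (r * a) = \<beta>\<close>. Then
  \<open>ACL_rectangle\<close> is applied with the two variables exchanged.\<close>

lemma radial_ACL:
 assumes r: "0 < r1" "r1 < r2" and t: "0 < t1" "t1 < t2" "t2 < pi"
  and free: "!!r t. r \<in> {r1..r2} ==> t \<in> {t1..t2} ==> pol x r t ~: K"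
 shows "AE t\<in>{t1<..<t2} in lborel. (\<exists>c. AE r\<in>{r1<..<r2} in lborel. V (r, t) = c + (LBINT s:{r1..r}. P (s, t)))"
proof -
 note pt = polar_test_general[OF r t free]
 note zero = pt(3-5)[of "%_. 0" "%_. 0" "%_. 0" "%_. 0"]
 have sw: "ind ({t1..t2} \<times> {r1..r2}) (b, a) = (ind ({r1..r2} \<times> {t1..t2}) (a, b) :: real)" for a b
  by (auto simp: indicator_def)
 have "AE t\<in>{t1<..<t2} in lborel. (\<exists>c. AE r in lborel. r \<in> {r1<..<r2} -->
  (case (t, r) of (t, r) => V (r, t)) = c + (LBINT s:{r1..r}. (case (t, s) of (t, s) => P (s, t))))"
 proof (rule ACL_rectangle[OF r(2)])
  have z: "integrable lborel2 (%p. ind ({r1..r2} \<times> {t1..t2}) p * V p)"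
   "integrable lborel2 (%p. ind ({r1..r2} \<times> {t1..t2}) p * P p)" using zero by auto
  show "integrable lborel2 (%p. ind ({t1..t2} \<times> {r1..r2}) p * (case p of (t, r) => V (r, t)))"
   using lborel_pair.integrable_product_swap[OF z(1)] by (simp add: case_prod_unfold indicator_times mult_ac)
  show "integrable lborel2 (%p. ind ({t1..t2} \<times> {r1..r2}) p * (case p of (t, r) => P (r, t)))"
   using lborel_pair.integrable_product_swap[OF z(2)] by (simp add: case_prod_unfold indicator_times mult_ac)
  fix n a b and \<beta> \<beta>' :: "real => real"
  assume ab: "t1 < a" "a < b" "b < t2" and b: "!!t. (\<beta> has_real_derivative \<beta>' t) (at t)" "continuous_on UNIV \<beta>'"
   "!!t. t ~: {r1..r2} ==> \<beta> t = 0" "!!t. t ~: {r1..r2} ==> \<beta>' t = 0"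
  have z: "bump n a b r = 0" "bump' n a b r = 0" if "r ~: {a<..<b}" for r
   using that by (auto simp: bump_eq_0 bump'_def sqpos_def max_def)
  have C1: "((%r. \<beta> r / r) has_real_derivative (\<beta>' r / r - \<beta> r / r^2)) (at r)" "continuous_on UNIV (%r. \<beta>' r / r - \<beta> r / r^2)" for r
   using divide_by_id_C1[of r1 \<beta> \<beta>', OF r(1) b(1,2)] b(3,4) by auto
  have C2: "((%r. \<beta> r / r / r) has_real_derivative ((\<beta>' r / r - \<beta> r / r^2) / r - \<beta> r / r / r^2)) (at r)"
   "continuous_on UNIV (%r. (\<beta>' r / r - \<beta> r / r^2) / r - \<beta> r / r / r^2)" for r
   using divide_by_id_C1[of r1 "%r. \<beta> r / r" "%r. \<beta>' r / r - \<beta> r / r^2", OF r(1) C1] b(3,4) by auto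
  define F where "F p = ind ({r1..r2} \<times> {t1..t2}) p * (bump n a b (snd p) * (V p * \<beta>' (fst p) + P p * \<beta> (fst p)))" for p
  have e: "ind ({r1..r2} \<times> {t1..t2}) p * (fst p * bump n a b (snd p) * (V p * (fst p * ((\<beta>' (fst p) / fst p - \<beta> (fst p) / (fst p)^2) / fst p - \<beta> (fst p) / fst p / (fst p)^2)
   + 2 * (\<beta> (fst p) / fst p / fst p)) + P p * (fst p * (\<beta> (fst p) / fst p / fst p)))) = F p" for p
  proof (cases "p \<in> {r1..r2} \<times> {t1..t2}")
   case True
   then have "fst p ~= 0" using r by auto
   then show ?thesis using True by (simp add: F_def field_simps power2_eq_square)
  qed (simp add: F_def)
  have i1: "(LINT p|lborel2. F p) = 0"
   unfolding e[symmetric]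
  proof (rule pt(2)[OF _ _ C2 _ _ DERIV_bump])
   show "continuous_on UNIV (bump' n a b)" by (intro continuous_intros)
   fix t assume "t ~: {t1..t2}"
   then have "t ~: {a<..<b}" using ab by auto
   then show "bump n a b t = 0" "bump' n a b t = 0" using z by blast+
  next
   fix r assume "r ~: {r1..r2}"
   then have "\<beta> r = 0" "\<beta>' r = 0" using b(3,4) by blast+
   then show "\<beta> r / r / r = 0" "(\<beta>' r / r - \<beta> r / r^2) / r - \<beta> r / r / r^2 = 0" by simp_all
  qed
  have "F \<in> bm lborel2"
  proof -
   have m: "\<beta> \<in> bm borel" "\<beta>' \<in> bm borel"
    using DERIV_continuous_on[of UNIV \<beta> \<beta>'] b(1,2) by (auto intro: borel_measurable_continuous_onI)
   have "{r1..r2} \<times> {t1..t2} \<in> sets lborel2" by (intro pair_measureI) auto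
   then show ?thesis unfolding F_def[abs_def] using m by measurable
  qed
  from lborel_pair.integral_product_swap[OF this]
  have "(LINT p|lborel2. (case p of (t, r) => F (r, t))) = 0" using i1 by simp
  then show "(LINT p|lborel2. ind ({t1..t2} \<times> {r1..r2}) p * (bump n a b (fst p) *
   ((case p of (t, r) => V (r, t)) * \<beta>' (snd p) + (case p of (t, r) => P (r, t)) * \<beta> (snd p)))) = 0"
   by (simp add: F_def case_prod_unfold indicator_times mult_ac)
 qed
 then show ?thesis by simp
qed

lemma slice_measurable [measurable]:
 "(%t. V (r, t)) \<in> bm borel" "(%t. P (r, t)) \<in> bm borel" "(%t. Q (r, t)) \<in> bm borel"
 "(%r. V (r, t)) \<in> bm borel" "(%r. P (r, t)) \<in> bm borel" "(%r. Q (r, t)) \<in> bm borel"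
 using measurable_Pair2[OF VPQ_meas(1), of r] measurable_Pair2[OF VPQ_meas(2), of r] measurable_Pair2[OF VPQ_meas(3), of r]
  measurable_Pair1[OF VPQ_meas(1), of t] measurable_Pair1[OF VPQ_meas(2), of t] measurable_Pair1[OF VPQ_meas(3), of t] by auto

lemma En_nonneg: "En p >= 0" by (simp add: En_def)

lemma En_meas [measurable]: "En \<in> bm lborel2"
 unfolding En_def[abs_def] by measurable

text \<open>The energy per radius without the Jacobian, extended-real valued because its finiteness
  holds only at almost every radius.\<close>

definition ee :: "real => ennreal" where "ee r = (NN t. ennreal (En (r, t)) * ind {0<..<pi} t)"

lemma ee_meas [measurable]: "ee \<in> bm borel"
proof -
 have "{0<..<pi} \<in> sets (borel :: real measure)" by simp
 then have "(%r. NN t. ennreal (En (r, t)) * ind {0<..<pi} t) \<in> bm lborel" by measurable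
 then show ?thesis by (simp add: ee_def[abs_def])
qed

lemma dirichlet_ball: "dirichlet (ball x R) = (NN r. ennreal r * ee r * ind {0<..<R} r)"
proof -
 have "dirichlet (ball x R) = (NP p. ennreal (fst p * En p) * ind strip p * ind (ball x R) (polp x p))"
  by (rule dirichlet_polar) simp
 also have "... = (NP p. ennreal (fst p * En p) * ind ({0<..<R} \<times> {0<..<pi}) p)"
  by (intro nn_integral_cong) (auto simp: strip_def indicator_def polp_def dist_pol)
 also have "... = (NN r. NN t. ennreal (fst (r, t) * En (r, t)) * ind ({0<..<R} \<times> {0<..<pi}) (r, t))"
 proof -
  have "{0<..<R} \<times> {0<..<pi} \<in> sets lborel2" by (intro pair_measureI) auto
  then show ?thesis by (subst lborel.nn_integral_fst[symmetric]) (auto intro!: borel_measurable_times_ennreal measurable_compose[OF _ measurable_ennreal])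
 qed
 also have "... = (NN r. ennreal r * ee r * ind {0<..<R} r)"
 proof (rule nn_integral_cong)
  fix r
  show "(NN t. ennreal (fst (r, t) * En (r, t)) * ind ({0<..<R} \<times> {0<..<pi}) (r, t)) = ennreal r * ee r * ind {0<..<R} r"
  proof (cases "r \<in> {0<..<R}")
   case True
   have "(NN t. ennreal (fst (r, t) * En (r, t)) * ind ({0<..<R} \<times> {0<..<pi}) (r, t)) = (NN t. ennreal r * (ennreal (En (r, t)) * ind {0<..<pi} t))"
    using True En_nonneg by (intro nn_integral_cong) (auto simp: indicator_times ennreal_mult mult_ac)
   also have "... = ennreal r * ee r" unfolding ee_def by (rule nn_integral_cmult) measurable
   finally show ?thesis using True by simp
  qed (auto simp: indicator_def)
 qed
 finally show ?thesis .
qed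

lemma ee_finite: "AE r in lborel. r > 0 --> ee r < \<infinity>"
proof -
 have "AE r in lborel. \<forall>n::nat. ennreal r * ee r * ind {0<..<real n} r ~= \<infinity>"
  unfolding AE_all_countable
 proof
  fix n :: nat
  have "(NN r. ennreal r * ee r * ind {0<..<real n} r) < \<infinity>"
   unfolding dirichlet_ball[symmetric] by (rule finite_bounded) simp
  then show "AE r in lborel. ennreal r * ee r * ind {0<..<real n} r ~= \<infinity>"
   by (intro nn_integral_PInf_AE) auto
 qed
 then show ?thesis
 proof eventually_elim
  case (elim r)
  show ?case
  proof
   assume r: "r > 0"
   obtain n where "r < real n" using reals_Archimedean2 by blast
   then have "ennreal r * ee r ~= \<infinity>" using elim r by (auto dest!: spec[of _ n] simp: indicator_def)
   then show "ee r < \<infinity>" using r by (auto simp: ennreal_mult_eq_top_iff less_top)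
  qed
 qed
qed

lemma slice_squares:
 assumes r: "r > 0" and e: "ee r < \<infinity>"
 shows "sint {0..pi} (%t. (P (r, t))^2)" "sint {0..pi} (%t. (Q (r, t))^2)"
  "ee r = ennreal ((LBINT t:{0..pi}. (P (r, t))^2) + (LBINT t:{0..pi}. (Q (r, t))^2) / r^2)"
proof -
 define f where "f t = En (r, t) * ind {0<..<pi} t" for t
 have eef: "ee r = (NN t. ennreal (f t))"
  unfolding ee_def f_def using En_nonneg by (intro nn_integral_cong) (auto simp: indicator_def)
 have fm: "f \<in> bm lborel" unfolding f_def[abs_def] En_def by measurable
 have fi: "integrable lborel f" using e fm En_nonneg unfolding eef by (intro integrableI_nonneg) (auto simp: f_def)
 have ends: "AE t in lborel. t ~= 0 & t ~= pi" using AE_lborel_singleton[of 0] AE_lborel_singleton[of pi] by eventually_elim auto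
 show ip: "sint {0..pi} (%t. (P (r, t))^2)" unfolding sintegrable_def
 proof (rule bochner_bound[OF fi])
  show "AE t in lborel. norm (ind {0..pi} t *R (P (r, t))^2) <= norm (f t)"
   using ends by eventually_elim (auto simp: f_def En_def indicator_def)
 qed measurable
 show iq: "sint {0..pi} (%t. (Q (r, t))^2)" unfolding sintegrable_def
 proof (rule bochner_bound)
  show "integrable lborel (%t. r^2 * f t)" using fi by simp
  show "AE t in lborel. norm (ind {0..pi} t *R (Q (r, t))^2) <= norm (r^2 * f t)"
   using ends by eventually_elim (use r in "auto simp: f_def En_def indicator_def field_simps")
 qed measurable
 have "ee r = ennreal (LBINT t. f t)" unfolding eef by (rule nn_integral_eq_integral[OF fi]) (use En_nonneg in "auto simp: f_def")
 also have "(LBINT t. f t) = (LBINT t:{0..pi}. (P (r, t))^2 + (Q (r, t))^2 / r^2)"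
  unfolding LBINT_def
 proof (rule integral_cong_AE)
  show "AE t in lborel. f t = ind {0..pi} t *R ((P (r, t))^2 + (Q (r, t))^2 / r^2)"
   using ends by eventually_elim (auto simp: f_def En_def indicator_def)
 qed (use fm in measurable)
 also have "... = (LBINT t:{0..pi}. (P (r, t))^2) + (LBINT t:{0..pi}. (Q (r, t))^2) / r^2"
  using ip iq by (subst set_integral_add(2)) auto
 finally show "ee r = ennreal ((LBINT t:{0..pi}. (P (r, t))^2) + (LBINT t:{0..pi}. (Q (r, t))^2) / r^2)" .
qed

end

lemma AE_obtain:
 assumes "AE t in lborel. P t" "a < (b::real)" obtains t where "a < t" "t < b" "P t"
proof (rule ccontr)
 assume n: "\<not> thesis"
 have "AE t in lborel. t ~: {a<..<b}" using assms(1) by eventually_elim (use n that in auto)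
 then have "{a<..<b} \<in> null_sets lborel" by (subst AE_iff_null_sets) auto
 then show False using assms(2) by (simp add: null_sets_def)
qed

lemma DERIV_along_arc:
 assumes "C1_gradient f Df"
 shows "((%t. f (pol x r t)) has_real_derivative (r * (Df (pol x r t) $ 2 * cos t - Df (pol x r t) $ 1 * sin t))) (at t)"
proof -
 have pol_alt: "pol x r t = x + (r * cos t) *R axis 1 1 + (r * sin t) *R axis 2 1" for t
  by (simp add: vec_eq_iff forall_2 axis_def)
 have 1: "((%t. pol x r t) has_derivative (%h. (- (r * sin t) * h) *R axis 1 1 + ((r * cos t) * h) *R axis 2 1)) (at t)"
  unfolding pol_alt by (auto intro!: derivative_eq_intros simp: fun_eq_iff algebra_simps)
 have "(f has_derivative (%h. h \<bullet> Df (pol x r t))) (at (pol x r t))"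
  using assms unfolding C1_gradient_def gderiv_def by blast
 from has_derivative_compose[OF 1 this] show ?thesis
  unfolding has_field_derivative_def
  by (elim back_subst[of "%D. (_ has_derivative D) _"]) (simp add: fun_eq_iff inner_add_left inner_commute[of "axis _ _"] cart_eq_inner_axis[symmetric] algebra_simps)
qed

lemma square_sum3_le: "(a + b + c)^2 <= 3 * a^2 + 3 * b^2 + 3 * (c::real)^2"
proof -
 have "3 * a^2 + 3 * b^2 + 3 * c^2 - (a + b + c)^2 = (a - b)^2 + (b - c)^2 + (a - c)^2"
  by (simp add: power2_eq_square algebra_simps)
 moreover have "... >= 0" by simp
 ultimately show ?thesis by linarith
qed

lemma swap_meas:
 assumes "f \<in> bm lborel2"
 shows "(%p. f (snd p, fst p)) \<in> bm (lborel \<Otimes>\<^sub>M (lborel :: real measure))"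
 by (rule measurable_compose[OF _ assms]) measurable

lemma indefinite_meas:
 assumes "f \<in> bm lborel2"
 shows "(%p. LBINT s:{a..snd p}. (f (fst p, s) :: real)) \<in> bm (lborel \<Otimes>\<^sub>M (lborel :: real measure))"
proof -
 have "(%(p, s). f (fst p, s)) \<in> bm (lborel2 \<Otimes>\<^sub>M lborel)"
  unfolding case_prod_unfold by (rule measurable_compose[OF _ assms]) measurable
 moreover have "(%(p :: real \<times> real, s). ind {a..snd p} s :: real) = (%(p, s). if a <= s & s <= snd p then 1 else 0)"
  by (auto simp: fun_eq_iff indicator_def)
 then have "(%(p :: real \<times> real, s). ind {a..snd p} s :: real) \<in> bm (lborel2 \<Otimes>\<^sub>M lborel)" by simp
 ultimately have "(%(p, s). ind {a..snd p} s *R f (fst p, s)) \<in> bm (lborel2 \<Otimes>\<^sub>M lborel)"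
  using borel_measurable_scaleR by (fastforce simp: case_prod_unfold)
 then show ?thesis unfolding LBINT_def by (rule lborel.borel_measurable_lebesgue_integral)
qed

context crack
begin

lemma \<Psi>_meas [measurable]: "(%p. \<Psi> (fst p) (snd p)) \<in> bm lborel2"
 unfolding \<Psi>_def by (rule indefinite_meas[OF VPQ_meas(3)])

lemma \<Psi>_ac:
 assumes "r > 0" "ee r < \<infinity>" shows "ac 0 pi (\<Psi> r) (%t. Q (r, t))"
 unfolding \<Psi>_def[abs_def]
 by (rule ac_indefinite, rule set_integrable_of_square) (use slice_squares(2)[OF assms] in auto)

text \<open>The increment of a C1 function along an arc and that of \<open>\<Psi>\<close> are both
  integrals over the arc; Cauchy-Schwarz bounds their difference by the square integral of the
  difference \<open>q\<close> of the angular derivatives.\<close>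

lemma arc_increment:
 assumes r: "r > 0" "ee r < \<infinity>" and f: "C1_gradient f Df" and c: "0 <= c0" "c1 <= pi" "a0 \<in> {c0..c1}" "t \<in> {c0..c1}"
 defines "q \<equiv> %s. r * (Df (pol x r s) $ 2 * cos s - Df (pol x r s) $ 1 * sin s) - Q (r, s)"
 shows "(f (pol x r t) - f (pol x r a0) - (\<Psi> r t - \<Psi> r a0))^2 <= pi * (LBINT s:{c0..c1}. (q s)^2)"
  and "sint {c0..c1} (%s. (q s)^2)"
proof -
 define df where "df s = r * (Df (pol x r s) $ 2 * cos s - Df (pol x r s) $ 1 * sin s)" for s
 have cD: "continuous_on UNIV df"
 proof -
  have "continuous_on UNIV Df" using f by (simp add: C1_gradient_def)
  then have "continuous_on UNIV (%s. Df (pol x r s))" by (rule continuous_on_compose2) (auto intro!: continuous_intros)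
  then show ?thesis unfolding df_def[abs_def] by (intro continuous_intros)
 qed
 have cm: "df \<in> bm borel" using cD by (rule borel_measurable_continuous_onI)
 have ac1: "ac 0 pi (%t. f (pol x r t)) df"
  by (rule ac_C1) (use DERIV_along_arc[OF f] continuous_on_subset[OF cD] in "auto simp: df_def")
 have qd: "q s = df s - Q (r, s)" for s by (simp add: q_def df_def)
 have qm: "q \<in> bm borel" unfolding qd using cm by measurable
 have i2: "sint {0..pi} (%s. (q s)^2)"
  unfolding sintegrable_def
 proof (rule bochner_bound)
  have "sint {0..pi} (%s. 2 * (df s)^2 + 2 * (Q (r, s))^2)"
   by (intro set_integral_add set_integrable_mult_right slice_squares(2)[OF r] borel_integrable_atLeastAtMost' continuous_intros continuous_on_subset[OF cD]) auto
  then show "integrable lborel (%s. ind {0..pi} s *R (2 * (df s)^2 + 2 * (Q (r, s))^2))" by (simp add: sintegrable_def)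
  have "(q s)^2 <= 2 * (df s)^2 + 2 * (Q (r, s))^2" for s
   using norm_add_sq_le[of "df s" "- Q (r, s)"] by (simp add: qd)
  then show "AE s in lborel. norm (ind {0..pi} s *R (q s)^2) <= norm (ind {0..pi} s *R (2 * (df s)^2 + 2 * (Q (r, s))^2))"
   by (intro AE_I2) (auto simp: indicator_def)
 qed (use qm in measurable)
 show i: "sint {c0..c1} (%s. (q s)^2)" by (rule set_integrable_subset[OF i2]) (use c in auto)
 have i1: "sint {0..pi} df" "sint {0..pi} (%s. Q (r, s))"
  using ac_integrable[OF ac1] ac_integrable[OF \<Psi>_ac[OF r]] by auto
 have main: "(f (pol x r b) - f (pol x r a) - (\<Psi> r b - \<Psi> r a))^2 <= pi * (LBINT s:{c0..c1}. (q s)^2)"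
  if ab: "c0 <= a" "a <= b" "b <= c1" for a b
 proof -
  have "f (pol x r b) - f (pol x r a) = (LBINT s:{a..b}. df s)"
   by (rule ac_diff[OF ac1]) (use ab c in auto)
  moreover have "\<Psi> r b - \<Psi> r a = (LBINT s:{a..b}. Q (r, s))"
   by (rule ac_diff[OF \<Psi>_ac[OF r]]) (use ab c in auto)
  moreover have "(LBINT s:{a..b}. df s - Q (r, s)) = (LBINT s:{a..b}. df s) - (LBINT s:{a..b}. Q (r, s))"
   by (rule set_integral_diff(2)) (use ab c in "auto intro!: set_integrable_subset[OF i1(1)] set_integrable_subset[OF i1(2)]")
  ultimately have e: "f (pol x r b) - f (pol x r a) - (\<Psi> r b - \<Psi> r a) = (LBINT s:{a..b}. 1 * q s)" by (simp add: qd)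
  have iab: "sint {a..b} (%s. (q s)^2)" by (rule set_integrable_subset[OF i]) (use ab in auto)
  have "(LBINT s:{a..b}. 1 * q s)^2 <= (LBINT s:{a..b}. 1^2) * (LBINT s:{a..b}. (q s)^2)"
   by (rule Cauchy_Schwarz_set_integral) (use qm iab set_integrable_const_Icc in auto)
  also have "(LBINT s:{a..b}. 1^2) = b - a" using ab by (simp add: LBINT_def)
  also have "(b - a) * (LBINT s:{a..b}. (q s)^2) <= pi * (LBINT s:{c0..c1}. (q s)^2)"
   using ab c by (intro mult_mono set_integral_mono_set[OF i]) (auto simp: LBINT_def intro!: integral_nonneg_AE)
  finally show ?thesis unfolding e .
 qed
 show "(f (pol x r t) - f (pol x r a0) - (\<Psi> r t - \<Psi> r a0))^2 <= pi * (LBINT s:{c0..c1}. (q s)^2)"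
 proof (cases "a0 <= t")
  case True then show ?thesis using main[of a0 t] c by auto
 next
  case False
  have "(f (pol x r t) - f (pol x r a0) - (\<Psi> r t - \<Psi> r a0))^2 = (f (pol x r a0) - f (pol x r t) - (\<Psi> r a0 - \<Psi> r t))^2"
   by (simp add: power2_eq_square algebra_simps)
  then show ?thesis using main[of t a0] c False by auto
 qed
qed

text \<open>This is how the zero trace enters. With an approximant \<open>v n\<close>, the
  difference of \<open>V\<close> and \<open>\<Psi> r t - \<Psi> r a0\<close> splits into the error
  of \<open>v n\<close>, its value on the axis and the difference of the increments along the arc.
  Integrated over the radii, each is controlled by a quantity that tends to zero by
  \<open>has_trace\<close>, while \<open>Z\<close> does not depend on \<open>n\<close>.\<close>

lemma boundary_slice:
 assumes a0: "a0 = 0 \<or> a0 = pi" and r0: "r0 > 0" and nK: "pol x r0 a0 ~: K"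
 obtains \<delta> th0 where "\<delta> > 0" "th0 > 0"
  "AE r in lborel. \<bar>r - r0\<bar> < \<delta> --> (AE t in lborel. t \<in> {0<..<pi} & \<bar>t - a0\<bar> < th0 --> V (r, t) = \<Psi> r t - \<Psi> r a0)"
proof -
 have sa: "sin a0 = 0" using a0 by auto
 define y0 where "y0 = pol x r0 a0"
 have "y0 \<in> frontier U - K" using nK sa x_in(2) by (simp add: y0_def U_simps)
 then obtain \<rho> v Dv where rho: "\<rho> > 0" "ball y0 \<rho> Int K = {}" and v: "!!n::nat. C1_gradient (v n) (Dv n)"
  and E0: "(%n. \<integral>\<^sup>+ y \<in> ball y0 \<rho> Int U. ennreal ((v n y - u y)^2 + (norm (Dv n y - g y))^2) \<partial>lebesgue) \<longlonglongrightarrow> 0"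
  and T0: "(%n. \<integral>\<^sup>+ y \<in> ball y0 \<rho> Int frontier U. ennreal ((v n y - 0)^2) \<partial>hausdorff1_measure) \<longlonglongrightarrow> 0"
  using trace unfolding has_trace_def g_def by blast
 \<comment> \<open>These sizes keep the polar rectangle in \<open>ball y0 \<rho>\<close>:
   \<open>3 / 8 * \<rho>\<close> is spent on the angle and \<open>\<rho> / 4\<close> on the
   radius.\<close>
 define \<delta> where "\<delta> = min (\<rho> / 4) (r0 / 2)"
 define th0 where "th0 = min 1 (\<rho> / (4 * r0))"
 have d: "\<delta> > 0" "\<delta> <= \<rho> / 4" "\<delta> <= r0 / 2" "th0 > 0" "th0 <= 1" "r0 * th0 <= \<rho> / 4"
  using rho r0 by (auto simp: \<delta>_def th0_def min_def field_simps)
 define r1 r2 c0 c1 where "r1 = r0 - \<delta>" and "r2 = r0 + \<delta>" and "c0 = max 0 (a0 - th0)" and "c1 = min pi (a0 + th0)"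
 have r12: "0 < r1" "r1 < r2" using d r0 by (auto simp: r1_def r2_def)
 have c: "0 <= c0" "c1 <= pi" "a0 \<in> {c0..c1}" "c0 < c1" using a0 d pi_gt3 by (auto simp: c0_def c1_def)
 have inball: "pol x r t \<in> ball y0 \<rho>" if "r \<in> {r1<..<r2}" "t \<in> {c0..c1}" for r t
 proof -
  have "dist (pol x r t) (pol x r a0) <= r * \<bar>t - a0\<bar>" using that r12 by (intro dist_pol_le) auto
  also have "... <= (3 / 2 * r0) * th0" using that r12 d by (intro mult_mono) (auto simp: c0_def c1_def r2_def)
  also have "... <= 3 / 8 * \<rho>" using d by (simp add: field_simps)
  finally have 1: "dist (pol x r t) (pol x r a0) <= 3 / 8 * \<rho>" .
  have "(dist (pol x r a0) y0)^2 = (r - r0)^2" unfolding y0_def dist_pol_sq by simp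
  then have "dist (pol x r a0) y0 = \<bar>r - r0\<bar>" by (metis power2_abs power2_eq_iff_nonneg abs_ge_zero zero_le_dist)
  also have "\<bar>r - r0\<bar> <= \<delta>" using that by (auto simp: r1_def r2_def)
  also have "\<delta> <= \<rho> / 4" by (rule d)
  finally show ?thesis using 1 dist_triangle[of "pol x r t" y0 "pol x r a0"] rho by (simp add: dist_commute)
 qed
 define q where "q n r t = r * (Dv n (pol x r t) $ 2 * cos t - Dv n (pol x r t) $ 1 * sin t) - Q (r, t)" for n r t
 define S where "S = {c0<..<c1}"
 \<comment> \<open>\<open>1 / r1\<close> undoes the Jacobian and \<open>r2^2\<close> pays for the
   factor \<open>r\<close> in the angular derivative. \<open>C'\<close> collects the coefficients
   \<open>3\<close>, \<open>3 * pi\<close> and \<open>3 * pi * pi\<close> of the three-term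
   splitting.\<close>
 define C where "C = (1 + r2^2) / r1"
 define C' where "C' = 3 + 3 * pi + 3 * pi * pi"
 define En' where "En' n = (\<integral>\<^sup>+ y \<in> ball y0 \<rho> Int U. ennreal ((v n y - u y)^2 + (norm (Dv n y - g y))^2) \<partial>lebesgue)" for n
 define Tn where "Tn n = (\<integral>\<^sup>+ y \<in> ball y0 \<rho> Int frontier U. ennreal ((v n y - 0)^2) \<partial>hausdorff1_measure)" for n
 have vm [measurable]: "v n \<in> bm borel" for n
  by (rule borel_measurable_continuous_onI) (rule C1_gradient_continuous[OF v])
 have Dvm0: "Dv n \<in> bm borel" for n
  by (rule borel_measurable_continuous_onI) (use v in "simp add: C1_gradient_def")
 have Dvm [measurable]: "(%y. Dv n y $ i) \<in> bm borel" for n i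
  using borel_measurable_inner[OF Dvm0 measurable_const[of "axis i 1"]] by (simp add: cart_eq_inner_axis)
 have qm [measurable]: "(%p. q n (fst p) (snd p)) \<in> bm lborel2" for n
 proof -
  have "(%p. Dv n (polp x p) $ i) \<in> bm lborel2" for i
   by (rule measurable_compose[OF measurable_polp Dvm])
  then show ?thesis unfolding q_def[abs_def] polp_def by simp
 qed
 have vpm [measurable]: "(%p. v n (polp x p)) \<in> bm lborel2" for n
  by (rule measurable_compose[OF measurable_polp vm])
 define A where "A n p = ennreal ((v n (polp x p) - V p)^2 + (q n (fst p) (snd p))^2)" for n p
 have Am [measurable]: "A n \<in> bm lborel2" for n unfolding A_def[abs_def] by measurable
 have Bs: "{r1<..<r2} \<times> S \<in> sets lborel2" unfolding S_def by (intro pair_measureI) auto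
 have Sm [measurable]: "S \<in> sets borel" by (simp add: S_def)
 have energy: "(NN r. (NN t. A n (r, t) * ind S t) * ind {r1<..<r2} r) <= ennreal C * En' n" for n
 proof -
  define F where "F y = ennreal ((v n y - u0 y)^2 + ((Dv n y $ 1 - ga y)^2 + (Dv n y $ 2 - gb y)^2)) * ind (ball y0 \<rho>) y" for y
  have "ball y0 \<rho> \<in> sets borel" by simp
  then have Fm: "F \<in> bm borel" unfolding F_def[abs_def] by measurable
  have "En' n = (\<integral>\<^sup>+ y. F y * ind half_plane y \<partial>lebesgue)"
   unfolding En'_def
  proof (rule nn_integral_cong_AE)
   show "AE y in lebesgue. ennreal ((v n y - u y)^2 + (norm (Dv n y - g y))^2) * ind (ball y0 \<rho> Int U) y = F y * ind half_plane y"
    using u0_AE ga_AE gb_AE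
   proof eventually_elim
    case (elim y)
    show ?case
    proof (cases "y \<in> ball y0 \<rho> Int U")
     case True
     then have "y \<in> U - K" "y \<in> half_plane" using rho U_half_plane by auto
     then show ?thesis using elim True by (simp add: F_def norm_vec2_sq del: ennreal_plus)
    qed (auto simp: F_def U_half_plane indicator_def)
   qed
  qed
  also have "... = (NN y. F y * ind half_plane y)" by (rule nn_integral_completion)
  also have "... = (NP p. (ennreal (fst p) * ind strip p) * F (polp x p))"
   by (rule nn_integral_polar[OF x_in(2) Fm])
  finally have e: "En' n = (NP p. (ennreal (fst p) * ind strip p) * F (polp x p))" .
  have "(NN r. (NN t. A n (r, t) * ind S t) * ind {r1<..<r2} r) = (NN r. NN t. A n (r, t) * ind ({r1<..<r2} \<times> S) (r, t))"
   by (intro nn_integral_cong) (auto simp: indicator_def)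
  also have "... = (NP p. A n p * ind ({r1<..<r2} \<times> S) p)"
   using Bs by (intro lborel.nn_integral_fst) auto
  also have "... <= (NP p. ennreal C * ((ennreal (fst p) * ind strip p) * F (polp x p)))"
  proof (rule nn_integral_mono)
   fix p
   show "A n p * ind ({r1<..<r2} \<times> S) p <= ennreal C * ((ennreal (fst p) * ind strip p) * F (polp x p))"
   proof (cases "p \<in> {r1<..<r2} \<times> S")
    case True
    then have r: "fst p \<in> {r1<..<r2}" "snd p \<in> {c0<..<c1}" by (auto simp: S_def)
    then have "p \<in> strip" using r12 c by (auto simp: strip_def mem_Times_iff)
    moreover have "polp x p \<in> ball y0 \<rho>" using inball[of "fst p" "snd p"] r by (simp add: polp_def)
    moreover have "(v n (polp x p) - V p)^2 + (q n (fst p) (snd p))^2 <= C * (fst p * ((v n (polp x p) - u0 (polp x p))^2 + ((Dv n (polp x p) $ 1 - ga (polp x p))^2 + (Dv n (polp x p) $ 2 - gb (polp x p))^2)))"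
    proof -
     define a d1 d2 cc ss rr where "a = v n (polp x p) - u0 (polp x p)" and "d1 = Dv n (polp x p) $ 1 - ga (polp x p)" and "d2 = Dv n (polp x p) $ 2 - gb (polp x p)"
      and "cc = cos (snd p)" and "ss = sin (snd p)" and "rr = fst p"
     have "q n (fst p) (snd p) = rr * (d2 * cc - d1 * ss)"
      by (simp add: q_def Q_def d1_def d2_def cc_def ss_def rr_def polp_def algebra_simps)
     moreover have "(d2 * cc - d1 * ss)^2 <= d1^2 + d2^2"
     proof -
      have "cc^2 + ss^2 = 1" by (simp add: cc_def ss_def)
      moreover have "(d1^2 + d2^2) * (cc^2 + ss^2) - (d2 * cc - d1 * ss)^2 = (d1 * cc + d2 * ss)^2" by algebra
      ultimately show ?thesis by (metis diff_ge_0_iff_ge mult.right_neutral zero_le_power2)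
     qed
     moreover have rr: "r1 < rr" "rr < r2" using r by (auto simp: rr_def)
     ultimately have "(q n (fst p) (snd p))^2 <= r2^2 * (d1^2 + d2^2)"
      using r12 by (auto simp: power_mult_distrib intro!: mult_mono power_mono)
     then have "a^2 + (q n (fst p) (snd p))^2 <= 1 * a^2 + r2^2 * (d1^2 + d2^2)" by simp
     also have "... <= (1 + r2^2) * (a^2 + (d1^2 + d2^2))" by (simp add: algebra_simps)
     also have "... = C * (r1 * (a^2 + (d1^2 + d2^2)))" using r12 by (simp add: C_def)
     also have "... <= C * (rr * (a^2 + (d1^2 + d2^2)))"
      using rr r12 by (intro mult_left_mono mult_right_mono) (auto simp: C_def)
     finally show ?thesis by (simp add: a_def d1_def d2_def rr_def V_def)
    qed
    moreover have "0 < fst p" "0 <= C" using r r12 by (auto simp: C_def)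
    ultimately show ?thesis using True
     by (simp add: A_def F_def ennreal_mult[symmetric] ennreal_leI del: ennreal_plus)
   qed simp
  qed
  also have "... = ennreal C * En' n"
   unfolding e by (intro nn_integral_cmult borel_measurable_times_ennreal measurable_compose[OF measurable_polp Fm]) measurable
  finally show ?thesis .
 qed
 have bdry: "(NN r. ennreal ((v n (pol x r a0))^2) * ind {r1<..<r2} r) <= Tn n" for n
 proof -
  have N: "ball y0 \<rho> Int frontier U \<in> sets borel" by (intro sets.Int) auto
  have "pol x r a0 \<in> ball y0 \<rho> Int frontier U" if "r \<in> {r1<..<r2}" for r
   using inball[OF that c(3)] sa x_in(2) by (simp add: U_simps)
  from lborel_line_le_hausdorff1[OF _ sa N this, of "%y. ennreal ((v n y - 0)^2)"] show ?thesis
   unfolding Tn_def by simp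
 qed
 define Z where "Z r = (NN t. ennreal ((V (r, t) - (\<Psi> r t - \<Psi> r a0))^2) * ind S t)" for r
 have \<Psi>1 [measurable]: "(%r. \<Psi> r t) \<in> bm borel" "\<Psi> r \<in> bm borel" for t r
  using measurable_Pair1[OF \<Psi>_meas, of t] measurable_Pair2[OF \<Psi>_meas, of r] by auto
 have Zm: "Z \<in> bm borel"
 proof -
  have [measurable]: "(%p. \<Psi> (fst p) a0) \<in> bm lborel2"
   by (rule measurable_compose[OF measurable_fst]) simp
  have m1: "(%p. ennreal ((V p - (\<Psi> (fst p) (snd p) - \<Psi> (fst p) a0))^2) * ind S (snd p)) \<in> bm lborel2"
   by measurable
  have "(%r. NN t. ennreal ((V (r, t) - (\<Psi> r t - \<Psi> r a0))^2) * ind S t) \<in> bm lborel"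
   using lborel.borel_measurable_nn_integral_fst[OF m1] by simp
  then show ?thesis by (simp add: Z_def[abs_def])
 qed
 have key: "Z r <= ennreal C' * ((NN t. A n (r, t) * ind S t) + ennreal ((v n (pol x r a0))^2))"
  if r: "r \<in> {r1<..<r2}" "ee r < \<infinity>" for r n
 proof -
  have rp: "r > 0" using r r12 by auto
  note ai = arc_increment[OF rp r(2) v c(1-3), of _ n]
  define D where "D = (LBINT s:{c0..c1}. (q n r s)^2)"
  have qi: "sint {c0..c1} (%s. (q n r s)^2)" using ai(2)[OF c(3)] by (simp add: q_def)
  have D0: "D >= 0" by (auto simp: D_def LBINT_def intro!: integral_nonneg_AE)
  have qrm: "(%t. q n r t) \<in> bm borel" using measurable_Pair2[OF qm, of r n] by simp
  have vrm: "(%t. v n (pol x r t)) \<in> bm borel" using measurable_Pair2[OF vpm, of r n] by (simp add: polp_def)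
  have Dn: "ennreal D = (NN t. ennreal ((q n r t)^2) * ind S t)"
  proof -
   have "ennreal D = (NN t. ennreal (ind {c0..c1} t *R (q n r t)^2))"
    unfolding D_def LBINT_def
    by (rule nn_integral_eq_integral[symmetric]) (use qi in "auto simp: sintegrable_def")
   also have "... = (NN t. ennreal ((q n r t)^2) * ind S t)"
   proof (rule nn_integral_cong_AE)
    show "AE t in lborel. ennreal (ind {c0..c1} t *R (q n r t)^2) = ennreal ((q n r t)^2) * ind S t"
     using AE_lborel_singleton[of c0] AE_lborel_singleton[of c1] by eventually_elim (auto simp: S_def indicator_def)
   qed
   finally show ?thesis .
  qed
  have pt: "ennreal ((V (r, t) - (\<Psi> r t - \<Psi> r a0))^2) * ind S t <=
   ennreal 3 * (ennreal ((v n (pol x r t) - V (r, t))^2) * ind S t) + ennreal (3 * (v n (pol x r a0))^2 + 3 * pi * D) * ind S t" for t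
  proof (cases "t \<in> S")
   case True
   define a b e where "a = V (r, t) - v n (pol x r t)" and "b = v n (pol x r a0)" and "e = v n (pol x r t) - v n (pol x r a0) - (\<Psi> r t - \<Psi> r a0)"
   have "e^2 <= pi * D" unfolding e_def D_def using ai(1)[of t] True by (auto simp: q_def S_def)
   moreover have "V (r, t) - (\<Psi> r t - \<Psi> r a0) = a + b + e" by (simp add: a_def b_def e_def)
   then have "(V (r, t) - (\<Psi> r t - \<Psi> r a0))^2 = (a + b + e)^2" by (simp only:)
   ultimately have "(V (r, t) - (\<Psi> r t - \<Psi> r a0))^2 <= 3 * a^2 + 3 * b^2 + 3 * (pi * D)"
    using square_sum3_le[of a b e] by linarith
   also have "a^2 = (v n (pol x r t) - V (r, t))^2" by (simp add: a_def power2_commute)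
   finally have "(V (r, t) - (\<Psi> r t - \<Psi> r a0))^2 <= 3 * (v n (pol x r t) - V (r, t))^2 + (3 * b^2 + 3 * pi * D)" by simp
   then have "ennreal ((V (r, t) - (\<Psi> r t - \<Psi> r a0))^2) <= ennreal (3 * (v n (pol x r t) - V (r, t))^2 + (3 * b^2 + 3 * pi * D))" by (rule ennreal_leI)
   also have "... = ennreal 3 * ennreal ((v n (pol x r t) - V (r, t))^2) + ennreal (3 * b^2 + 3 * pi * D)"
    using D0 by (subst ennreal_plus) (auto simp: ennreal_mult)
   finally show ?thesis using True by (simp add: b_def del: ennreal_plus)
  qed simp
  have "Z r <= (NN t. ennreal 3 * (ennreal ((v n (pol x r t) - V (r, t))^2) * ind S t) + ennreal (3 * (v n (pol x r a0))^2 + 3 * pi * D) * ind S t)"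
   unfolding Z_def by (rule nn_integral_mono) (rule pt)
  also have "... = ennreal 3 * (NN t. ennreal ((v n (pol x r t) - V (r, t))^2) * ind S t) + ennreal (3 * (v n (pol x r a0))^2 + 3 * pi * D) * emeasure lborel S"
   using vrm by (subst nn_integral_add) (auto simp: nn_integral_cmult nn_integral_cmult_indicator simp del: ennreal_plus)
  also have "emeasure lborel S <= ennreal pi" using c by (simp add: S_def ennreal_leI)
  also have "ennreal (3 * (v n (pol x r a0))^2 + 3 * pi * D) * ennreal pi = ennreal (3 * pi) * ennreal ((v n (pol x r a0))^2) + ennreal (3 * pi * pi) * ennreal D"
   using D0 by (simp add: ennreal_mult[symmetric] ennreal_plus[symmetric] algebra_simps del: ennreal_plus)
  also have "ennreal 3 * (NN t. ennreal ((v n (pol x r t) - V (r, t))^2) * ind S t) + (ennreal (3 * pi) * ennreal ((v n (pol x r a0))^2) + ennreal (3 * pi * pi) * ennreal D)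
   <= ennreal C' * (NN t. ennreal ((v n (pol x r t) - V (r, t))^2) * ind S t) + (ennreal C' * ennreal ((v n (pol x r a0))^2) + ennreal C' * ennreal D)"
   by (intro add_mono mult_right_mono ennreal_leI) (auto simp: C'_def)
  also have "... = ennreal C' * (((NN t. ennreal ((v n (pol x r t) - V (r, t))^2) * ind S t) + ennreal D) + ennreal ((v n (pol x r a0))^2))"
   by (simp add: distrib_left add_ac)
  also have "(NN t. ennreal ((v n (pol x r t) - V (r, t))^2) * ind S t) + ennreal D = (NN t. A n (r, t) * ind S t)"
   unfolding Dn using vrm qrm
   by (subst nn_integral_add[symmetric]) (auto simp: A_def polp_def indicator_def intro!: nn_integral_cong)
  finally show ?thesis by (simp add: add_left_mono mult_left_mono)
 qed
 have "(NN r. Z r * ind {r1<..<r2} r) <= ennreal C' * (ennreal C * En' n + Tn n)" for n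
 proof -
  have Jm: "(%r. NN t. A n (r, t) * ind S t) \<in> bm borel"
  proof -
   have m1: "(%p. A n p * ind S (snd p)) \<in> bm lborel2" by measurable
   show ?thesis using lborel.borel_measurable_nn_integral_fst[OF m1] by simp
  qed
  have pam: "(%r. v n (pol x r a0)) \<in> bm borel" using measurable_Pair1[OF vpm, of a0 n] by (simp add: polp_def)
  have "(NN r. Z r * ind {r1<..<r2} r) <= (NN r. ennreal C' * ((NN t. A n (r, t) * ind S t) * ind {r1<..<r2} r + ennreal ((v n (pol x r a0))^2) * ind {r1<..<r2} r))"
  proof (rule nn_integral_mono_AE)
   show "AE r in lborel. Z r * ind {r1<..<r2} r <= ennreal C' * ((NN t. A n (r, t) * ind S t) * ind {r1<..<r2} r + ennreal ((v n (pol x r a0))^2) * ind {r1<..<r2} r)"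
    using ee_finite
   proof eventually_elim
    case (elim r)
    show ?case
    proof (cases "r \<in> {r1<..<r2}")
     case True
     then have "ee r < \<infinity>" using elim r12 by auto
     then show ?thesis using key[OF True] True by simp
    qed simp
   qed
  qed
  also have "... = ennreal C' * ((NN r. (NN t. A n (r, t) * ind S t) * ind {r1<..<r2} r) + (NN r. ennreal ((v n (pol x r a0))^2) * ind {r1<..<r2} r))"
   using Jm pam by (subst nn_integral_cmult) (auto simp: nn_integral_add)
  also have "... <= ennreal C' * (ennreal C * En' n + Tn n)" by (intro mult_left_mono add_mono energy bdry) simp
  finally show ?thesis .
 qed
 moreover have "(%n. ennreal C' * (ennreal C * En' n + Tn n)) \<longlonglongrightarrow> ennreal C' * (ennreal C * 0 + 0)"
  using E0 T0 unfolding En'_def Tn_def by (intro tendsto_intros ennreal_tendsto_cmult tendsto_add) auto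
 ultimately have "(NN r. Z r * ind {r1<..<r2} r) <= ennreal C' * (ennreal C * 0 + 0)"
  by (intro LIMSEQ_le_const) auto
 then have "(NN r. Z r * ind {r1<..<r2} r) = 0" by simp
 then have "AE r in lborel. Z r * ind {r1<..<r2} r = 0"
  using Zm by (subst nn_integral_0_iff_AE[symmetric]) auto
 then have "AE r in lborel. \<bar>r - r0\<bar> < \<delta> --> (AE t in lborel. t \<in> {0<..<pi} & \<bar>t - a0\<bar> < th0 --> V (r, t) = \<Psi> r t - \<Psi> r a0)"
 proof eventually_elim
  case (elim r)
  show ?case
  proof
   assume "\<bar>r - r0\<bar> < \<delta>"
   then have "r \<in> {r1<..<r2}" by (auto simp: r1_def r2_def)
   then have "Z r = 0" using elim by (auto split: split_indicator_asm)
   then have "AE t in lborel. ennreal ((V (r, t) - (\<Psi> r t - \<Psi> r a0))^2) * ind S t = 0"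
    unfolding Z_def by (subst (asm) nn_integral_0_iff_AE) auto
   then show "AE t in lborel. t \<in> {0<..<pi} & \<bar>t - a0\<bar> < th0 --> V (r, t) = \<Psi> r t - \<Psi> r a0"
   proof eventually_elim
    case (elim t)
    show ?case
    proof
     assume "t \<in> {0<..<pi} & \<bar>t - a0\<bar> < th0"
     then have "t \<in> S" by (auto simp: S_def c0_def c1_def)
     then show "V (r, t) = \<Psi> r t - \<Psi> r a0" using elim by simp
    qed
   qed
  qed
 qed
 with d show ?thesis by (intro that) auto
qed

lemma free_nbhd:
 assumes "r0 > 0" "0 <= a" "b <= pi" and free: "!!t. t \<in> {a..b} ==> pol x r0 t ~: K"
 obtains \<delta> where "\<delta> > 0" "!!r t. \<bar>r - r0\<bar> < \<delta> ==> t \<in> {a..b} ==> pol x r t ~: K"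
proof -
 have "compact (pol x r0 ` {a..b})" by (intro compact_continuous_image continuous_intros) auto
 moreover have "pol x r0 ` {a..b} Int K = {}" using free by auto
 ultimately obtain d where d: "d > 0" "\<forall>y\<in>pol x r0 ` {a..b}. \<forall>z\<in>K. d <= dist y z"
  using separate_compact_closed[OF _ closed_K] by blast
 have "pol x r t ~: K" if "\<bar>r - r0\<bar> < d" "t \<in> {a..b}" for r t
 proof
  assume "pol x r t \<in> K"
  then have "d <= dist (pol x r0 t) (pol x r t)" using d(2) that by blast
  moreover have "(dist (pol x r0 t) (pol x r t))^2 = \<bar>r - r0\<bar>^2" unfolding dist_pol_sq by (simp add: power2_commute)
  then have "dist (pol x r0 t) (pol x r t) = \<bar>r - r0\<bar>" by (simp only: power2_eq_iff_nonneg abs_ge_zero zero_le_dist)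
  ultimately show False using that by simp
 qed
 then show ?thesis using d that by blast
qed

text \<open>\<open>boundary_slice\<close> determines \<open>V\<close> near the axis,
  \<open>angular_ACL\<close> determines it up to a constant on the free arc; on the overlap of the
  two regions the constant is identified.\<close>

lemma slice_local:
 assumes a0: "a0 = 0 \<or> a0 = pi" and r0: "r0 > 0" and ts: "ts \<in> {0<..<pi}"
  and free: "!!t. t \<in> {min a0 ts..max a0 ts} ==> pol x r0 t ~: K"
 shows "\<exists>\<delta>>0. AE r in lborel. \<bar>r - r0\<bar> < \<delta> --> (AE t\<in>{min a0 ts<..<max a0 ts} in lborel. V (r, t) = \<Psi> r t - \<Psi> r a0)"
proof -
 have m: "0 <= min a0 ts" "max a0 ts <= pi" using a0 ts by auto
 obtain \<delta>1 where d1: "\<delta>1 > 0" "!!r t. \<bar>r - r0\<bar> < \<delta>1 ==> t \<in> {min a0 ts..max a0 ts} ==> pol x r t ~: K"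
  using free_nbhd[OF r0 m free] by blast
 obtain \<delta>2 th0 where d2: "\<delta>2 > 0" "th0 > 0" and
  bd: "AE r in lborel. \<bar>r - r0\<bar> < \<delta>2 --> (AE t in lborel. t \<in> {0<..<pi} & \<bar>t - a0\<bar> < th0 --> V (r, t) = \<Psi> r t - \<Psi> r a0)"
  using boundary_slice[OF a0 r0] free[of a0] by auto
 define \<delta> where "\<delta> = min (min \<delta>1 \<delta>2) r0 / 2"
 have d: "\<delta> > 0" "\<delta> < \<delta>1" "\<delta> < \<delta>2" "\<delta> < r0" using d1 d2 r0 by (auto simp: \<delta>_def)
 define m0 where "m0 = min th0 \<bar>ts - a0\<bar> / 2"
 have m0: "0 < m0" "m0 < th0" "m0 < \<bar>ts - a0\<bar>" using d2 a0 ts by (auto simp: m0_def min_def)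
 define tb where "tb = (if a0 = 0 then m0 else pi - m0)"
 define lo hi where "lo = min tb ts" and "hi = max tb ts"
 have lohi: "0 < lo" "lo < hi" "hi < pi" "min a0 ts <= lo" "hi <= max a0 ts" "\<bar>tb - a0\<bar> = m0" "tb = lo \<or> tb = hi"
  using a0 ts m0 by (auto simp: tb_def lo_def hi_def)
 have "AE r\<in>{r0 - \<delta><..<r0 + \<delta>} in lborel. (\<exists>c. AE t\<in>{lo<..<hi} in lborel. V (r, t) = c + (LBINT s:{lo..t}. Q (r, s)))"
 proof (rule angular_ACL[OF _ _ lohi(1-3)])
  fix r t assume "r \<in> {r0 - \<delta>..r0 + \<delta>}" "t \<in> {lo..hi}"
  then have "\<bar>r - r0\<bar> < \<delta>1" "t \<in> {min a0 ts..max a0 ts}" using d lohi unfolding atLeastAtMost_iff by linarith+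
  then show "pol x r t ~: K" by (rule d1(2))
 qed (use d in auto)
 then have "AE r in lborel. \<bar>r - r0\<bar> < \<delta> --> (AE t\<in>{min a0 ts<..<max a0 ts} in lborel. V (r, t) = \<Psi> r t - \<Psi> r a0)"
  using bd ee_finite
 proof eventually_elim
  case (elim r)
  show ?case
  proof
   assume r: "\<bar>r - r0\<bar> < \<delta>"
   then have rp: "r > 0" "ee r < \<infinity>" using elim(3) d by auto
   obtain c where c: "AE t\<in>{lo<..<hi} in lborel. V (r, t) = c + (LBINT s:{lo..t}. Q (r, s))"
    using elim(1) r by (auto simp: abs_less_iff)
   have b: "AE t in lborel. t \<in> {0<..<pi} & \<bar>t - a0\<bar> < th0 --> V (r, t) = \<Psi> r t - \<Psi> r a0"
    using elim(2) r d by auto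
   have inc: "(LBINT s:{lo..t}. Q (r, s)) = \<Psi> r t - \<Psi> r lo" if "t \<in> {lo<..<hi}" for t
    by (rule ac_diff[OF \<Psi>_ac[OF rp], symmetric]) (use that lohi in auto)
   define e where "e = min (th0 - m0) (hi - lo)"
   have e: "e > 0" "e <= th0 - m0" "e <= hi - lo" using m0 lohi by (auto simp: e_def)
   \<comment> \<open>A window next to \<open>tb\<close> in which both formulas are available; one
     common angle \<open>t1\<close> in it suffices.\<close>
   define l1 h1 where "l1 = (if tb = lo then lo else hi - e)" and "h1 = (if tb = lo then lo + e else hi)"
   have lh: "l1 < h1" using e by (auto simp: l1_def h1_def)
   have bc: "AE t in lborel. (t \<in> {lo<..<hi} --> V (r, t) = c + (LBINT s:{lo..t}. Q (r, s))) &
     (t \<in> {0<..<pi} & \<bar>t - a0\<bar> < th0 --> V (r, t) = \<Psi> r t - \<Psi> r a0)"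
    using b c by eventually_elim blast
   obtain t1 where t1: "l1 < t1" "t1 < h1" "(t1 \<in> {lo<..<hi} --> V (r, t1) = c + (LBINT s:{lo..t1}. Q (r, s))) &
    (t1 \<in> {0<..<pi} & \<bar>t1 - a0\<bar> < th0 --> V (r, t1) = \<Psi> r t1 - \<Psi> r a0)"
    by (rule AE_obtain[OF bc lh])
   have t1': "t1 \<in> {lo<..<hi}" using t1(1,2) e by (auto simp: l1_def h1_def split: if_splits)
   moreover have "\<bar>t1 - tb\<bar> < e" using t1(1,2) lohi(7) by (auto simp: l1_def h1_def split: if_splits)
   then have "\<bar>t1 - a0\<bar> < th0" using e lohi(6) by linarith
   ultimately have cv: "c = \<Psi> r lo - \<Psi> r a0" using t1(3) inc[OF t1'] lohi by auto
   then have c': "AE t\<in>{lo<..<hi} in lborel. V (r, t) = \<Psi> r t - \<Psi> r a0"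
    using c by eventually_elim (use inc cv in auto)
   show "AE t\<in>{min a0 ts<..<max a0 ts} in lborel. V (r, t) = \<Psi> r t - \<Psi> r a0"
    using b c'
   proof eventually_elim
    case (elim t)
    show ?case
    proof
     assume t: "t \<in> {min a0 ts<..<max a0 ts}"
     have "\<bar>t - a0\<bar> < th0 \<or> t \<in> {lo<..<hi}"
      using t a0 m0 ts by (auto simp: lo_def hi_def tb_def min_def max_def abs_if split: if_splits)
     moreover have "t \<in> {0<..<pi}" using t m by auto
     ultimately show "V (r, t) = \<Psi> r t - \<Psi> r a0" using elim by blast
    qed
   qed
  qed
 qed
 then show ?thesis using d by blast
qed

text \<open>For one angle \<open>ts\<close> the claim holds at almost every radius whose arc from
  the axis to \<open>ts\<close> misses \<open>K\<close>. Rational \<open>ts\<close> on either side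
  of the single point of \<open>K\<close> exhaust both arcs, and being countable they produce one
  null set of radii.\<close>

lemma slices: "AE r in lborel. r > 0 --> good r & ee r < \<infinity> & (\<exists>ka. K Int sphere x r = {pol x r ka} & slice ka (%t. V (r, t)) (%t. Q (r, t)))"
proof -
 define S where "S a0 ts = {r. r > 0 & (\<forall>t\<in>{min a0 ts..max a0 ts}. pol x r t ~: K)}" for a0 ts
 define claim where "claim a0 ts r \<longleftrightarrow> (AE t\<in>{min a0 ts<..<max a0 ts} in lborel. V (r, t) = \<Psi> r t - \<Psi> r a0)" for a0 ts r
 have "AE r in lborel. r \<in> S a0 ts --> claim a0 ts r" if A: "a0 = 0 \<or> a0 = pi" "ts \<in> {0<..<pi}" for a0 ts
 proof (rule AE_local)
  fix r0 assume "r0 \<in> S a0 ts"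
  then obtain \<delta> where d: "\<delta> > 0" "AE r in lborel. \<bar>r - r0\<bar> < \<delta> --> claim a0 ts r"
   using slice_local[OF A(1) _ A(2), of r0] unfolding S_def claim_def by blast
  then show "\<exists>\<delta>>0. AE r in lborel. \<bar>r - r0\<bar> < \<delta> --> r \<in> S a0 ts --> claim a0 ts r"
   by (intro exI[of _ \<delta>] conjI) (auto elim: eventually_mono)
 qed
 moreover have cnt: "countable (\<rat> Int {0<..<pi})" by (intro countable_Int1 countable_rat)
 ultimately have "AE r in lborel. \<forall>ts\<in>\<rat> Int {0<..<pi}. r \<in> S a0 ts --> claim a0 ts r" if "a0 = 0 \<or> a0 = pi" for a0
  using that by (subst AE_ball_countable[OF cnt]) auto
 from this[of 0] this[of pi] have
  "AE r in lborel. \<forall>ts\<in>\<rat> Int {0<..<pi}. r \<in> S 0 ts --> claim 0 ts r" "AE r in lborel. \<forall>ts\<in>\<rat> Int {0<..<pi}. r \<in> S pi ts --> claim pi ts r" by auto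
 then show ?thesis
  using AE_good ee_finite
 proof eventually_elim
  case (elim r)
  show ?case
  proof
   assume r: "r > 0"
   then have gr: "good r" and er: "ee r < \<infinity>" using elim by auto
   obtain p where p: "K Int sphere x r = {p}" using gr by (auto simp: good_def)
   then have "dist x p = r" "p \<in> K" by auto
   then obtain ka where k: "0 <= ka" "ka < 2 * pi" "p = pol x r ka" using pol_surj[of x p r 0] by auto
   have "p $ 2 >= 0" using \<open>p \<in> K\<close> K_sub U_simps(2) by auto
   then have "sin ka >= 0" using k r x_in(2) by (simp add: zero_le_mult_iff)
   then have kpi: "ka <= pi" using sin_lt_zero[of ka] k by force
   have only: "t = ka" if "pol x r t \<in> K" "t \<in> {0..pi}" for t
   proof -
    have "pol x r t \<in> K Int sphere x r" using that r by (simp add: dist_pol)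
    then have "pol x r t = pol x r ka" using p k(3) by blast
    moreover have "\<bar>t - ka\<bar> < 2 * pi" using that(2) k kpi pi_gt_zero unfolding atLeastAtMost_iff by linarith
    ultimately show ?thesis using r by (intro pol_inj[of x r t ka])
   qed
   have z: "\<Psi> r 0 = 0" by (simp add: \<Psi>_def set_integral_zero_singleton)
   have ae: "AE t\<in>{min a0 ts<..<max a0 ts} in lborel. V (r, t) = \<Psi> r t - \<Psi> r a0"
    if "a0 = 0 & ts < ka \<or> a0 = pi & ka < ts" "ts \<in> \<rat> Int {0<..<pi}" for a0 ts
   proof -
    have "r \<in> S a0 ts" using that r by (auto simp: S_def dest!: only)
    then show ?thesis using elim(1,2) that by (auto simp: claim_def)
   qed
   define T where "T a0 = {ts\<in>\<rat> Int {0<..<pi}. a0 = 0 & ts < ka \<or> a0 = pi & ka < ts}" for a0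
   have cT: "countable (T a0)" for a0 by (rule countable_subset[OF _ cnt]) (auto simp: T_def)
   have "\<forall>ts\<in>T a0. AE t\<in>{min a0 ts<..<max a0 ts} in lborel. V (r, t) = \<Psi> r t - \<Psi> r a0" for a0
    using ae unfolding T_def by blast
   then have A: "AE t in lborel. \<forall>ts\<in>T a0. t \<in> {min a0 ts<..<max a0 ts} --> V (r, t) = \<Psi> r t - \<Psi> r a0" for a0
    unfolding AE_ball_countable[OF cT] .
   have "slice ka (%t. V (r, t)) (%t. Q (r, t))"
    unfolding slice_def
   proof (intro conjI k(1) kpi slice_measurable slice_squares(2)[OF r er])
    show "AE t\<in>{0<..<ka} in lborel. V (r, t) = (LBINT s:{0..t}. Q (r, s))"
     using A[of 0]
    proof eventually_elim
     case (elim t)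
     show ?case
     proof
      assume t: "t \<in> {0<..<ka}"
      obtain ts where "ts \<in> \<rat>" "t < ts" "ts < ka" using Rats_dense_in_real[of t ka] t by auto
      moreover have "ts \<in> T 0" using calculation t kpi by (auto simp: T_def)
      ultimately have "t \<in> {min 0 ts<..<max 0 ts} --> V (r, t) = \<Psi> r t - \<Psi> r 0" "ts > t" using elim by blast+
      then have "V (r, t) = \<Psi> r t - \<Psi> r 0" using t by auto
      then show "V (r, t) = (LBINT s:{0..t}. Q (r, s))" using z by (simp add: \<Psi>_def)
     qed
    qed
    show "AE t\<in>{ka<..<pi} in lborel. V (r, t) = - (LBINT s:{t..pi}. Q (r, s))"
     using A[of pi]
    proof eventually_elim
     case (elim t)
     show ?case
     proof
      assume t: "t \<in> {ka<..<pi}"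
      obtain ts where "ts \<in> \<rat>" "ka < ts" "ts < t" using Rats_dense_in_real[of ka t] t by auto
      moreover have "ts \<in> T pi" using calculation t k by (auto simp: T_def)
      ultimately have "t \<in> {min pi ts<..<max pi ts} --> V (r, t) = \<Psi> r t - \<Psi> r pi" "ts < t" using elim by blast+
      then have "V (r, t) = \<Psi> r t - \<Psi> r pi" using t by auto
      moreover have "\<Psi> r pi - \<Psi> r t = (LBINT s:{t..pi}. Q (r, s))"
       by (rule ac_diff[OF \<Psi>_ac[OF r er]]) (use t k in auto)
      ultimately show "V (r, t) = - (LBINT s:{t..pi}. Q (r, s))" by simp
     qed
    qed
   qed
   then show "good r & ee r < \<infinity> & (\<exists>ka. K Int sphere x r = {pol x r ka} & slice ka (%t. V (r, t)) (%t. Q (r, t)))"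
    using gr er p k by blast
  qed
 qed
qed

text \<open>A segment that misses \<open>K\<close> has positive distance to it, so a whole polar
  rectangle around it is free and \<open>radial_ACL\<close> applies; \<open>AE_local\<close> joins
  the local statements.\<close>

lemma rays:
 assumes r: "0 < r1" "r1 < r2"
 shows "AE t in lborel. t \<in> {t \<in> {0<..<pi}. \<forall>r\<in>{r1..r2}. pol x r t ~: K} -->
  (\<exists>c. AE r\<in>{r1<..<r2} in lborel. V (r, t) = c + (LBINT s:{r1..r}. P (s, t)))"
proof (rule AE_local)
 fix t0 assume t0: "t0 \<in> {t \<in> {0<..<pi}. \<forall>r\<in>{r1..r2}. pol x r t ~: K}"
 have "compact ((%r. pol x r t0) ` {r1..r2})" by (intro compact_continuous_image continuous_intros) auto
 moreover have "(%r. pol x r t0) ` {r1..r2} Int K = {}" using t0 by auto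
 ultimately obtain d where d: "d > 0" "\<forall>y\<in>(%r. pol x r t0) ` {r1..r2}. \<forall>z\<in>K. d <= dist y z"
  using separate_compact_closed[OF _ closed_K] by blast
 define \<delta> where "\<delta> = min (d / r2) (min t0 (pi - t0)) / 2"
 have "0 < min (d / r2) (min t0 (pi - t0))" using d r t0 by auto
 moreover have h: "2 * (z / 2) = z" for z :: real by simp
 have "2 * \<delta> = min (d / r2) (min t0 (pi - t0))" unfolding \<delta>_def by (rule h)
 ultimately have "\<delta> < min (d / r2) (min t0 (pi - t0))" "\<delta> > 0" by linarith+
 then have "\<delta> < d / r2" "\<delta> < t0" "\<delta> < pi - t0" "\<delta> > 0" by auto
 then have de: "r2 * \<delta> < d" "\<delta> < t0" "\<delta> < pi - t0" "\<delta> > 0" using r by (auto simp: field_simps)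
 have free: "pol x r t ~: K" if "r \<in> {r1..r2}" "t \<in> {t0 - \<delta>..t0 + \<delta>}" for r t
 proof
  assume "pol x r t \<in> K"
  then have "d <= dist (pol x r t0) (pol x r t)" using d(2) that by blast
  also have "... <= r * \<bar>t0 - t\<bar>" using that r by (intro dist_pol_le) auto
  also have "... <= r2 * \<delta>" using that r by (intro mult_mono) auto
  finally show False using de by simp
 qed
 have "AE t\<in>{t0 - \<delta><..<t0 + \<delta>} in lborel. (\<exists>c. AE r\<in>{r1<..<r2} in lborel. V (r, t) = c + (LBINT s:{r1..r}. P (s, t)))"
  by (rule radial_ACL[OF r _ _ _ free]) (use de in auto)
 then show "\<exists>\<delta>>0. AE t in lborel. \<bar>t - t0\<bar> < \<delta> --> t \<in> {t \<in> {0<..<pi}. \<forall>r\<in>{r1..r2}. pol x r t ~: K} -->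
  (\<exists>c. AE r\<in>{r1<..<r2} in lborel. V (r, t) = c + (LBINT s:{r1..r}. P (s, t)))"
  by (intro exI[of _ \<delta>] conjI de(4)) (auto elim!: eventually_mono simp: abs_less_iff)
qed

end

section \<open>Energy identities and monotonicity\<close>

lemma measurable_set_integral_slice:
 fixes f :: "real \<times> real => real"
 assumes [measurable]: "f \<in> bm lborel2"
 shows "(%r. LBINT t:{a..b}. f (r, t)) \<in> bm borel"
proof -
 have [measurable]: "{a..b} \<in> sets (borel :: real measure)" by simp
 have "(%r. LBINT t. ind {a..b} t *R f (r, t)) \<in> bm lborel"
  by (rule lborel.borel_measurable_lebesgue_integral) measurable
 then show ?thesis by (simp add: LBINT_def)
qed

lemma quadratic_coefficient_zero:
 fixes a b :: real
 assumes "!!\<tau>. 0 <= 2 * \<tau> * a + \<tau>^2 * b" shows "a = 0"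
proof (rule ccontr)
 assume "a ~= 0"
 define \<tau> where "\<tau> = - a / (1 + \<bar>b\<bar>)"
 have "2 * \<tau> * a + \<tau>^2 * b <= 2 * \<tau> * a + \<tau>^2 * (1 + \<bar>b\<bar>)" by (intro add_left_mono mult_left_mono) auto
 also have "\<tau>^2 * (1 + \<bar>b\<bar>) = - \<tau> * a" by (simp add: \<tau>_def power2_eq_square)
 also have "2 * \<tau> * a + - \<tau> * a = - (a^2 / (1 + \<bar>b\<bar>))" by (simp add: \<tau>_def power2_eq_square)
 also have "... < 0" using \<open>a ~= 0\<close> by (simp add: add_pos_nonneg)
 finally show False using assms[of \<tau>] by simp
qed

text \<open>\<open>H\<close> is a function of the squared radius, so that the radial function built
  from it is C1 at the centre too. By the chain rule the derivative of \<open>H (r^2)\<close> in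
  \<open>r\<close> is \<open>bump n a b r\<close>.\<close>

lemma cutoff_primitive:
 assumes ab: "0 < a" "a < b"
 obtains H where "!!s. (H has_real_derivative (bump n a b (sqrt s) / (2 * sqrt s))) (at s)" "!!s. b^2 <= s ==> H s = H (b^2)"
  "continuous_on UNIV (%s. bump n a b (sqrt s) / (2 * sqrt s))"
proof -
 define h where "h s = bump n a b (sqrt s) / (2 * sqrt s)" for s
 have hz: "h s = 0" if "s < a^2" for s
 proof -
  have "sqrt s < a" using that ab by (metis abs_of_pos real_sqrt_abs real_sqrt_less_iff)
  then show ?thesis by (simp add: h_def bump_eq_0)
 qed
 have "continuous_on ({0<..} Un {..<a^2}) h"
 proof (rule continuous_on_open_Un)
  show "continuous_on {0<..} h" unfolding h_def[abs_def] by (intro continuous_intros) auto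
  show "continuous_on {..<a^2} h" by (rule continuous_on_eq[of _ "%_. 0"]) (use hz in auto)
 qed auto
 moreover have "{0<..} Un {..<a^2} = UNIV" using ab by (auto simp: not_less intro: less_le_trans[of 0 "a^2"])
 ultimately have ch: "continuous_on UNIV h" by simp
 then have "isCont h s" for s by (simp add: continuous_on_eq_continuous_at)
 then obtain H where H: "!!s. (H has_real_derivative h s) (at s)"
  using einterval_antiderivative[of "-\<infinity>" "\<infinity>" h] unfolding has_real_derivative_iff_has_vector_derivative by auto
 have "\<exists>c. \<forall>s\<in>{b^2..}. H s = c"
 proof (rule has_field_derivative_zero_constant)
  fix s assume s: "s \<in> {b^2..}"
  then have "b <= sqrt s" using ab by (intro real_le_rsqrt) auto
  then have "h s = 0" by (simp add: h_def bump_eq_0)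
  then show "(H has_real_derivative 0) (at s within {b^2..})" using H[of s] by (simp add: has_field_derivative_at_within)
 qed simp
 then obtain c where "\<forall>s\<in>{b^2..}. H s = c" by blast
 then have Hc: "H s = H (b^2)" if "b^2 <= s" for s using that by auto
 show ?thesis by (rule that[OF H[unfolded h_def] Hc ch[unfolded h_def]])
qed

lemmas sint_linear = set_integral_mult_right set_integral_add set_integral_diff set_integrable_mult_right

context crack
begin

definition nice where "nice r \<longleftrightarrow> r > 0 & good r & ee r < \<infinity> &
 (\<exists>ka. K Int sphere x r = {pol x r ka} & slice ka (%t. V (r, t)) (%t. Q (r, t)))"

lemma AE_nice: "AE r in lborel. r > 0 --> nice r"
 using slices by eventually_elim (auto simp: nice_def)

text \<open>Angular integrals over a half circle. \<open>r * BB r\<close> is the flux of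
  \<open>u\<close> times its gradient through it, \<open>ed\<close> the angular energy, and
  \<open>DD R\<close> the Dirichlet energy of the disk of radius \<open>R\<close>.\<close>

definition PP where "PP r = (LBINT t:{0..pi}. (P (r, t))^2)"
definition QQ where "QQ r = (LBINT t:{0..pi}. (Q (r, t))^2)"
definition BB where "BB r = (LBINT t:{0..pi}. P (r, t) * V (r, t))"
definition CC where "CC r = (LBINT t:{0..pi}. (V (r, t))^2)"
definition ed where "ed r = PP r + QQ r / r^2"
definition DD where "DD R = (LBINT r:{0..R}. r * ed r)"

lemma PQBC_meas [measurable]: "PP \<in> bm borel" "QQ \<in> bm borel" "BB \<in> bm borel" "CC \<in> bm borel"
 "ed \<in> bm borel"
proof -
 show [measurable]: "PP \<in> bm borel" "QQ \<in> bm borel" "BB \<in> bm borel" "CC \<in> bm borel"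
  unfolding PP_def[abs_def] QQ_def[abs_def] BB_def[abs_def] CC_def[abs_def] by (intro measurable_set_integral_slice; measurable)+
 show "ed \<in> bm borel" unfolding ed_def[abs_def] by measurable
qed

lemma PQC_nonneg: "PP r >= 0" "QQ r >= 0" "CC r >= 0" "ed r >= 0"
proof -
 show "PP r >= 0" "QQ r >= 0" "CC r >= 0" unfolding PP_def QQ_def CC_def LBINT_def by (auto intro!: integral_nonneg_AE)
 then show "ed r >= 0" by (simp add: ed_def)
qed

lemma nice_integrable:
 assumes "nice r"
 shows "r > 0" "ee r = ennreal (ed r)" "sint {0..pi} (%t. (P (r, t))^2)" "sint {0..pi} (%t. (Q (r, t))^2)"
  "sint {0..pi} (%t. (V (r, t))^2)" "sint {0..pi} (%t. P (r, t) * V (r, t))"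
  "CC r <= 4 * QQ r" "\<bar>BB r\<bar> <= PP r + CC r"
proof -
 obtain ka where r: "r > 0" "ee r < \<infinity>" and s: "slice ka (%t. V (r, t)) (%t. Q (r, t))" using assms by (auto simp: nice_def)
 show "r > 0" by (rule r)
 show "ee r = ennreal (ed r)" using slice_squares(3)[OF r] by (simp add: ed_def PP_def QQ_def)
 show p: "sint {0..pi} (%t. (P (r, t))^2)" and "sint {0..pi} (%t. (Q (r, t))^2)"
  by (rule slice_squares[OF r])+
 show v: "sint {0..pi} (%t. (V (r, t))^2)" by (rule slice_total(1)[OF s])
 show pv: "sint {0..pi} (%t. P (r, t) * V (r, t))"
  by (rule Cauchy_Schwarz_set_integral(2)) (use p v in auto)
 show "CC r <= 4 * QQ r" using slice_total(4)[OF s] by (simp add: CC_def QQ_def)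
 have "(BB r)^2 <= PP r * CC r" unfolding BB_def PP_def CC_def by (rule Cauchy_Schwarz_set_integral(1)) (use p v in auto)
 also have "... <= (PP r + CC r)^2" using PQC_nonneg[of r] by (simp add: power2_eq_square algebra_simps)
 finally show "\<bar>BB r\<bar> <= PP r + CC r" using PQC_nonneg[of r] by (simp add: abs_le_square_iff[symmetric])
qed

text \<open>Wirtinger's inequality makes \<open>r * ed r\<close>, whose integral is the finite
  energy, dominate everything that occurs when the function is scaled.\<close>

lemma BB_CC_le:
 assumes "nice r" "r <= R" shows "\<bar>BB r\<bar> <= (1 + 4 * R^2) * ed r" "CC r <= (4 * R^2) * ed r"
proof -
 have r: "r > 0" using nice_integrable(1)[OF assms(1)] .
 have "QQ r = r^2 * (QQ r / r^2)" using r by simp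
 also have "... <= R^2 * ed r" using r assms PQC_nonneg[of r] by (intro mult_mono power_mono) (auto simp: ed_def)
 finally show 1: "CC r <= (4 * R^2) * ed r" using nice_integrable(7)[OF assms(1)] by simp
 have "PP r <= ed r" using PQC_nonneg[of r] by (simp add: ed_def)
 then show "\<bar>BB r\<bar> <= (1 + 4 * R^2) * ed r" using nice_integrable(8)[OF assms(1)] 1 by (simp add: algebra_simps)
qed

lemma ed_integral:
 shows "sint {0..R} (%r. r * ed r)" and "dirichlet (ball x R) = ennreal (DD R)" and "DD R >= 0"
proof -
 define f where "f r = ind {0..R} r *R (r * ed r)" for r
 have fm: "f \<in> bm lborel" unfolding f_def[abs_def] by measurable
 have f0: "f r >= 0" for r using PQC_nonneg(4)[of r] by (auto simp: f_def indicator_def)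
 have e: "dirichlet (ball x R) = (NN r. ennreal (f r))"
  unfolding dirichlet_ball
 proof (rule nn_integral_cong_AE)
  show "AE r in lborel. ennreal r * ee r * ind {0<..<R} r = ennreal (f r)"
   using AE_nice AE_lborel_singleton[of 0] AE_lborel_singleton[of R]
  proof eventually_elim
   case (elim r)
   show ?case
   proof (cases "r \<in> {0<..<R}")
    case True
    then have "ee r = ennreal (ed r)" using elim nice_integrable by auto
    then show ?thesis using True PQC_nonneg(4)[of r] by (simp add: f_def ennreal_mult)
   qed (use elim in "auto simp: f_def indicator_def")
  qed
 qed
 have fin: "dirichlet (ball x R) < \<infinity>" by (rule finite_bounded) simp
 have i: "integrable lborel f" using fin f0 fm unfolding e by (intro integrableI_nonneg) auto
 then show "sint {0..R} (%r. r * ed r)" by (simp add: sintegrable_def f_def[abs_def])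
 show "dirichlet (ball x R) = ennreal (DD R)"
  unfolding e DD_def LBINT_def f_def[symmetric] by (rule nn_integral_eq_integral[OF i]) (use f0 in auto)
 show "DD R >= 0" unfolding DD_def LBINT_def f_def[symmetric] by (rule integral_nonneg_AE) (use f0 in auto)
qed

lemma DD_ac: "ac 0 R DD (%r. r * ed r)"
 unfolding DD_def[abs_def] by (rule ac_indefinite[OF ed_integral(1)])

text \<open>The cut inequality for the whole disk: the added frontier is a half circle of length
  \<open>pi * R\<close>.\<close>

lemma half_disc_bound: assumes "R > 0" shows "dirichlet (ball x R) + hausdorff1 (K Int ball x R) <= ennreal (pi * R)"
proof -
 have "dirichlet (ball x R) + hausdorff1 (K Int ball x R) <= hausdorff1 (frontier (ball x R) Int closure U)"
  by (rule cut_inequality) auto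
 also have "frontier (ball x R) Int closure U <= pol x R ` {0..pi}"
 proof
  fix y assume y: "y \<in> frontier (ball x R) Int closure U"
  then have "dist x y = R" using assms by simp
  then obtain t where t: "0 <= t" "t < 2 * pi" "y = pol x R t" using pol_surj[of x y R 0] by auto
  have "sin t >= 0" using y t assms x_in(2) U_simps(2) by (auto simp: zero_le_mult_iff)
  then have "t <= pi" using sin_lt_zero[of t] t by force
  then show "y \<in> pol x R ` {0..pi}" using t by auto
 qed
 then have "hausdorff1 (frontier (ball x R) Int closure U) <= hausdorff1 (pol x R ` {0..pi})" by (rule hausdorff1_mono)
 also have "... <= ennreal (R * (pi - 0))" by (rule hausdorff1_arc_le) (use assms in auto)
 finally show ?thesis by (simp add: mult.commute)
qed

lemma DD_le: assumes "R > 0" shows "DD R <= pi * R"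
proof -
 have "ennreal (DD R) <= ennreal (pi * R)"
  by (rule order_trans[OF _ half_disc_bound[OF assms]]) (simp add: ed_integral(2))
 then show ?thesis using assms by (simp add: ennreal_le_iff)
qed

text \<open>First variation for the factor \<open>1 + \<tau> * ph\<close>. The difference of the
  energies is a quadratic in \<open>\<tau>\<close> that is nonnegative for both signs of
  \<open>\<tau>\<close>, so its linear coefficient vanishes. \<open>- k\<close> is the derivative of
  \<open>ph\<close>, which brings in the mixed term \<open>BB\<close>.\<close>

lemma radial_cutoff:
 assumes R: "good R" and ab: "0 < a" "a < b" "b < R"
  and H: "!!s. (H has_real_derivative (bump n a b (sqrt s) / (2 * sqrt s))) (at s)"
  and Hb: "!!s. b^2 <= s ==> H s = H (b^2)" and ch': "continuous_on UNIV (%s. bump n a b (sqrt s) / (2 * sqrt s))"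
 defines "ph \<equiv> %r. H (b^2) - H (r^2)" and "k \<equiv> bump n a b"
 shows "(LBINT r:{0..R}. r * (ph r * ed r - k r * BB r)) = 0"
proof -
 define h where "h s = bump n a b (sqrt s) / (2 * sqrt s)" for s
 have R0: "R > 0" using ab by simp
 have ch: "continuous_on UNIV h" using ch' by (simp add: h_def[abs_def])
 have cH: "continuous_on UNIV H" using DERIV_continuous_on[of UNIV H h] H by (auto simp: h_def)
 have cph: "continuous_on S ph" for S unfolding ph_def by (intro continuous_intros continuous_on_compose2[OF cH]) auto
 have [measurable]: "ph \<in> bm borel" "k \<in> bm borel"
  unfolding k_def by (auto intro!: borel_measurable_continuous_onI cph continuous_intros)
 obtain M where M: "!!r. r \<in> {0..R} ==> \<bar>ph r\<bar> <= M"
 proof -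
  have "compact (ph ` {0..R})" by (intro compact_continuous_image cph) auto
  then obtain c where "\<forall>z\<in>ph ` {0..R}. norm z <= c" using compact_imp_bounded bounded_iff by blast
  then show ?thesis using that[of c] by auto
 qed
 have kb: "\<bar>k r\<bar> <= 1" for r unfolding k_def by (rule bump_abs_le)
 have M0: "M >= 0" using M[of 0] R0 by auto
 \<comment> \<open>Coefficients of \<open>2 * \<tau>\<close> and of \<open>\<tau>^2\<close> in the
   angular energy of the scaled function, multiplied by the Jacobian.\<close>
 define a1 where "a1 r = r * (ph r * ed r - k r * BB r)" for r
 define a2 where "a2 r = r * ((ph r)^2 * ed r - 2 * k r * ph r * BB r + (k r)^2 * CC r)" for r
 have dom: "sint {0..R} f" if fm: "f \<in> bm borel" and fb: "!!r. nice r ==> r <= R ==> \<bar>f r\<bar> <= c * (r * ed r)" for f c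
  unfolding sintegrable_def
 proof (rule bochner_bound)
  show "integrable lborel (%r. c * (ind {0..R} r *R (r * ed r)))"
   using ed_integral(1)[of R] by (simp add: sintegrable_def)
  show "AE r in lborel. norm (ind {0..R} r *R f r) <= norm (c * (ind {0..R} r *R (r * ed r)))"
   using AE_nice AE_lborel_singleton[of 0]
  proof eventually_elim
   case (elim r)
   show ?case
   proof (cases "r \<in> {0..R}")
    case True
    then have "\<bar>f r\<bar> <= c * (r * ed r)" using elim fb[of r] by auto
    then show ?thesis using True by simp
   qed simp
  qed
 qed (use fm in measurable)
 have i1: "sint {0..R} a1"
 proof (rule dom[where c = "M + (1 + 4 * R^2)"])
  show "a1 \<in> bm borel" unfolding a1_def[abs_def] by measurable
  fix r assume r: "nice r" "r <= R"
  have rp: "r > 0" using nice_integrable(1)[OF r(1)] .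
  have "\<bar>ph r * ed r - k r * BB r\<bar> <= \<bar>ph r\<bar> * ed r + \<bar>k r\<bar> * \<bar>BB r\<bar>"
   using abs_triangle_ineq4[of "ph r * ed r" "k r * BB r"] PQC_nonneg(4)[of r] by (simp add: abs_mult)
  also have "... <= M * ed r + 1 * ((1 + 4 * R^2) * ed r)"
   using M[of r] r rp kb[of r] BB_CC_le(1)[OF r] PQC_nonneg(4)[of r] by (intro add_mono mult_mono) auto
  finally have "r * \<bar>ph r * ed r - k r * BB r\<bar> <= r * (M * ed r + 1 * ((1 + 4 * R^2) * ed r))" using rp by (intro mult_left_mono) auto
  moreover have "\<bar>a1 r\<bar> = r * \<bar>ph r * ed r - k r * BB r\<bar>" using rp by (simp only: a1_def abs_mult abs_of_pos)
  moreover have "(M + (1 + 4 * R^2)) * (r * ed r) = r * (M * ed r + 1 * ((1 + 4 * R^2) * ed r))" by algebra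
  ultimately show "\<bar>a1 r\<bar> <= (M + (1 + 4 * R^2)) * (r * ed r)" by (simp only:)
 qed
 have i2: "sint {0..R} a2"
 proof (rule dom[where c = "M^2 + 2 * (M * (1 + 4 * R^2)) + 4 * R^2"])
  show "a2 \<in> bm borel" unfolding a2_def[abs_def] by measurable
  fix r assume r: "nice r" "r <= R"
  have rp: "r > 0" using nice_integrable(1)[OF r(1)] .
  have p: "\<bar>ph r\<bar> <= M" using M r rp by auto
  have k2: "(k r)^2 <= 1" using kb[of r] by (simp add: abs_square_le_1)
  have "\<bar>(ph r)^2 * ed r - 2 * k r * ph r * BB r + (k r)^2 * CC r\<bar> <= \<bar>ph r\<bar>^2 * ed r + 2 * (\<bar>k r\<bar> * \<bar>ph r\<bar> * \<bar>BB r\<bar>) + (k r)^2 * CC r"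
   using PQC_nonneg[of r] abs_triangle_ineq[of "(ph r)^2 * ed r - 2 * k r * ph r * BB r" "(k r)^2 * CC r"] abs_triangle_ineq4[of "(ph r)^2 * ed r" "2 * k r * ph r * BB r"]
   by (simp add: abs_mult)
  also have "... <= M^2 * ed r + 2 * (1 * M * ((1 + 4 * R^2) * ed r)) + 1 * ((4 * R^2) * ed r)"
   using p kb[of r] k2 BB_CC_le[OF r] PQC_nonneg[of r] M0 by (intro add_mono mult_mono power_mono mult_left_mono) auto
  finally have "r * \<bar>(ph r)^2 * ed r - 2 * k r * ph r * BB r + (k r)^2 * CC r\<bar> <= r * (M^2 * ed r + 2 * (1 * M * ((1 + 4 * R^2) * ed r)) + 1 * ((4 * R^2) * ed r))"
   using rp by (intro mult_left_mono) auto
  moreover have "\<bar>a2 r\<bar> = r * \<bar>(ph r)^2 * ed r - 2 * k r * ph r * BB r + (k r)^2 * CC r\<bar>" using rp by (simp only: a2_def abs_mult abs_of_pos)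
  moreover have "(M^2 + 2 * (M * (1 + 4 * R^2)) + 4 * R^2) * (r * ed r) = r * (M^2 * ed r + 2 * (1 * M * ((1 + 4 * R^2) * ed r)) + 1 * ((4 * R^2) * ed r))" by algebra
  ultimately show "\<bar>a2 r\<bar> <= (M^2 + 2 * (M * (1 + 4 * R^2)) + 4 * R^2) * (r * ed r)" by (simp only:)
 qed
 have "0 <= 2 * \<tau> * (LBINT r:{0..R}. a1 r) + \<tau>^2 * (LBINT r:{0..R}. a2 r)" for \<tau>
 proof -
  define \<eta> where "\<eta> y = 1 + \<tau> * (H (b^2) - H ((y - x) \<bullet> (y - x)))" for y :: "real^2"
  define D\<eta> where "D\<eta> y = (- \<tau> * h ((y - x) \<bullet> (y - x))) *R (2 *R (y - x))" for y :: "real^2"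
  have sqd: "(y - x) \<bullet> (y - x) = (dist x y)^2" for y :: "real^2"
  proof -
   have "dist x y = norm (y - x)" by (simp add: dist_norm norm_minus_commute)
   then show ?thesis by (simp only: power2_norm_eq_inner)
  qed
  have C1: "C1_gradient \<eta> D\<eta>"
   unfolding C1_gradient_def
  proof (intro conjI allI)
   fix y
   have 1: "((%y. (y - x) \<bullet> (y - x)) has_derivative (%d. d \<bullet> (2 *R (y - x)))) (at y)"
    by (auto intro!: derivative_eq_intros simp: fun_eq_iff inner_commute algebra_simps)
   have "GDERIV (%y. H ((y - x) \<bullet> (y - x))) y :> h ((y - x) \<bullet> (y - x)) *R (2 *R (y - x))"
    by (rule GDERIV_DERIV_compose) (use 1 H in "auto simp: gderiv_def h_def")
   then have "GDERIV (%y. \<tau> * (H (b^2) - H ((y - x) \<bullet> (y - x)))) y :> \<tau> *R (0 - h ((y - x) \<bullet> (y - x)) *R (2 *R (y - x)))"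
    using GDERIV_mult[OF GDERIV_const GDERIV_diff[OF GDERIV_const]] by fastforce
   then have "GDERIV (%y. 1 + \<tau> * (H (b^2) - H ((y - x) \<bullet> (y - x)))) y :> 0 + \<tau> *R (0 - h ((y - x) \<bullet> (y - x)) *R (2 *R (y - x)))"
    by (rule GDERIV_add[OF GDERIV_const])
   moreover have "0 + \<tau> *R (0 - h ((y - x) \<bullet> (y - x)) *R (2 *R (y - x))) = D\<eta> y" by (simp add: D\<eta>_def)
   ultimately show "GDERIV \<eta> y :> D\<eta> y" by (simp only: \<eta>_def[abs_def])
   show "continuous_on UNIV D\<eta>" unfolding D\<eta>_def[abs_def]
    by (intro continuous_intros continuous_on_compose2[OF ch]) auto
  qed
  have one: "\<eta> y = 1" if "y ~: ball x R" for y
  proof -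
   have "b^2 <= (dist x y)^2" using that ab by (intro power_mono) auto
   then have "H ((dist x y)^2) = H (b^2)" by (rule Hb)
   then show ?thesis unfolding \<eta>_def sqd by simp
  qed
  define F where "F y = ennreal ((\<eta> y * ga y + u0 y * D\<eta> y $ 1)^2 + (\<eta> y * gb y + u0 y * D\<eta> y $ 2)^2) * ind (ball x R) y" for y
  have c: "continuous_on UNIV \<eta>" "continuous_on UNIV D\<eta>" using C1_gradient_continuous[OF C1] C1 by (auto simp: C1_gradient_def)
  have [measurable]: "\<eta> \<in> bm borel" "(%y. D\<eta> y $ i) \<in> bm borel" for i
   using c by (auto intro!: borel_measurable_continuous_onI continuous_intros)
  have "ball x R \<in> sets borel" by simp
  then have Fm: "F \<in> bm borel" unfolding F_def[abs_def] by measurable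
   have nn: "AE r in lborel. 0 <= ind {0..R} r *R (r * ed r + 2 * \<tau> * a1 r + \<tau>^2 * a2 r)"
    using AE_nice AE_lborel_singleton[of 0]
   proof eventually_elim
    case (elim r)
    show ?case
    proof (cases "r \<in> {0..R}")
     case True
     then have nr: "nice r" and r: "r > 0" using elim by auto
     define et kk where "et = 1 + \<tau> * ph r" and "kk = \<tau> * k r"
     note ni = nice_integrable[OF nr]
     have "0 <= (LBINT t:{0..pi}. (et * P (r, t) - kk * V (r, t))^2)"
      by (auto simp: LBINT_def intro!: integral_nonneg_AE)
     also have "... = (LBINT t:{0..pi}. et^2 * (P (r, t))^2 - 2 * kk * et * (P (r, t) * V (r, t)) + kk^2 * (V (r, t))^2)"
      by (rule set_lebesgue_integral_cong) (auto simp: power2_eq_square algebra_simps)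
     also have "... = et^2 * PP r - 2 * kk * et * BB r + kk^2 * CC r"
      unfolding PP_def BB_def CC_def
      by (simp only: sint_linear ni)
     finally have "0 <= r * (et^2 * PP r - 2 * kk * et * BB r + kk^2 * CC r + et^2 / r^2 * QQ r)"
      using r PQC_nonneg[of r] by (intro mult_nonneg_nonneg add_nonneg_nonneg[of _ "et^2 / r^2 * QQ r"]) auto
     also have "... = r * ed r + 2 * \<tau> * a1 r + \<tau>^2 * a2 r"
      by (simp add: ed_def a1_def a2_def et_def kk_def power2_eq_square algebra_simps add_divide_distrib)
     finally show ?thesis using True by simp
    qed simp
   qed
  have "ennreal (DD R) <= (\<integral>\<^sup>+ y \<in> (ball x R Int U) - K. ennreal ((norm (\<eta> y *R g y + u y *R D\<eta> y))^2) \<partial>lebesgue)"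
   unfolding ed_integral(2)[symmetric] by (rule scaled_competitor[OF R C1 one])
  also have "... <= (\<integral>\<^sup>+ y. F y * ind half_plane y \<partial>lebesgue)"
  proof (rule nn_integral_mono_AE)
   show "AE y in lebesgue. ennreal ((norm (\<eta> y *R g y + u y *R D\<eta> y))^2) * ind ((ball x R Int U) - K) y <= F y * ind half_plane y"
    using u0_AE ga_AE gb_AE
   proof eventually_elim
    case (elim y)
    show ?case
    proof (cases "y \<in> (ball x R Int U) - K")
     case True
     then have "y \<in> U - K" "y \<in> half_plane" using U_half_plane by auto
     then show ?thesis using elim True by (simp add: F_def norm_vec2_sq del: ennreal_plus)
    qed simp
   qed
  qed
  also have "... = (NN y. F y * ind half_plane y)" by (rule nn_integral_completion)
  also have "... = (NP p. (ennreal (fst p) * ind strip p) * F (polp x p))"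
   by (rule nn_integral_polar[OF x_in(2) Fm])
  also have "... = (NN r. NN t. (ennreal (fst (r, t)) * ind strip (r, t)) * F (polp x (r, t)))"
  proof -
   have "(%p. (ennreal (fst p) * ind strip p) * F (polp x p)) \<in> bm lborel2"
    by (intro borel_measurable_times_ennreal measurable_compose[OF measurable_polp Fm]) measurable
   from lborel.nn_integral_fst[OF this] show ?thesis by simp
  qed
  also have "... = (NN r. ennreal (ind {0..R} r *R (r * ed r + 2 * \<tau> * a1 r + \<tau>^2 * a2 r)))"
  proof (rule nn_integral_cong_AE)
   show "AE r in lborel. (NN t. (ennreal (fst (r, t)) * ind strip (r, t)) * F (polp x (r, t))) = ennreal (ind {0..R} r *R (r * ed r + 2 * \<tau> * a1 r + \<tau>^2 * a2 r))"
    using AE_nice AE_lborel_singleton[of 0] AE_lborel_singleton[of R]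
   proof eventually_elim
    case (elim r)
    show ?case
    proof (cases "r \<in> {0<..<R}")
     case False
     have z: "(ennreal (fst (r, t)) * ind strip (r, t)) * F (polp x (r, t)) = 0" for t
      using False by (auto simp: F_def strip_def polp_def dist_pol indicator_def)
     show ?thesis unfolding z using False elim by (auto simp: indicator_def)
    next
     case True
     then have nr: "nice r" and r: "r > 0" "r < R" using elim by auto
     note ni = nice_integrable[OF nr]
     define et kk where "et = 1 + \<tau> * ph r" and "kk = \<tau> * k r"
     define f where "f t = r * (et^2 * (P (r, t))^2 - 2 * kk * et * (P (r, t) * V (r, t)) + kk^2 * (V (r, t))^2 + et^2 / r^2 * (Q (r, t))^2)" for t
     have f_alt: "f t = r * ((et * P (r, t) - kk * V (r, t))^2 + (et * (Q (r, t) / r))^2)" for t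
      by (simp add: f_def power2_eq_square algebra_simps)
     have f0: "f t >= 0" for t unfolding f_alt using r by simp
     have fi: "sint {0..pi} f"
      unfolding f_def[abs_def] by (intro set_integrable_mult_right set_integral_add set_integral_diff ni)
     have pt: "(ennreal (fst (r, t)) * ind strip (r, t)) * F (polp x (r, t)) = ennreal (ind {0<..<pi} t *R f t)" for t
     proof (cases "t \<in> {0<..<pi}")
      case t: True
      define y where "y = pol x r t"
      have sq: "(y - x) \<bullet> (y - x) = r^2" unfolding sqd y_def dist_pol by simp
      have et: "\<eta> y = et" by (simp add: \<eta>_def sq et_def ph_def)
      have hr: "h (r^2) = k r / (2 * r)" using r by (simp add: h_def k_def)
      have D1: "D\<eta> y $ 1 = - kk * cos t" "D\<eta> y $ 2 = - kk * sin t"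
       unfolding D\<eta>_def sq hr using r x_in(2) by (simp_all add: y_def kk_def)
      define A B where "A = et * ga y + u0 y * (- kk * cos t)" and "B = et * gb y + u0 y * (- kk * sin t)"
      have cs: "(cos t)^2 + (sin t)^2 = 1" by simp
      have "A^2 + B^2 = (A * cos t + B * sin t)^2 + (B * cos t - A * sin t)^2"
       using cs by algebra
      also have "A * cos t + B * sin t = et * (ga y * cos t + gb y * sin t) - kk * u0 y * ((cos t)^2 + (sin t)^2)"
       unfolding A_def B_def by algebra
      also have "ga y * cos t + gb y * sin t = P (r, t)" by (simp add: P_def polp_def y_def)
      also have "u0 y = V (r, t)" by (simp add: V_def polp_def y_def)
      also have "B * cos t - A * sin t = et * (gb y * cos t - ga y * sin t)" unfolding A_def B_def by algebra
      also have "gb y * cos t - ga y * sin t = Q (r, t) / r" using r by (simp add: Q_def polp_def y_def)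
      finally have e2: "r * (A^2 + B^2) = f t" unfolding cs f_alt by simp
      have e1: "F (polp x (r, t)) = ennreal (A^2 + B^2)"
       using r by (simp add: F_def polp_def y_def[symmetric] et D1 A_def B_def del: ennreal_plus) (simp add: y_def dist_pol)
      have e3: "ennreal (fst (r, t)) * ind strip (r, t) = ennreal r" using t r by (simp add: strip_def)
      have "ennreal r * ennreal (A^2 + B^2) = ennreal (f t)"
       unfolding e2[symmetric] by (rule ennreal_mult[symmetric]) (use r in auto)
      then show ?thesis unfolding e1 e3 using t by simp
     qed (simp add: strip_def)
     have "(NN t. (ennreal (fst (r, t)) * ind strip (r, t)) * F (polp x (r, t))) = (NN t. ennreal (ind {0..pi} t *R f t))"
      unfolding pt
     proof (rule nn_integral_cong_AE)
      show "AE t in lborel. ennreal (ind {0<..<pi} t *R f t) = ennreal (ind {0..pi} t *R f t)"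
       using AE_lborel_singleton[of 0] AE_lborel_singleton[of pi] by eventually_elim (auto simp: indicator_def)
     qed
     also have "... = ennreal (LBINT t:{0..pi}. f t)"
      unfolding LBINT_def by (rule nn_integral_eq_integral) (use fi f0 in "auto simp: sintegrable_def")
     also have "(LBINT t:{0..pi}. f t) = r * (et^2 * PP r - 2 * kk * et * BB r + kk^2 * CC r + et^2 / r^2 * QQ r)"
      unfolding f_def PP_def BB_def CC_def QQ_def
      by (simp only: sint_linear ni)
     also have "... = r * ed r + 2 * \<tau> * a1 r + \<tau>^2 * a2 r"
      by (simp add: ed_def a1_def a2_def et_def kk_def power2_eq_square algebra_simps add_divide_distrib)
     finally show ?thesis using True by simp
    qed
   qed
  qed
  also have "... = ennreal (LBINT r:{0..R}. r * ed r + 2 * \<tau> * a1 r + \<tau>^2 * a2 r)"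
   unfolding LBINT_def
  proof (rule nn_integral_eq_integral)
   have "sint {0..R} (%r. r * ed r + 2 * \<tau> * a1 r + \<tau>^2 * a2 r)"
    by (intro set_integral_add set_integrable_mult_right ed_integral(1) i1 i2)
   then show "integrable lborel (%r. ind {0..R} r *R (r * ed r + 2 * \<tau> * a1 r + \<tau>^2 * a2 r))" by (simp add: sintegrable_def)
   show "AE r in lborel. 0 <= ind {0..R} r *R (r * ed r + 2 * \<tau> * a1 r + \<tau>^2 * a2 r)" by (rule nn)
  qed
  finally have le: "ennreal (DD R) <= ennreal (LBINT r:{0..R}. r * ed r + 2 * \<tau> * a1 r + \<tau>^2 * a2 r)" .
  have eq: "(LBINT r:{0..R}. r * ed r + 2 * \<tau> * a1 r + \<tau>^2 * a2 r) = DD R + 2 * \<tau> * (LBINT r:{0..R}. a1 r) + \<tau>^2 * (LBINT r:{0..R}. a2 r)"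
   unfolding DD_def
   by (simp only: sint_linear ed_integral(1) i1 i2)
  have "0 <= (LBINT r:{0..R}. r * ed r + 2 * \<tau> * a1 r + \<tau>^2 * a2 r)"
   unfolding LBINT_def using nn by (rule integral_nonneg_AE)
  then have "DD R <= (LBINT r:{0..R}. r * ed r + 2 * \<tau> * a1 r + \<tau>^2 * a2 r)" using le by (simp only: ennreal_le_iff)
  then show ?thesis unfolding eq by simp
 qed
 from quadratic_coefficient_zero[OF this] show ?thesis by (simp add: a1_def)
qed


lemma rBB_integrable: "sint {0..R} (%r. r * BB r)"
 unfolding sintegrable_def
proof (rule bochner_bound)
 show "integrable lborel (%r. (1 + 4 * R^2) * (ind {0..R} r *R (r * ed r)))"
  using ed_integral(1)[of R] by (simp add: sintegrable_def)
 show "AE r in lborel. norm (ind {0..R} r *R (r * BB r)) <= norm ((1 + 4 * R^2) * (ind {0..R} r *R (r * ed r)))"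
  using AE_nice AE_lborel_singleton[of 0]
 proof eventually_elim
  case (elim r)
  show ?case
  proof (cases "r \<in> {0..R}")
   case True
   then have nr: "nice r" and r: "r > 0" "r <= R" using elim by auto
   have "\<bar>BB r\<bar> <= (1 + 4 * R^2) * ed r" by (rule BB_CC_le(1)[OF nr r(2)])
   then have "r * \<bar>BB r\<bar> <= r * ((1 + 4 * R^2) * ed r)" using r by (intro mult_left_mono) auto
   then show ?thesis using True r PQC_nonneg(4)[of r] by (simp add: abs_mult mult_ac)
  qed simp
 qed
qed measurable

text \<open>Since \<open>ph\<close> has derivative \<open>- k\<close> and vanishes at
  \<open>R\<close>, integration by parts turns the term \<open>ph r * (r * ed r)\<close> into
  \<open>k r * DD r\<close>. The first variation then says that \<open>r * BB r - DD r\<close> is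
  orthogonal to every bump.\<close>

lemma DD_flux_local:
 assumes R: "good R" shows "AE r\<in>{0<..<R} in lborel. r * BB r - DD r = 0"
proof (rule AE_zero_if_bump_integrals_zero)
 have DDi: "sint {0..R} DD" by (rule borel_integrable_atLeastAtMost'[OF ac_continuous[OF DD_ac]])
 show "sint {0..R} (%r. r * BB r - DD r)" by (rule set_integral_diff(1)[OF rBB_integrable DDi])
 fix n a b assume ab: "0 < a" "a < b" "b < R"
 obtain H where H: "!!s. (H has_real_derivative (bump n a b (sqrt s) / (2 * sqrt s))) (at s)" "!!s. b^2 <= s ==> H s = H (b^2)"
  "continuous_on UNIV (%s. bump n a b (sqrt s) / (2 * sqrt s))"
  using cutoff_primitive[OF ab(1,2)] by blast
 define ph k where "ph r = H (b^2) - H (r^2)" and "k = bump n a b" for r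
 have R0: "R > 0" using ab by simp
 have z: "(LBINT r:{0..R}. r * (ph r * ed r - k r * BB r)) = 0"
  using radial_cutoff[OF R ab H] by (simp add: ph_def k_def)
 have Dph: "(ph has_real_derivative - k r) (at r)" if "0 <= r" for r
 proof -
  have "(ph has_real_derivative (0 - (bump n a b (sqrt (r^2)) / (2 * sqrt (r^2))) * (2 * r))) (at r)"
   unfolding ph_def[abs_def] by (intro DERIV_diff DERIV_const DERIV_chain2[OF H(1)]) (auto intro!: derivative_eq_intros)
  moreover have "0 - (bump n a b (sqrt (r^2)) / (2 * sqrt (r^2))) * (2 * r) = - k r"
   using that ab by (cases "r = 0") (auto simp: k_def bump_eq_0)
  ultimately show ?thesis by simp
 qed
 have ck: "continuous_on S k" for S unfolding k_def by (intro continuous_intros)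
 have acph: "ac 0 R ph (%r. - k r)" by (rule ac_C1) (use Dph ck in "auto intro!: continuous_intros")
 have "ph R = 0"
 proof -
  have "b^2 <= R^2" using ab by (intro power_mono) auto
  from H(2)[OF this] show ?thesis by (simp add: ph_def)
 qed
 moreover have "DD 0 = 0" by (simp add: DD_def set_integral_zero_singleton)
 ultimately have p: "(LBINT r:{0..R}. - k r * DD r + ph r * (r * ed r)) = 0"
  using ac_by_parts[OF acph DD_ac] R0 by simp
 have i1: "sint {0..R} (%r. - k r * DD r + ph r * (r * ed r))" by (rule ac_integrable[OF ac_mult[OF acph DD_ac]])
 have i2: "sint {0..R} (%r. r * (ph r * ed r - k r * BB r))"
 proof -
  have "sint {0..R} (%r. ph r * (r * ed r) - k r * (r * BB r))"
   by (intro set_integral_diff set_integrable_mult_continuous(2) ed_integral(1) rBB_integrable ck ac_continuous[OF acph])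
  then show ?thesis by (simp add: algebra_simps)
 qed
 have "(LBINT r:{0..R}. k r * (r * BB r - DD r)) = (LBINT r:{0..R}. (- k r * DD r + ph r * (r * ed r)) - r * (ph r * ed r - k r * BB r))"
  by (rule set_lebesgue_integral_cong) (auto simp: algebra_simps)
 also have "... = 0" using set_integral_diff(2)[OF i1 i2] p z by simp
 finally show "(LBINT r:{0..R}. bump n a b r * (r * BB r - DD r)) = 0" by (simp add: k_def)
qed

lemma DD_flux: "AE r in lborel. r > 0 --> DD r = r * BB r"
proof -
 have "AE r\<in>{0<..<real n} in lborel. DD r = r * BB r" for n
 proof -
  obtain R where "good R" "real n < R" using good_between[of "real n" "real n + 1"] by auto
  with DD_flux_local[of R] show ?thesis by (auto elim!: eventually_mono)
 qed
 then have "AE r in lborel. \<forall>n. r \<in> {0<..<real n} --> DD r = r * BB r" by (subst AE_all_countable) auto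
 then show ?thesis
 proof eventually_elim
  case (elim r)
  then show ?case using reals_Archimedean2[of r] by auto
 qed
qed

text \<open>\<open>dd\<close> is the derivative of \<open>DD r / r\<close>. \<open>RR\<close>
  measures the failure of Euler's relation \<open>P = V / (2 * r)\<close> for functions homogeneous
  of degree 1/2.\<close>

definition RR where "RR r = (LBINT t:{0..pi}. (P (r, t) - V (r, t) / (2 * r))^2)"
definition dd where "dd r = ed r - DD r / r^2"

lemma defect_integral:
 assumes "0 < r1" "r1 <= r2"
 shows "sint {r1..r2} dd" "(LBINT r:{r1..r2}. dd r) = DD r2 / r2 - DD r1 / r1"
proof -
 have 1: "ac r1 r2 DD (%r. r * ed r)" by (rule ac_subinterval[OF DD_ac[of r2]]) (use assms in auto)
 have 2: "ac r1 r2 (%r. 1 / r) (%r. - (1 / r^2))"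
  by (rule ac_C1) (use assms in "auto intro!: derivative_eq_intros continuous_intros simp: power2_eq_square")
 note m = ac_mult[OF 1 2]
 have e: "r * ed r * (1 / r) + DD r * - (1 / r^2) = dd r" if "r \<in> {r1..r2}" for r
  using that assms by (simp add: dd_def)
 show "sint {r1..r2} dd"
  using ac_integrable[OF m] by (rule set_integrable_cong[THEN iffD1, rotated 3]) (use e in auto)
 have "(LBINT r:{r1..r2}. dd r) = (LBINT r:{r1..r2}. r * ed r * (1 / r) + DD r * - (1 / r^2))"
  by (rule set_lebesgue_integral_cong) (use e in auto)
 also have "... = DD r2 * (1 / r2) - DD r1 * (1 / r1)" using ac_diff[OF m, of r1 r2] assms by simp
 finally show "(LBINT r:{r1..r2}. dd r) = DD r2 / r2 - DD r1 / r1" by simp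
qed

text \<open>With the flux identity, \<open>dd r = PP r + QQ r / r^2 - BB r / r\<close>. Completing
  the square in \<open>P\<close> turns this into \<open>RR r\<close> plus the Wirtinger deficit over
  \<open>r^2\<close>, both nonnegative. A small defect thus controls radial homogeneity and the
  angular profile at once.\<close>

lemma defect_split:
 assumes n: "nice r" and f: "DD r = r * BB r"
 shows "dd r = RR r + (QQ r - CC r / 4) / r^2" "RR r >= 0" "QQ r - CC r / 4 >= 0" "dd r >= 0"
  "sint {0..pi} (%t. (P (r, t) - V (r, t) / (2 * r))^2)"
proof -
 note ni = nice_integrable[OF n]
 have e: "(P (r, t) - V (r, t) / (2 * r))^2 = (P (r, t))^2 - (1 / r) * (P (r, t) * V (r, t)) + (1 / (4 * r^2)) * (V (r, t))^2" for t
  using ni(1) by (simp add: power2_eq_square field_simps)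
 show i: "sint {0..pi} (%t. (P (r, t) - V (r, t) / (2 * r))^2)"
  unfolding e by (intro set_integral_add set_integral_diff set_integrable_mult_right ni)
 have R: "RR r = PP r - (1 / r) * BB r + (1 / (4 * r^2)) * CC r"
  unfolding RR_def e PP_def BB_def CC_def
  by (simp only: sint_linear ni)
 show 1: "dd r = RR r + (QQ r - CC r / 4) / r^2"
  unfolding R dd_def f ed_def using ni(1) by (simp add: power2_eq_square field_simps)
 show 2: "RR r >= 0" by (auto simp: RR_def LBINT_def intro!: integral_nonneg_AE)
 show 3: "QQ r - CC r / 4 >= 0" using ni(7) by simp
 show "dd r >= 0" using 1 2 3 by simp
qed

lemma ratio_mono:
 assumes "0 < r1" "r1 <= r2" shows "DD r1 / r1 <= DD r2 / r2"
proof -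
 have "0 <= (LBINT r:{r1..r2}. dd r)"
  unfolding LBINT_def
 proof (rule integral_nonneg_AE)
  show "AE r in lborel. 0 <= ind {r1..r2} r *R dd r"
   using AE_nice DD_flux
  proof eventually_elim
   case (elim r)
   show ?case using elim assms defect_split(4)[of r] by (auto simp: indicator_def)
  qed
 qed
 then show ?thesis using defect_integral(2)[OF assms] by simp
qed

text \<open>If each doubling from \<open>r0\<close> on raised the ratio by more than
  \<open>\<epsilon>\<close>, finitely many doublings would carry it beyond its bound pi.\<close>

lemma small_defect:
 assumes r0: "r0 > 0" and e: "\<epsilon> > 0"
 obtains \<rho> where "\<rho> >= r0" "DD (2 * \<rho>) / (2 * \<rho>) - DD \<rho> / \<rho> <= \<epsilon>"
proof (rule ccontr)
 assume n: "\<not> thesis"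
 have "real k * \<epsilon> <= DD (2 ^ k * r0) / (2 ^ k * r0)" for k
 proof (induction k)
  case 0
  show ?case using r0 ed_integral(3)[of r0] by simp
 next
  case (Suc k)
  have "1 * r0 <= 2 ^ k * r0" using r0 by (intro mult_right_mono) auto
  then have "\<not> DD (2 * (2 ^ k * r0)) / (2 * (2 ^ k * r0)) - DD (2 ^ k * r0) / (2 ^ k * r0) <= \<epsilon>" using n that[of "2 ^ k * r0"] by auto
  then show ?case using Suc by (simp add: algebra_simps)
 qed
 moreover obtain k where "pi < real k * \<epsilon>" using reals_Archimedean3[OF e] by blast
 moreover have "DD (2 ^ k * r0) / (2 ^ k * r0) <= pi" using DD_le[of "2 ^ k * r0"] r0 by (simp add: field_simps)
 ultimately show False by (meson not_less order_trans)
qed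

text \<open>Without energy, Wirtinger's inequality on the slices makes \<open>u\<close> vanish
  almost everywhere. Then \<open>K\<close> can be erased inside a good disk at no cost, which
  contradicts normalization at \<open>x\<close>.\<close>

lemma DD_pos: obtains r0 where "r0 > 0" "DD r0 > 0"
proof (rule ccontr)
 assume "\<not> thesis"
 then have "\<forall>r>0. \<not> DD r > 0" using that by blast
 then have D0: "DD r = 0" if "r > 0" for r using that ed_integral(3)[of r] by force
 have "AE r in lborel. r > 0 --> CC r = 0"
 proof -
  have "AE r in lborel. \<forall>n::nat. ind {0..real n} r *R (r * ed r) = 0"
   unfolding AE_all_countable
  proof
   fix n :: nat
   have "DD (real n) = 0" using D0[of "real n"] by (cases "n = 0") (auto simp: DD_def set_integral_zero_singleton)
   moreover have "AE r in lborel. 0 <= ind {0..real n} r *R (r * ed r)" using PQC_nonneg(4) by (auto simp: indicator_def)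
   ultimately show "AE r in lborel. ind {0..real n} r *R (r * ed r) = 0"
    using ed_integral(1)[of "real n"] unfolding DD_def LBINT_def sintegrable_def
    by (subst (asm) integral_nonneg_eq_0_iff_AE) auto
  qed
  then show ?thesis using AE_nice
  proof eventually_elim
   case (elim r)
   show ?case
   proof
    assume r: "r > 0"
    obtain n where "r < real n" using reals_Archimedean2 by blast
    then have "ed r = 0" using elim(1) r by (auto dest!: spec[of _ n])
    moreover have "0 <= QQ r / r^2" "0 <= PP r" using PQC_nonneg[of r] by auto
    ultimately have "QQ r / r^2 = 0" unfolding ed_def by linarith
    then have "QQ r = 0" using r by simp
    then show "CC r = 0" using nice_integrable(7)[of r] elim(2) r PQC_nonneg(3)[of r] by auto
   qed
  qed
 qed
 then have CC0: "AE r in lborel. r > 0 --> CC r = 0" .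
 have uz: "AE y in lebesgue. y \<in> U - K --> u y = 0"
 proof -
  have m: "(%y. ennreal ((u0 y)^2)) \<in> bm borel" by measurable
  have "(NN y. ennreal ((u0 y)^2) * ind half_plane y) = (NP p. (ennreal (fst p) * ind strip p) * ennreal ((u0 (polp x p))^2))"
   by (rule nn_integral_polar[OF x_in(2) m])
  also have "... = (NN r. NN t. (ennreal (fst (r, t)) * ind strip (r, t)) * ennreal ((V (r, t))^2))"
  proof -
   have "(%p. (ennreal (fst p) * ind strip p) * ennreal ((V p)^2)) \<in> bm lborel2"
    by measurable
   from lborel.nn_integral_fst[OF this] show ?thesis by (simp add: V_def)
  qed
  also have "... = (\<integral>\<^sup>+ r. 0 \<partial>(lborel :: real measure))"
  proof (rule nn_integral_cong_AE)
   show "AE r in lborel. (NN t. (ennreal (fst (r, t)) * ind strip (r, t)) * ennreal ((V (r, t))^2)) = 0"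
    using CC0 AE_nice
   proof eventually_elim
    case (elim r)
    show ?case
    proof (cases "r > 0")
     case True
     then have i: "integrable lborel (%t. ind {0..pi} t *R (V (r, t))^2)" and z: "(LBINT t. ind {0..pi} t *R (V (r, t))^2) = 0"
      using elim nice_integrable(5)[of r] by (auto simp: sintegrable_def CC_def LBINT_def)
     have "AE t in lborel. ind {0..pi} t *R (V (r, t))^2 = 0"
      using integral_nonneg_eq_0_iff_AE[OF i] z by auto
     then have "AE t in lborel. (ennreal (fst (r, t)) * ind strip (r, t)) * ennreal ((V (r, t))^2) = 0"
      by eventually_elim (auto simp: strip_def indicator_def split: if_splits)
     then show ?thesis by (subst nn_integral_cong_AE[where v = "%_. 0"]) auto
    next
     case False
     have "(ennreal (fst (r, t)) * ind strip (r, t)) * ennreal ((V (r, t))^2) = 0" for t using False by (simp add: strip_def)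
     then show ?thesis by (subst nn_integral_cong[where v = "%_. 0"]) auto
    qed
   qed
  qed
  finally have "(NN y. ennreal ((u0 y)^2) * ind half_plane y) = 0" by simp
  then have "AE y in lborel. ennreal ((u0 y)^2) * ind half_plane y = 0"
   using m half_plane_sets by (subst (asm) nn_integral_0_iff_AE) auto
  then have "AE y in lebesgue. ennreal ((u0 y)^2) * ind half_plane y = 0" by (rule AE_completion)
  then show ?thesis using u0_AE
  proof eventually_elim
   case (elim y)
   show ?case
   proof
    assume y: "y \<in> U - K"
    then have "y \<in> half_plane" using U_half_plane by auto
    then have "u0 y = 0" using elim(1) by auto
    then show "u y = 0" using elim(2) y by simp
   qed
  qed
 qed
 obtain R where R: "good R" using good_between[of 0 1] by auto
 then have R0: "R > 0" by (simp add: good_def)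
 obtain p0 where p0: "K Int sphere x R = {p0}" using R by (auto simp: good_def)
 define J where "J = K - ball x R"
 have cJ: "closed J" unfolding J_def using closed_K by auto
 have oJ: "open (U - J)" using U_simps(4) cJ by (rule open_Diff)
 have wz: "weak_gradient_on (U - J) (%_. 0) (%_. 0)"
  unfolding weak_gradient_on_def by (auto simp: LBINT_def)
 have gz: "AE y in lebesgue. y \<in> U - J --> weak_grad (U - J) (%_. 0) y = 0"
  using weak_grad_AE[OF oJ wz] .
 have adm: "admissible_pair U J (%_. 0)"
  unfolding admissible_pair_def
 proof (intro conjI cJ)
  show "J <= closure U" using K_sub by (auto simp: J_def)
  show "W12_loc U J (%_. 0)"
   by (rule W12_locI[OF oJ wz]) auto
  show "has_trace U J (%_. 0) (%_. 0)"
   unfolding has_trace_def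
  proof
   fix y assume "y \<in> frontier U - J"
   then have "y \<in> - J" "open (- J)" using cJ by auto
   then obtain \<rho> where rho: "\<rho> > 0" "ball y \<rho> <= - J" using open_contains_ball by blast
   have "(\<integral>\<^sup>+ z \<in> ball y \<rho> Int U. ennreal ((0 - 0)^2 + (norm (0 - weak_grad (U - J) (%_. 0) z))^2) \<partial>lebesgue) = (\<integral>\<^sup>+ z. 0 \<partial>(lebesgue :: (real^2) measure))"
    by (rule nn_integral_cong_AE) (use gz rho(2) in "auto elim!: eventually_mono simp: indicator_def")
   then show "\<exists>\<rho>>0. ball y \<rho> Int J = {} & (\<exists>v Dv. (\<forall>n::nat. C1_gradient (v n) (Dv n)) &
     (%n. \<integral>\<^sup>+ z \<in> ball y \<rho> Int U. ennreal ((v n z - 0)^2 + (norm (Dv n z - weak_grad (U - J) (%_. 0) z))^2) \<partial>lebesgue) \<longlonglongrightarrow> 0 &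
     (%n. \<integral>\<^sup>+ z \<in> ball y \<rho> Int frontier U. ennreal ((v n z - 0)^2) \<partial>hausdorff1_measure) \<longlonglongrightarrow> 0)"
    using rho by (intro exI[of _ \<rho>] conjI exI[of _ "%_ _. 0"]) (auto simp: C1_gradient_zero)
  qed
 qed
 have JK: "J - ball x R = K - ball x R" by (auto simp: J_def)
 have "admissible_competitor U K u J (%_. 0) (ball x R)"
  unfolding admissible_competitor_def
 proof (intro conjI ballI impI adm JK)
  show "AE y in lebesgue. y \<in> U - K - ball x R --> 0 = u y" using uz by eventually_elim auto
  fix p q assume "p \<in> - (ball x R Un K)" "q \<in> - (ball x R Un K)" "connected_component_set (- K) p ~= connected_component_set (- K) q"
  then show "connected_component_set (- J) p ~= connected_component_set (- J) q"
   by (rule separation_preserved[OF R0 closed_K equalityD1[OF p0] JK])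
 qed auto
 then have "energy U K u (ball x R) <= energy U J (%_. 0) (ball x R)" using minimizer unfolding generalized_minimizer_def by blast
 also have "energy U J (%_. 0) (ball x R) = 0"
 proof -
  have "(\<integral>\<^sup>+ z \<in> (ball x R Int U) - J. ennreal ((norm (weak_grad (U - J) (%_. 0) z))^2) \<partial>lebesgue) = (\<integral>\<^sup>+ z. 0 \<partial>(lebesgue :: (real^2) measure))"
   by (rule nn_integral_cong_AE) (use gz in "auto elim!: eventually_mono simp: indicator_def")
  moreover have "J Int ball x R = {}" by (auto simp: J_def)
  ultimately show ?thesis by (simp add: energy_def)
 qed
 finally have "hausdorff1 (K Int ball x R) = 0" by (simp add: energy_u)
 then show False using norm_K x_in R0 unfolding normalized_def by fastforce
qed

end

section \<open>Profiles at regular radii and the exclusion of switching\<close>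

lemma lborel_le_hausdorff1_AE:
 fixes f :: "'a::metric_space => real"
 assumes "\<delta> > 0" "C > 0"
  and "!!y z. y \<in> A ==> z \<in> A ==> dist y z <= \<delta> ==> \<bar>f y - f z\<bar> <= C * dist y z"
  and S: "S \<in> sets borel" "AE r in lborel. r \<in> S --> r \<in> f ` A"
 shows "emeasure lborel S <= ennreal C * hausdorff1 A"
proof -
 obtain N where N: "!!r. r \<in> space lborel - N ==> r \<in> S --> r \<in> f ` A" "N \<in> null_sets lborel"
  using AE_E3[OF S(2)] by blast
 have "emeasure lborel S = emeasure lborel (S - N)" using N(2) S(1) by (subst emeasure_Diff_null_set) auto
 also have "... <= ennreal C * hausdorff1 A"
  by (rule lborel_le_hausdorff1_image[OF assms(1-3)]) (use N S in "auto")
 finally show ?thesis .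
qed

lemma dist_dist_le: "\<bar>dist x y - dist x z\<bar> <= 1 * dist y z"
 by (metis abs_dist_diff_le dist_commute mult_1)

context crack
begin

text \<open>At a regular radius the trace of \<open>u\<close> on the half circle is close to a multiple of
 \<open>sin (t / 2)\<close> or of \<open>cos (t / 2)\<close>, and the point of \<open>K\<close> lies near the corresponding end.\<close>

definition left_profile where "left_profile l \<gamma> \<eta> r \<longleftrightarrow>
 (\<exists>m. m^2 >= l * r / (4 * pi) & (AE t\<in>{0<..<pi - \<eta>} in lborel. (V (r, t) - m * sin (t / 2))^2 <= \<gamma> * r))"
definition right_profile where "right_profile l \<gamma> \<eta> r \<longleftrightarrow>
 (\<exists>m. m^2 >= l * r / (4 * pi) & (AE t\<in>{\<eta><..<pi} in lborel. (V (r, t) - m * cos (t / 2))^2 <= \<gamma> * r))"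
definition crosses where "crosses a \<eta> r \<longleftrightarrow> (\<exists>ka. K Int sphere x r = {pol x r ka} & \<bar>ka - a\<bar> < \<eta>)"

text \<open>\<open>slice_profile\<close> is applied with the bounds \<open>l * r\<close> and
  \<open>\<gamma> * r\<close>: the defect controls the Wirtinger deficit, and the flux identity
  supplies the lower bound for the mass.\<close>

lemma profile:
 assumes n: "nice r" and f: "DD r = r * BB r" and l: "0 < l" "l <= DD r / r" and g: "r * dd r <= \<gamma>"
  and c: "\<gamma> <= l / 16" "\<gamma> < \<eta> * l / (2 * pi)" "0 < \<eta>" "\<eta> <= pi / 2"
 shows "crosses pi \<eta> r & left_profile l \<gamma> \<eta> r \<or> crosses 0 \<eta> r & right_profile l \<gamma> \<eta> r"
proof -
 note ni = nice_integrable[OF n] and ds = defect_split[OF n f]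
 have r: "r > 0" by (rule ni(1))
 have dd: "dd r <= \<gamma> / r" using g r by (simp add: field_simps)
 then have RR: "RR r <= \<gamma> / r" using ds(1,3) r by (smt (verit) divide_nonneg_nonneg zero_le_power2)
 have "(QQ r - CC r / 4) / r^2 <= \<gamma> / r" using ds(1,2) dd by linarith
 then have "QQ r - CC r / 4 <= \<gamma> / r * r^2" using r by (subst (asm) pos_divide_le_eq) auto
 then have QC: "QQ r - CC r / 4 <= \<gamma> * r" using r by (simp add: power2_eq_square)
 have g0: "\<gamma> >= 0" using RR ds(2) r by (smt (verit) divide_neg_pos)
 \<comment> \<open>\<open>DD r / r = BB r\<close> is the sum of \<open>CC r / (2 * r)\<close> and a
   cross term \<open>X\<close>. If \<open>CC r < l * r\<close>, the first is below
   \<open>l / 2\<close> and the second at most \<open>l / 4\<close>, which contradicts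
   \<open>l <= DD r / r\<close>.\<close>
 have CCl: "l * r <= CC r"
 proof (rule ccontr)
  assume "\<not> ?thesis"
  then have C: "CC r < l * r" by simp
  define X where "X = (LBINT t:{0..pi}. (P (r, t) - V (r, t) / (2 * r)) * V (r, t))"
  have Xi: "sint {0..pi} (%t. (P (r, t) - V (r, t) / (2 * r)) * V (r, t))"
   by (rule Cauchy_Schwarz_set_integral(2)) (use ds(5) ni in auto)
  have "X^2 <= RR r * CC r" unfolding X_def RR_def CC_def
   by (rule Cauchy_Schwarz_set_integral(1)) (use ds(5) ni in auto)
  also have "... <= (\<gamma> / r) * (l * r)" using RR C ds(2) PQC_nonneg(3)[of r] g0 r by (intro mult_mono) auto
  also have "... = \<gamma> * l" using r by simp
  also have "... <= (l / 16) * l" using c l by (intro mult_right_mono) auto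
  also have "... = (l / 4)^2" by (simp add: power2_eq_square)
  finally have "X^2 <= (l / 4)^2" .
  then have X: "X <= l / 4" by (rule power2_le_imp_le) (use l in simp)
  have "BB r = (LBINT t:{0..pi}. (P (r, t) - V (r, t) / (2 * r)) * V (r, t) + (1 / (2 * r)) * (V (r, t))^2)"
   unfolding BB_def using r by (intro set_lebesgue_integral_cong) (auto simp: power2_eq_square field_simps)
  also have "... = X + (1 / (2 * r)) * CC r"
   unfolding X_def CC_def by (simp only: set_integral_add(2) set_integral_mult_right set_integrable_mult_right ni Xi)
  finally have "BB r = X + CC r / (2 * r)" by simp
  moreover have "CC r / (2 * r) < l / 2" using C r by (simp add: field_simps)
  moreover have "DD r / r = BB r" using f r by simp
  ultimately show False using l X by linarith
 qed
 obtain ka where k: "K Int sphere x r = {pol x r ka}" and s: "slice ka (%t. V (r, t)) (%t. Q (r, t))"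
  using n by (auto simp: nice_def)
 have kp: "0 <= ka" "ka <= pi" using s by (auto simp: slice_def)
 have "ka > pi - \<eta> & left_profile l \<gamma> \<eta> r \<or> ka < \<eta> & right_profile l \<gamma> \<eta> r"
  unfolding left_profile_def right_profile_def
 proof (rule slice_profile[OF s c(3,4)])
  show "0 < l * r" "\<gamma> * r <= l * r / 16" using l r c by auto
  have "\<gamma> * r < \<eta> * l / (2 * pi) * r" using c(2) r by (rule mult_strict_right_mono)
  then show "\<gamma> * r < \<eta> * (l * r) / (2 * pi)" by (simp add: mult_ac)
 qed (use CCl QC in "auto simp: CC_def QQ_def")
 moreover have "\<bar>ka - pi\<bar> < \<eta>" if "ka > pi - \<eta>" using that kp by linarith
 moreover have "\<bar>ka - 0\<bar> < \<eta>" if "ka < \<eta>" using that kp by linarith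
 ultimately show ?thesis using k unfolding crosses_def by blast
qed

definition blocked where "blocked a b = {t \<in> {0<..<pi}. \<exists>r\<in>{a..b}. pol x r t \<in> K}"

lemma blocked_sets: "blocked a b \<in> sets borel"
proof -
 have "closed {p. polp x p \<in> K}" using continuous_closed_vimage[OF closed_K] continuous_polp
  by (metis closed_vimage_Int continuous_on_closed_vimage closed_UNIV vimage_def Int_UNIV_right closed_K)
 then have "compact (({a..b} \<times> {0..pi}) Int {p. polp x p \<in> K})" by (intro compact_Int_closed compact_Times) auto
 then have "compact (snd ` (({a..b} \<times> {0..pi}) Int {p. polp x p \<in> K}))" by (intro compact_continuous_image continuous_intros)
 then have "snd ` (({a..b} \<times> {0..pi}) Int {p. polp x p \<in> K}) \<in> sets borel" by (rule borel_compact)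
 moreover have "blocked a b = snd ` (({a..b} \<times> {0..pi}) Int {p. polp x p \<in> K}) Int {0<..<pi}"
  by (force simp: blocked_def polp_def image_iff)
 ultimately show ?thesis by auto
qed

text \<open>Counting length: the disk of radius \<open>102 / 100 * \<rho>\<close> contains at most
  \<open>pi\<close> times its radius, and \<open>K\<close> already needs \<open>\<rho>\<close>
  inside the disk of radius \<open>\<rho>\<close>, one point per radius. What remains for the
  annulus bounds the blocked angles, because the angle is Lipschitz there.\<close>

lemma blocked_le:
 assumes rho: "\<rho> > 0"
 shows "emeasure lborel (blocked \<rho> (101 / 100 * \<rho>)) <= ennreal (8 / 7 * (102 / 100 * pi - 1))"
proof -
 define A where "A = K Int {y. \<rho> <= dist x y} Int ball x (102 / 100 * \<rho>)"
 define A0 where "A0 = {y \<in> K. \<exists>r\<in>{\<rho>..101 / 100 * \<rho>}. \<exists>t\<in>{0<..<pi}. y = pol x r t}"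
 have inner: "ennreal \<rho> <= hausdorff1 (K Int ball x \<rho>)"
 proof -
  have "emeasure lborel {0<..<\<rho>} <= ennreal 1 * hausdorff1 (K Int ball x \<rho>)"
  proof (rule lborel_le_hausdorff1_AE[of 1 1 _ "dist x"])
   show "AE r\<in>{0<..<\<rho>} in lborel. r \<in> dist x ` (K Int ball x \<rho>)"
    using AE_good
   proof eventually_elim
    case (elim r)
    show ?case
    proof
     assume r: "r \<in> {0<..<\<rho>}"
     then obtain p where "K Int sphere x r = {p}" using elim by (auto simp: good_def)
     then have "p \<in> K" "dist x p = r" by auto
     then show "r \<in> dist x ` (K Int ball x \<rho>)" using r by auto
    qed
   qed
  qed (use dist_dist_le in auto)
  then show ?thesis using rho by simp
 qed
 have outer: "emeasure lborel (blocked \<rho> (101 / 100 * \<rho>)) <= ennreal (8 / (7 * \<rho>)) * hausdorff1 A0"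
 proof (rule lborel_le_hausdorff1_image[of "\<rho> / 2" _ _ ang])
  fix y z assume "y \<in> A0" "z \<in> A0" and d: "dist y z <= \<rho> / 2"
  then obtain r a s b where y: "r \<in> {\<rho>..101 / 100 * \<rho>}" "a \<in> {0<..<pi}" "y = pol x r a" and z: "s \<in> {\<rho>..101 / 100 * \<rho>}" "b \<in> {0<..<pi}" "z = pol x s b"
   by (auto simp: A0_def)
  \<comment> \<open>Half of the angle: the chord is at least \<open>2 * \<rho> * sin w\<close>.
    Pairs at distance at most \<open>\<rho> / 2\<close> have \<open>w <= 1 / 2\<close>, hence
    \<open>cos w >= 7 / 8\<close>. This improves the Lipschitz constant from the crude
    \<open>2 / \<rho>\<close>, with which the bound on blocked angles would exceed pi.\<close>
  define w where "w = \<bar>a - b\<bar> / 2"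
  have w: "0 <= w" "w <= pi / 2" using y z by (auto simp: w_def)
  have w_cases: "w = (a - b) / 2 \<or> w = - ((a - b) / 2)" unfolding w_def by (cases "a < b") (simp_all only: abs_of_neg abs_of_nonneg less_iff_diff_less_0[symmetric] not_less le_iff_diff_le_0[symmetric] minus_divide_left minus_diff_eq diff_ge_0_iff_ge simp_thms)
  have sw: "0 <= sin w" using w by (intro sin_ge_zero) auto
  have "(2 * \<rho> * sin w)^2 = 4 * (\<rho> * \<rho>) * (sin w)^2" by (simp add: power2_eq_square)
  also have "... <= 4 * (r * s) * (sin w)^2" using y z rho by (intro mult_right_mono mult_left_mono mult_mono) auto
  also have "(sin w)^2 = (sin ((a - b) / 2))^2" using w_cases by (elim disjE) (simp_all only: sin_minus power2_minus)
  also have "4 * (r * s) * (sin ((a - b) / 2))^2 = 2 * r * s * (1 - cos (a - b))" by (simp add: one_minus_cos)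
  also have "... <= (dist y z)^2" unfolding y z dist_pol_sq by simp
  finally have le: "2 * \<rho> * sin w <= dist y z" by (rule power2_le_imp_le) simp
  have "w / 2 <= sin w" by (rule half_le_sin[OF w])
  then have "\<rho> * w <= 2 * \<rho> * sin w" using rho by (simp add: field_simps)
  then have "\<rho> * w <= \<rho> / 2" using le d by linarith
  then have w2: "w <= 1 / 2" using rho by (simp add: field_simps)
  have s0: "0 <= sin (w / 2)" using w by (intro sin_ge_zero) auto
  have "sin (w / 2) <= w / 2" using w by (intro sin_x_le_x) auto
  then have "sin (w / 2) <= 1 / 4" using w2 by simp
  then have "(sin (w / 2))^2 <= (1 / 4)^2" using s0 by (intro power_mono) auto
  then have "7 / 8 <= cos w" using one_minus_cos[of w] by (simp add: power2_eq_square)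
  then have "w * (7 / 8) <= w * cos w" using w by (intro mult_left_mono) auto
  also have "... <= sin w" by (rule mult_cos_le_sin) (use w in auto)
  finally have "2 * \<rho> * (w * (7 / 8)) <= 2 * \<rho> * sin w" using rho by (intro mult_left_mono) auto
  then have "(7 * \<rho>) * (2 * w) <= 8 * dist y z" using le by simp
  then have "2 * w <= 8 * dist y z / (7 * \<rho>)" using rho by (simp add: pos_le_divide_eq mult.commute)
  moreover have "ang y = a" "ang z = b" using y z rho ang_pol by auto
  ultimately show "\<bar>ang y - ang z\<bar> <= 8 / (7 * \<rho>) * dist y z" by (simp add: w_def)
 next
  show "blocked \<rho> (101 / 100 * \<rho>) <= ang ` A0"
  proof
   fix t assume "t \<in> blocked \<rho> (101 / 100 * \<rho>)"
   then obtain r where r: "t \<in> {0<..<pi}" "r \<in> {\<rho>..101 / 100 * \<rho>}" "pol x r t \<in> K" by (auto simp: blocked_def)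
   then have "ang (pol x r t) = t" using rho by (intro ang_pol) auto
   moreover have "pol x r t \<in> A0" unfolding A0_def using r by blast
   ultimately show "t \<in> ang ` A0" by (metis imageI)
  qed
 qed (use rho blocked_sets in auto)
 have "A0 <= A"
 proof
  fix y assume "y \<in> A0"
  then obtain r t where "y \<in> K" "r \<in> {\<rho>..101 / 100 * \<rho>}" "y = pol x r t" by (auto simp: A0_def)
  moreover then have "dist x y = r" using rho by (simp add: dist_pol)
  ultimately show "y \<in> A" using rho by (auto simp: A_def)
 qed
 then have "hausdorff1 A0 <= hausdorff1 A" by (rule hausdorff1_mono)
 have m: "K Int ball x \<rho> \<in> sets borel" "A \<in> sets borel"
 proof -
  have "closed {y. \<rho> <= dist x y}" by (intro closed_Collect_le continuous_intros)
  then show "K Int ball x \<rho> \<in> sets borel" "A \<in> sets borel" unfolding A_def using K_borel by (auto intro!: sets.Int)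
 qed
 have "ennreal \<rho> + hausdorff1 A <= hausdorff1 (K Int ball x \<rho>) + hausdorff1 A" using inner by (rule add_right_mono)
 also have "... = hausdorff1 (K Int ball x \<rho> Un A)"
  by (rule hausdorff1_Un_disjoint[symmetric]) (use m in "auto simp: A_def")
 also have "... <= hausdorff1 (K Int ball x (102 / 100 * \<rho>))" by (rule hausdorff1_mono) (use rho in "auto simp: A_def")
 also have "... <= dirichlet (ball x (102 / 100 * \<rho>)) + hausdorff1 (K Int ball x (102 / 100 * \<rho>))" by simp
 also have "... <= ennreal (pi * (102 / 100 * \<rho>))" by (rule half_disc_bound) (use rho in auto)
 finally have tot: "ennreal \<rho> + hausdorff1 A <= ennreal (pi * (102 / 100 * \<rho>))" .
 then have "hausdorff1 A < \<infinity>" by (metis ennreal_less_top ennreal_add_less_top infinity_ennreal_def order_le_less_trans)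
 then obtain a where a: "hausdorff1 A = ennreal a" "a >= 0" by (cases "hausdorff1 A") auto
 have "\<rho> + a <= pi * (102 / 100 * \<rho>)" using tot a rho by (simp add: ennreal_plus[symmetric] del: ennreal_plus)
 then have "8 / (7 * \<rho>) * a <= 8 / (7 * \<rho>) * (\<rho> * (102 / 100 * pi - 1))" using rho by (intro mult_left_mono) (auto simp: algebra_simps)
 also have "... = 8 / 7 * (102 / 100 * pi - 1)" using rho by (simp add: field_simps)
 finally have "8 / (7 * \<rho>) * a <= 8 / 7 * (102 / 100 * pi - 1)" .
 then have "ennreal (8 / (7 * \<rho>)) * hausdorff1 A <= ennreal (8 / 7 * (102 / 100 * pi - 1))"
  unfolding a using rho a(2) by (simp add: ennreal_mult[symmetric] ennreal_leI)
 moreover have "ennreal (8 / (7 * \<rho>)) * hausdorff1 A0 <= ennreal (8 / (7 * \<rho>)) * hausdorff1 A"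
  using \<open>hausdorff1 A0 <= hausdorff1 A\<close> by (intro mult_left_mono) auto
 ultimately show ?thesis using outer by order
qed

end

lemma obtain_far_pair:
 assumes T: "T \<in> sets borel" "emeasure lborel T > ennreal (2 * d)" and d: "d > (0::real)"
 obtains s t where "s \<in> T" "t \<in> T" "d <= t - s"
proof (rule ccontr)
 assume n: "\<not> thesis"
 have "T ~= {}" using T(2) by auto
 then obtain t0 where t0: "t0 \<in> T" by blast
 have "T <= {t0 - d..t0 + d}"
 proof
  fix t assume t: "t \<in> T"
  have "\<not> d <= t - t0" "\<not> d <= t0 - t" using n that[OF t0 t] that[OF t t0] by blast+
  then show "t \<in> {t0 - d..t0 + d}" by auto
 qed
 then have "emeasure lborel T <= emeasure lborel {t0 - d..t0 + d}" by (intro emeasure_mono) auto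
 also have "... = ennreal (2 * d)" using d by (subst emeasure_lborel_Icc) auto
 finally show False using T(2) by simp
qed

context crack
begin

text \<open>On a free ray \<open>V\<close> is a constant plus \<open>pint\<close>. The constant
  \<open>cc\<close> is written as a mean value, so that it is measurable in the angle.\<close>

definition pint where "pint a r t = (LBINT s:{a..r}. P (s, t))"
definition cc where "cc a b t = (LBINT r:{a..b}. V (r, t) - pint a r t) / (b - a)"

definition on_ray where "on_ray a b r \<longleftrightarrow> (AE t in lborel. t \<in> {0<..<pi} - blocked a b --> V (r, t) = cc a b t + pint a r t)"

lemma pint_meas [measurable]: "(%p. pint a (fst p) (snd p)) \<in> bm lborel2"
 using swap_meas[OF indefinite_meas[OF swap_meas[OF VPQ_meas(2)], of a]] by (simp add: pint_def)

lemma cc_meas [measurable]: "cc a b \<in> bm borel"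
proof -
 have "(%p. V p - pint a (fst p) (snd p)) \<in> bm lborel2" by measurable
 from measurable_set_integral_slice[OF swap_meas[OF this], of a b]
 have "(%t. LBINT r:{a..b}. V (r, t) - pint a r t) \<in> bm borel" by simp
 then show ?thesis unfolding cc_def[abs_def] by (rule borel_measurable_divide) simp
qed

lemma ray_eq:
 assumes r: "0 < a" "a < b"
 shows "AE t in lborel. t \<in> {0<..<pi} - blocked a b --> (AE r\<in>{a<..<b} in lborel. V (r, t) = cc a b t + pint a r t)"
 using rays[OF r]
proof eventually_elim
 case (elim t)
 show ?case
 proof
  assume t: "t \<in> {0<..<pi} - blocked a b"
  then obtain c where c: "AE r\<in>{a<..<b} in lborel. V (r, t) = c + pint a r t"
   using elim by (auto simp: blocked_def pint_def)
  have [measurable]: "(%r. pint a r t) \<in> bm borel" using measurable_Pair1[OF pint_meas, of t a] by simp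
  have "(LBINT r:{a..b}. V (r, t) - pint a r t) = (LBINT r:{a..b}. c)"
   unfolding LBINT_def
  proof (rule integral_cong_AE)
   show "AE r in lborel. ind {a..b} r *R (V (r, t) - pint a r t) = ind {a..b} r *R c"
    using c AE_lborel_singleton[of a] AE_lborel_singleton[of b] by eventually_elim (auto simp: indicator_def)
  qed measurable
  also have "... = c * (b - a)" using r by (simp add: LBINT_def)
  finally have "cc a b t = c" using r by (simp add: cc_def)
  then show "AE r\<in>{a<..<b} in lborel. V (r, t) = cc a b t + pint a r t" using c by simp
 qed
qed

text \<open>Exchanges the quantifiers: a null set of radii on almost every ray becomes a null set of
  angles at almost every radius. This needs a measurable exceptional set, hence the measurability of
  \<open>cc\<close>, \<open>pint\<close> and \<open>blocked\<close>.\<close>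

lemma ray_slices:
 assumes r: "0 < a" "a < b"
 shows "AE r\<in>{a<..<b} in lborel. on_ray a b r"
proof -
 have ctm: "(%p. cc a b (snd p)) \<in> bm lborel2"
  by (rule measurable_compose[OF measurable_snd]) simp
 have "AE t in lborel. AE r in lborel. t \<in> {0<..<pi} - blocked a b --> r \<in> {a<..<b} --> V (r, t) = cc a b t + pint a r t"
  using ray_eq[OF r] by eventually_elim auto
 then have "AE r in lborel. AE t in lborel. t \<in> {0<..<pi} - blocked a b --> r \<in> {a<..<b} --> V (r, t) = cc a b t + pint a r t"
 proof (subst lborel_pair.AE_commute)
  define A I where "A = {0<..<pi} - blocked a b" and "I = {a<..<b}"
  have AI: "A \<in> sets borel" "I \<in> sets borel" using blocked_sets by (auto simp: A_def I_def)
  then have AI': "snd -` A Int space lborel2 \<in> sets lborel2" "fst -` I Int space lborel2 \<in> sets lborel2"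
   using measurable_sets[OF measurable_snd, of A lborel lborel] measurable_sets[OF measurable_fst, of I lborel lborel] by simp_all
  define F where "F p = V p - (cc a b (snd p) + pint a (fst p) (snd p))" for p
  have "F \<in> bm lborel2" unfolding F_def[abs_def] using ctm by measurable
  then have "F -` {0} Int space lborel2 \<in> sets lborel2" by (rule measurable_sets) simp
  then have "space lborel2 - ((snd -` A Int space lborel2) Int (fst -` I Int space lborel2) - (F -` {0} Int space lborel2)) \<in> sets lborel2"
   by (rule sets.Diff[OF sets.top sets.Diff[OF sets.Int[OF AI']]])
  also have "space lborel2 - ((snd -` A Int space lborel2) Int (fst -` I Int space lborel2) - (F -` {0} Int space lborel2))
   = {p \<in> space lborel2. snd p \<in> {0<..<pi} - blocked a b --> fst p \<in> {a<..<b} --> V (fst p, snd p) = cc a b (snd p) + pint a (fst p) (snd p)}"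
   unfolding A_def[symmetric] I_def[symmetric] by (auto simp: F_def)
  finally show "{p \<in> space lborel2. snd p \<in> {0<..<pi} - blocked a b --> fst p \<in> {a<..<b} --> V (fst p, snd p) = cc a b (snd p) + pint a (fst p) (snd p)} \<in> sets lborel2" .
 qed
 then show ?thesis unfolding on_ray_def by eventually_elim auto
qed

lemma Tonelli_slice:
 fixes f :: "real \<times> real => real" and a b :: real
 assumes f: "f \<in> bm lborel2"
 shows "(NN t. (NN s. ennreal (f (s, t)) * ind {a..b} s) * ind {0..pi} t)
  = (NN s. (NN t. ennreal (f (s, t)) * ind {0..pi} t) * ind {a..b} s)"
  and "(%t. NN s. ennreal (f (s, t)) * ind {a..b} s) \<in> bm borel"
proof -
 have I: "{a..b} \<in> sets (borel :: real measure)" "{0..pi} \<in> sets (borel :: real measure)" by auto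
 have m: "(%p. ennreal (f p) * (ind {a..b} (fst p) * ind {0..pi} (snd p))) \<in> bm lborel2"
  using f I by measurable
 have "(NN t. (NN s. ennreal (f (s, t)) * ind {a..b} s) * ind {0..pi} t)
  = (NN t. NN s. ennreal (f (s, t)) * (ind {a..b} s * ind {0..pi} t))"
  by (intro nn_integral_cong) (auto simp: indicator_def)
 also have "... = (NN s. NN t. ennreal (f (s, t)) * (ind {a..b} s * ind {0..pi} t))"
  using m by (intro lborel_pair.Fubini') (simp add: case_prod_unfold)
 also have "... = (NN s. (NN t. ennreal (f (s, t)) * ind {0..pi} t) * ind {a..b} s)"
  by (intro nn_integral_cong) (auto simp: indicator_def)
 finally show "(NN t. (NN s. ennreal (f (s, t)) * ind {a..b} s) * ind {0..pi} t)
  = (NN s. (NN t. ennreal (f (s, t)) * ind {0..pi} t) * ind {a..b} s)" .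
 have "(%p. ennreal (f (snd p, fst p)) * ind {a..b} (snd p)) \<in> bm lborel2"
  using swap_meas[OF f] I by measurable
 from lborel.borel_measurable_nn_integral_fst[OF this]
 show "(%t. NN s. ennreal (f (s, t)) * ind {a..b} s) \<in> bm borel" by simp
qed

lemma Icc_nn_integral:
 assumes "sint {a..b} f" "!!t. f t >= (0::real)"
 shows "(NN t. ennreal (f t) * ind {a..b} t) = ennreal (LBINT t:{a..b}. f t)"
proof -
 have "(NN t. ennreal (f t) * ind {a..b} t) = (NN t. ennreal (ind {a..b} t *R f t))"
  by (intro nn_integral_cong) (auto simp: indicator_def)
 also have "... = ennreal (LBINT t:{a..b}. f t)"
  unfolding LBINT_def by (rule nn_integral_eq_integral) (use assms in "auto simp: sintegrable_def")
 finally show ?thesis .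
qed

lemma Icc_set_integrable:
 fixes f :: "real => real"
 assumes "f \<in> bm borel" "!!t. f t >= (0::real)" "(NN t. ennreal (f t) * ind {a..b} t) < \<infinity>"
 shows "sint {a..b} f"
 unfolding sintegrable_def
proof (rule integrableI_nonneg)
 have "(NN t. ennreal (ind {a..b} t *R f t)) = (NN t. ennreal (f t) * ind {a..b} t)"
  by (intro nn_integral_cong) (auto simp: indicator_def)
 then show "(NN t. ennreal (ind {a..b} t *R f t)) < \<infinity>" using assms(3) by simp
qed (use assms in "auto simp: indicator_def")

definition XX where "XX a b t = (NN s. ennreal ((P (s, t) - V (s, t) / (2 * s))^2) * ind {a..b} s)"

lemma XX_meas [measurable]: "XX a b \<in> bm borel"
proof -
 have "(%p. (P p - V p / (2 * fst p))^2) \<in> bm lborel2" by measurable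
 from Tonelli_slice(2)[OF this] show ?thesis by (simp add: XX_def[abs_def])
qed

text \<open>By Tonelli the homogeneity defects collected along the rays are those collected along
  the half circles, and these are bounded by the growth of \<open>DD r / r\<close>.\<close>

lemma XX_integral:
 assumes "0 < a" "a <= b"
 shows "(NN t. XX a b t * ind {0..pi} t) <= ennreal (DD b / b - DD a / a)"
proof -
 have "(%p. (P p - V p / (2 * fst p))^2) \<in> bm lborel2" by measurable
 from Tonelli_slice(1)[OF this] have "(NN t. XX a b t * ind {0..pi} t)
  = (NN s. (NN t. ennreal ((P (s, t) - V (s, t) / (2 * s))^2) * ind {0..pi} t) * ind {a..b} s)"
  by (simp add: XX_def)
 also have "... <= (NN s. ennreal (ind {a..b} s *R dd s))"
 proof (rule nn_integral_mono_AE)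
  show "AE s in lborel. (NN t. ennreal ((P (s, t) - V (s, t) / (2 * s))^2) * ind {0..pi} t) * ind {a..b} s <= ennreal (ind {a..b} s *R dd s)"
   using AE_nice DD_flux
  proof eventually_elim
   case (elim s)
   show ?case
   proof (cases "s \<in> {a..b}")
    case True
    then have s: "nice s" "DD s = s * BB s" "s > 0" using elim assms by auto
    note ds = defect_split[OF s(1,2)]
    have "RR s <= dd s" using ds(1,3) s(3) by simp
    then show ?thesis using True Icc_nn_integral[OF ds(5)] by (simp add: RR_def ennreal_leI)
   qed simp
  qed
 qed
 also have "... = ennreal (LBINT s:{a..b}. dd s)"
  unfolding LBINT_def
 proof (rule nn_integral_eq_integral)
  show "integrable lborel (%s. ind {a..b} s *R dd s)" using defect_integral(1)[OF assms] by (simp add: sintegrable_def)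
  show "AE s in lborel. 0 <= ind {a..b} s *R dd s"
   using AE_nice DD_flux by eventually_elim (use assms defect_split(4) in "auto simp: indicator_def")
 qed
 finally show ?thesis by (simp add: defect_integral(2)[OF assms])
qed

lemma radial_square_integrable:
 assumes "0 < a" "a <= b"
 shows "AE t\<in>{0..pi} in lborel. sint {a..b} (%s. (P (s, t))^2)"
proof -
 have m: "(%p. (P p)^2) \<in> bm lborel2" by measurable
 have "(NN t. (NN s. ennreal ((P (s, t))^2) * ind {a..b} s) * ind {0..pi} t)
  = (NN s. (NN t. ennreal ((P (s, t))^2) * ind {0..pi} t) * ind {a..b} s)"
  by (rule Tonelli_slice(1)[OF m])
 also have "... <= (NN s. ennreal ((1 / a) * (ind {0..b} s *R (s * ed s))))"
 proof (rule nn_integral_mono_AE)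
  show "AE s in lborel. (NN t. ennreal ((P (s, t))^2) * ind {0..pi} t) * ind {a..b} s <= ennreal ((1 / a) * (ind {0..b} s *R (s * ed s)))"
   using AE_nice
  proof eventually_elim
   case (elim s)
   show ?case
   proof (cases "s \<in> {a..b}")
    case True
    then have s: "nice s" "s > 0" using elim assms by auto
    have "PP s <= ed s" using PQC_nonneg[of s] by (simp add: ed_def)
    also have "... = 1 * ed s" by simp
    also have "... <= (s / a) * ed s" using True assms PQC_nonneg[of s] by (intro mult_right_mono) auto
    finally show ?thesis using True assms Icc_nn_integral[OF nice_integrable(3)[OF s(1)]] by (simp add: PP_def ennreal_leI)
   qed simp
  qed
 qed
 also have "... < \<infinity>"
 proof -
  have "integrable lborel (%s. (1 / a) * (ind {0..b} s *R (s * ed s)))"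
   using ed_integral(1)[of b] by (simp add: sintegrable_def)
  then show ?thesis by (subst nn_integral_eq_integral) (use assms PQC_nonneg(4) in "auto simp: indicator_def")
 qed
 finally have "AE t in lborel. (NN s. ennreal ((P (s, t))^2) * ind {a..b} s) * ind {0..pi} t ~= \<infinity>"
  using Tonelli_slice(2)[OF m, of a b] by (intro nn_integral_PInf_AE) auto
 then show ?thesis
 proof eventually_elim
  case (elim t)
  show ?case
  proof
   assume "t \<in> {0..pi}"
   then show "sint {a..b} (%s. (P (s, t))^2)"
    using elim by (intro Icc_set_integrable) (auto simp: less_top)
  qed
 qed
qed

text \<open>Along a ray, \<open>V / sqrt r\<close> has derivative
  \<open>(P - V / (2 * r)) / sqrt r\<close>, so Cauchy-Schwarz bounds its variation by the defect
  \<open>XX\<close> of that ray.\<close>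

lemma ray_increment:
 assumes a: "0 < a" "a < b" and p2: "sint {a..b} (%s. (P (s, t))^2)"
  and w: "AE r\<in>{a<..<b} in lborel. V (r, t) = c + pint a r t" and X: "XX a b t <= ennreal e" "0 <= e"
  and r: "a <= r" "r <= r'" "r' <= b"
 shows "((c + pint a r' t) / sqrt r' - (c + pint a r t) / sqrt r)^2 <= (b - a) / a * e"
proof -
 define W where "W r = c + pint a r t" for r
 have pi1: "sint {a..b} (%s. P (s, t))" by (rule set_integrable_of_square[OF _ p2]) simp
 have acW: "ac a b W (%s. P (s, t))"
  using ac_indefinite[OF pi1] by (simp add: ac_def W_def pint_def set_integral_zero_singleton)
 have acs: "ac a b (%s. 1 / sqrt s) (%s. - (1 / (2 * s * sqrt s)))"
 proof (rule ac_C1)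
  fix s assume s: "a <= s" "s <= b"
  then have sp: "s > 0" using a by simp
  then have "sqrt s * sqrt s = s" by simp
  then show "((%s. 1 / sqrt s) has_real_derivative - (1 / (2 * s * sqrt s))) (at s)"
   using sp by (auto intro!: derivative_eq_intros simp: field_simps)
 qed (use a in "auto intro!: continuous_intros")
 define q where "q s = P (s, t) - W s / (2 * s)" for s
 note acm = ac_mult[OF acW acs]
 have Wc: "continuous_on {a..b} W" by (rule ac_continuous[OF acW])
 have qm: "(%s. P (s, t) - V (s, t) / (2 * s)) \<in> bm borel" by measurable
 define q0 where "q0 s = P (s, t) - V (s, t) / (2 * s)" for s
 have ae: "AE s\<in>{a..b} in lborel. q s = q0 s"
  using w AE_lborel_singleton[of a] AE_lborel_singleton[of b]
  by eventually_elim (auto simp: q_def q0_def W_def)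
 have q0i: "sint {a..b} (%s. (q0 s)^2)"
  by (rule Icc_set_integrable) (use qm X in "auto simp: q0_def XX_def intro: order_le_less_trans")
 have q0I: "(LBINT s:{a..b}. (q0 s)^2) <= e"
  using X Icc_nn_integral[OF q0i] by (simp add: XX_def q0_def)
 have sub: "sint {r..r'} (%s. (q0 s)^2)" by (rule set_integrable_subset[OF q0i]) (use r in auto)
 have ci: "continuous_on {r..r'} (%s. 1 / sqrt s)" by (intro continuous_intros) (use a r in auto)
 have "W r' * (1 / sqrt r') - W r * (1 / sqrt r) = (LBINT s:{r..r'}. P (s, t) * (1 / sqrt s) + W s * - (1 / (2 * s * sqrt s)))"
  by (rule ac_diff[OF acm]) (use r in auto)
 also have "... = (LBINT s:{r..r'}. (1 / sqrt s) * q0 s)"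
  unfolding LBINT_def
 proof (rule integral_cong_AE)
  have "sint {r..r'} (%s. P (s, t) * (1 / sqrt s) + W s * - (1 / (2 * s * sqrt s)))"
   by (rule set_integrable_subset[OF ac_integrable[OF acm]]) (use r in auto)
  then show "(%s. ind {r..r'} s *R (P (s, t) * (1 / sqrt s) + W s * - (1 / (2 * s * sqrt s)))) \<in> bm lborel"
   unfolding sintegrable_def by (rule borel_measurable_integrable)
  show "(%s. ind {r..r'} s *R (1 / sqrt s * q0 s)) \<in> bm lborel"
   unfolding q0_def by measurable
  show "AE s in lborel. ind {r..r'} s *R (P (s, t) * (1 / sqrt s) + W s * - (1 / (2 * s * sqrt s))) = ind {r..r'} s *R (1 / sqrt s * q0 s)"
   using ae
  proof eventually_elim
   case (elim s)
   show ?case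
   proof (cases "s \<in> {r..r'}")
    case True
    then have "q0 s = P (s, t) - W s / (2 * s)" "s > 0" using elim r a by (auto simp: q_def)
    moreover have "P (s, t) * (1 / sqrt s) + W s * - (1 / (2 * s * sqrt s)) = 1 / sqrt s * (P (s, t) - W s / (2 * s))"
     by (simp add: right_diff_distrib)
    ultimately show ?thesis by (simp only:)
   qed simp
  qed
 qed
 finally have e: "W r' / sqrt r' - W r / sqrt r = (LBINT s:{r..r'}. (1 / sqrt s) * q0 s)" by simp
 have si: "sint {r..r'} (%s. (1 / sqrt s)^2)"
  by (rule borel_integrable_atLeastAtMost') (use a r in "auto intro!: continuous_intros")
 have "(LBINT s:{r..r'}. (1 / sqrt s) * q0 s)^2 <= (LBINT s:{r..r'}. (1 / sqrt s)^2) * (LBINT s:{r..r'}. (q0 s)^2)"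
  by (rule Cauchy_Schwarz_set_integral(1)) (use si sub in "auto simp: q0_def")
 also have "... <= ((b - a) / a) * e"
 proof (rule mult_mono)
  have "(LBINT s:{r..r'}. (1 / sqrt s)^2) <= (LBINT s:{r..r'}. 1 / a)"
  proof (rule set_integral_mono[OF si set_integrable_const_Icc])
   fix s assume "s \<in> {r..r'}"
   then show "(1 / sqrt s)^2 <= 1 / a" using a r by (auto simp: power_divide frac_le)
  qed
  also have "... = (r' - r) / a" using r by (simp add: LBINT_def)
  also have "... <= (b - a) / a" using a r by (intro divide_right_mono) auto
  finally show "(LBINT s:{r..r'}. (1 / sqrt s)^2) <= (b - a) / a" .
  show "(LBINT s:{r..r'}. (q0 s)^2) <= e"
   by (rule order_trans[OF set_integral_mono_set[OF q0i] q0I]) (use r in auto)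
  show "0 <= (LBINT s:{r..r'}. (q0 s)^2)" by (auto simp: LBINT_def intro!: integral_nonneg_AE)
 qed (use a in auto)
 finally show ?thesis unfolding W_def[symmetric] e .
qed

text \<open>On a free ray with small defect \<open>V / sqrt r\<close> is nearly constant, so a sine
  profile at one radius and a cosine profile at another would nearly coincide at that angle. There
  are enough such rays for two of them to be at angular distance \<open>1 / 5\<close>, which forces
  the amplitude of the sine profile to be too small.\<close>

lemma no_switch:
 fixes \<rho> :: real
 defines "\<rho>2 \<equiv> 101 / 100 * \<rho>"
 assumes rho: "\<rho> > 0" and eps: "DD \<rho>2 / \<rho>2 - DD \<rho> / \<rho> <= \<epsilon>" "0 < \<epsilon>" "\<epsilon> <= \<gamma>" and l: "0 < l" "\<gamma> <= l / 250000" and eta: "0 < \<eta>" "\<eta> <= 1 / 100"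
  and r: "\<rho> < r" "r < \<rho>2" "on_ray \<rho> \<rho>2 r" and r': "\<rho> < r'" "r' < \<rho>2" "on_ray \<rho> \<rho>2 r'"
  and pr: "left_profile l \<gamma> \<eta> r" "right_profile l \<gamma> \<eta> r'"
 shows False
proof -
 obtain m where m: "m^2 >= l * r / (4 * pi)" "AE t\<in>{0<..<pi - \<eta>} in lborel. (V (r, t) - m * sin (t / 2))^2 <= \<gamma> * r"
  using pr(1) unfolding left_profile_def by blast
 obtain n where n: "AE t\<in>{\<eta><..<pi} in lborel. (V (r', t) - n * cos (t / 2))^2 <= \<gamma> * r'"
  using pr(2) unfolding right_profile_def by blast
 have rho2: "\<rho> < \<rho>2" using rho by (simp add: \<rho>2_def)
 have rp: "r > 0" "r' > 0" using r r' rho by auto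
 define Xb where "Xb = {t. ennreal (100 * \<epsilon>) <= XX \<rho> \<rho>2 t} Int {0..pi}"
 have Xbm: "Xb \<in> sets borel" unfolding Xb_def by measurable
 define T where "T = {\<eta><..<pi - \<eta>} - blocked \<rho> \<rho>2 - Xb"
 have Tm: "T \<in> sets borel" unfolding T_def using blocked_sets Xbm by auto
 have Xb: "emeasure lborel Xb <= ennreal (1 / 100)"
 proof -
  have "emeasure lborel ({t\<in>{0..pi}. 1 <= ennreal (1 / (100 * \<epsilon>)) * XX \<rho> \<rho>2 t}) <= ennreal (1 / (100 * \<epsilon>)) * (NN t. XX \<rho> \<rho>2 t * ind {0..pi} t)"
   by (rule nn_integral_Markov_inequality) measurable
  also have "... <= ennreal (1 / (100 * \<epsilon>)) * ennreal \<epsilon>"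
   using XX_integral[of \<rho> \<rho>2] rho rho2 eps by (intro mult_left_mono) (auto intro: order_trans ennreal_leI)
  also have "... = ennreal (1 / 100)" using eps by (simp add: ennreal_mult[symmetric])
  finally have *: "emeasure lborel ({t\<in>{0..pi}. 1 <= ennreal (1 / (100 * \<epsilon>)) * XX \<rho> \<rho>2 t}) <= ennreal (1 / 100)" .
  have "Xb <= {t\<in>{0..pi}. 1 <= ennreal (1 / (100 * \<epsilon>)) * XX \<rho> \<rho>2 t}"
  proof
   fix t assume t: "t \<in> Xb"
   then have "ennreal (1 / (100 * \<epsilon>)) * ennreal (100 * \<epsilon>) <= ennreal (1 / (100 * \<epsilon>)) * XX \<rho> \<rho>2 t"
    by (intro mult_left_mono) (auto simp: Xb_def)
   moreover have "ennreal (1 / (100 * \<epsilon>)) * ennreal (100 * \<epsilon>) = 1" using eps by (simp add: ennreal_mult[symmetric])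
   ultimately show "t \<in> {t\<in>{0..pi}. 1 <= ennreal (1 / (100 * \<epsilon>)) * XX \<rho> \<rho>2 t}" using t by (simp add: Xb_def)
  qed
  then have "emeasure lborel Xb <= emeasure lborel ({t\<in>{0..pi}. 1 <= ennreal (1 / (100 * \<epsilon>)) * XX \<rho> \<rho>2 t})"
   by (intro emeasure_mono) measurable
  with * show ?thesis by (rule order_trans[rotated])
 qed
 \<comment> \<open>\<open>pi - 2 * \<eta>\<close> exceeds the sum of the bound for the blocked
   angles, of \<open>1 / 100\<close> for the angles with large defect and of \<open>2 / 5\<close>;
   the bound \<open>pi < 4\<close> is enough for this.\<close>
 have big: "emeasure lborel T > ennreal (2 * (1 / 5))"
 proof (rule ccontr)
  assume "\<not> ?thesis"
  then have T: "emeasure lborel T <= ennreal (2 * (1 / 5))" by (simp add: not_less)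
  have "ennreal (pi - 2 * \<eta>) = emeasure lborel {\<eta><..<pi - \<eta>}" using eta pi_gt3 by simp
  also have "... <= emeasure lborel (T Un (blocked \<rho> \<rho>2 Un Xb))"
   by (rule emeasure_mono) (use Tm Xbm blocked_sets in "auto simp: T_def")
  also have "... <= emeasure lborel T + emeasure lborel (blocked \<rho> \<rho>2 Un Xb)"
   by (rule emeasure_subadditive) (use Tm Xbm blocked_sets in auto)
  also have "... <= emeasure lborel T + (emeasure lborel (blocked \<rho> \<rho>2) + emeasure lborel Xb)"
   by (intro add_left_mono emeasure_subadditive) (use Xbm blocked_sets in auto)
  also have "... <= ennreal (2 * (1 / 5)) + (ennreal (8 / 7 * (102 / 100 * pi - 1)) + ennreal (1 / 100))"
   by (intro add_mono T Xb) (use blocked_le[OF rho] in "simp add: \<rho>2_def")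
  also have "... = ennreal (2 * (1 / 5) + (8 / 7 * (102 / 100 * pi - 1) + 1 / 100))"
   using pi_gt3 by (subst ennreal_plus[symmetric], simp, simp)+ simp
  finally have "pi - 2 * \<eta> <= 2 * (1 / 5) + (8 / 7 * (102 / 100 * pi - 1) + 1 / 100)"
   using pi_gt3 by (subst (asm) ennreal_le_iff) auto
  moreover have "8 / 7 * (102 / 100 * pi - 1) = 816 / 700 * pi - 8 / 7" by (simp add: field_simps)
  ultimately show False using pi_less_4 eta by linarith
 qed
 have sT: "t \<in> {0<..<pi} - blocked \<rho> \<rho>2 & t \<in> {0<..<pi - \<eta>} & t \<in> {\<eta><..<pi} & t \<in> {0..pi} & XX \<rho> \<rho>2 t <= ennreal (100 * \<epsilon>)" if "t \<in> T" for t
 proof -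
  have "t \<in> {0..pi}" using that eta by (auto simp: T_def)
  then have "\<not> ennreal (100 * \<epsilon>) <= XX \<rho> \<rho>2 t" using that by (auto simp: T_def Xb_def)
  then show ?thesis using that eta by (auto simp: T_def)
 qed
 define ok where "ok t \<longleftrightarrow> (V (r, t) - m * sin (t / 2))^2 <= \<gamma> * r & (V (r', t) - n * cos (t / 2))^2 <= \<gamma> * r' &
  (V (r', t) / sqrt r' - V (r, t) / sqrt r)^2 <= \<epsilon>" for t
 have "AE t in lborel. t \<in> T --> ok t"
  using r(3)[unfolded on_ray_def] r'(3)[unfolded on_ray_def] m(2) n ray_eq[OF rho rho2] radial_square_integrable[OF rho less_imp_le[OF rho2]]
 proof eventually_elim
  case (elim t)
  show ?case
  proof
   assume "t \<in> T"
   note t = sT[OF this]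
   have w: "AE r\<in>{\<rho><..<\<rho>2} in lborel. V (r, t) = cc \<rho> \<rho>2 t + pint \<rho> r t" and p2: "sint {\<rho>..\<rho>2} (%s. (P (s, t))^2)"
    using elim t by blast+
   \<comment> \<open>The relative width \<open>1 / 100\<close> of the annulus cancels the factor 100
     lost in Markov's inequality.\<close>
   have e0: "(\<rho>2 - \<rho>) / \<rho> * (100 * \<epsilon>) = \<epsilon>" using rho by (simp add: \<rho>2_def field_simps)
   have inc: "((cc \<rho> \<rho>2 t + pint \<rho> r2 t) / sqrt r2 - (cc \<rho> \<rho>2 t + pint \<rho> r1 t) / sqrt r1)^2 <= \<epsilon>" if "\<rho> <= r1" "r1 <= r2" "r2 <= \<rho>2" for r1 r2
    using ray_increment[OF rho rho2 p2 w, of "100 * \<epsilon>" r1 r2] t eps that unfolding e0 by simp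
   have "V (r, t) = cc \<rho> \<rho>2 t + pint \<rho> r t" "V (r', t) = cc \<rho> \<rho>2 t + pint \<rho> r' t" using elim t by blast+
   then have "(V (r', t) / sqrt r' - V (r, t) / sqrt r)^2 <= \<epsilon>"
    using inc[of r r'] inc[of r' r] r r' by (cases "r <= r'") (simp_all add: power2_commute)
   then show "ok t" using elim t unfolding ok_def by blast
  qed
 qed
 then obtain N where N: "!!t. t \<in> space lborel - N ==> t \<in> T --> ok t" "N \<in> null_sets lborel" using AE_E3 by blast
 have "emeasure lborel (T - N) = emeasure lborel T" using N(2) Tm by (subst emeasure_Diff_null_set) auto
 then have "emeasure lborel (T - N) > ennreal (2 * (1 / 5))" using big by simp
 moreover have "T - N \<in> sets borel" using Tm N(2) by auto
 ultimately obtain t1 t2 where t12: "t1 \<in> T - N" "t2 \<in> T - N" "1 / 5 <= t2 - t1"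
  using obtain_far_pair[of "T - N" "1 / 5"] by auto
 define \<mu> \<nu> where "\<mu> = m / sqrt r" and "\<nu> = n / sqrt r'"
 define \<psi> where "\<psi> t = \<mu> * sin (t / 2) - \<nu> * cos (t / 2)" for t
 have psi: "(\<psi> t)^2 <= 9 * \<gamma>" if "t \<in> T - N" for t
 proof -
  have o: "ok t" using that N(1) by auto
  have dv: "(z / sqrt s)^2 <= \<gamma>" if "z^2 <= \<gamma> * s" "s > 0" for z s
   using that by (simp add: power_divide pos_divide_le_eq)
  have 1: "((V (r, t) - m * sin (t / 2)) / sqrt r)^2 <= \<gamma>" "((V (r', t) - n * cos (t / 2)) / sqrt r')^2 <= \<gamma>"
   using o rp unfolding ok_def by (blast intro: dv)+
  have 2: "(V (r', t) / sqrt r' - V (r, t) / sqrt r)^2 <= \<gamma>" using o eps unfolding ok_def by linarith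
  have "\<psi> t = - ((V (r, t) - m * sin (t / 2)) / sqrt r) + (V (r', t) - n * cos (t / 2)) / sqrt r' + - (V (r', t) / sqrt r' - V (r, t) / sqrt r)"
   by (simp add: \<psi>_def \<mu>_def \<nu>_def diff_divide_distrib)
  then have "(\<psi> t)^2 <= 3 * (- ((V (r, t) - m * sin (t / 2)) / sqrt r))^2 + 3 * ((V (r', t) - n * cos (t / 2)) / sqrt r')^2 + 3 * (- (V (r', t) / sqrt r' - V (r, t) / sqrt r))^2"
   by (simp only: square_sum3_le)
  also have "... <= 9 * \<gamma>" unfolding power2_minus using 1 2 by linarith
  finally show ?thesis .
 qed
 define \<Delta> where "\<Delta> = (t2 - t1) / 2"
 \<comment> \<open>The second angle serves to eliminate \<open>\<nu>\<close>; one angle alone gives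
   only one relation between the two amplitudes.\<close>
 have "\<mu> * sin \<Delta> = cos (t1 / 2) * \<psi> t2 - cos (t2 / 2) * \<psi> t1"
 proof -
  have De: "\<Delta> = t2 / 2 - t1 / 2" by (simp add: \<Delta>_def diff_divide_distrib)
  have "sin \<Delta> = sin (t2 / 2) * cos (t1 / 2) - cos (t2 / 2) * sin (t1 / 2)" unfolding De by (rule sin_diff)
  then show ?thesis unfolding \<psi>_def by algebra
 qed
 then have "(\<mu> * sin \<Delta>)^2 <= 2 * (cos (t1 / 2) * \<psi> t2)^2 + 2 * (cos (t2 / 2) * \<psi> t1)^2"
  using norm_add_sq_le[of "cos (t1 / 2) * \<psi> t2" "- (cos (t2 / 2) * \<psi> t1)"] by simp
 also have "... <= 2 * (9 * \<gamma>) + 2 * (9 * \<gamma>)"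
 proof -
  have "(cos u * z)^2 <= z^2" for u z :: real
  proof -
   have "(cos u)^2 <= 1" by (simp add: abs_square_le_1)
   then have "(cos u)^2 * z^2 <= 1 * z^2" by (rule mult_right_mono) simp
   then show ?thesis by (simp add: power_mult_distrib)
  qed
  from this[of "t1 / 2" "\<psi> t2"] this[of "t2 / 2" "\<psi> t1"] show ?thesis using psi[OF t12(1)] psi[OF t12(2)] by linarith
 qed
 finally have up: "\<mu>^2 * (sin \<Delta>)^2 <= 36 * \<gamma>" by (simp add: power_mult_distrib)
 have D: "1 / 10 <= \<Delta>" "\<Delta> <= pi / 2"
  using t12 sT[of t1] sT[of t2] by (auto simp: \<Delta>_def)
 then have "\<Delta> / 2 <= sin \<Delta>" by (intro half_le_sin) auto
 then have "1 / 20 <= sin \<Delta>" using D by simp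
 then have "(1 / 20)^2 <= (sin \<Delta>)^2" by (intro power_mono) auto
 moreover have "l / 16 <= \<mu>^2"
 proof -
  have "l / 16 <= l / (4 * pi)" using l pi_less_4 by (intro divide_left_mono) auto
  also have "... = (l * r / (4 * pi)) / r" using rp by simp
  also have "... <= m^2 / r" using m(1) rp by (intro divide_right_mono) auto
  finally show ?thesis using rp by (simp add: \<mu>_def power_divide)
 qed
 ultimately have "(l / 16) * (1 / 20)^2 <= \<mu>^2 * (sin \<Delta>)^2" using l by (intro mult_mono) auto
 \<comment> \<open>The two bounds read \<open>l / 6400 <= 36 * \<gamma>\<close>, whereas
   \<open>\<gamma> <= l / 250000\<close>.\<close>
 then show False using up l by (simp add: power2_eq_square)
qed

end

section \<open>The tent and the contradiction\<close>

lemma square_le_add: "b^2 <= 2 * a^2 + 2 * (a - b)^2" for a b :: real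
proof -
 have "2 * a^2 + 2 * (a - b)^2 - b^2 = (2 * a - b)^2" by (simp add: power2_eq_square algebra_simps)
 moreover have "(2 * a - b)^2 >= 0" by simp
 ultimately show ?thesis by linarith
qed

context crack
begin

text \<open>What the tent needs at one radius, for the half axis at angle \<open>a\<close>: the
  crossing lies within \<open>\<eta>\<close> of it, the radial defect is small, and \<open>V\<close>
  is bounded away from zero on the adjacent quarter circle outside the
  \<open>\<eta>\<close>-zone.\<close>

definition flat where "flat a \<eta> \<gamma> l r \<longleftrightarrow> nice r & DD r = r * BB r & r * RR r <= \<gamma> & crosses a \<eta> r &
 (AE t in lborel. t \<in> {0<..<pi} & \<eta> < \<bar>t - a\<bar> & \<bar>t - a\<bar> < pi / 2 --> l * r / 128 <= (V (r, t))^2)"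

text \<open>Balance of the cut under a tent with half base \<open>h\<close> and slope
  \<open>\<delta>\<close>. The roof costs at most \<open>(1 + \<delta>^2 / 2) * (2 * h)\<close>. The
  cut saves the part of \<open>K\<close> below the roof, nearly \<open>2 * h\<close>, and the energy
  in a sector of angle \<open>\<omega>\<close>. Since \<open>\<omega>\<close> is proportional to
  \<open>\<delta>\<close>, the left side is linear in the slope; the right side collects the excess
  of the roof, the loss at the tips and the bad radii.\<close>

lemma tent:
 assumes a0: "a0 = 0 \<or> a0 = pi" and rho: "\<rho> > 0" and de: "0 < \<delta>" "\<delta> <= 1" and om: "\<omega> = \<delta> / 3200" and eta: "0 < \<eta>" "2 * \<eta> <= \<omega>"
  and l: "0 < l" and ga: "\<gamma> <= \<omega> * l / 4096" and B: "B \<in> sets borel" "emeasure lborel B <= ennreal \<beta>" "0 <= \<beta>" "\<beta> <= \<rho> / 400"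
  and main: "AE r\<in>{\<rho><..<101 / 100 * \<rho>} in lborel. r ~: B --> flat a0 \<eta> \<gamma> l r"
 shows "\<rho> / 400 * (\<omega> * l / 4096) <= \<rho> * \<delta>^2 / 200 + 8 * \<rho> * \<eta> / \<delta> + \<beta>"
proof -
 \<comment> \<open>\<open>rc\<close> is the midpoint and \<open>h\<close> the half length of the
   interval from \<open>\<rho>\<close> to \<open>101 / 100 * \<rho>\<close>; the sign
   \<open>\<sigma>\<close> selects the half axis.\<close>
 define \<sigma> rc h c where "\<sigma> = cos a0" and "rc = \<rho> * (201 / 200)" and "h = \<rho> / 200" and "c = x $ 1 + \<sigma> * rc"
 have s: "sin a0 = 0" "\<bar>\<sigma>\<bar> = 1" using a0 by (auto simp: \<sigma>_def)
 have h0: "h > 0" using rho by (simp add: h_def)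
 \<comment> \<open>The tent is doubled across the axis to be open in the plane; the lower half lies
   outside \<open>closure U\<close> and costs nothing.\<close>
 define W where "W = {y :: real^2. \<bar>y $ 2\<bar> < \<delta> * (h - \<bar>y $ 1 - c\<bar>)}"
 have oW: "open W" unfolding W_def by (intro open_Collect_less continuous_intros)
 have bW: "bounded W"
 proof (rule bounded_subset[OF bounded_cball[of "vec2 (c, 0)" "2 * h"]])
  show "W <= cball (vec2 (c, 0)) (2 * h)"
  proof
   fix y assume "y \<in> W"
   then have y: "\<bar>y $ 2\<bar> < \<delta> * (h - \<bar>y $ 1 - c\<bar>)" by (simp add: W_def)
   then have "0 < \<delta> * (h - \<bar>y $ 1 - c\<bar>)" by linarith
   then have 1: "\<bar>y $ 1 - c\<bar> < h" using de by (simp add: zero_less_mult_iff)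
   have "\<delta> * (h - \<bar>y $ 1 - c\<bar>) <= 1 * h" using de 1 by (intro mult_mono) auto
   then have 2: "\<bar>y $ 2\<bar> < h" using y by linarith
   have "(dist (vec2 (c, 0)) y)^2 = \<bar>y $ 1 - c\<bar>^2 + \<bar>y $ 2\<bar>^2" unfolding dist_vec2_sq by (simp add: power2_commute)
   also have "... <= h^2 + h^2" using 1 2 by (intro add_mono power_mono) auto
   also have "... <= (2 * h)^2" by (simp add: power2_eq_square)
   finally show "y \<in> cball (vec2 (c, 0)) (2 * h)" using h0 by (auto intro: power2_le_imp_le)
  qed
 qed
 \<comment> \<open>A point within \<open>d\<close> of the half axis point of the same radius is
   under the roof if the roof there, after a shift of the foot by at most \<open>d\<close>, is still
   higher than \<open>d\<close>.\<close>
 have inW: "pol x r t \<in> W" if r: "0 <= r" and d: "\<bar>r - rc\<bar> + d + d / \<delta> < h" "r * \<bar>t - a0\<bar> <= d" for r t d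
 proof -
  have "dist (pol x r t) (pol x r a0) <= d" using dist_pol_le[OF r, of x t a0] d(2) by linarith
  then have "\<bar>(pol x r t - pol x r a0) $ i\<bar> <= d" for i
   using component_le_norm_cart[of "pol x r t - pol x r a0" i] by (simp add: dist_norm)
  from this[of 1] this[of 2] have cmp: "\<bar>pol x r t $ 1 - (x $ 1 + r * \<sigma>)\<bar> <= d" "\<bar>pol x r t $ 2\<bar> <= d"
   using s x_in(2) by (simp_all add: \<sigma>_def)
  have "\<bar>(r - rc) * \<sigma>\<bar> = \<bar>r - rc\<bar>" using s by (simp add: abs_mult)
  moreover have "pol x r t $ 1 - c = (pol x r t $ 1 - (x $ 1 + r * \<sigma>)) + (r - rc) * \<sigma>" unfolding c_def by algebra
  ultimately have "\<bar>pol x r t $ 1 - c\<bar> <= d + \<bar>r - rc\<bar>" using cmp(1) by linarith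
  then have "d / \<delta> < h - \<bar>pol x r t $ 1 - c\<bar>" using d(1) by linarith
  then have "d < \<delta> * (h - \<bar>pol x r t $ 1 - c\<bar>)" using de by (simp add: pos_divide_less_eq mult.commute)
  then show ?thesis using cmp(2) by (simp add: W_def)
 qed
 have fr: "hausdorff1 (frontier W Int closure U) <= ennreal ((1 + \<delta>^2 / 2) * (2 * h))"
 proof -
  define f where "f s = vec2 (s, \<delta> * (h - \<bar>s - c\<bar>))" for s
  have "closure W <= {y. \<bar>y $ 2\<bar> <= \<delta> * (h - \<bar>y $ 1 - c\<bar>)}"
   by (rule closure_minimal) (auto simp: W_def intro!: closed_Collect_le continuous_intros)
  then have "frontier W <= {y. \<bar>y $ 2\<bar> = \<delta> * (h - \<bar>y $ 1 - c\<bar>)}"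
   unfolding frontier_def interior_open[OF oW] by (force simp: W_def)
  then have "frontier W Int closure U <= f ` {c - h..c + h}"
  proof (intro subsetI)
   fix y assume sub: "frontier W <= {y. \<bar>y $ 2\<bar> = \<delta> * (h - \<bar>y $ 1 - c\<bar>)}" and y: "y \<in> frontier W Int closure U"
   then have e: "y $ 2 = \<delta> * (h - \<bar>y $ 1 - c\<bar>)" "0 <= y $ 2" using U_simps(2) by auto
   then have "0 <= h - \<bar>y $ 1 - c\<bar>" using de by (simp add: zero_le_mult_iff)
   moreover have "y = f (y $ 1)" using e by (simp add: f_def vec_eq_iff forall_2)
   ultimately show "y \<in> f ` {c - h..c + h}" by (intro image_eqI[of _ _ "y $ 1"]) auto
  qed
  then have "hausdorff1 (frontier W Int closure U) <= hausdorff1 (f ` {c - h..c + h})" by (rule hausdorff1_mono)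
  also have "... <= ennreal ((1 + \<delta>^2 / 2) * ((c + h) - (c - h)))"
  proof (rule hausdorff1_Lipschitz_image_le)
   fix s t
   have "\<bar>\<bar>t - c\<bar> - \<bar>s - c\<bar>\<bar> <= \<bar>s - t\<bar>" by linarith
   then have "\<bar>\<bar>t - c\<bar> - \<bar>s - c\<bar>\<bar>^2 <= \<bar>s - t\<bar>^2" by (intro power_mono) auto
   then have "\<delta>^2 * (\<bar>t - c\<bar> - \<bar>s - c\<bar>)^2 <= \<delta>^2 * (s - t)^2" by (intro mult_left_mono) auto
   moreover have "(dist (f s) (f t))^2 = (s - t)^2 + \<delta>^2 * (\<bar>t - c\<bar> - \<bar>s - c\<bar>)^2"
    unfolding dist_vec2_sq f_def vec2_nth fst_conv snd_conv by algebra
   ultimately have "(dist (f s) (f t))^2 <= (1 + \<delta>^2) * (s - t)^2" by (simp add: algebra_simps)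
   also have "... <= (1 + \<delta>^2 / 2)^2 * (s - t)^2"
   proof (rule mult_right_mono)
    have "(1 + \<delta>^2 / 2)^2 = 1 + \<delta>^2 + (\<delta>^2 / 2)^2" by (simp add: power2_eq_square algebra_simps)
    then show "1 + \<delta>^2 <= (1 + \<delta>^2 / 2)^2" by simp
   qed simp
   also have "... = ((1 + \<delta>^2 / 2) * \<bar>s - t\<bar>)^2" by (simp add: power_mult_distrib)
   finally show "dist (f s) (f t) <= (1 + \<delta>^2 / 2) * \<bar>s - t\<bar>" by (rule power2_le_imp_le) (simp add: add_nonneg_nonneg)
  qed (use h0 in "auto simp: add_nonneg_nonneg")
  finally show ?thesis by (simp add: mult.commute)
 qed
 have sub_I: "r \<in> {\<rho><..<101 / 100 * \<rho>}" "0 <= r" "r <= 2 * \<rho>" if "\<bar>r - rc\<bar> < h" for r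
 proof -
  have "r - rc < h" "rc - r < h" using that by linarith+
  then show "r \<in> {\<rho><..<101 / 100 * \<rho>}" "0 <= r" "r <= 2 * \<rho>" using rho unfolding rc_def h_def by auto
 qed
 have minus_B: "ennreal (2 * v) <= emeasure lborel ({rc - v<..<rc + v} - B) + ennreal \<beta>" for v
 proof -
  have "ennreal (2 * v) <= emeasure lborel {rc - v<..<rc + v}"
   by (cases "0 <= v") (simp_all add: ennreal_neg)
  also have "... <= emeasure lborel (({rc - v<..<rc + v} - B) Un B)" using B by (intro emeasure_mono) auto
  also have "... <= emeasure lborel ({rc - v<..<rc + v} - B) + emeasure lborel B" using B by (intro emeasure_subadditive) auto
  also have "... <= emeasure lborel ({rc - v<..<rc + v} - B) + ennreal \<beta>" by (intro add_left_mono B)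
  finally show ?thesis .
 qed
 \<comment> \<open>Near the tips the roof is too low: crossings at angle below \<open>\<eta>\<close>
   are under it only at distance at least \<open>4 * \<rho> * \<eta> / \<delta>\<close> from the
   ends of the base.\<close>
 define h' where "h' = h - 4 * \<rho> * \<eta> / \<delta>"
 have len: "ennreal (2 * h') <= hausdorff1 (K Int W) + ennreal \<beta>"
 proof -
  have "emeasure lborel ({rc - h'<..<rc + h'} - B) <= ennreal 1 * hausdorff1 (K Int W)"
  proof (rule lborel_le_hausdorff1_AE[of 1 1 _ "dist x"])
   show "AE r in lborel. r \<in> {rc - h'<..<rc + h'} - B --> r \<in> dist x ` (K Int W)"
    using main
   proof eventually_elim
    case (elim r)
    show ?case
    proof
     assume r: "r \<in> {rc - h'<..<rc + h'} - B"
     have "0 <= 4 * \<rho> * \<eta> / \<delta>" using rho de eta by auto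
     then have rh: "\<bar>r - rc\<bar> < h'" "h' <= h" using r by (auto simp: h'_def)
     then have "\<bar>r - rc\<bar> < h" by linarith
     note rI = sub_I[OF this]
     obtain ka where k: "K Int sphere x r = {pol x r ka}" "\<bar>ka - a0\<bar> < \<eta>" using elim rI r unfolding flat_def crosses_def by blast
     have "pol x r ka \<in> W"
     proof (rule inW[OF rI(2), of "2 * \<rho> * \<eta>"])
      show "r * \<bar>ka - a0\<bar> <= 2 * \<rho> * \<eta>" using rI k rho by (intro mult_mono) auto
      have "2 * \<rho> * \<eta> * \<delta> <= 2 * \<rho> * \<eta> * 1" using rho eta de by (intro mult_left_mono) auto
      then have "2 * \<rho> * \<eta> <= 2 * \<rho> * \<eta> / \<delta>" using de by (simp add: pos_le_divide_eq)
      moreover have "4 * \<rho> * \<eta> / \<delta> = 2 * \<rho> * \<eta> / \<delta> + 2 * \<rho> * \<eta> / \<delta>" by (simp add: field_simps)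
      ultimately show "\<bar>r - rc\<bar> + 2 * \<rho> * \<eta> + 2 * \<rho> * \<eta> / \<delta> < h" using rh(1) unfolding h'_def by linarith
     qed
     moreover have "pol x r ka \<in> K" "dist x (pol x r ka) = r" using k(1) by auto
     ultimately show "r \<in> dist x ` (K Int W)" by (intro image_eqI[of _ _ "pol x r ka"]) auto
    qed
   qed
  qed (use dist_dist_le B in auto)
  then show ?thesis using minus_B[of h'] by (simp add: add_right_mono order_trans)
 qed
 have dir: "ennreal (\<omega> * l / 4096) * emeasure lborel ({rc - h / 2<..<rc + h / 2} - B) <= dirichlet W"
 proof -
  \<comment> \<open>The sector between the angles \<open>\<eta>\<close> and \<open>\<omega>\<close>
    from the half axis: beyond the zone in which the profile says nothing, but under the roof over
    the middle half of the base.\<close>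
  define al1 al2 where "al1 = (if a0 = 0 then \<eta> else pi - \<omega>)" and "al2 = (if a0 = 0 then \<omega> else pi - \<eta>)"
  have o1: "\<omega> < pi / 2" "\<omega> < pi" using om de pi_gt3 by auto
  have al: "0 < al1" "al1 <= al2" "al2 < pi" "al2 - al1 = \<omega> - \<eta>" using a0 eta o1 by (auto simp: al1_def al2_def)
  have al_in: "t \<in> {0<..<pi}" "\<bar>t - a0\<bar> <= \<omega>" if "t \<in> {al1..al2}" for t
   using that a0 eta o1 by (auto simp: al1_def al2_def split: if_splits)
  have al_op: "\<eta> < \<bar>t - a0\<bar>" "\<bar>t - a0\<bar> < pi / 2" if "t \<in> {al1<..<al2}" for t
   using that a0 eta o1 by (auto simp: al1_def al2_def split: if_splits)
  \<comment> \<open>\<open>V^2\<close> is large in the sector and small \<open>RR\<close> keeps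
    \<open>P\<close> close to \<open>V / (2 * r)\<close>, so the radial derivative alone carries
    enough energy. The value \<open>2 * (l / (1024 * r))\<close> is the lower bound
    \<open>l * r / 128\<close> divided by \<open>4 * r^2\<close>.\<close>
  have slice_bound: "ennreal (\<omega> * l / 4096) <= (NN t. ennreal (fst (r, t) * En (r, t)) * ind strip (r, t) * ind W (polp x (r, t)))"
   if r: "\<bar>r - rc\<bar> < h / 2" and fl: "flat a0 \<eta> \<gamma> l r" for r
  proof -
   have n: "nice r" and f: "DD r = r * BB r" and R: "r * RR r <= \<gamma>"
    and lo: "AE t in lborel. t \<in> {0<..<pi} & \<eta> < \<bar>t - a0\<bar> & \<bar>t - a0\<bar> < pi / 2 --> l * r / 128 <= (V (r, t))^2"
    using fl unfolding flat_def by blast+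
   have "\<bar>r - rc\<bar> < h" using r h0 by linarith
   note rI = sub_I[OF this]
   have rp: "r > 0" using nice_integrable(1)[OF n] .
   have Wt: "pol x r t \<in> W" if "t \<in> {al1..al2}" for t
   proof (rule inW[OF rI(2), of "2 * \<rho> * \<omega>"])
    show "r * \<bar>t - a0\<bar> <= 2 * \<rho> * \<omega>" using rI al_in[OF that] rho by (intro mult_mono) auto
    have "2 * \<rho> * \<omega> <= \<rho> / 1600" using om de rho by simp
    moreover have "2 * \<rho> * \<omega> / \<delta> = \<rho> / 1600" unfolding om using de by simp
    moreover have "\<bar>r - rc\<bar> < \<rho> / 400" using r by (simp add: h_def)
    ultimately have "\<bar>r - rc\<bar> + 2 * \<rho> * \<omega> + 2 * \<rho> * \<omega> / \<delta> < \<rho> / 400 + \<rho> / 1600 + \<rho> / 1600"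
     by (intro add_less_le_mono) auto
    also have "... < h" using rho by (simp add: h_def)
    finally show "\<bar>r - rc\<bar> + 2 * \<rho> * \<omega> + 2 * \<rho> * \<omega> / \<delta> < h" .
   qed
   define e where "e t = (P (r, t) - V (r, t) / (2 * r))^2" for t
   have ei: "sint {0..pi} e" unfolding e_def[abs_def] by (rule defect_split(5)[OF n f])
   have Pi: "sint {al1..al2} (%t. (P (r, t))^2)"
    by (rule set_integrable_subset[OF nice_integrable(3)[OF n]]) (use al in auto)
   have ei2: "sint {al1..al2} e" by (rule set_integrable_subset[OF ei]) (use al in auto)
   have "(\<omega> - \<eta>) * (l / (1024 * r)) - RR r <= (LBINT t:{al1..al2}. l / (1024 * r)) - (LBINT t:{al1..al2}. e t)"
   proof -
    have "(LBINT t:{al1..al2}. e t) <= RR r" unfolding RR_def e_def[symmetric]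
     by (rule set_integral_mono_set[OF ei]) (use al in "auto simp: e_def")
    moreover have "(LBINT t:{al1..al2}. l / (1024 * r)) = (\<omega> - \<eta>) * (l / (1024 * r))"
     using al by (simp add: LBINT_def)
    ultimately show ?thesis by linarith
   qed
   also have "... = (LBINT t:{al1..al2}. l / (1024 * r) - e t)"
    by (rule set_integral_diff(2)[symmetric, OF set_integrable_const_Icc ei2])
   also have "... <= (LBINT t:{al1..al2}. (P (r, t))^2)"
    unfolding LBINT_def
   proof (rule integral_mono_AE)
    show "integrable lborel (%t. ind {al1..al2} t *R (l / (1024 * r) - e t))"
     using set_integral_diff(1)[OF set_integrable_const_Icc ei2] by (simp add: sintegrable_def)
    show "integrable lborel (%t. ind {al1..al2} t *R (P (r, t))^2)" using Pi by (simp add: sintegrable_def)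
    show "AE t in lborel. ind {al1..al2} t *R (l / (1024 * r) - e t) <= ind {al1..al2} t *R (P (r, t))^2"
     using lo AE_lborel_singleton[of al1] AE_lborel_singleton[of al2]
    proof eventually_elim
     case (elim t)
     show ?case
     proof (cases "t \<in> {al1..al2}")
      case True
      then have "t \<in> {al1<..<al2}" using elim by auto
      then have v: "l * r / 128 <= (V (r, t))^2" using elim(1) al_in[OF True] al_op by blast
      have "(V (r, t) / (2 * r))^2 <= 2 * (P (r, t))^2 + 2 * e t"
       unfolding e_def by (rule square_le_add)
      moreover have "(l * r / 128) / (4 * r^2) <= (V (r, t) / (2 * r))^2"
      proof -
       have "(V (r, t) / (2 * r))^2 = (V (r, t))^2 / (4 * r^2)" by (simp add: power_divide power_mult_distrib)
       then show ?thesis using divide_right_mono[OF v, of "4 * r^2"] by simp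
      qed
      moreover have "(l * r / 128) / (4 * r^2) = 2 * (l / (1024 * r))" using rp by (simp add: power2_eq_square)
      ultimately have "l / (1024 * r) - e t <= (P (r, t))^2" by linarith
      then show ?thesis using True by simp
     qed simp
    qed
   qed
   finally have "r * ((\<omega> - \<eta>) * (l / (1024 * r)) - RR r) <= r * (LBINT t:{al1..al2}. (P (r, t))^2)"
    using rp by (intro mult_left_mono) auto
   moreover have "r * ((\<omega> - \<eta>) * (l / (1024 * r)) - RR r) = (\<omega> - \<eta>) * l / 1024 - r * RR r" using rp by (simp add: field_simps)
   moreover have "\<omega> / 2 * l <= (\<omega> - \<eta>) * l" using eta l by (intro mult_right_mono) auto
   moreover have "\<omega> * l / 2048 = \<omega> / 2 * l / 1024" by simp
   ultimately have low: "\<omega> * l / 4096 <= r * (LBINT t:{al1..al2}. (P (r, t))^2)" using R ga by linarith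
   also have "... = (LBINT t:{al1..al2}. r * (P (r, t))^2)" by simp
   finally have "ennreal (\<omega> * l / 4096) <= ennreal (LBINT t:{al1..al2}. r * (P (r, t))^2)" by (rule ennreal_leI)
   also have "... = (NN t. ennreal (r * (P (r, t))^2) * ind {al1..al2} t)"
    by (rule Icc_nn_integral[symmetric]) (use Pi rp in auto)
   also have "... <= (NN t. ennreal (fst (r, t) * En (r, t)) * ind strip (r, t) * ind W (polp x (r, t)))"
   proof (rule nn_integral_mono)
    fix t
    show "ennreal (r * (P (r, t))^2) * ind {al1..al2} t <= ennreal (fst (r, t) * En (r, t)) * ind strip (r, t) * ind W (polp x (r, t))"
    proof (cases "t \<in> {al1..al2}")
     case True
     have "r * (P (r, t))^2 <= r * En (r, t)" using rp by (intro mult_left_mono) (auto simp: En_def)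
     then show ?thesis using True Wt[OF True] al_in[OF True] rp by (simp add: strip_def polp_def ennreal_leI)
    qed simp
   qed
   finally show ?thesis .
  qed
  have "ennreal (\<omega> * l / 4096) * emeasure lborel ({rc - h / 2<..<rc + h / 2} - B) = (NN r. ennreal (\<omega> * l / 4096) * ind ({rc - h / 2<..<rc + h / 2} - B) r)"
   using B by (subst nn_integral_cmult_indicator) auto
  also have "... <= (NN r. NN t. ennreal (fst (r, t) * En (r, t)) * ind strip (r, t) * ind W (polp x (r, t)))"
  proof (rule nn_integral_mono_AE)
   show "AE r in lborel. ennreal (\<omega> * l / 4096) * ind ({rc - h / 2<..<rc + h / 2} - B) r <= (NN t. ennreal (fst (r, t) * En (r, t)) * ind strip (r, t) * ind W (polp x (r, t)))"
    using main
   proof eventually_elim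
    case (elim r)
    show ?case
    proof (cases "r \<in> {rc - h / 2<..<rc + h / 2} - B")
     case True
     then have "rc - h / 2 < r" "r < rc + h / 2" by auto
     then have r: "\<bar>r - rc\<bar> < h / 2" by linarith
     then have "\<bar>r - rc\<bar> < h" using h0 by linarith
     then have "r \<in> {\<rho><..<101 / 100 * \<rho>}" by (rule sub_I)
     then show ?thesis using elim True slice_bound[OF r] by auto
    qed simp
   qed
  qed
  also have "... = dirichlet W"
  proof -
   have Wm: "W \<in> sets borel" using oW by (rule borel_open)
   then have iW: "(ind W :: real^2 => ennreal) \<in> bm borel" by (rule borel_measurable_indicator)
   have "(%p. ennreal (fst p * En p) * ind strip p * ind W (polp x p)) \<in> bm lborel2"
    by (intro borel_measurable_times_ennreal measurable_compose[OF measurable_polp iW] measurable_compose[OF _ measurable_ennreal] borel_measurable_indicator strip_sets) measurable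
   from lborel.nn_integral_fst[OF this] show ?thesis unfolding dirichlet_polar[OF Wm] by simp
  qed
  finally show ?thesis .
 qed
 have cut: "dirichlet W + hausdorff1 (K Int W) <= ennreal ((1 + \<delta>^2 / 2) * (2 * h))"
  using cut_inequality[OF oW bW] fr by (rule order_trans)
 have "dirichlet W < \<infinity>" "hausdorff1 (K Int W) < \<infinity>" using finite_bounded[OF bW] by auto
 then obtain dW hW where dh: "dirichlet W = ennreal dW" "dW >= 0" "hausdorff1 (K Int W) = ennreal hW" "hW >= 0"
  by (cases "dirichlet W"; cases "hausdorff1 (K Int W)") auto
 define mR where "mR = measure lborel ({rc - h / 2<..<rc + h / 2} - B)"
 have "emeasure lborel ({rc - h / 2<..<rc + h / 2} - B) <= emeasure lborel {rc - h / 2<..<rc + h / 2}" by (rule emeasure_mono) auto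
 also have "... < \<infinity>" using h0 by simp
 finally have mR: "emeasure lborel ({rc - h / 2<..<rc + h / 2} - B) = ennreal mR" "mR >= 0"
  unfolding mR_def by (auto intro!: emeasure_eq_ennreal_measure)
 have wl: "0 <= \<omega> * l / 4096" using om de l by simp
 have "h <= mR + \<beta>" using minus_B[of "h / 2"] mR B(3) by (simp add: ennreal_plus[symmetric] del: ennreal_plus)
 then have "\<rho> / 400 <= mR" using B(4) unfolding h_def by linarith
 then have "\<rho> / 400 * (\<omega> * l / 4096) <= mR * (\<omega> * l / 4096)" using wl by (rule mult_right_mono)
 also have "... <= dW" using dir wl dh mR by (simp add: ennreal_mult[symmetric] mult.commute)
 finally have 1: "\<rho> / 400 * (\<omega> * l / 4096) <= dW" .
 have "2 * h' <= hW + \<beta>" using len dh B(3) by (simp add: ennreal_plus[symmetric] del: ennreal_plus)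
 moreover have "dW + hW <= (1 + \<delta>^2 / 2) * (2 * h)" using cut dh h0 by (simp add: ennreal_plus[symmetric] add_nonneg_nonneg del: ennreal_plus)
 moreover have "(1 + \<delta>^2 / 2) * (2 * h) = 2 * h + \<rho> * \<delta>^2 / 200" by (simp add: h_def algebra_simps)
 moreover have "2 * h' = 2 * h - 8 * \<rho> * \<eta> / \<delta>" by (simp add: h'_def)
 ultimately show ?thesis using 1 by linarith
qed


text \<open>Markov's inequality for \<open>dd\<close>, whose integral over the doubling interval is
  the growth of \<open>DD r / r\<close>.\<close>

lemma bad_radii:
 assumes rho: "\<rho> > 0" and c: "c > 0" and e: "DD (2 * \<rho>) / (2 * \<rho>) - DD \<rho> / \<rho> <= \<epsilon>"
 obtains B where "B \<in> sets borel" "emeasure lborel B <= ennreal (\<epsilon> / c)" "!!r. r \<in> {\<rho>..2 * \<rho>} ==> r ~: B ==> dd r <= c"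
proof -
 have r2: "\<rho> <= 2 * \<rho>" using rho by simp
 define F where "F r = ind {\<rho>..2 * \<rho>} r *R dd r" for r
 have Fi: "integrable lborel F" using defect_integral(1)[OF rho r2] by (simp add: F_def[abs_def] sintegrable_def)
 have Fm: "F \<in> bm borel" using borel_measurable_integrable[OF Fi] by simp
 have F0: "AE r in lborel. 0 <= F r"
  using AE_nice DD_flux by eventually_elim (use rho defect_split(4) in "auto simp: F_def indicator_def")
 define B where "B = {r. c <= F r}"
 have Bm: "B \<in> sets borel" unfolding B_def using Fm by measurable
 have "emeasure lborel {r \<in> space lborel. c <= F r} <= ennreal (1 / c * (LBINT r. F r))"
  by (rule integral_Markov_inequality[OF Fi F0 c])
 also have "(LBINT r. F r) = DD (2 * \<rho>) / (2 * \<rho>) - DD \<rho> / \<rho>"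
  using defect_integral(2)[OF rho r2] by (simp add: F_def[abs_def] LBINT_def)
 also have "ennreal (1 / c * (DD (2 * \<rho>) / (2 * \<rho>) - DD \<rho> / \<rho>)) <= ennreal (\<epsilon> / c)"
  using e c by (intro ennreal_leI) (simp add: divide_right_mono)
 finally have "emeasure lborel B <= ennreal (\<epsilon> / c)" by (simp add: B_def)
 moreover have "dd r <= c" if "r \<in> {\<rho>..2 * \<rho>}" "r ~: B" for r using that by (simp add: B_def F_def)
 ultimately show ?thesis using that Bm by blast
qed

text \<open>The amplitude gives \<open>(m * z)^2 >= l * r / 32\<close>, of which the error removes
  at most \<open>l * r / 64\<close>; halving what is left yields the constant
  \<open>1 / 128\<close>.\<close>

lemma profile_lower_bound:
 assumes l: "0 < l" "\<gamma> <= l / 128" and r: "r > 0" and m: "m^2 >= l * r / (4 * pi)" and z: "z^2 >= 1 / 2" and v: "(v - m * z)^2 <= \<gamma> * r"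
 shows "l * r / 128 <= v^2"
proof -
 have "l * r / 16 <= l * r / (4 * pi)" using l r pi_less_4 by (intro divide_left_mono) auto
 then have "l * r / 16 <= m^2" using m by simp
 then have "l * r / 16 * (1 / 2) <= m^2 * z^2" using z l r by (intro mult_mono) auto
 moreover have "(m * z)^2 <= 2 * v^2 + 2 * (v - m * z)^2" by (rule square_le_add)
 moreover have "\<gamma> * r <= l / 128 * r" using l r by (intro mult_right_mono) auto
 ultimately have "l * r / 32 <= 2 * v^2 + 2 * (l / 128 * r)" using v by (simp add: power_mult_distrib)
 then show ?thesis by simp
qed

lemma contradiction: False
proof -
 obtain r0 where r0: "r0 > 0" "DD r0 > 0" by (rule DD_pos)
 define l where "l = DD r0 / r0"
 have l: "0 < l" "l < 4"
 proof -
  show "0 < l" using r0 by (simp add: l_def)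
  have "l <= pi" using DD_le[OF r0(1)] r0 by (simp add: l_def field_simps)
  then show "l < 4" using pi_less_4 by linarith
 qed
 \<comment> \<open>The constants are fitted to the final balance, in which every term is a multiple
   of \<open>\<rho> * (\<delta> * l)\<close>. \<open>\<delta>\<close> proportional to
   \<open>l\<close> makes the quadratic excess of the roof small; \<open>\<eta>\<close> makes the
   loss at the tips one quarter of the gain, and \<open>\<epsilon>\<close> does the same for the bad
   radii. The divisor 8 in \<open>\<gamma>\<close> stands for a number above
   \<open>2 * pi\<close>.\<close>
 define \<delta> where "\<delta> = l / 200000000"
 define \<omega> where "\<omega> = \<delta> / 3200"
 define \<eta> where "\<eta> = \<delta> * (\<delta> * l / 167772160000)"
 define \<gamma> where "\<gamma> = \<eta> * l / 8"
 define \<epsilon> where "\<epsilon> = \<gamma> * (\<delta> * l / 41943040000)"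
 have de: "0 < \<delta>" "\<delta> < 1 / 50000000" using l by (auto simp: \<delta>_def)
 have dl: "0 < \<delta> * l" "\<delta> * l < 1 / 12500000"
 proof -
  show "0 < \<delta> * l" using de l by simp
  have "\<delta> * l < (1 / 50000000) * 4" using de l by (intro mult_strict_mono) auto
  then show "\<delta> * l < 1 / 12500000" by simp
 qed
 have eta: "0 < \<eta>" "\<eta> <= \<delta> / 100000000"
 proof -
  show "0 < \<eta>" using de dl l by (simp add: \<eta>_def)
  have "\<delta> * (\<delta> * l / 167772160000) <= \<delta> * (1 / 100000000)" using de dl by (intro mult_left_mono) auto
  then show "\<eta> <= \<delta> / 100000000" by (simp add: \<eta>_def)
 qed
 have eta2: "2 * \<eta> <= \<omega>" "\<eta> <= 1 / 100" "\<eta> <= pi / 2" using eta de pi_gt3 by (auto simp: \<omega>_def)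
 have ga: "0 < \<gamma>" "\<gamma> <= l / 250000" "\<gamma> <= l / 16" "\<gamma> <= l / 128" "\<gamma> < \<eta> * l / (2 * pi)" "\<gamma> <= \<omega> * l / 4096"
 proof -
  show g0: "0 < \<gamma>" using eta l by (simp add: \<gamma>_def)
  have "\<eta> * l <= (1 / 5000000000000000) * l" using eta de l by (intro mult_right_mono) auto
  then show "\<gamma> <= l / 250000" "\<gamma> <= l / 16" "\<gamma> <= l / 128" using l by (auto simp: \<gamma>_def)
  show "\<gamma> < \<eta> * l / (2 * pi)" unfolding \<gamma>_def using eta l pi_less_4 by (intro divide_strict_left_mono) auto
  have "\<eta> * l <= (\<delta> / 100000000) * l" using eta l by (intro mult_right_mono) auto
  then show "\<gamma> <= \<omega> * l / 4096" using dl by (simp add: \<gamma>_def \<omega>_def)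
 qed
 have ep: "0 < \<epsilon>" "\<epsilon> <= \<gamma>"
 proof -
  show "0 < \<epsilon>" using ga dl by (simp add: \<epsilon>_def)
  have "\<gamma> * (\<delta> * l / 41943040000) <= \<gamma> * 1" using ga dl by (intro mult_left_mono) auto
  then show "\<epsilon> <= \<gamma>" by (simp add: \<epsilon>_def)
 qed
 obtain \<rho> where rr: "\<rho> >= r0" "DD (2 * \<rho>) / (2 * \<rho>) - DD \<rho> / \<rho> <= \<epsilon>" by (rule small_defect[OF r0(1) ep(1)])
 have rho: "\<rho> > 0" using rr r0 by linarith
 define \<rho>2 where "\<rho>2 = 101 / 100 * \<rho>"
 have rho2: "\<rho> < \<rho>2" "\<rho>2 <= 2 * \<rho>" using rho by (auto simp: \<rho>2_def)
 have defl: "DD \<rho>2 / \<rho>2 - DD \<rho> / \<rho> <= \<epsilon>" using ratio_mono[of \<rho>2 "2 * \<rho>"] rho rho2 rr by simp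
 \<comment> \<open>Bound for the measure of the radii with
   \<open>dd r > \<gamma> / (2 * \<rho>)\<close>; at the others \<open>r <= 2 * \<rho>\<close> gives
   \<open>r * dd r <= \<gamma>\<close>.\<close>
 define \<beta> where "\<beta> = \<epsilon> / (\<gamma> / (2 * \<rho>))"
 have be: "\<beta> = \<rho> * (\<delta> * l) / 20971520000" using ga rho by (simp add: \<beta>_def \<epsilon>_def)
 have "0 < \<gamma> / (2 * \<rho>)" using ga rho by simp
 from bad_radii[OF rho this rr(2)] obtain B where B: "B \<in> sets borel" "emeasure lborel B <= ennreal \<beta>"
  "!!r. r \<in> {\<rho>..2 * \<rho>} ==> r ~: B ==> dd r <= \<gamma> / (2 * \<rho>)" unfolding \<beta>_def by blast
 have be0: "0 <= \<beta>" "\<beta> <= \<rho> / 400"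
 proof -
  show "0 <= \<beta>" unfolding be using rho dl by simp
  have "\<rho> * (\<delta> * l) <= \<rho> * 1" using rho dl by (intro mult_left_mono) auto
  then show "\<beta> <= \<rho> / 400" unfolding be using rho by simp
 qed
 define reg where "reg r \<longleftrightarrow> \<rho> < r & r < \<rho>2 & r ~: B & nice r & DD r = r * BB r &
  on_ray \<rho> \<rho>2 r" for r
 have AE_reg: "AE r\<in>{\<rho><..<\<rho>2} in lborel. r ~: B --> reg r"
  using AE_nice DD_flux ray_slices[OF rho rho2(1)] by eventually_elim (use rho in "auto simp: reg_def")
 have small: "r * dd r <= \<gamma>" "r * RR r <= \<gamma>" if "reg r" for r
 proof -
  have r: "\<rho> < r" "r <= 2 * \<rho>" "r > 0" "nice r" "DD r = r * BB r" "r ~: B" using that rho rho2 by (auto simp: reg_def)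
  note ds = defect_split[OF r(4,5)]
  have "r * dd r <= (2 * \<rho>) * (\<gamma> / (2 * \<rho>))" using r B(3)[of r] ds(4) by (intro mult_mono) auto
  then show "r * dd r <= \<gamma>" using rho by simp
  moreover have "RR r <= dd r" using ds(1,3) r by simp
  then have "r * RR r <= r * dd r" using r by (intro mult_left_mono) auto
  ultimately show "r * RR r <= \<gamma>" by linarith
 qed
 have dich: "crosses pi \<eta> r & left_profile l \<gamma> \<eta> r \<or> crosses 0 \<eta> r & right_profile l \<gamma> \<eta> r" if "reg r" for r
 proof -
  have r: "nice r" "DD r = r * BB r" "\<rho> < r" using that by (auto simp: reg_def)
  have "l <= DD r / r" unfolding l_def using ratio_mono[of r0 r] r0 rr r by simp
  from profile[OF r(1,2) l(1) this small(1)[OF that] ga(3,5) eta(1) eta2(3)] show ?thesis .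
 qed
 have excl: False if "reg r" "left_profile l \<gamma> \<eta> r" "reg r'" "right_profile l \<gamma> \<eta> r'" for r r'
  by (rule no_switch[OF rho defl[unfolded \<rho>2_def] ep l(1) ga(2) eta(1) eta2(2) _ _ _ _ _ _ that(2,4)])
   (use that(1,3) in "simp_all add: reg_def \<rho>2_def")
 have halves: "(sin (t / 2))^2 >= 1 / 2" if "pi / 2 <= t" "t <= pi" for t
 proof -
  have "cos t <= cos (pi / 2)" by (rule cos_monotone_0_pi_le) (use that in auto)
  then show ?thesis using one_minus_cos[of t] by simp
 qed
 have halves2: "(cos (t / 2))^2 >= 1 / 2" if "0 <= t" "t <= pi / 2" for t
 proof -
  have "cos (pi / 2) <= cos t" by (rule cos_monotone_0_pi_le) (use that in auto)
  then have "(sin (t / 2))^2 <= 1 / 2" using one_minus_cos[of t] by simp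
  then show ?thesis using sin_cos_squared_add[of "t / 2"] by linarith
 qed
 have "\<rho> / 400 * (\<omega> * l / 4096) <= \<rho> * \<delta>^2 / 200 + 8 * \<rho> * \<eta> / \<delta> + \<beta>"
 \<comment> \<open>By \<open>excl\<close> one right profile makes all regular radii right, and
   without one all are left; so the tent can stand on one fixed half axis.\<close>
 proof (cases "\<exists>r'. reg r' & right_profile l \<gamma> \<eta> r'")
  case False
  show ?thesis
  proof (rule tent[of pi, OF _ rho de(1) _ \<omega>_def eta(1) eta2(1) l(1) ga(6) B(1,2) be0])
   show "AE r\<in>{\<rho><..<101 / 100 * \<rho>} in lborel. r ~: B --> flat pi \<eta> \<gamma> l r"
    using AE_reg
   proof eventually_elim
    case (elim r)
    show ?case
    proof (intro impI)
     assume "r \<in> {\<rho><..<101 / 100 * \<rho>}" "r ~: B"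
     then have rg: "reg r" using elim by (simp add: \<rho>2_def)
     then have G: "crosses pi \<eta> r" "left_profile l \<gamma> \<eta> r" using dich False by blast+
     have r: "nice r" "DD r = r * BB r" "r > 0" using rg rho by (auto simp: reg_def)
     obtain m where m: "m^2 >= l * r / (4 * pi)" "AE t\<in>{0<..<pi - \<eta>} in lborel. (V (r, t) - m * sin (t / 2))^2 <= \<gamma> * r"
      using G(2) unfolding left_profile_def by blast
     have "AE t in lborel. t \<in> {0<..<pi} & \<eta> < \<bar>t - pi\<bar> & \<bar>t - pi\<bar> < pi / 2 --> l * r / 128 <= (V (r, t))^2"
      using m(2)
     proof eventually_elim
      case (elim t)
      show ?case
      proof
       assume "t \<in> {0<..<pi} & \<eta> < \<bar>t - pi\<bar> & \<bar>t - pi\<bar> < pi / 2"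
       then have "t \<in> {0<..<pi - \<eta>}" "((sin (t / 2))^2) >= 1 / 2" using halves[of t] by (auto simp: abs_if split: if_splits)
       then show "l * r / 128 <= (V (r, t))^2"
        using profile_lower_bound[OF l(1) ga(4) r(3) m(1)] elim by blast
      qed
     qed
     then show "flat pi \<eta> \<gamma> l r" using r small(2)[OF rg] G(1) unfolding flat_def by blast
    qed
   qed
  qed (use de in auto)
 next
  case True
  then obtain r' where r': "reg r'" "right_profile l \<gamma> \<eta> r'" by blast
  show ?thesis
  proof (rule tent[of 0, OF _ rho de(1) _ \<omega>_def eta(1) eta2(1) l(1) ga(6) B(1,2) be0])
   show "AE r\<in>{\<rho><..<101 / 100 * \<rho>} in lborel. r ~: B --> flat 0 \<eta> \<gamma> l r"
    using AE_reg
   proof eventually_elim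
    case (elim r)
    show ?case
    proof (intro impI)
     assume "r \<in> {\<rho><..<101 / 100 * \<rho>}" "r ~: B"
     then have rg: "reg r" using elim by (simp add: \<rho>2_def)
     then have G: "crosses 0 \<eta> r" "right_profile l \<gamma> \<eta> r" using dich excl r' by blast+
     have r: "nice r" "DD r = r * BB r" "r > 0" using rg rho by (auto simp: reg_def)
     obtain m where m: "m^2 >= l * r / (4 * pi)" "AE t\<in>{\<eta><..<pi} in lborel. (V (r, t) - m * cos (t / 2))^2 <= \<gamma> * r"
      using G(2) unfolding right_profile_def by blast
     have "AE t in lborel. t \<in> {0<..<pi} & \<eta> < \<bar>t - 0\<bar> & \<bar>t - 0\<bar> < pi / 2 --> l * r / 128 <= (V (r, t))^2"
      using m(2)
     proof eventually_elim
      case (elim t)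
      show ?case
      proof
       assume "t \<in> {0<..<pi} & \<eta> < \<bar>t - 0\<bar> & \<bar>t - 0\<bar> < pi / 2"
       then have "t \<in> {\<eta><..<pi}" "((cos (t / 2))^2) >= 1 / 2" using halves2[of t] by (auto simp: abs_if split: if_splits)
       then show "l * r / 128 <= (V (r, t))^2"
        using profile_lower_bound[OF l(1) ga(4) r(3) m(1)] elim by blast
      qed
     qed
     then show "flat 0 \<eta> \<gamma> l r" using r small(2)[OF rg] G(1) unfolding flat_def by blast
    qed
   qed
  qed (use de in auto)
 qed
 moreover have "\<rho> / 400 * (\<omega> * l / 4096) = \<rho> * (\<delta> * l) / 5242880000" by (simp add: \<omega>_def)
 moreover have "8 * \<rho> * \<eta> / \<delta> = \<rho> * (\<delta> * l) / 20971520000" using de by (simp add: \<eta>_def)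
 moreover have "\<rho> * \<delta>^2 / 200 = \<rho> * (\<delta> * l) / 40000000000" by (simp add: \<delta>_def power2_eq_square)
 ultimately have "\<rho> * (\<delta> * l) / 5242880000 <= \<rho> * (\<delta> * l) / 40000000000 + \<rho> * (\<delta> * l) / 20971520000 + \<rho> * (\<delta> * l) / 20971520000"
  by (simp only: be)
 moreover have "0 < \<rho> * (\<delta> * l)" using rho dl by simp
 moreover have "\<not> X / 5242880000 <= X / 40000000000 + X / 20971520000 + X / 20971520000" if "0 < X" for X :: real
  using that by simp
 ultimately show False by blast
qed

end

theorem proposition2p16:
  fixes U K :: "(real^2) set" and u :: "real^2 \<Rightarrow> real" and x :: "real^2"
  assumes "U = {y. y $ 2 > 0}"
    and "generalized_minimizer U K u" and "normalized K"
    and "x \<in> K \<inter> frontier U"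
  shows "\<not> (AE r in lborel. r > 0 \<longrightarrow>
            emeasure (count_space UNIV) (K \<inter> frontier (ball x r)) = 1)"
proof
 assume one: "AE r in lborel. r > 0 --> emeasure (count_space UNIV) (K Int frontier (ball x r)) = 1"
 have "open U" "closure U = {y. y $ 2 >= 0}" unfolding assms(1) by (rule open_halfspace_component_gt_cart) simp
 then have "frontier U = {y. y $ 2 = 0}" unfolding frontier_def by (auto simp: interior_open assms(1))
 then have "x \<in> K" "x $ 2 = 0" using assms(4) by auto
 then interpret crack U K u x
  using assms(1-3) one by unfold_locales auto
 show False by (rule contradiction)
qed

end
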